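(* Let $k$ be an algebraically closed field and let $A$ be a finitely generated associative $k$-algebra. If $A$ is coherent and hereditary, then for every $n\ge 1$ the $k$-scheme $\mathrm{Rep}_A^n$ is smooth.
   Context: An $A$-bimodule is the same as a left module over $A^e=A\otimes_k A^{\mathrm{op}}$; a finite rank free $A$-bimodule is a free $A^e$-module of finite rank. The algebra $A$ is called coherent if the kernel of any morphism between finite rank free $A$-bimodules is a finitely generated $A$-bimodule. $A$ is hereditary if its (left) global dimension is at most $1$, i.e. every left $A$-module has a projective resolution of length at most $1$. $\mathrm{Rep}_A^n$ is the affine $k$-scheme of finite type representing the functor from commutative $k$-algebras to sets $B\mapsto \mathrm{Hom}_{k\text{-alg}}(A,M_n(B))$, where $M_n(B)$ is the ring of $n\times n$ matrices over $B$. *)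

theory Defs
  imports "HOL-Algebra.Algebraic_Closure"
begin

section \<open>Associative algebras\<close>

text \<open>
  Unital associative algebras over a commutative ring, not necessarily commutative.
  The commutative ones are the library locale \<^locale>\<open>algebra\<close>.  The zero algebra is allowed in
  both cases.
\<close>

locale assoc_algebra = module R M + ring M for R and M (structure) +
  assumes smult_assoc_l:
      "\<lbrakk>c \<in> carrier R; x \<in> carrier M; y \<in> carrier M\<rbrakk> \<Longrightarrow>
        (c \<odot>\<^bsub>M\<^esub> x) \<otimes>\<^bsub>M\<^esub> y = c \<odot>\<^bsub>M\<^esub> (x \<otimes>\<^bsub>M\<^esub> y)"
    and smult_assoc_r:
      "\<lbrakk>c \<in> carrier R; x \<in> carrier M; y \<in> carrier M\<rbrakk> \<Longrightarrow>
        x \<otimes>\<^bsub>M\<^esub> (c \<odot>\<^bsub>M\<^esub> y) = c \<odot>\<^bsub>M\<^esub> (x \<otimes>\<^bsub>M\<^esub> y)"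

definition alg_hom ::
  "('k, 'c) ring_scheme \<Rightarrow> ('k, 'a, 'd) module_scheme \<Rightarrow> ('k, 'b, 'e) module_scheme \<Rightarrow> ('a \<Rightarrow> 'b) set"
  where "alg_hom k A B =
    {h \<in> ring_hom A B. \<forall>c\<in>carrier k. \<forall>x\<in>carrier A. h (c \<odot>\<^bsub>A\<^esub> x) = c \<odot>\<^bsub>B\<^esub> h x}"

inductive_set alg_generated ::
  "('k, 'c) ring_scheme \<Rightarrow> ('k, 'a, 'd) module_scheme \<Rightarrow> 'a set \<Rightarrow> 'a set"
  for k A S
  where
    zero: "\<zero>\<^bsub>A\<^esub> \<in> alg_generated k A S"
  | one: "\<one>\<^bsub>A\<^esub> \<in> alg_generated k A S"
  | incl: "x \<in> S \<Longrightarrow> x \<in> alg_generated k A S"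
  | smult: "\<lbrakk>c \<in> carrier k; x \<in> alg_generated k A S\<rbrakk> \<Longrightarrow> c \<odot>\<^bsub>A\<^esub> x \<in> alg_generated k A S"
  | add: "\<lbrakk>x \<in> alg_generated k A S; y \<in> alg_generated k A S\<rbrakk> \<Longrightarrow> x \<oplus>\<^bsub>A\<^esub> y \<in> alg_generated k A S"
  | mult: "\<lbrakk>x \<in> alg_generated k A S; y \<in> alg_generated k A S\<rbrakk> \<Longrightarrow> x \<otimes>\<^bsub>A\<^esub> y \<in> alg_generated k A S"

definition finitely_generated_algebra ::
  "('k, 'c) ring_scheme \<Rightarrow> ('k, 'a, 'd) module_scheme \<Rightarrow> bool"
  where "finitely_generated_algebra k A \<longleftrightarrow>
    (\<exists>S. finite S \<and> S \<subseteq> carrier A \<and> alg_generated k A S = carrier A)"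

definition opposite_algebra :: "('k, 'a, 'd) module_scheme \<Rightarrow> ('k, 'a, 'd) module_scheme"
  where "opposite_algebra A = A\<lparr>monoid.mult := \<lambda>x y. y \<otimes>\<^bsub>A\<^esub> x\<rparr>"

text \<open>The ring \<^term>\<open>A Quot I\<close> together with its scalar multiplication.\<close>

definition quot_algebra :: "('k, 'a, 'd) module_scheme \<Rightarrow> 'a set \<Rightarrow> ('k, 'a set) module"
  where "quot_algebra A I =
    ring.extend (A Quot I) \<lparr>smult = (\<lambda>c Y. (\<Union>x\<in>Y. I +>\<^bsub>A\<^esub> (c \<odot>\<^bsub>A\<^esub> x)))\<rparr>"

definition mat_algebra :: "('k, 'b, 'd) module_scheme \<Rightarrow> nat \<Rightarrow> ('k, nat \<times> nat \<Rightarrow> 'b) module"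
  where "mat_algebra B n =
    (let N = {..<n} \<times> {..<n} in
      \<lparr>carrier = N \<rightarrow>\<^sub>E carrier B,
       monoid.mult = \<lambda>P Q. \<lambda>(i, j)\<in>N. \<Oplus>\<^bsub>B\<^esub>l\<in>{..<n}. P (i, l) \<otimes>\<^bsub>B\<^esub> Q (l, j),
       one = \<lambda>(i, j)\<in>N. if i = j then \<one>\<^bsub>B\<^esub> else \<zero>\<^bsub>B\<^esub>,
       zero = \<lambda>_\<in>N. \<zero>\<^bsub>B\<^esub>,
       add = \<lambda>P Q. \<lambda>p\<in>N. P p \<oplus>\<^bsub>B\<^esub> Q p,
       smult = \<lambda>c P. \<lambda>p\<in>N. c \<odot>\<^bsub>B\<^esub> P p\<rparr>)"


section \<open>Monoid algebras, polynomial algebras and tensor products\<close>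

text \<open>
  Elements of the monoid algebra are the finitely supported functions from the monoid to \<open>k\<close>,
  extended by zero outside the carrier of the monoid.
\<close>

definition msupp :: "('k, 'c) ring_scheme \<Rightarrow> ('g \<Rightarrow> 'k) \<Rightarrow> 'g set"
  where "msupp k f = {x. f x \<noteq> \<zero>\<^bsub>k\<^esub>}"

definition msingle :: "('k, 'c) ring_scheme \<Rightarrow> 'g \<Rightarrow> 'g \<Rightarrow> 'k"
  where "msingle k x = (\<lambda>y. if y = x then \<one>\<^bsub>k\<^esub> else \<zero>\<^bsub>k\<^esub>)"

definition monoid_algebra ::
  "('k, 'c) ring_scheme \<Rightarrow> ('g, 'd) monoid_scheme \<Rightarrow> ('k, 'g \<Rightarrow> 'k) module"
  where "monoid_algebra k G =
    \<lparr>carrier = {f. range f \<subseteq> carrier k \<and> finite (msupp k f) \<and> msupp k f \<subseteq> carrier G},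
     monoid.mult = \<lambda>f g z. finsum k (\<lambda>(x, y). f x \<otimes>\<^bsub>k\<^esub> g y)
        {(x, y). x \<in> msupp k f \<and> y \<in> msupp k g \<and> x \<otimes>\<^bsub>G\<^esub> y = z},
     one = msingle k \<one>\<^bsub>G\<^esub>,
     zero = \<lambda>_. \<zero>\<^bsub>k\<^esub>,
     add = \<lambda>f g x. f x \<oplus>\<^bsub>k\<^esub> g x,
     smult = \<lambda>c f x. c \<otimes>\<^bsub>k\<^esub> f x\<rparr>"

text \<open>
  Monomials in the variables \<open>V\<close> are multisets over \<open>V\<close>, so the polynomial algebra
  \<open>k[V]\<close> is the monoid algebra of the free commutative monoid on \<open>V\<close>.
\<close>

definition monomials :: "'x set \<Rightarrow> 'x multiset monoid"
  where "monomials V = \<lparr>carrier = {m. set_mset m \<subseteq> V}, monoid.mult = (+), one = {#}\<rparr>"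

abbreviation poly_algebra ::
  "('k, 'c) ring_scheme \<Rightarrow> 'x set \<Rightarrow> ('k, 'x multiset \<Rightarrow> 'k) module"
  where "poly_algebra k V \<equiv> monoid_algebra k (monomials V)"

abbreviation poly_var :: "('k, 'c) ring_scheme \<Rightarrow> 'x \<Rightarrow> 'x multiset \<Rightarrow> 'k"
  where "poly_var k x \<equiv> msingle k {#x#}"

text \<open>
  The tensor product of two algebras is the algebra on symbols \<open>a \<otimes> b\<close> with
  \<open>(a \<otimes> b)(a' \<otimes> b') = aa' \<otimes> bb'\<close>, modulo \<open>k\<close>-bilinearity of \<open>a \<otimes> b\<close>.  The span of the bilinearity
  relations is stable under multiplication by symbols, so it is already the ideal they generate, and
  the underlying module is the usual tensor product of \<open>k\<close>-modules.
\<close>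

definition tensor_relations ::
  "('k, 'c) ring_scheme \<Rightarrow> ('k, 'a, 'd) module_scheme \<Rightarrow> ('k, 'b, 'e) module_scheme
    \<Rightarrow> ('a \<times> 'b \<Rightarrow> 'k) set"
  where "tensor_relations k A B =
    (let P = monoid_algebra k (A \<times>\<times> B); t = (\<lambda>a b. msingle k (a, b)) in
      {t (a \<oplus>\<^bsub>A\<^esub> a') b \<ominus>\<^bsub>P\<^esub> (t a b \<oplus>\<^bsub>P\<^esub> t a' b) | a a' b.
          a \<in> carrier A \<and> a' \<in> carrier A \<and> b \<in> carrier B} \<union>
      {t a (b \<oplus>\<^bsub>B\<^esub> b') \<ominus>\<^bsub>P\<^esub> (t a b \<oplus>\<^bsub>P\<^esub> t a b') | a b b'.
          a \<in> carrier A \<and> b \<in> carrier B \<and> b' \<in> carrier B} \<union>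
      {t (c \<odot>\<^bsub>A\<^esub> a) b \<ominus>\<^bsub>P\<^esub> c \<odot>\<^bsub>P\<^esub> t a b | c a b.
          c \<in> carrier k \<and> a \<in> carrier A \<and> b \<in> carrier B} \<union>
      {t a (c \<odot>\<^bsub>B\<^esub> b) \<ominus>\<^bsub>P\<^esub> c \<odot>\<^bsub>P\<^esub> t a b | c a b.
          c \<in> carrier k \<and> a \<in> carrier A \<and> b \<in> carrier B})"

definition tensor_algebra ::
  "('k, 'c) ring_scheme \<Rightarrow> ('k, 'a, 'd) module_scheme \<Rightarrow> ('k, 'b, 'e) module_scheme
    \<Rightarrow> ('k, ('a \<times> 'b \<Rightarrow> 'k) set) module"
  where "tensor_algebra k A B =
    (let P = monoid_algebra k (A \<times>\<times> B) in quot_algebra P (Idl\<^bsub>P\<^esub> (tensor_relations k A B)))"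

definition enveloping_algebra ::
  "('k, 'c) ring_scheme \<Rightarrow> ('k, 'a, 'd) module_scheme \<Rightarrow> ('k, ('a \<times> 'a \<Rightarrow> 'k) set) module"
  where "enveloping_algebra k A = tensor_algebra k A (opposite_algebra A)"


section \<open>Left modules over noncommutative rings\<close>

text \<open>
  The library locale \<^locale>\<open>module\<close> requires a commutative base ring.  As there, the fields
  \<^const>\<open>monoid.mult\<close> and \<^const>\<open>one\<close> of a module record carry no information.
\<close>

locale left_module = R?: ring R + M?: abelian_group M
  for R :: "('r, 'c) ring_scheme" (structure) and M :: "('r, 'm, 'd) module_scheme" (structure) +
  assumes smult_closed:
      "\<lbrakk>r \<in> carrier R; x \<in> carrier M\<rbrakk> \<Longrightarrow> r \<odot>\<^bsub>M\<^esub> x \<in> carrier M"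
    and smult_l_distr:
      "\<lbrakk>r \<in> carrier R; s \<in> carrier R; x \<in> carrier M\<rbrakk> \<Longrightarrow>
        (r \<oplus>\<^bsub>R\<^esub> s) \<odot>\<^bsub>M\<^esub> x = r \<odot>\<^bsub>M\<^esub> x \<oplus>\<^bsub>M\<^esub> s \<odot>\<^bsub>M\<^esub> x"
    and smult_r_distr:
      "\<lbrakk>r \<in> carrier R; x \<in> carrier M; y \<in> carrier M\<rbrakk> \<Longrightarrow>
        r \<odot>\<^bsub>M\<^esub> (x \<oplus>\<^bsub>M\<^esub> y) = r \<odot>\<^bsub>M\<^esub> x \<oplus>\<^bsub>M\<^esub> r \<odot>\<^bsub>M\<^esub> y"
    and smult_assoc:
      "\<lbrakk>r \<in> carrier R; s \<in> carrier R; x \<in> carrier M\<rbrakk> \<Longrightarrow>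
        (r \<otimes>\<^bsub>R\<^esub> s) \<odot>\<^bsub>M\<^esub> x = r \<odot>\<^bsub>M\<^esub> (s \<odot>\<^bsub>M\<^esub> x)"
    and smult_one:
      "x \<in> carrier M \<Longrightarrow> \<one>\<^bsub>R\<^esub> \<odot>\<^bsub>M\<^esub> x = x"

definition lmod_hom ::
  "('r, 'c) ring_scheme \<Rightarrow> ('r, 'm, 'd) module_scheme \<Rightarrow> ('r, 'n, 'e) module_scheme \<Rightarrow> ('m \<Rightarrow> 'n) set"
  where "lmod_hom R M N =
    {h \<in> carrier M \<rightarrow> carrier N.
      (\<forall>x\<in>carrier M. \<forall>y\<in>carrier M. h (x \<oplus>\<^bsub>M\<^esub> y) = h x \<oplus>\<^bsub>N\<^esub> h y) \<and>
      (\<forall>r\<in>carrier R. \<forall>x\<in>carrier M. h (r \<odot>\<^bsub>M\<^esub> x) = r \<odot>\<^bsub>N\<^esub> h x)}"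

inductive_set lmod_span ::
  "('r, 'c) ring_scheme \<Rightarrow> ('r, 'm, 'd) module_scheme \<Rightarrow> 'm set \<Rightarrow> 'm set"
  for R M S
  where
    zero: "\<zero>\<^bsub>M\<^esub> \<in> lmod_span R M S"
  | step: "\<lbrakk>r \<in> carrier R; x \<in> S; y \<in> lmod_span R M S\<rbrakk> \<Longrightarrow> r \<odot>\<^bsub>M\<^esub> x \<oplus>\<^bsub>M\<^esub> y \<in> lmod_span R M S"

definition fg_submodule ::
  "('r, 'c) ring_scheme \<Rightarrow> ('r, 'm, 'd) module_scheme \<Rightarrow> 'm set \<Rightarrow> bool"
  where "fg_submodule R M K \<longleftrightarrow> (\<exists>S. finite S \<and> S \<subseteq> carrier M \<and> lmod_span R M S = K)"

text \<open>The free left module with basis \<open>V\<close>: finitely supported functions from \<open>V\<close> to \<open>R\<close>.\<close>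

definition free_module ::
  "('r, 'c) ring_scheme \<Rightarrow> 'x set \<Rightarrow> ('r, 'x \<Rightarrow> 'r) module"
  where "free_module R V =
    \<lparr>carrier = {f. range f \<subseteq> carrier R \<and> finite (msupp R f) \<and> msupp R f \<subseteq> V},
     monoid.mult = undefined,
     one = undefined,
     zero = \<lambda>_. \<zero>\<^bsub>R\<^esub>,
     add = \<lambda>f g x. f x \<oplus>\<^bsub>R\<^esub> g x,
     smult = \<lambda>r f x. r \<otimes>\<^bsub>R\<^esub> f x\<rparr>"

text \<open>
  Projective means direct summand of a free module.  A basis of such a free module may be taken
  inside the type of elements of \<open>P\<close>, because a projective \<open>P\<close> is a summand of the free module
  on the set \<^term>\<open>carrier P\<close>.
\<close>

definition projective_module ::
  "('r, 'c) ring_scheme \<Rightarrow> ('r, 'p, 'd) module_scheme \<Rightarrow> bool"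
  where "projective_module R P \<longleftrightarrow>
    left_module R P \<and>
    (\<exists>(V :: 'p set) i p. i \<in> lmod_hom R P (free_module R V) \<and> p \<in> lmod_hom R (free_module R V) P \<and>
      (\<forall>x\<in>carrier P. p (i x) = x))"

text \<open>
  \<open>proj_dim_le_1 R M\<close>: there is an exact sequence \<open>0 \<rightarrow> P1 \<rightarrow> P0 \<rightarrow> M \<rightarrow> 0\<close> with projective \<open>P0\<close>,
  \<open>P1\<close>.  The type of their elements is no restriction: if such a sequence exists at all,
  then by Schanuel's lemma one exists in which \<open>P0\<close> is the free module on \<^term>\<open>carrier M\<close> and
  \<open>P1\<close> is the kernel of the canonical map \<open>P0 \<rightarrow> M\<close>.
\<close>

definition proj_dim_le_1 ::
  "('r, 'c) ring_scheme \<Rightarrow> ('r, 'm, 'd) module_scheme \<Rightarrow> bool"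
  where "proj_dim_le_1 R M \<longleftrightarrow>
    (\<exists>(P0 :: ('r, 'm \<Rightarrow> 'r) module) (P1 :: ('r, 'm \<Rightarrow> 'r) module) d e.
      projective_module R P0 \<and> projective_module R P1 \<and>
      d \<in> lmod_hom R P1 P0 \<and> e \<in> lmod_hom R P0 M \<and>
      inj_on d (carrier P1) \<and> d ` carrier P1 = a_kernel P0 M e \<and> e ` carrier P0 = carrier M)"

definition left_gldim_le_1 :: "'m itself \<Rightarrow> ('r, 'c) ring_scheme \<Rightarrow> bool"
  where "left_gldim_le_1 _ R \<longleftrightarrow> (\<forall>M :: ('r, 'm) module. left_module R M \<longrightarrow> proj_dim_le_1 R M)"

text \<open>
  A formula cannot quantify over modules of all types.  The type chosen here carries a copy of every
  countably generated module: the cosets of a submodule of the free module with countable basis are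
  sets of functions from \<^typ>\<open>nat\<close> to \<open>R\<close>.  By Auslander's theorem the global dimension is the supremum of the projective dimensions
  of the cyclic modules, so this is equivalent to the condition on all left modules.
\<close>

definition hereditary :: "('r, 'c) ring_scheme \<Rightarrow> bool"
  where "hereditary R \<longleftrightarrow> left_gldim_le_1 TYPE((nat \<Rightarrow> 'r) set) R"

definition coherent_algebra ::
  "('k, 'c) ring_scheme \<Rightarrow> ('k, 'a, 'd) module_scheme \<Rightarrow> bool"
  where "coherent_algebra k A \<longleftrightarrow>
    (let E = enveloping_algebra k A; F = (\<lambda>p :: nat. free_module E {..<p}) in
      \<forall>p q. \<forall>f\<in>lmod_hom E (F p) (F q). fg_submodule E (F p) (a_kernel (F p) (F q) f))"


section \<open>The representation scheme\<close>

text \<open>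
  The coordinate ring of \<open>Rep\<^sub>A\<^sup>n\<close>: generated by the entries \<open>x(a,i,j)\<close> of a generic
  matrix for every element \<open>a\<close> of \<open>A\<close>, subject to the relations saying that \<open>a \<mapsto> (x(a,i,j))\<close> is a
  homomorphism of algebras.
\<close>

definition rep_relations ::
  "('k, 'c) ring_scheme \<Rightarrow> ('k, 'a, 'd) module_scheme \<Rightarrow> nat
    \<Rightarrow> (('a \<times> nat \<times> nat) multiset \<Rightarrow> 'k) set"
  where "rep_relations k A n =
    (let P = poly_algebra k (carrier A \<times> {..<n} \<times> {..<n});
         x = (\<lambda>a i j. poly_var k (a, i, j)) in
      {x (a \<oplus>\<^bsub>A\<^esub> b) i j \<ominus>\<^bsub>P\<^esub> (x a i j \<oplus>\<^bsub>P\<^esub> x b i j) | a b i j.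
          a \<in> carrier A \<and> b \<in> carrier A \<and> i < n \<and> j < n} \<union>
      {x (c \<odot>\<^bsub>A\<^esub> a) i j \<ominus>\<^bsub>P\<^esub> c \<odot>\<^bsub>P\<^esub> x a i j | c a i j.
          c \<in> carrier k \<and> a \<in> carrier A \<and> i < n \<and> j < n} \<union>
      {x \<one>\<^bsub>A\<^esub> i j \<ominus>\<^bsub>P\<^esub> (if i = j then \<one>\<^bsub>P\<^esub> else \<zero>\<^bsub>P\<^esub>) | i j. i < n \<and> j < n} \<union>
      {x (a \<otimes>\<^bsub>A\<^esub> b) i j \<ominus>\<^bsub>P\<^esub> (\<Oplus>\<^bsub>P\<^esub>l\<in>{..<n}. x a i l \<otimes>\<^bsub>P\<^esub> x b l j) | a b i j.
          a \<in> carrier A \<and> b \<in> carrier A \<and> i < n \<and> j < n})"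

definition rep_coord_ring ::
  "('k, 'c) ring_scheme \<Rightarrow> ('k, 'a, 'd) module_scheme \<Rightarrow> nat
    \<Rightarrow> ('k, (('a \<times> nat \<times> nat) multiset \<Rightarrow> 'k) set) module"
  where "rep_coord_ring k A n =
    (let P = poly_algebra k (carrier A \<times> {..<n} \<times> {..<n}) in
      quot_algebra P (Idl\<^bsub>P\<^esub> (rep_relations k A n)))"

definition generic_rep ::
  "('k, 'c) ring_scheme \<Rightarrow> ('k, 'a, 'd) module_scheme \<Rightarrow> nat
    \<Rightarrow> 'a \<Rightarrow> nat \<times> nat \<Rightarrow> (('a \<times> nat \<times> nat) multiset \<Rightarrow> 'k) set"
  where "generic_rep k A n a =
    (\<lambda>(i, j)\<in>{..<n} \<times> {..<n}.
      let P = poly_algebra k (carrier A \<times> {..<n} \<times> {..<n}) in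
        Idl\<^bsub>P\<^esub> (rep_relations k A n) +>\<^bsub>P\<^esub> poly_var k (a, i, j))"


section \<open>Smooth affine schemes\<close>

definition finitely_presented_algebra ::
  "('k, 'c) ring_scheme \<Rightarrow> ('k, 'r, 'd) module_scheme \<Rightarrow> bool"
  where "finitely_presented_algebra k R \<longleftrightarrow>
    (\<exists>(m :: nat) S. finite S \<and> S \<subseteq> carrier (poly_algebra k {..<m}) \<and>
      (let Q = quot_algebra (poly_algebra k {..<m}) (Idl\<^bsub>poly_algebra k {..<m}\<^esub> S) in
        \<exists>f\<in>alg_hom k Q R. bij_betw f (carrier Q) (carrier R)))"

text \<open>
  The infinitesimal lifting property, for commutative test algebras with elements in a type \<open>'b\<close>.
  The property proper is the conjunction of these statements over all types \<open>'b\<close>; a theorem asserting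
  it has a type variable in place of \<open>'b\<close>.
\<close>

definition formally_smooth ::
  "'b itself \<Rightarrow> ('k, 'c) ring_scheme \<Rightarrow> ('k, 'r, 'd) module_scheme \<Rightarrow> bool"
  where "formally_smooth _ k R \<longleftrightarrow>
    (\<forall>(B :: ('k, 'b) module) I.
      algebra k B \<and> ideal I B \<and> (\<forall>x\<in>I. \<forall>y\<in>I. x \<otimes>\<^bsub>B\<^esub> y = \<zero>\<^bsub>B\<^esub>) \<longrightarrow>
      (\<forall>g\<in>alg_hom k R (quot_algebra B I).
        \<exists>f\<in>alg_hom k R B. \<forall>x\<in>carrier R. I +>\<^bsub>B\<^esub> f x = g x))"

text \<open>
  Smoothness of the affine scheme \<open>Spec R\<close> over \<open>k\<close> in the sense of EGA: formally smooth and of finite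
  presentation.
\<close>

definition smooth_affine_scheme ::
  "'b itself \<Rightarrow> ('k, 'c) ring_scheme \<Rightarrow> ('k, 'r, 'd) module_scheme \<Rightarrow> bool"
  where "smooth_affine_scheme T k R \<longleftrightarrow>
    algebra k R \<and> finitely_presented_algebra k R \<and> formally_smooth T k R"


section \<open>Universal properties of the constructions\<close>

locale monoid_algebra_loc = k?: cring k + G?: Group.monoid G
  for k :: "('k, 'c) ring_scheme" (structure) and G :: "('g, 'd) monoid_scheme" (structure)
begin

abbreviation "P \<equiv> monoid_algebra k G"

lemma P_carrier: "f \<in> carrier P \<longleftrightarrow>
    (\<forall>x. f x \<in> carrier k) \<and> finite (msupp k f) \<and> msupp k f \<subseteq> carrier G"
  by (auto simp: monoid_algebra_def)

lemma P_coeff: "f \<in> carrier P \<Longrightarrow> f x \<in> carrier k"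
  by (auto simp: P_carrier)

lemma P_add: "f \<oplus>\<^bsub>P\<^esub> g = (\<lambda>x. f x \<oplus>\<^bsub>k\<^esub> g x)"
  and P_zero: "\<zero>\<^bsub>P\<^esub> = (\<lambda>_. \<zero>\<^bsub>k\<^esub>)"
  and P_one: "\<one>\<^bsub>P\<^esub> = msingle k \<one>\<^bsub>G\<^esub>"
  and P_smult: "c \<odot>\<^bsub>P\<^esub> f = (\<lambda>x. c \<otimes>\<^bsub>k\<^esub> f x)"
  by (simp_all add: monoid_algebra_def)

lemma P_mult:
  assumes f: "f \<in> carrier P" and g: "g \<in> carrier P"
    and S: "finite S" "msupp k f \<subseteq> S" and T: "finite T" "msupp k g \<subseteq> T"
  shows "(f \<otimes>\<^bsub>P\<^esub> g) z =
    finsum k (\<lambda>p. if fst p \<otimes>\<^bsub>G\<^esub> snd p = z then f (fst p) \<otimes>\<^bsub>k\<^esub> g (snd p) else \<zero>\<^bsub>k\<^esub>) (S \<times> T)"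
proof -
  have c: "f x \<in> carrier k" "g x \<in> carrier k" for x
    using f g by (auto simp: P_carrier)
  let ?A = "{(x, y). x \<in> msupp k f \<and> y \<in> msupp k g \<and> x \<otimes>\<^bsub>G\<^esub> y = z}"
  have "(f \<otimes>\<^bsub>P\<^esub> g) z = finsum k (\<lambda>(x, y). f x \<otimes>\<^bsub>k\<^esub> g y) ?A"
    by (simp add: monoid_algebra_def)
  also have "\<dots> = finsum k (\<lambda>p. if fst p \<otimes>\<^bsub>G\<^esub> snd p = z then f (fst p) \<otimes>\<^bsub>k\<^esub> g (snd p) else \<zero>\<^bsub>k\<^esub>) (S \<times> T)"
  proof (rule k.add.finprod_mono_neutral_cong_left)
    show "finite (S \<times> T)" using S T by simp
    show "?A \<subseteq> S \<times> T" using S T by auto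
    show "\<And>i. i \<in> S \<times> T - ?A \<Longrightarrow>
       (if fst i \<otimes>\<^bsub>G\<^esub> snd i = z then f (fst i) \<otimes>\<^bsub>k\<^esub> g (snd i) else \<zero>\<^bsub>k\<^esub>) = \<zero>\<^bsub>k\<^esub>"
      using c by (auto simp: msupp_def)
    show "\<And>x. x \<in> ?A \<Longrightarrow> (case x of (x, y) \<Rightarrow> f x \<otimes>\<^bsub>k\<^esub> g y) =
       (if fst x \<otimes>\<^bsub>G\<^esub> snd x = z then f (fst x) \<otimes>\<^bsub>k\<^esub> g (snd x) else \<zero>\<^bsub>k\<^esub>)"
      by auto
  qed (use c in auto)
  finally show ?thesis .
qed

lemma msupp_add: 
  assumes "f \<in> carrier P" "g \<in> carrier P"
  shows "msupp k (f \<oplus>\<^bsub>P\<^esub> g) \<subseteq> msupp k f \<union> msupp k g"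
  using assms by (auto simp: msupp_def P_add)

lemma P_add_closed: "\<lbrakk>f \<in> carrier P; g \<in> carrier P\<rbrakk> \<Longrightarrow> f \<oplus>\<^bsub>P\<^esub> g \<in> carrier P"
  using msupp_add[of f g] finite_subset[of _ "msupp k f \<union> msupp k g"]
  unfolding P_carrier by (auto simp: P_add)

lemma P_zero_closed: "\<zero>\<^bsub>P\<^esub> \<in> carrier P"
  by (auto simp: P_carrier P_zero msupp_def)

lemma P_smult_closed: 
  assumes "c \<in> carrier k" "f \<in> carrier P"
  shows "c \<odot>\<^bsub>P\<^esub> f \<in> carrier P"
proof -
  have "msupp k (c \<odot>\<^bsub>P\<^esub> f) \<subseteq> msupp k f" using assms by (auto simp: msupp_def P_smult)
  with assms finite_subset show ?thesis unfolding P_carrier by (auto simp: P_smult) 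
qed

lemma msingle_closed: "x \<in> carrier G \<Longrightarrow> msingle k x \<in> carrier P"
  by (auto simp: P_carrier msingle_def msupp_def intro: finite_subset[of _ "{x}"])

lemma P_abelian_group: "abelian_group P"
proof (rule abelian_groupI)
  fix f assume f: "f \<in> carrier P"
  have "(\<ominus>\<^bsub>k\<^esub> \<one>\<^bsub>k\<^esub>) \<odot>\<^bsub>P\<^esub> f \<in> carrier P" using f by (intro P_smult_closed) auto
  moreover have "(\<ominus>\<^bsub>k\<^esub> \<one>\<^bsub>k\<^esub>) \<odot>\<^bsub>P\<^esub> f \<oplus>\<^bsub>P\<^esub> f = \<zero>\<^bsub>P\<^esub>"
    using P_coeff[OF f] by (auto simp: P_add P_zero P_smult k.l_minus k.l_neg)
  ultimately show "\<exists>y\<in>carrier P. y \<oplus>\<^bsub>P\<^esub> f = \<zero>\<^bsub>P\<^esub>" by blast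
qed (auto simp: P_add_closed P_zero_closed P_coeff intro!: ext, auto simp: P_add P_zero P_coeff k.a_ac)

lemma P_module: "module k P"
  by (rule moduleI)
    (auto simp: P_abelian_group P_smult_closed intro: k.cring_axioms intro!: ext,
     auto simp: P_add P_smult P_coeff k.l_distr k.r_distr k.m_assoc)

sublocale Pm: module k P by (rule P_module)

lemma P_mult_closed:
  assumes f: "f \<in> carrier P" and g: "g \<in> carrier P"
  shows "f \<otimes>\<^bsub>P\<^esub> g \<in> carrier P"
proof -
  have c: "f x \<in> carrier k" "g x \<in> carrier k" for x
    using f g by (auto simp: P_carrier)
  have fin: "finite (msupp k f)" "finite (msupp k g)" "msupp k f \<subseteq> carrier G" "msupp k g \<subseteq> carrier G"
    using f g by (auto simp: P_carrier)
  note m = P_mult[OF f g fin(1) subset_refl fin(2) subset_refl]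
  have "msupp k (f \<otimes>\<^bsub>P\<^esub> g) \<subseteq> (\<lambda>p. fst p \<otimes>\<^bsub>G\<^esub> snd p) ` (msupp k f \<times> msupp k g)"
  proof
    fix z assume "z \<in> msupp k (f \<otimes>\<^bsub>P\<^esub> g)"
    hence "(f \<otimes>\<^bsub>P\<^esub> g) z \<noteq> \<zero>\<^bsub>k\<^esub>" by (simp add: msupp_def)
    moreover have "(f \<otimes>\<^bsub>P\<^esub> g) z = \<zero>\<^bsub>k\<^esub>"
      if "\<And>p. p \<in> msupp k f \<times> msupp k g \<Longrightarrow> fst p \<otimes>\<^bsub>G\<^esub> snd p \<noteq> z"
      unfolding m by (rule k.add.finprod_one_eqI) (use that in auto)
    ultimately obtain p where "p \<in> msupp k f \<times> msupp k g" "fst p \<otimes>\<^bsub>G\<^esub> snd p = z" by blast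
    thus "z \<in> (\<lambda>p. fst p \<otimes>\<^bsub>G\<^esub> snd p) ` (msupp k f \<times> msupp k g)" by (auto split: if_splits)
  qed
  moreover have "finite \<dots>" using fin by simp
  moreover have "\<dots> \<subseteq> carrier G" using fin by (auto intro!: G.m_closed)
  moreover have "(f \<otimes>\<^bsub>P\<^esub> g) z \<in> carrier k" for z
    unfolding m by (rule k.add.finprod_closed) (use c in auto)
  ultimately show ?thesis unfolding P_carrier by (meson finite_subset subset_trans)
qed

lemma P_l_distr:
  assumes f: "f \<in> carrier P" and g: "g \<in> carrier P" and h: "h \<in> carrier P"
  shows "(f \<oplus>\<^bsub>P\<^esub> g) \<otimes>\<^bsub>P\<^esub> h = f \<otimes>\<^bsub>P\<^esub> h \<oplus>\<^bsub>P\<^esub> g \<otimes>\<^bsub>P\<^esub> h"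
proof
  fix z
  let ?S = "msupp k f \<union> msupp k g"
  have S: "finite ?S" "finite (msupp k h)" using f g h by (auto simp: P_carrier)
  have c: "f x \<in> carrier k" "g x \<in> carrier k" "h x \<in> carrier k" for x
    using f g h by (auto simp: P_carrier)
  note eqs = P_mult[OF P_add_closed[OF f g] h S(1) msupp_add[OF f g] S(2) subset_refl]
    P_mult[OF f h S(1) _ S(2) subset_refl] P_mult[OF g h S(1) _ S(2) subset_refl]
  show "((f \<oplus>\<^bsub>P\<^esub> g) \<otimes>\<^bsub>P\<^esub> h) z = (f \<otimes>\<^bsub>P\<^esub> h \<oplus>\<^bsub>P\<^esub> g \<otimes>\<^bsub>P\<^esub> h) z"
    by (subst P_add, simp only: eqs Un_upper1 Un_upper2, subst k.add.finprod_multf[symmetric])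
      (auto simp: c P_add k.l_distr simp del: k.add.finprod_multf intro!: k.add.finprod_cong')
qed

lemma P_r_distr:
  assumes f: "f \<in> carrier P" and g: "g \<in> carrier P" and h: "h \<in> carrier P"
  shows "h \<otimes>\<^bsub>P\<^esub> (f \<oplus>\<^bsub>P\<^esub> g) = h \<otimes>\<^bsub>P\<^esub> f \<oplus>\<^bsub>P\<^esub> h \<otimes>\<^bsub>P\<^esub> g"
proof
  fix z
  let ?S = "msupp k f \<union> msupp k g"
  have S: "finite ?S" "finite (msupp k h)" using f g h by (auto simp: P_carrier)
  have c: "f x \<in> carrier k" "g x \<in> carrier k" "h x \<in> carrier k" for x
    using f g h by (auto simp: P_carrier)
  note eqs = P_mult[OF h P_add_closed[OF f g] S(2) subset_refl S(1) msupp_add[OF f g]]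
    P_mult[OF h f S(2) subset_refl S(1)] P_mult[OF h g S(2) subset_refl S(1)]
  show "(h \<otimes>\<^bsub>P\<^esub> (f \<oplus>\<^bsub>P\<^esub> g)) z = (h \<otimes>\<^bsub>P\<^esub> f \<oplus>\<^bsub>P\<^esub> h \<otimes>\<^bsub>P\<^esub> g) z"
    by (subst P_add, simp only: eqs Un_upper1 Un_upper2, subst k.add.finprod_multf[symmetric])
      (auto simp: c P_add k.r_distr simp del: k.add.finprod_multf intro!: k.add.finprod_cong')
qed

lemma msingle_mult:
  assumes "x \<in> carrier G" "y \<in> carrier G" "c \<in> carrier k" "d \<in> carrier k"
  shows "(c \<odot>\<^bsub>P\<^esub> msingle k x) \<otimes>\<^bsub>P\<^esub> (d \<odot>\<^bsub>P\<^esub> msingle k y) = (c \<otimes>\<^bsub>k\<^esub> d) \<odot>\<^bsub>P\<^esub> msingle k (x \<otimes>\<^bsub>G\<^esub> y)"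
proof
  fix z
  have s: "msupp k (c \<odot>\<^bsub>P\<^esub> msingle k x) \<subseteq> {x}" "msupp k (d \<odot>\<^bsub>P\<^esub> msingle k y) \<subseteq> {y}"
    using assms by (auto simp: msupp_def P_smult msingle_def)
  have cl: "c \<odot>\<^bsub>P\<^esub> msingle k x \<in> carrier P" "d \<odot>\<^bsub>P\<^esub> msingle k y \<in> carrier P"
    using assms by (auto simp: P_smult_closed msingle_closed)
  show "((c \<odot>\<^bsub>P\<^esub> msingle k x) \<otimes>\<^bsub>P\<^esub> (d \<odot>\<^bsub>P\<^esub> msingle k y)) z = ((c \<otimes>\<^bsub>k\<^esub> d) \<odot>\<^bsub>P\<^esub> msingle k (x \<otimes>\<^bsub>G\<^esub> y)) z"
    using assms P_mult[OF cl _ s(1) _ s(2), of z]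
    by (auto simp: P_smult msingle_def)
qed

lemma P_induct [consumes 1, case_names zero single add]:
  assumes f: "f \<in> carrier P" and z: "Q \<zero>\<^bsub>P\<^esub>"
    and s: "\<And>c x. \<lbrakk>c \<in> carrier k; x \<in> carrier G\<rbrakk> \<Longrightarrow> Q (c \<odot>\<^bsub>P\<^esub> msingle k x)"
    and a: "\<And>f g. \<lbrakk>f \<in> carrier P; g \<in> carrier P; Q f; Q g\<rbrakk> \<Longrightarrow> Q (f \<oplus>\<^bsub>P\<^esub> g)"
  shows "Q f"
proof -
  have "\<forall>f. f \<in> carrier P \<longrightarrow> msupp k f \<subseteq> S \<longrightarrow> Q f" if "finite S" for S
    using that
  proof induction
    case empty
    have "f = \<zero>\<^bsub>P\<^esub>" if "msupp k f \<subseteq> {}" for f using that by (auto simp: msupp_def P_zero)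
    thus ?case using z by auto
  next
    case (insert x S)
    show ?case
    proof (intro allI impI)
      fix f assume f: "f \<in> carrier P" and fS: "msupp k f \<subseteq> insert x S"
      show "Q f"
      proof (cases "x \<in> msupp k f")
        case True
        let ?g = "f(x := \<zero>\<^bsub>k\<^esub>)"
        have x: "x \<in> carrier G" using True f by (auto simp: P_carrier)
        have sg: "msupp k ?g \<subseteq> msupp k f" "msupp k ?g \<subseteq> S" using fS by (auto simp: msupp_def)
        have g: "?g \<in> carrier P" using f finite_subset[OF sg(1)] sg(1) by (auto simp: P_carrier)
        have "f = f x \<odot>\<^bsub>P\<^esub> msingle k x \<oplus>\<^bsub>P\<^esub> ?g"
          using f by (auto simp: P_add P_smult msingle_def P_coeff)
        moreover have "Q (f x \<odot>\<^bsub>P\<^esub> msingle k x \<oplus>\<^bsub>P\<^esub> ?g)"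
          using insert.IH g sg x f by (intro a s P_smult_closed msingle_closed) (auto simp: P_coeff)
        ultimately show ?thesis by metis
      qed (use insert.IH f fS in blast)
    qed
  qed
  thus ?thesis using f by (auto simp: P_carrier)
qed

lemma P_zero_mult: "f \<in> carrier P \<Longrightarrow> \<zero>\<^bsub>P\<^esub> \<otimes>\<^bsub>P\<^esub> f = \<zero>\<^bsub>P\<^esub>" "f \<in> carrier P \<Longrightarrow> f \<otimes>\<^bsub>P\<^esub> \<zero>\<^bsub>P\<^esub> = \<zero>\<^bsub>P\<^esub>"
  using P_mult[of "\<zero>\<^bsub>P\<^esub>" f "{}"] P_mult[of f "\<zero>\<^bsub>P\<^esub>" "msupp k f" "{}"]
  by (auto simp: P_zero_closed P_carrier msupp_def P_zero fun_eq_iff)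

lemmas P_simps = P_add_closed P_mult_closed P_smult_closed msingle_closed P_zero_closed
  P_l_distr P_r_distr P_zero_mult

lemma P_one_closed: "\<one>\<^bsub>P\<^esub> \<in> carrier P"
  by (simp add: P_one msingle_closed)

lemma P_assoc:
  assumes f: "f \<in> carrier P" and g: "g \<in> carrier P" and h: "h \<in> carrier P"
  shows "(f \<otimes>\<^bsub>P\<^esub> g) \<otimes>\<^bsub>P\<^esub> h = f \<otimes>\<^bsub>P\<^esub> (g \<otimes>\<^bsub>P\<^esub> h)"
  using f
proof (induction rule: P_induct)
  case (single c x)
  note cx = this
  show ?case using g
  proof (induction rule: P_induct)
    case (single d y)
    note dy = this
    show ?case using h
      by (induction rule: P_induct)
        (use cx dy in \<open>auto simp: P_simps msingle_mult k.m_assoc G.m_assoc\<close>)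
  qed (use cx h in \<open>auto simp: P_simps\<close>)
qed (use g h in \<open>auto simp: P_simps\<close>)

lemma P_smult_mult:
  assumes f: "f \<in> carrier P" and g: "g \<in> carrier P" and a: "a \<in> carrier k"
  shows "(a \<odot>\<^bsub>P\<^esub> f) \<otimes>\<^bsub>P\<^esub> g = a \<odot>\<^bsub>P\<^esub> (f \<otimes>\<^bsub>P\<^esub> g)" "f \<otimes>\<^bsub>P\<^esub> (a \<odot>\<^bsub>P\<^esub> g) = a \<odot>\<^bsub>P\<^esub> (f \<otimes>\<^bsub>P\<^esub> g)"
proof -
  have "(a \<odot>\<^bsub>P\<^esub> f) \<otimes>\<^bsub>P\<^esub> g = a \<odot>\<^bsub>P\<^esub> (f \<otimes>\<^bsub>P\<^esub> g) \<and> f \<otimes>\<^bsub>P\<^esub> (a \<odot>\<^bsub>P\<^esub> g) = a \<odot>\<^bsub>P\<^esub> (f \<otimes>\<^bsub>P\<^esub> g)"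
    using f
  proof (induction rule: P_induct)
    case (single c x)
    note cx = this
    show ?case using g
    proof (induction rule: P_induct)
      case (single d y)
      thus ?case using cx a
        by (simp add: msingle_mult k.m_ac msingle_closed flip: Pm.smult_assoc1)
    qed (use cx a in \<open>auto simp: P_simps Pm.smult_r_distr\<close>)
  qed (use g a in \<open>auto simp: P_simps Pm.smult_r_distr\<close>)
  thus "(a \<odot>\<^bsub>P\<^esub> f) \<otimes>\<^bsub>P\<^esub> g = a \<odot>\<^bsub>P\<^esub> (f \<otimes>\<^bsub>P\<^esub> g)" "f \<otimes>\<^bsub>P\<^esub> (a \<odot>\<^bsub>P\<^esub> g) = a \<odot>\<^bsub>P\<^esub> (f \<otimes>\<^bsub>P\<^esub> g)" by auto
qed

lemma P_one_single: "\<one>\<^bsub>P\<^esub> = \<one>\<^bsub>k\<^esub> \<odot>\<^bsub>P\<^esub> msingle k \<one>\<^bsub>G\<^esub>"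
  by (simp add: P_one msingle_closed)

lemma P_one_mult:
  assumes f: "f \<in> carrier P"
  shows "\<one>\<^bsub>P\<^esub> \<otimes>\<^bsub>P\<^esub> f = f" "f \<otimes>\<^bsub>P\<^esub> \<one>\<^bsub>P\<^esub> = f"
proof -
  have "\<one>\<^bsub>P\<^esub> \<otimes>\<^bsub>P\<^esub> f = f \<and> f \<otimes>\<^bsub>P\<^esub> \<one>\<^bsub>P\<^esub> = f"
    using f
  proof (induction rule: P_induct)
    case (single c x)
    thus ?case unfolding P_one_single by (simp add: msingle_mult)
  qed (auto simp: P_simps P_one_closed)
  thus "\<one>\<^bsub>P\<^esub> \<otimes>\<^bsub>P\<^esub> f = f" "f \<otimes>\<^bsub>P\<^esub> \<one>\<^bsub>P\<^esub> = f" by auto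
qed

lemma P_ring: "ring P"
  by (rule ringI[OF P_abelian_group monoidI])
    (auto simp: P_simps P_assoc P_one_closed P_one_mult)

lemma assoc_algebra_monoid_algebra: "assoc_algebra k P"
  by (intro assoc_algebra.intro assoc_algebra_axioms.intro P_module P_ring P_smult_mult)


lemma algebra_monoid_algebra:
  assumes "comm_monoid G"
  shows "algebra k P"
proof -
  interpret comm_monoid G by fact
  have "f \<otimes>\<^bsub>P\<^esub> g = g \<otimes>\<^bsub>P\<^esub> f" if f: "f \<in> carrier P" and g: "g \<in> carrier P" for f g
    using f
  proof (induction rule: P_induct)
    case (single c x)
    note cx = this
    show ?case using g
      by (induction rule: P_induct) (use cx in \<open>auto simp: P_simps msingle_mult k.m_comm m_comm\<close>)
  qed (use g in \<open>auto simp: P_simps\<close>)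
  hence "cring P"
    by (intro cring.intro P_ring comm_monoid.intro comm_monoid_axioms.intro ring.is_monoid)
  thus ?thesis
    by (intro algebra.intro algebra_axioms.intro P_module P_smult_mult)
qed

lemma monoid_algebra_lift:
  fixes B :: "('k, 'b, 'e) module_scheme"
  assumes B: "assoc_algebra k B" and \<phi>: "\<phi> \<in> carrier G \<rightarrow> carrier B"
    and \<phi>1: "\<phi> \<one>\<^bsub>G\<^esub> = \<one>\<^bsub>B\<^esub>"
    and \<phi>m: "\<And>x y. \<lbrakk>x \<in> carrier G; y \<in> carrier G\<rbrakk> \<Longrightarrow> \<phi> (x \<otimes>\<^bsub>G\<^esub> y) = \<phi> x \<otimes>\<^bsub>B\<^esub> \<phi> y"
  shows "\<exists>h\<in>alg_hom k P B. \<forall>x\<in>carrier G. h (msingle k x) = \<phi> x"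
proof -
  interpret B: assoc_algebra k B by fact
  define E where "E f = finsum B (\<lambda>x. f x \<odot>\<^bsub>B\<^esub> \<phi> x) (msupp k f)" for f
  have E: "E f = finsum B (\<lambda>x. f x \<odot>\<^bsub>B\<^esub> \<phi> x) S"
    if f: "f \<in> carrier P" and S: "finite S" "msupp k f \<subseteq> S" "S \<subseteq> carrier G" for f S
    unfolding E_def
  proof (rule B.add.finprod_mono_neutral_cong_left)
    show "\<And>i. i \<in> S - msupp k f \<Longrightarrow> f i \<odot>\<^bsub>B\<^esub> \<phi> i = \<zero>\<^bsub>B\<^esub>"
      using \<phi> S by (auto simp: msupp_def Pi_iff subset_iff)
  qed (use that \<phi> in \<open>auto simp: P_coeff intro!: B.smult_closed\<close>)
  have closed: "E f \<in> carrier B" if "f \<in> carrier P" for f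
    unfolding E_def using that \<phi> by (intro B.add.finprod_closed) (auto simp: P_carrier)
  have add: "E (f \<oplus>\<^bsub>P\<^esub> g) = E f \<oplus>\<^bsub>B\<^esub> E g" if f: "f \<in> carrier P" and g: "g \<in> carrier P" for f g
  proof -
    let ?S = "msupp k f \<union> msupp k g"
    have S: "finite ?S" "?S \<subseteq> carrier G" using f g by (auto simp: P_carrier)
    have "E (f \<oplus>\<^bsub>P\<^esub> g) = finsum B (\<lambda>x. f x \<odot>\<^bsub>B\<^esub> \<phi> x \<oplus>\<^bsub>B\<^esub> g x \<odot>\<^bsub>B\<^esub> \<phi> x) ?S"
      unfolding E[OF P_add_closed[OF f g] S(1) msupp_add[OF f g] S(2)]
      using f g S \<phi>
      by (intro B.add.finprod_cong') (auto simp: P_add B.smult_l_distr P_coeff Pi_iff subset_iff)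
    also have "\<dots> = E f \<oplus>\<^bsub>B\<^esub> E g"
      unfolding E[OF f S(1) Un_upper1 S(2)] E[OF g S(1) Un_upper2 S(2)]
      using f g S \<phi> by (intro B.add.finprod_multf) (auto simp: P_coeff Pi_iff subset_iff)
    finally show ?thesis .
  qed
  have zero: "E \<zero>\<^bsub>P\<^esub> = \<zero>\<^bsub>B\<^esub>" unfolding E_def by (simp add: msupp_def P_zero)
  have single: "E (c \<odot>\<^bsub>P\<^esub> msingle k x) = c \<odot>\<^bsub>B\<^esub> \<phi> x" if c: "c \<in> carrier k" and x: "x \<in> carrier G" for c x
  proof -
    have "E (c \<odot>\<^bsub>P\<^esub> msingle k x) = finsum B (\<lambda>y. (c \<odot>\<^bsub>P\<^esub> msingle k x) y \<odot>\<^bsub>B\<^esub> \<phi> y) {x}"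
      using c x by (intro E P_smult_closed msingle_closed) (auto simp: msupp_def P_smult msingle_def)
    also have "\<dots> = c \<odot>\<^bsub>B\<^esub> \<phi> x"
    proof -
      have "\<phi> x \<in> carrier B" using \<phi> x by auto
      thus ?thesis using c by (simp add: P_smult msingle_def)
    qed
    finally show ?thesis .
  qed
  have smult: "E (c \<odot>\<^bsub>P\<^esub> f) = c \<odot>\<^bsub>B\<^esub> E f" if c: "c \<in> carrier k" and f: "f \<in> carrier P" for c f
    using f
  proof (induction rule: P_induct)
    case (single d x)
    hence "\<phi> x \<in> carrier B" using \<phi> by auto
    have "c \<odot>\<^bsub>P\<^esub> (d \<odot>\<^bsub>P\<^esub> msingle k x) = (c \<otimes>\<^bsub>k\<^esub> d) \<odot>\<^bsub>P\<^esub> msingle k x"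
      using single c by (simp add: Pm.smult_assoc1 msingle_closed)
    thus ?case using single c \<open>\<phi> x \<in> carrier B\<close> \<open>\<And>c x. \<lbrakk>c \<in> carrier k; x \<in> carrier G\<rbrakk> \<Longrightarrow> E (c \<odot>\<^bsub>P\<^esub> msingle k x) = c \<odot>\<^bsub>B\<^esub> \<phi> x\<close>
      by (simp add: B.smult_assoc1)
  qed (use c zero add closed in \<open>auto simp: P_simps Pm.smult_r_distr B.smult_r_distr\<close>)
  have mult: "E (f \<otimes>\<^bsub>P\<^esub> g) = E f \<otimes>\<^bsub>B\<^esub> E g" if f: "f \<in> carrier P" and g: "g \<in> carrier P" for f g
    using f
  proof (induction rule: P_induct)
    case (single c x)
    note cx = this
    show ?case using g
    proof (induction rule: P_induct)
      case (single d y)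
      have "\<phi> x \<in> carrier B" "\<phi> y \<in> carrier B" using \<phi> cx single by auto
      thus ?case using cx single \<open>\<And>c x. \<lbrakk>c \<in> carrier k; x \<in> carrier G\<rbrakk> \<Longrightarrow> E (c \<odot>\<^bsub>P\<^esub> msingle k x) = c \<odot>\<^bsub>B\<^esub> \<phi> x\<close>
        by (simp add: msingle_mult \<phi>m B.smult_assoc_l B.smult_assoc_r k.m_comm flip: B.smult_assoc1)
    qed (use cx zero add closed in \<open>auto simp: P_simps B.r_distr\<close>)
  qed (use g zero add closed in \<open>auto simp: P_simps B.l_distr\<close>)
  have one: "E (msingle k x) = \<phi> x" if "x \<in> carrier G" for x
  proof -
    have "\<phi> x \<in> carrier B" using \<phi> that by auto
    thus ?thesis using single[OF k.one_closed that] that by (simp add: msingle_closed)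
  qed
  have "E \<in> alg_hom k P B"
    unfolding alg_hom_def
    by (auto intro!: ring_hom_memI simp: closed mult add smult P_one one \<phi>1)
  with one show ?thesis by blast
qed

lemma alg_hom_monoid_algebra_unique:
  fixes B :: "('k, 'b, 'e) module_scheme"
  assumes B: "assoc_algebra k B" and h: "h \<in> alg_hom k P B" and h': "h' \<in> alg_hom k P B"
    and eq: "\<And>x. x \<in> carrier G \<Longrightarrow> h (msingle k x) = h' (msingle k x)"
    and f: "f \<in> carrier P"
  shows "h f = h' f"
  using f
proof (induction rule: P_induct)
  case zero
  interpret B: assoc_algebra k B by fact
  have "h \<zero>\<^bsub>P\<^esub> = \<zero>\<^bsub>B\<^esub>" "h' \<zero>\<^bsub>P\<^esub> = \<zero>\<^bsub>B\<^esub>"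
    using h h' ring_hom_zero[OF _ P_ring B.ring_axioms] by (auto simp: alg_hom_def)
  thus ?case by simp
next
  case (single c x)
  thus ?case using h h' eq by (simp add: alg_hom_def msingle_closed)
next
  case (add f g)
  thus ?case using h h' by (auto simp: alg_hom_def ring_hom_add)
qed

end

lemma (in algebra) is_assoc_algebra: "assoc_algebra R M"
proof (intro assoc_algebra.intro assoc_algebra_axioms.intro module)
  show "ring M" by (rule cring.axioms(1)[OF M_cring])
  show "c \<odot>\<^bsub>M\<^esub> x \<otimes>\<^bsub>M\<^esub> y = c \<odot>\<^bsub>M\<^esub> (x \<otimes>\<^bsub>M\<^esub> y)" "x \<otimes>\<^bsub>M\<^esub> (c \<odot>\<^bsub>M\<^esub> y) = c \<odot>\<^bsub>M\<^esub> (x \<otimes>\<^bsub>M\<^esub> y)"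
    if "c \<in> carrier R" "x \<in> carrier M" "y \<in> carrier M" for c x y
    using that smult_assoc2[of c x y] smult_assoc2[of c y x]
      comm_monoid.m_comm[OF cring.axioms(2)[OF M_cring]] by simp_all
qed

context
  fixes k :: "('k, 'c) ring_scheme" and A :: "('k, 'a, 'd) module_scheme" and I :: "'a set"
  assumes A: "assoc_algebra k A" and I: "ideal I A"
begin

interpretation A: assoc_algebra k A by (rule A)
interpretation I: ideal I A by (rule I)

lemma quot_algebra_simps:
  "carrier (quot_algebra A I) = (\<lambda>x. I +>\<^bsub>A\<^esub> x) ` carrier A"
  "\<zero>\<^bsub>quot_algebra A I\<^esub> = I +>\<^bsub>A\<^esub> \<zero>\<^bsub>A\<^esub>"
  "\<one>\<^bsub>quot_algebra A I\<^esub> = I +>\<^bsub>A\<^esub> \<one>\<^bsub>A\<^esub>"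
  "\<lbrakk>x \<in> carrier A; y \<in> carrier A\<rbrakk> \<Longrightarrow>
    (I +>\<^bsub>A\<^esub> x) \<oplus>\<^bsub>quot_algebra A I\<^esub> (I +>\<^bsub>A\<^esub> y) = I +>\<^bsub>A\<^esub> (x \<oplus>\<^bsub>A\<^esub> y)"
  "\<lbrakk>x \<in> carrier A; y \<in> carrier A\<rbrakk> \<Longrightarrow>
    (I +>\<^bsub>A\<^esub> x) \<otimes>\<^bsub>quot_algebra A I\<^esub> (I +>\<^bsub>A\<^esub> y) = I +>\<^bsub>A\<^esub> (x \<otimes>\<^bsub>A\<^esub> y)"
  by (auto simp: quot_algebra_def ring.extend_def FactRing_def A_RCOSETS_def' I.rcoset_mult_add I.a_rcos_sum
      I.a_rcos_const)

lemma quot_algebra_smult: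
  assumes c: "c \<in> carrier k" and x: "x \<in> carrier A"
  shows "c \<odot>\<^bsub>quot_algebra A I\<^esub> (I +>\<^bsub>A\<^esub> x) = I +>\<^bsub>A\<^esub> (c \<odot>\<^bsub>A\<^esub> x)"
proof -
  have eq: "I +>\<^bsub>A\<^esub> (c \<odot>\<^bsub>A\<^esub> y) = I +>\<^bsub>A\<^esub> (c \<odot>\<^bsub>A\<^esub> x)" if y: "y \<in> I +>\<^bsub>A\<^esub> x" for y
  proof -
    from y obtain i where i: "i \<in> I" and yi: "y = i \<oplus>\<^bsub>A\<^esub> x" by (auto simp: a_r_coset_def')
    have iA: "i \<in> carrier A" using i I.a_subset by auto
    have "c \<odot>\<^bsub>A\<^esub> i = (c \<odot>\<^bsub>A\<^esub> \<one>\<^bsub>A\<^esub>) \<otimes>\<^bsub>A\<^esub> i" using A.smult_assoc_l[OF c A.one_closed iA] iA by simp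
    hence "c \<odot>\<^bsub>A\<^esub> i \<in> I" using I.I_l_closed[OF i] c by simp
    hence "c \<odot>\<^bsub>A\<^esub> y \<in> I +>\<^bsub>A\<^esub> (c \<odot>\<^bsub>A\<^esub> x)"
      using yi A.smult_r_distr[OF c iA x] by (auto simp: a_r_coset_def')
    thus ?thesis using I.a_repr_independence'[of _ "c \<odot>\<^bsub>A\<^esub> x"] c x by simp
  qed
  have "x \<in> I +>\<^bsub>A\<^esub> x" by (rule I.a_rcos_self[OF x])
  hence "I +>\<^bsub>A\<^esub> x \<noteq> {}" by blast
  hence "(\<Union>y\<in>I +>\<^bsub>A\<^esub> x. I +>\<^bsub>A\<^esub> (c \<odot>\<^bsub>A\<^esub> y)) = I +>\<^bsub>A\<^esub> (c \<odot>\<^bsub>A\<^esub> x)"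
    by (rule SUP_eq_const) (rule eq)
  thus ?thesis by (simp add: quot_algebra_def ring.extend_def)
qed

lemma quot_algebra_ring: "ring (quot_algebra A I)"
proof -
  have cl: "x \<oplus>\<^bsub>A Quot I\<^esub> y = x \<oplus>\<^bsub>quot_algebra A I\<^esub> y" "x \<otimes>\<^bsub>A Quot I\<^esub> y = x \<otimes>\<^bsub>quot_algebra A I\<^esub> y"
     "\<zero>\<^bsub>A Quot I\<^esub> = \<zero>\<^bsub>quot_algebra A I\<^esub>" "\<one>\<^bsub>A Quot I\<^esub> = \<one>\<^bsub>quot_algebra A I\<^esub>"
     "carrier (A Quot I) = carrier (quot_algebra A I)" for x y
    by (simp_all add: quot_algebra_def ring.extend_def)
  interpret Q: ring "A Quot I" by (rule I.quotient_is_ring)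
  show ?thesis
    by (intro ringI abelian_groupI monoidI; unfold cl[symmetric])
      (auto simp: Q.a_ac Q.m_assoc Q.l_distr Q.r_distr intro: Q.add.l_inv_ex)
qed

lemma assoc_algebra_quot_algebra: "assoc_algebra k (quot_algebra A I)"
proof (intro assoc_algebra.intro assoc_algebra_axioms.intro moduleI quot_algebra_ring)
  show "abelian_group (quot_algebra A I)" by (rule ring.is_abelian_group[OF quot_algebra_ring])
qed (auto simp: quot_algebra_simps quot_algebra_smult A.smult_l_distr A.smult_r_distr
   A.smult_assoc1 A.smult_assoc_l A.smult_assoc_r intro: A.R.cring_axioms)

lemma quot_algebra_proj: "(\<lambda>x. I +>\<^bsub>A\<^esub> x) \<in> alg_hom k A (quot_algebra A I)"
  unfolding alg_hom_def
  by (auto intro!: ring_hom_memI simp: quot_algebra_simps quot_algebra_smult)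

lemma quot_algebra_eq: 
  assumes "x \<in> carrier A" "y \<in> carrier A" "x \<ominus>\<^bsub>A\<^esub> y \<in> I"
  shows "I +>\<^bsub>A\<^esub> x = I +>\<^bsub>A\<^esub> y"
proof -
  have "x = (x \<ominus>\<^bsub>A\<^esub> y) \<oplus>\<^bsub>A\<^esub> y"
    using assms by (simp add: a_minus_def A.a_assoc A.l_neg)
  hence "x \<in> I +>\<^bsub>A\<^esub> y" using assms(3) by (auto simp: a_r_coset_def')
  thus ?thesis using I.a_repr_independence' assms by auto
qed

lemma quot_algebra_lift:
  fixes B :: "('k, 'b, 'e) module_scheme"
  assumes B: "assoc_algebra k B" and h: "h \<in> alg_hom k A B" and h0: "\<And>x. x \<in> I \<Longrightarrow> h x = \<zero>\<^bsub>B\<^esub>"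
  shows "\<exists>g\<in>alg_hom k (quot_algebra A I) B. \<forall>x\<in>carrier A. g (I +>\<^bsub>A\<^esub> x) = h x"
proof -
  interpret B: assoc_algebra k B by fact
  note hh = h[unfolded alg_hom_def]
  have hc: "h x \<in> carrier B" if "x \<in> carrier A" for x using hh that by (auto simp: ring_hom_def)
  define g where "g Y = h (SOME x. x \<in> Y)" for Y
  have g: "g (I +>\<^bsub>A\<^esub> x) = h x" if x: "x \<in> carrier A" for x
  proof -
    have "(SOME y. y \<in> I +>\<^bsub>A\<^esub> x) \<in> I +>\<^bsub>A\<^esub> x" using I.a_rcos_self[OF x] by (rule someI)
    then obtain i where i: "i \<in> I" "(SOME y. y \<in> I +>\<^bsub>A\<^esub> x) = i \<oplus>\<^bsub>A\<^esub> x" by (auto simp: a_r_coset_def')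
    hence "i \<in> carrier A" using I.a_subset by auto
    thus ?thesis unfolding g_def i(2) using hh x h0[OF i(1)] hc[OF x] by (auto simp: ring_hom_add)
  qed
  have "g \<in> alg_hom k (quot_algebra A I) B"
    using hh unfolding alg_hom_def
    by (auto intro!: ring_hom_memI simp: quot_algebra_simps quot_algebra_smult g hc ring_hom_add ring_hom_mult ring_hom_one)
  with g show ?thesis by blast
qed

end

lemma algebra_quot_algebra:
  assumes A: "algebra k A" and I: "ideal I A"
  shows "algebra k (quot_algebra A I)"
proof -
  interpret A: algebra k A by fact
  note aa = A.is_assoc_algebra
  interpret Q: assoc_algebra k "quot_algebra A I" by (rule assoc_algebra_quot_algebra[OF aa I])
  have "cring (quot_algebra A I)"
    by (intro cring.intro Q.ring_axioms comm_monoid.intro comm_monoid_axioms.intro Q.is_monoid)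
      (auto simp: quot_algebra_simps[OF aa I] comm_monoid.m_comm[OF cring.axioms(2)[OF A.M_cring]])
  thus ?thesis
    by (intro algebra.intro algebra_axioms.intro Q.module_axioms Q.smult_assoc_l)
qed

lemma alg_hom_vanishes_genideal:
  assumes A: "assoc_algebra k A" and B: "assoc_algebra k B" and h: "h \<in> alg_hom k A B"
    and S: "S \<subseteq> carrier A" and h0: "\<And>s. s \<in> S \<Longrightarrow> h s = \<zero>\<^bsub>B\<^esub>" and x: "x \<in> Idl\<^bsub>A\<^esub> S"
  shows "h x = \<zero>\<^bsub>B\<^esub>"
proof -
  interpret A: assoc_algebra k A by fact
  interpret B: assoc_algebra k B by fact
  have "h \<in> ring_hom A B" using h by (simp add: alg_hom_def)
  then have "ring_hom_ring A B h" by (rule ring_hom_ringI2[OF A.ring_axioms B.ring_axioms])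
  then have "ideal (a_kernel A B h) A" by (rule ring_hom_ring.kernel_is_ideal)
  moreover have "S \<subseteq> a_kernel A B h" using S h0 by (auto simp: a_kernel_def')
  ultimately have "Idl\<^bsub>A\<^esub> S \<subseteq> a_kernel A B h" by (rule A.genideal_minimal)
  thus ?thesis using x by (auto simp: a_kernel_def')
qed

lemma assoc_algebra_opposite_algebra:
  assumes A: "assoc_algebra k A"
  shows "assoc_algebra k (opposite_algebra A)"
proof -
  interpret A: assoc_algebra k A by fact
  have s: "carrier (opposite_algebra A) = carrier A" "\<zero>\<^bsub>opposite_algebra A\<^esub> = \<zero>\<^bsub>A\<^esub>"
    "\<one>\<^bsub>opposite_algebra A\<^esub> = \<one>\<^bsub>A\<^esub>" "x \<oplus>\<^bsub>opposite_algebra A\<^esub> y = x \<oplus>\<^bsub>A\<^esub> y"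
    "x \<otimes>\<^bsub>opposite_algebra A\<^esub> y = y \<otimes>\<^bsub>A\<^esub> x" "c \<odot>\<^bsub>opposite_algebra A\<^esub> x = c \<odot>\<^bsub>A\<^esub> x" for x y c
    by (simp_all add: opposite_algebra_def)
  have "abelian_group (opposite_algebra A)"
    by (rule abelian_groupI) (auto simp: s A.a_ac intro: A.add.l_inv_ex)
  moreover have "Group.monoid (opposite_algebra A)"
    by (rule monoidI) (auto simp: s A.m_assoc)
  ultimately show ?thesis
    by (intro assoc_algebra.intro assoc_algebra_axioms.intro moduleI ringI A.R.cring_axioms)
      (auto simp: s A.l_distr A.r_distr A.smult_l_distr A.smult_r_distr A.smult_assoc1
        A.smult_assoc_l A.smult_assoc_r)
qed

lemma monoid_algebra_loc_DirProd:
  assumes A: "assoc_algebra k A" and B: "assoc_algebra k B"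
  shows "monoid_algebra_loc k (A \<times>\<times> B)"
proof -
  interpret A: assoc_algebra k A by fact
  interpret B: assoc_algebra k B by fact
  show ?thesis
    by (intro monoid_algebra_loc.intro A.R.cring_axioms DirProd_monoid A.monoid_axioms B.monoid_axioms)
qed

lemma tensor_relations_closed:
  assumes A: "assoc_algebra k A" and B: "assoc_algebra k B"
  shows "tensor_relations k A B \<subseteq> carrier (monoid_algebra k (A \<times>\<times> B))"
proof -
  interpret A: assoc_algebra k A by fact
  interpret B: assoc_algebra k B by fact
  interpret P: monoid_algebra_loc k "A \<times>\<times> B" by (rule monoid_algebra_loc_DirProd[OF A B])
  interpret Pr: ring P.P by (rule P.P_ring)
  have t: "msingle k (a, b) \<in> carrier P.P" if "a \<in> carrier A" "b \<in> carrier B" for a b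
    using that by (intro P.msingle_closed) (simp add: DirProd_def)
  show ?thesis
    unfolding tensor_relations_def Let_def
    by (auto intro!: abelian_group.minus_closed[OF P.P_abelian_group] P.P_add_closed P.P_smult_closed t)
qed

lemma assoc_algebra_tensor_algebra:
  assumes A: "assoc_algebra k A" and B: "assoc_algebra k B"
  shows "assoc_algebra k (tensor_algebra k A B)"
proof -
  interpret P: monoid_algebra_loc k "A \<times>\<times> B" by (rule monoid_algebra_loc_DirProd[OF A B])
  show ?thesis unfolding tensor_algebra_def Let_def
    by (intro assoc_algebra_quot_algebra P.assoc_algebra_monoid_algebra
        ring.genideal_ideal P.P_ring tensor_relations_closed A B)
qed

definition tensor_pure ::
  "('k, 'c) ring_scheme \<Rightarrow> ('k, 'a, 'd) module_scheme \<Rightarrow> ('k, 'b, 'e) module_scheme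
    \<Rightarrow> 'a \<Rightarrow> 'b \<Rightarrow> ('a \<times> 'b \<Rightarrow> 'k) set"
  where "tensor_pure k A B a b =
    (let P = monoid_algebra k (A \<times>\<times> B) in Idl\<^bsub>P\<^esub> (tensor_relations k A B) +>\<^bsub>P\<^esub> msingle k (a, b))"

lemma tensor_algebra_lift:
  fixes C :: "('k, 't, 'u) module_scheme"
  assumes A: "assoc_algebra k A" and B: "assoc_algebra k B" and C: "assoc_algebra k C"
    and f: "f \<in> alg_hom k A C" and g: "g \<in> alg_hom k B C"
    and comm: "\<And>a b. \<lbrakk>a \<in> carrier A; b \<in> carrier B\<rbrakk> \<Longrightarrow> f a \<otimes>\<^bsub>C\<^esub> g b = g b \<otimes>\<^bsub>C\<^esub> f a"
  shows "\<exists>h\<in>alg_hom k (tensor_algebra k A B) C. \<forall>a\<in>carrier A. \<forall>b\<in>carrier B.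
    h (tensor_pure k A B a b) = f a \<otimes>\<^bsub>C\<^esub> g b"
proof -
  interpret A: assoc_algebra k A by fact
  interpret B: assoc_algebra k B by fact
  interpret C: assoc_algebra k C by fact
  interpret P: monoid_algebra_loc k "A \<times>\<times> B" by (rule monoid_algebra_loc_DirProd[OF A B])
  interpret Pr: ring P.P by (rule P.P_ring)
  note aP = P.assoc_algebra_monoid_algebra
  have fr: "f \<in> ring_hom A C" and gr: "g \<in> ring_hom B C" using f g by (auto simp: alg_hom_def)
  have fc: "f a \<in> carrier C" if "a \<in> carrier A" for a using that fr by (auto simp: ring_hom_def)
  have gc: "g a \<in> carrier C" if "a \<in> carrier B" for a using that gr by (auto simp: ring_hom_def)
  have fs: "f (c \<odot>\<^bsub>A\<^esub> a) = c \<odot>\<^bsub>C\<^esub> f a" if "c \<in> carrier k" "a \<in> carrier A" for c a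
    using that f by (simp add: alg_hom_def)
  have gs: "g (c \<odot>\<^bsub>B\<^esub> a) = c \<odot>\<^bsub>C\<^esub> g a" if "c \<in> carrier k" "a \<in> carrier B" for c a
    using that g by (simp add: alg_hom_def)
  have "\<exists>h\<in>alg_hom k P.P C. \<forall>p\<in>carrier (A \<times>\<times> B). h (msingle k p) = f (fst p) \<otimes>\<^bsub>C\<^esub> g (snd p)"
  proof (rule P.monoid_algebra_lift[OF C])
    fix p q assume pq: "p \<in> carrier (A \<times>\<times> B)" "q \<in> carrier (A \<times>\<times> B)"
    obtain a b a' b' where e: "p = (a, b)" "q = (a', b')" "a \<in> carrier A" "a' \<in> carrier A"
      "b \<in> carrier B" "b' \<in> carrier B" using pq by (auto simp: DirProd_def)
    have "f a \<otimes>\<^bsub>C\<^esub> f a' \<otimes>\<^bsub>C\<^esub> (g b \<otimes>\<^bsub>C\<^esub> g b') = f a \<otimes>\<^bsub>C\<^esub> (f a' \<otimes>\<^bsub>C\<^esub> g b) \<otimes>\<^bsub>C\<^esub> g b'"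
      using e by (simp add: C.m_assoc fc gc)
    also have "\<dots> = f a \<otimes>\<^bsub>C\<^esub> g b \<otimes>\<^bsub>C\<^esub> (f a' \<otimes>\<^bsub>C\<^esub> g b')"
      unfolding comm[OF e(4,5)] using e by (simp add: C.m_assoc fc gc)
    finally show "f (fst (p \<otimes>\<^bsub>A \<times>\<times> B\<^esub> q)) \<otimes>\<^bsub>C\<^esub> g (snd (p \<otimes>\<^bsub>A \<times>\<times> B\<^esub> q)) =
        f (fst p) \<otimes>\<^bsub>C\<^esub> g (snd p) \<otimes>\<^bsub>C\<^esub> (f (fst q) \<otimes>\<^bsub>C\<^esub> g (snd q))"
      using e fr gr by (simp add: DirProd_def ring_hom_mult)
  qed (use fr gr fc gc in \<open>auto simp: DirProd_def ring_hom_one\<close>)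
  then obtain h where h: "h \<in> alg_hom k P.P C"
    and hp: "\<And>a b. a \<in> carrier A \<Longrightarrow> b \<in> carrier B \<Longrightarrow> h (msingle k (a, b)) = f a \<otimes>\<^bsub>C\<^esub> g b"
    by (force simp: DirProd_def)
  have hr: "h \<in> ring_hom P.P C" using h by (simp add: alg_hom_def)
  interpret h: ring_hom_ring P.P C h by (rule ring_hom_ringI2[OF Pr.ring_axioms C.ring_axioms hr])
  have hs: "h (c \<odot>\<^bsub>P.P\<^esub> t) = c \<odot>\<^bsub>C\<^esub> h t" if "c \<in> carrier k" "t \<in> carrier P.P" for c t
    using h that by (simp add: alg_hom_def)
  have t: "msingle k (a, b) \<in> carrier P.P" if "a \<in> carrier A" "b \<in> carrier B" for a b
    using that by (intro P.msingle_closed) (simp add: DirProd_def)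
  have hminus: "h (s \<ominus>\<^bsub>P.P\<^esub> t) = \<zero>\<^bsub>C\<^esub>" if "h s = h t" "s \<in> carrier P.P" "t \<in> carrier P.P" for s t
    using that by (simp add: a_minus_def C.r_neg)
  have h0: "h s = \<zero>\<^bsub>C\<^esub>" if s: "s \<in> tensor_relations k A B" for s
    using s unfolding tensor_relations_def Let_def
    by (elim UnE; clarify; intro hminus)
      (auto simp: t hp hs fc gc fs gs ring_hom_add[OF fr] ring_hom_add[OF gr] P.P_smult_closed
        C.l_distr C.r_distr C.smult_assoc_l C.smult_assoc_r)
  note rel = tensor_relations_closed[OF A B]
  have I: "ideal (Idl\<^bsub>P.P\<^esub> (tensor_relations k A B)) P.P" by (rule Pr.genideal_ideal[OF rel])
  have "h s = \<zero>\<^bsub>C\<^esub>" if "s \<in> Idl\<^bsub>P.P\<^esub> (tensor_relations k A B)" for s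
    by (rule alg_hom_vanishes_genideal[OF aP C h rel h0 that])
  from quot_algebra_lift[OF aP I C h this]
  obtain h' where h': "h' \<in> alg_hom k (tensor_algebra k A B) C"
    and hh': "\<forall>t\<in>carrier P.P. h' (Idl\<^bsub>P.P\<^esub> (tensor_relations k A B) +>\<^bsub>P.P\<^esub> t) = h t"
    unfolding tensor_algebra_def Let_def by blast
  have "h' (tensor_pure k A B a b) = f a \<otimes>\<^bsub>C\<^esub> g b" if "a \<in> carrier A" "b \<in> carrier B" for a b
    using bspec[OF hh' t[OF that]] hp[OF that] by (simp add: tensor_pure_def Let_def)
  with h' show ?thesis by blast
qed

lemma comm_monoid_monomials: "comm_monoid (monomials V)"
  by (rule comm_monoidI) (auto simp: monomials_def)

lemma monoid_algebra_loc_monomials: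
  assumes "cring k"
  shows "monoid_algebra_loc k (monomials V)"
  using assms comm_monoid_monomials[of V]
  by (simp add: monoid_algebra_loc_def comm_monoid.axioms(1))

lemma algebra_poly_algebra:
  assumes "cring k"
  shows "algebra k (poly_algebra k V)"
  by (rule monoid_algebra_loc.algebra_monoid_algebra
      [OF monoid_algebra_loc_monomials[OF assms] comm_monoid_monomials])

lemma poly_var_closed:
  assumes "cring k" "v \<in> V"
  shows "poly_var k v \<in> carrier (poly_algebra k V)"
  by (rule monoid_algebra_loc.msingle_closed[OF monoid_algebra_loc_monomials[OF assms(1)]])
    (use assms in \<open>simp add: monomials_def\<close>)

lemma poly_algebra_lift:
  assumes B: "algebra k B" and \<rho>: "\<And>v. v \<in> V \<Longrightarrow> \<rho> v \<in> carrier B"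
  shows "\<exists>h\<in>alg_hom k (poly_algebra k V) B. \<forall>v\<in>V. h (poly_var k v) = \<rho> v"
proof -
  interpret Bc: cring B by (rule algebra.M_cring[OF B])
  interpret B: algebra k B by fact
  interpret P: monoid_algebra_loc k "monomials V"
    by (rule monoid_algebra_loc_monomials) (rule B.R_cring)
  define \<phi> where "\<phi> m = finprod B (\<lambda>v. \<rho> v [^]\<^bsub>B\<^esub> count m v) (set_mset m)" for m
  have \<phi>: "\<phi> m = finprod B (\<lambda>v. \<rho> v [^]\<^bsub>B\<^esub> count m v) S"
    if "finite S" "set_mset m \<subseteq> S" "S \<subseteq> V" for m S
    unfolding \<phi>_def
    by (rule Bc.finprod_mono_neutral_cong_left)
      (use that \<rho> in \<open>auto simp: not_in_iff Pi_iff subset_iff\<close>)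
  have "\<exists>h\<in>alg_hom k (poly_algebra k V) B. \<forall>m\<in>carrier (monomials V). h (msingle k m) = \<phi> m"
  proof (rule P.monoid_algebra_lift[OF B.is_assoc_algebra])
    show "\<phi> \<in> carrier (monomials V) \<rightarrow> carrier B"
      using \<rho> by (auto simp: \<phi>_def monomials_def subset_iff intro!: Bc.finprod_closed Bc.nat_pow_closed)
    show "\<phi> \<one>\<^bsub>monomials V\<^esub> = \<one>\<^bsub>B\<^esub>" by (simp add: \<phi>_def monomials_def)
    fix m m' assume m: "m \<in> carrier (monomials V)" "m' \<in> carrier (monomials V)"
    let ?S = "set_mset m \<union> set_mset m'"
    have S: "finite ?S" "?S \<subseteq> V" using m by (auto simp: monomials_def)
    have \<rho>S: "\<And>v. v \<in> ?S \<Longrightarrow> \<rho> v \<in> carrier B" using S \<rho> by auto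
    have "\<phi> (m \<otimes>\<^bsub>monomials V\<^esub> m') =
        finprod B (\<lambda>v. \<rho> v [^]\<^bsub>B\<^esub> count m v \<otimes>\<^bsub>B\<^esub> \<rho> v [^]\<^bsub>B\<^esub> count m' v) ?S"
      by (subst \<phi>[OF S(1) _ S(2)])
        (use \<rho>S in \<open>auto simp: monomials_def Bc.nat_pow_mult simp del: Bc.finprod_multf intro!: Bc.finprod_cong'\<close>)
    also have "\<dots> = \<phi> m \<otimes>\<^bsub>B\<^esub> \<phi> m'"
      unfolding \<phi>[OF S(1) Un_upper1 S(2)] \<phi>[OF S(1) Un_upper2 S(2)]
      using \<rho>S by (intro Bc.finprod_multf) auto
    finally show "\<phi> (m \<otimes>\<^bsub>monomials V\<^esub> m') = \<phi> m \<otimes>\<^bsub>B\<^esub> \<phi> m'" .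
  qed
  then obtain h where h: "h \<in> alg_hom k (poly_algebra k V) B"
    and h\<phi>: "\<And>m. m \<in> carrier (monomials V) \<Longrightarrow> h (msingle k m) = \<phi> m"
    by blast
  have "h (poly_var k v) = \<rho> v" if v: "v \<in> V" for v
  proof -
    have "h (poly_var k v) = \<phi> {#v#}" using v by (intro h\<phi>) (simp add: monomials_def)
    thus ?thesis using \<rho>[OF v] by (simp add: \<phi>_def Bc.nat_pow_eone)
  qed
  with h show ?thesis by blast
qed

lemma poly_algebra_hom_unique:
  assumes B: "algebra k B"
    and h: "h \<in> alg_hom k (poly_algebra k V) B" and h': "h' \<in> alg_hom k (poly_algebra k V) B"
    and eq: "\<And>v. v \<in> V \<Longrightarrow> h (poly_var k v) = h' (poly_var k v)"
    and f: "f \<in> carrier (poly_algebra k V)"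
  shows "h f = h' f"
proof -
  interpret B: algebra k B by fact
  interpret P: monoid_algebra_loc k "monomials V"
    by (rule monoid_algebra_loc_monomials) (rule B.R_cring)
  show ?thesis
  proof (rule P.alg_hom_monoid_algebra_unique[OF B.is_assoc_algebra h h' _ f])
    fix m assume "m \<in> carrier (monomials V)"
    hence "set_mset m \<subseteq> V" by (simp add: monomials_def)
    thus "h (msingle k m) = h' (msingle k m)"
    proof (induction m)
      case empty
      have "h \<one>\<^bsub>P.P\<^esub> = h' \<one>\<^bsub>P.P\<^esub>" using h h' ring_hom_one[of h P.P B] ring_hom_one[of h' P.P B] by (simp add: alg_hom_def)
      moreover have "\<one>\<^bsub>P.P\<^esub> = msingle k {#}" by (simp add: P.P_one) (simp add: monomials_def)
      ultimately show ?case by simp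
    next
      case (add v m)
      have c: "m \<in> carrier (monomials V)" "{#v#} \<in> carrier (monomials V)"
        using add.prems by (auto simp: monomials_def)
      have "msingle k (add_mset v m) = poly_var k v \<otimes>\<^bsub>P.P\<^esub> msingle k m"
        using P.msingle_mult[OF c(2,1) B.R.one_closed B.R.one_closed] c
        by (simp add: P.msingle_closed P.G.m_closed) (simp add: monomials_def)
      moreover have "h (poly_var k v) = h' (poly_var k v)" "h (msingle k m) = h' (msingle k m)"
        using add eq by auto
      ultimately show ?case
        using h h' c ring_hom_mult[of h P.P B] ring_hom_mult[of h' P.P B]
        by (simp add: alg_hom_def P.msingle_closed)
    qed
  qed
qed

definition mat_map :: "nat \<Rightarrow> ('b \<Rightarrow> 'c) \<Rightarrow> (nat \<times> nat \<Rightarrow> 'b) \<Rightarrow> nat \<times> nat \<Rightarrow> 'c"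
  where "mat_map n f M = (\<lambda>p\<in>{..<n} \<times> {..<n}. f (M p))"

lemma rep_relations_closed:
  assumes k: "cring k" and A: "assoc_algebra k A"
  shows "rep_relations k A n \<subseteq> carrier (poly_algebra k (carrier A \<times> {..<n} \<times> {..<n}))"
proof -
  interpret A: assoc_algebra k A by fact
  let ?P = "poly_algebra k (carrier A \<times> {..<n} \<times> {..<n})"
  interpret Pc: cring ?P by (rule algebra.M_cring[OF algebra_poly_algebra[OF k]])
  interpret P: algebra k ?P by (rule algebra_poly_algebra[OF k])
  have v: "poly_var k (a, i, j) \<in> carrier ?P" if "a \<in> carrier A" "i < n" "j < n" for a i j
    using that by (intro poly_var_closed k) auto
  show ?thesis
    unfolding rep_relations_def Let_def
    by (auto intro!: Pc.minus_closed Pc.add.m_closed P.smult_closed Pc.finsum_closed Pc.m_closed v)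
qed

text \<open>
  The coordinate ring, with its generic representation, represents the functor
  \<open>B \<mapsto> Hom(A, M\<^sub>n(B))\<close> on commutative \<open>k\<close>-algebras \<open>B\<close>.
\<close>

theorem rep_coord_ring_represents:
  fixes B :: "('k, 'b, 'e) module_scheme" and n :: nat
  assumes k: "cring k" and A: "assoc_algebra k A"
  defines "R \<equiv> rep_coord_ring k A n"
  shows "algebra k R"
    and "generic_rep k A n \<in> alg_hom k A (mat_algebra R n)"
    and "\<lbrakk>algebra k B; \<rho> \<in> alg_hom k A (mat_algebra B n)\<rbrakk> \<Longrightarrow>
      \<exists>f\<in>alg_hom k R B. \<forall>a\<in>carrier A. mat_map n f (generic_rep k A n a) = \<rho> a"
    and "\<lbrakk>algebra k B; f \<in> alg_hom k R B; g \<in> alg_hom k R B;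
      \<forall>a\<in>carrier A. mat_map n f (generic_rep k A n a) = mat_map n g (generic_rep k A n a)\<rbrakk> \<Longrightarrow>
      \<forall>x\<in>carrier R. f x = g x"
proof -
  let ?V = "carrier A \<times> {..<n} \<times> {..<n}"
  let ?N = "{..<n} \<times> {..<n}"
  define P where "P = poly_algebra k ?V"
  define I where "I = Idl\<^bsub>P\<^esub> (rep_relations k A n)"
  interpret A: assoc_algebra k A by fact
  have algP: "algebra k P" unfolding P_def by (rule algebra_poly_algebra[OF k])
  interpret Pc: cring P by (rule algebra.M_cring[OF algP])
  interpret P: algebra k P by (rule algP)
  have rel: "rep_relations k A n \<subseteq> carrier P" unfolding P_def by (rule rep_relations_closed[OF k A])
  have I: "ideal I P" unfolding I_def by (rule Pc.genideal_ideal[OF rel])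
  have R: "R = quot_algebra P I" by (simp add: R_def rep_coord_ring_def P_def I_def Let_def)
  show algR: "algebra k R" unfolding R by (rule algebra_quot_algebra[OF P.algebra_axioms I])
  interpret Rc: cring R by (rule algebra.M_cring[OF algR])
  interpret R: algebra k R by (rule algR)
  define y where "y a i j = I +>\<^bsub>P\<^esub> poly_var k (a, i, j)" for a i j
  have v: "poly_var k (a, i, j) \<in> carrier P" if "a \<in> carrier A" "i < n" "j < n" for a i j
    unfolding P_def using that by (intro poly_var_closed k) auto
  note aP = P.is_assoc_algebra
  have proj: "(\<lambda>x. I +>\<^bsub>P\<^esub> x) \<in> alg_hom k P R" unfolding R by (rule quot_algebra_proj[OF aP I])
  hence projr: "(\<lambda>x. I +>\<^bsub>P\<^esub> x) \<in> ring_hom P R" by (simp add: alg_hom_def)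
  interpret proj: ring_hom_cring P R "\<lambda>x. I +>\<^bsub>P\<^esub> x"
    by (intro ring_hom_cring.intro ring_hom_cring_axioms.intro Pc.cring_axioms Rc.cring_axioms projr)
  have gen: "generic_rep k A n a = (\<lambda>(i, j)\<in>?N. y a i j)" for a
    by (simp add: generic_rep_def y_def P_def I_def Let_def)
  have yc: "y a i j \<in> carrier R" if "a \<in> carrier A" "i < n" "j < n" for a i j
    unfolding y_def using v[OF that] by simp
  have eqI: "I +>\<^bsub>P\<^esub> s = I +>\<^bsub>P\<^esub> t" if "s \<ominus>\<^bsub>P\<^esub> t \<in> rep_relations k A n" "s \<in> carrier P" "t \<in> carrier P" for s t
    using that rel Pc.genideal_self[OF rel] by (intro quot_algebra_eq[OF aP I]) (auto simp: I_def)
  have y_add: "y (a \<oplus>\<^bsub>A\<^esub> b) i j = y a i j \<oplus>\<^bsub>R\<^esub> y b i j"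
    if "a \<in> carrier A" "b \<in> carrier A" "i < n" "j < n" for a b i j
  proof -
    have "I +>\<^bsub>P\<^esub> poly_var k (a \<oplus>\<^bsub>A\<^esub> b, i, j) = I +>\<^bsub>P\<^esub> (poly_var k (a, i, j) \<oplus>\<^bsub>P\<^esub> poly_var k (b, i, j))"
    proof (rule eqI)
      show "poly_var k (a \<oplus>\<^bsub>A\<^esub> b, i, j) \<ominus>\<^bsub>P\<^esub> (poly_var k (a, i, j) \<oplus>\<^bsub>P\<^esub> poly_var k (b, i, j)) \<in> rep_relations k A n"
        unfolding rep_relations_def Let_def P_def[symmetric] using that by blast
    qed (use that v in auto)
    thus ?thesis using v that by (simp add: y_def)
  qed
  have y_smult: "y (c \<odot>\<^bsub>A\<^esub> a) i j = c \<odot>\<^bsub>R\<^esub> y a i j"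
    if "c \<in> carrier k" "a \<in> carrier A" "i < n" "j < n" for c a i j
  proof -
    have "I +>\<^bsub>P\<^esub> poly_var k (c \<odot>\<^bsub>A\<^esub> a, i, j) = I +>\<^bsub>P\<^esub> (c \<odot>\<^bsub>P\<^esub> poly_var k (a, i, j))"
    proof (rule eqI)
      show "poly_var k (c \<odot>\<^bsub>A\<^esub> a, i, j) \<ominus>\<^bsub>P\<^esub> c \<odot>\<^bsub>P\<^esub> poly_var k (a, i, j) \<in> rep_relations k A n"
        unfolding rep_relations_def Let_def P_def[symmetric] using that by blast
    qed (use that v in auto)
    thus ?thesis using v that proj by (simp add: y_def alg_hom_def)
  qed
  have y_one: "y \<one>\<^bsub>A\<^esub> i j = (if i = j then \<one>\<^bsub>R\<^esub> else \<zero>\<^bsub>R\<^esub>)" if "i < n" "j < n" for i j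
  proof -
    have "I +>\<^bsub>P\<^esub> poly_var k (\<one>\<^bsub>A\<^esub>, i, j) = I +>\<^bsub>P\<^esub> (if i = j then \<one>\<^bsub>P\<^esub> else \<zero>\<^bsub>P\<^esub>)"
    proof (rule eqI)
      show "poly_var k (\<one>\<^bsub>A\<^esub>, i, j) \<ominus>\<^bsub>P\<^esub> (if i = j then \<one>\<^bsub>P\<^esub> else \<zero>\<^bsub>P\<^esub>) \<in> rep_relations k A n"
        unfolding rep_relations_def Let_def P_def[symmetric] using that by blast
    qed (use that v in auto)
    thus ?thesis by (simp add: y_def split: if_splits)
  qed
  have y_mult: "y (a \<otimes>\<^bsub>A\<^esub> b) i j = (\<Oplus>\<^bsub>R\<^esub>l\<in>{..<n}. y a i l \<otimes>\<^bsub>R\<^esub> y b l j)"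
    if "a \<in> carrier A" "b \<in> carrier A" "i < n" "j < n" for a b i j
  proof -
    have c: "(\<lambda>l. poly_var k (a, i, l) \<otimes>\<^bsub>P\<^esub> poly_var k (b, l, j)) \<in> {..<n} \<rightarrow> carrier P"
      using that v by auto
    have "I +>\<^bsub>P\<^esub> poly_var k (a \<otimes>\<^bsub>A\<^esub> b, i, j) =
        I +>\<^bsub>P\<^esub> (\<Oplus>\<^bsub>P\<^esub>l\<in>{..<n}. poly_var k (a, i, l) \<otimes>\<^bsub>P\<^esub> poly_var k (b, l, j))"
    proof (rule eqI)
      show "poly_var k (a \<otimes>\<^bsub>A\<^esub> b, i, j) \<ominus>\<^bsub>P\<^esub>
          (\<Oplus>\<^bsub>P\<^esub>l\<in>{..<n}. poly_var k (a, i, l) \<otimes>\<^bsub>P\<^esub> poly_var k (b, l, j)) \<in> rep_relations k A n"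
        unfolding rep_relations_def Let_def P_def[symmetric] using that by blast
    qed (use that v c in auto)
    also have "\<dots> = (\<Oplus>\<^bsub>R\<^esub>l\<in>{..<n}. y a i l \<otimes>\<^bsub>R\<^esub> y b l j)"
      unfolding proj.hom_finsum[OF c] using that v
      by (intro Rc.add.finprod_cong') (auto simp: y_def)
    finally show ?thesis by (simp add: y_def)
  qed
  have sum_eq: "(\<Oplus>\<^bsub>R\<^esub>l\<in>{..<n}. (if l < n then y a i l else undefined) \<otimes>\<^bsub>R\<^esub>
      (if l < n then y b l j else undefined)) = (\<Oplus>\<^bsub>R\<^esub>l\<in>{..<n}. y a i l \<otimes>\<^bsub>R\<^esub> y b l j)"
    if "a \<in> carrier A" "b \<in> carrier A" "i < n" "j < n" for a b i j
    by (rule Rc.add.finprod_cong') (use that yc in auto)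
  show "generic_rep k A n \<in> alg_hom k A (mat_algebra R n)"
    unfolding alg_hom_def gen[abs_def]
    by (auto intro!: ring_hom_memI
        simp: mat_algebra_def Let_def fun_eq_iff yc y_add y_smult y_one y_mult sum_eq)
  {
    assume B: "algebra k B" and \<rho>: "\<rho> \<in> alg_hom k A (mat_algebra B n)"
    interpret Bc: cring B by (rule algebra.M_cring[OF B])
    interpret B: algebra k B by fact
    have \<rho>c: "\<rho> a (i, j) \<in> carrier B" if "a \<in> carrier A" "i < n" "j < n" for a i j
      using \<rho> that by (auto simp: alg_hom_def mat_algebra_def ring_hom_def Let_def Pi_iff)
    have \<rho>ext: "\<rho> a \<in> extensional ?N" if "a \<in> carrier A" for a
      using \<rho> that by (auto simp: alg_hom_def mat_algebra_def ring_hom_def Let_def Pi_iff PiE_iff)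
    have "\<exists>h\<in>alg_hom k P B. \<forall>v\<in>?V. h (poly_var k v) = (case v of (a, i, j) \<Rightarrow> \<rho> a (i, j))"
      unfolding P_def by (rule poly_algebra_lift[OF B]) (use \<rho>c in auto)
    then obtain h where h: "h \<in> alg_hom k P B"
      and hv: "\<And>a i j. a \<in> carrier A \<Longrightarrow> i < n \<Longrightarrow> j < n \<Longrightarrow> h (poly_var k (a, i, j)) = \<rho> a (i, j)"
      by force
    interpret h: ring_hom_cring P B h
      by (intro ring_hom_cring.intro ring_hom_cring_axioms.intro Pc.cring_axioms Bc.cring_axioms)
        (use h in \<open>simp add: alg_hom_def\<close>)
    have hs: "h (c \<odot>\<^bsub>P\<^esub> t) = c \<odot>\<^bsub>B\<^esub> h t" if "c \<in> carrier k" "t \<in> carrier P" for c t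
      using h that by (simp add: alg_hom_def)
    have hminus: "h (s \<ominus>\<^bsub>P\<^esub> t) = \<zero>\<^bsub>B\<^esub>" if "h s = h t" "s \<in> carrier P" "t \<in> carrier P" for s t
      using that by (simp add: a_minus_def Bc.r_neg)
    have \<rho>_add: "\<rho> (a \<oplus>\<^bsub>A\<^esub> b) (i, j) = \<rho> a (i, j) \<oplus>\<^bsub>B\<^esub> \<rho> b (i, j)"
      and \<rho>_mult: "\<rho> (a \<otimes>\<^bsub>A\<^esub> b) (i, j) = (\<Oplus>\<^bsub>B\<^esub>l\<in>{..<n}. \<rho> a (i, l) \<otimes>\<^bsub>B\<^esub> \<rho> b (l, j))"
      if "a \<in> carrier A" "b \<in> carrier A" "i < n" "j < n" for a b i j
      using \<rho> that by (auto simp: alg_hom_def mat_algebra_def ring_hom_def Let_def)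
    have \<rho>_smult: "\<rho> (c \<odot>\<^bsub>A\<^esub> a) (i, j) = c \<odot>\<^bsub>B\<^esub> \<rho> a (i, j)"
      if "c \<in> carrier k" "a \<in> carrier A" "i < n" "j < n" for a c i j
      using \<rho> that by (auto simp: alg_hom_def mat_algebra_def Let_def)
    have \<rho>_one: "\<rho> \<one>\<^bsub>A\<^esub> (i, j) = (if i = j then \<one>\<^bsub>B\<^esub> else \<zero>\<^bsub>B\<^esub>)" if "i < n" "j < n" for i j
      using \<rho> that by (auto simp: alg_hom_def mat_algebra_def ring_hom_def Let_def)
    have h0: "h s = \<zero>\<^bsub>B\<^esub>" if s: "s \<in> rep_relations k A n" for s
    proof -
      have fs: "finsum B (h \<circ> (\<lambda>l. poly_var k (a, i, l) \<otimes>\<^bsub>P\<^esub> poly_var k (b, l, j))) {..<n} =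
          (\<Oplus>\<^bsub>B\<^esub>l\<in>{..<n}. \<rho> a (i, l) \<otimes>\<^bsub>B\<^esub> \<rho> b (l, j))"
        if "a \<in> carrier A" "b \<in> carrier A" "i < n" "j < n" for a b i j
        using that v by (intro Bc.add.finprod_cong') (auto simp: hv \<rho>c)
      have fc: "(\<Oplus>\<^bsub>P\<^esub>l\<in>{..<n}. poly_var k (a, i, l) \<otimes>\<^bsub>P\<^esub> poly_var k (b, l, j)) \<in> carrier P"
        if "a \<in> carrier A" "b \<in> carrier A" "i < n" "j < n" for a b i j
        using that v by (intro Pc.add.finprod_closed) auto
      from s show ?thesis
        unfolding rep_relations_def Let_def P_def[symmetric]
        by (elim UnE; clarify; intro hminus)
          (auto simp: v hv hs fs fc \<rho>_add \<rho>_smult \<rho>_one \<rho>_mult)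
    qed
    have "h s = \<zero>\<^bsub>B\<^esub>" if "s \<in> I" for s
      using alg_hom_vanishes_genideal[OF aP B.is_assoc_algebra h rel h0] that by (simp add: I_def)
    then obtain f where f: "f \<in> alg_hom k R B" and fh: "\<forall>t\<in>carrier P. f (I +>\<^bsub>P\<^esub> t) = h t"
      using quot_algebra_lift[OF aP I B.is_assoc_algebra h] unfolding R by blast
    have "mat_map n f (generic_rep k A n a) = \<rho> a" if a: "a \<in> carrier A" for a
      by (rule extensionalityI[of _ ?N])
        (use a fh v hv \<rho>ext in \<open>auto simp: mat_map_def gen y_def\<close>)
    with f show "\<exists>f\<in>alg_hom k R B. \<forall>a\<in>carrier A. mat_map n f (generic_rep k A n a) = \<rho> a"
      by blast
  }
  assume B: "algebra k B" and f: "f \<in> alg_hom k R B" and g: "g \<in> alg_hom k R B"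
    and eq: "\<forall>a\<in>carrier A. mat_map n f (generic_rep k A n a) = mat_map n g (generic_rep k A n a)"
  have comp: "(\<lambda>t. h (I +>\<^bsub>P\<^esub> t)) \<in> alg_hom k P B" if "h \<in> alg_hom k R B" for h
    using that proj unfolding alg_hom_def
    by (auto intro!: ring_hom_memI simp: ring_hom_mult ring_hom_add ring_hom_one ring_hom_closed)
  have var: "f (y a i j) = g (y a i j)" if "a \<in> carrier A" "i < n" "j < n" for a i j
    using fun_cong[OF bspec[OF eq that(1)], of "(i, j)"] that by (simp add: mat_map_def gen)
  have uniq: "h t = h' t" if "h \<in> alg_hom k P B" "h' \<in> alg_hom k P B"
      "\<And>v. v \<in> ?V \<Longrightarrow> h (poly_var k v) = h' (poly_var k v)" "t \<in> carrier P" for h h' t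
    by (rule poly_algebra_hom_unique[OF B that[unfolded P_def]])
  have "f (I +>\<^bsub>P\<^esub> t) = g (I +>\<^bsub>P\<^esub> t)" if "t \<in> carrier P" for t
    by (rule uniq[OF comp[OF f] comp[OF g] _ that]) (use var in \<open>auto simp: y_def\<close>)
  thus "\<forall>x\<in>carrier R. f x = g x"
    unfolding R by (auto simp: quot_algebra_simps(1)[OF aP I])
qed

end

theory Submission
  imports Defs "HOL-Algebra.UnivPoly" "HOL-Library.Multiset_Order"
begin

text \<open>
  Coherence of \<open>A\<close> provides a resolution \<open>E\<^sup>r \<rightarrow> E\<^sup>q \<rightarrow> E\<^sup>p \<rightarrow> E \<rightarrow> A\<close> by finite free modules over the
  enveloping algebra \<open>E\<close>. For the universal representation \<open>A \<rightarrow> M\<^sub>n(R)\<close> over the coordinate ring \<open>R\<close>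
  and an \<open>R\<close>-module \<open>M\<close>, it induces a complex \<open>M\<^sub>n(M)\<^sup>p \<rightarrow> M\<^sub>n(M)\<^sup>q \<rightarrow> M\<^sub>n(M)\<^sup>r\<close>, given by matrices over
  \<open>R\<close>, which is exact if and only if all Hochschild 2-cocycles with values in \<open>M\<^sub>n(M)\<close> are coboundaries.
  At a closed point of \<open>R\<close>, where \<open>M = k\<close>, this holds because \<open>A\<close> is hereditary. A contracting homotopy
  at a closed point extends, up to a denominator, to \<open>R\<close>; by the Nullstellensatz the denominators
  generate the unit ideal, so that the complex has a contracting homotopy over \<open>R\<close> and is exact for
  every \<open>M\<close>. The obstruction to lifting a representation along a square-zero extension with kernel
  \<open>I\<close> is a cocycle with values in \<open>M\<^sub>n(I)\<close>; hence it vanishes and \<open>R\<close> is formally smooth. By Hilbert's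
  basis theorem it is also finitely presented.
\<close>

\<comment> \<open>The kernel \<open>I\<close> of a test extension is an arbitrary module over the
  coordinate ring \<open>R\<close>, and \<open>R\<close> is not known to be reduced, so exactness at
  the closed points says nothing directly about coefficients in \<open>I\<close>. A matrix identity
  \<open>D1 U + V D2 = 1\<close> over \<open>R\<close> does, since it survives every change of
  coefficients. Coherence keeps the free modules of the resolution of finite rank, so that a
  homotopy consists of finite matrices and finitely many denominators have to be cleared. At a
  closed point, with V = k^n, cocycles modulo coboundaries form HH^2(A, End V) = Ext^2_A(V, V),
  which is zero over a hereditary algebra; concretely, the kernel of A^n \<rightarrow> V is
  projective. The map E^p \<rightarrow> E of the resolution is built on s \<otimes> 1 - 1 \<otimes>
  s for generators s of A, because these elements generate the kernel of the multiplication E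
  \<rightarrow> A. A homomorphism R \<rightarrow> B/I has in general no multiplicative lift to B,
  but a k-linear lift is enough to make \<open>I\<close> an R-module, because I^2 = 0.\<close>
syntax "_index" :: "logic \<Rightarrow> index"  ("\<^sub>_" [1000] 1000)
syntax "_finsum_less" :: "index \<Rightarrow> idt \<Rightarrow> nat \<Rightarrow> 'b \<Rightarrow> 'b"  ("(3\<Oplus>__<_. _)" [1000, 0, 51, 10] 10)
translations "\<Oplus>\<^bsub>G\<^esub>i<n. b" \<rightharpoonup> "CONST finsum G (\<lambda>i. b) {..<n}"

subsection \<open>Homomorphisms into an algebraically closed field\<close>

text \<open>The polynomials of \<open>poly_ring\<close> are coefficient lists with the leading
  coefficient first, hence \<open>rev\<close>; the finite sum on the right is the form that
  evaluation in \<open>UnivPoly\<close> produces.\<close>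

lemma (in ring) eval_rev_map:
  assumes "x \<in> carrier R" "\<And>i. i < n \<Longrightarrow> f i \<in> carrier R"
  shows "eval (rev (map f [0..<n])) x = (\<Oplus>i<n. f i \<otimes> x [^] i)"
  using assms
proof (induction n)
  case (Suc n)
  have "eval (rev (map f [0..<Suc n])) x = f n \<otimes> x [^] n \<oplus> (\<Oplus>i<n. f i \<otimes> x [^] i)"
    using Suc by simp
  thus ?case using Suc.prems by (simp add: lessThan_Suc Pi_iff)
qed simp

text \<open>All polynomials over the field split, so the number of roots with multiplicity is the
  degree \<open>n\<close>, which is positive.\<close>

lemma (in algebraically_closed) root_exists:
  fixes f :: "nat \<Rightarrow> 'a"
  assumes f: "\<And>i. f i \<in> carrier L" and n: "n > 0" and fn: "f n \<noteq> \<zero>"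
  shows "\<exists>x\<in>carrier L. (\<Oplus>i\<in>{..n}. f i \<otimes> x [^] i) = \<zero>"
proof -
  let ?l = "rev (map f [0..<Suc n])"
  have "?l \<in> carrier (poly_ring L)"
    using f fn by (auto simp: univ_poly_carrier[symmetric] polynomial_def)
  hence l: "?l \<in> carrier (poly_ring L)" and "splitted ?l" by (auto intro: roots_over_carrier)
  hence "size (roots ?l) = n" by (simp add: splitted_def)
  then obtain a where "a \<in># roots ?l" using n by (metis multiset_nonemptyE not_less_zero size_empty)
  hence "is_root ?l a" using roots_mem_iff_is_root[OF l] by simp
  thus ?thesis using eval_rev_map[of a "Suc n" f] f by (auto simp: is_root_def lessThan_Suc_atMost)
qed

text \<open>If the degree is positive, a root of f - 1 is a point where f takes the value 1; this
  avoids counting the roots of f.\<close>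

lemma (in algebraically_closed) nonroot_exists:
  fixes f :: "nat \<Rightarrow> 'a"
  assumes f: "\<And>i. f i \<in> carrier L" and fn: "f n \<noteq> \<zero>"
  shows "\<exists>x\<in>carrier L. (\<Oplus>i\<in>{..n}. f i \<otimes> x [^] i) \<noteq> \<zero>"
proof (cases "n = 0")
  case True
  thus ?thesis using f fn by (intro bexI[of _ \<one>]) auto
next
  case False
  then obtain m where m: "n = Suc m" using not0_implies_Suc by blast
  let ?g = "f(0 := f 0 \<ominus> \<one>)"
  have gc: "?g i \<in> carrier L" for i using f by simp
  obtain x where x: "x \<in> carrier L" "(\<Oplus>i\<in>{..n}. ?g i \<otimes> x [^] i) = \<zero>"
    using root_exists[of ?g n, OF gc] fn False by (metis (no_types, lifting) fun_upd_other gr0I)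
  have s: "(\<Oplus>i\<in>{..n}. g i \<otimes> x [^] i) = (\<Oplus>i\<in>{..m}. g (Suc i) \<otimes> x [^] (Suc i)) \<oplus> g 0"
    if "\<And>i. g i \<in> carrier L" for g
    unfolding m using x(1) that by (subst finsum_Suc2) auto
  have "(\<Oplus>i\<in>{..n}. f i \<otimes> x [^] i) = (\<Oplus>i\<in>{..n}. ?g i \<otimes> x [^] i) \<oplus> \<one>"
    using f x(1) by (subst (1 2) s) (auto simp: a_minus_def a_assoc l_neg)
  thus ?thesis using x by (intro bexI[of _ x]) (simp_all del: fun_upd_apply)
qed

text \<open>
  Atiyah--Macdonald, Proposition 5.23, for one generator. If \<open>x\<close> is algebraic over \<open>A\<close>, a relation
  \<open>p\<close> of minimal degree and pseudo-division reduce everything to the leading coefficient of \<open>p\<close>.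
\<close>

lemma extend_hom_one_generator:
  fixes K (structure)
  assumes L: "algebraically_closed k" and K: "domain K" and A: "subring A K" and x: "x \<in> carrier K"
  shows "\<exists>B. subring B K \<and> A \<subseteq> B \<and> x \<in> B \<and>
    (\<forall>b\<in>B. b \<noteq> \<zero> \<longrightarrow> (\<exists>a\<in>A. a \<noteq> \<zero> \<and> (\<forall>ph\<in>ring_hom (K\<lparr>carrier := A\<rparr>) k. ph a \<noteq> \<zero>\<^sub>k \<longrightarrow>
      (\<exists>ps\<in>ring_hom (K\<lparr>carrier := B\<rparr>) k. (\<forall>c\<in>A. ps c = ph c) \<and> ps b \<noteq> \<zero>\<^sub>k))))"
proof -
  interpret L: algebraically_closed k by fact
  interpret K: domain K by fact
  define KA where "KA = K\<lparr>carrier := A\<rparr>"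
  have s: "carrier KA = A" "\<zero>\<^sub>KA = \<zero>" "\<one>\<^sub>KA = \<one>"
    "a \<oplus>\<^sub>KA b = a \<oplus> b" "a \<otimes>\<^sub>KA b = a \<otimes> b" for a b
    by (simp_all add: KA_def)
  have AK: "A \<subseteq> carrier K" using subringE(1)[OF A] .
  have "subcring A K" by (rule K.subcringI'[OF A])
  hence KAc: "cring KA" using K.subcring_iff[OF AK] by (simp add: KA_def)
  have KAd: "domain KA"
    by (intro domain.intro KAc domain_axioms.intro)
       (use AK K.integral in \<open>auto simp: s\<close>)
  interpret KA: domain KA by fact
  define P where "P = UP KA"
  interpret U: UP_domain KA P by (intro UP_domain.intro KAd) (simp add: P_def)
  interpret V: UP_pre_univ_prop KA K "\<lambda>x. x" P
    by (intro UP_pre_univ_prop.intro UnivPoly.ring_hom_cringI KAc K.cring_axioms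
        UP_cring.intro) (use AK in \<open>auto intro!: ring_hom_memI simp: s P_def\<close>)
  define Ev where "Ev = UnivPoly.eval KA K (\<lambda>x. x) x"
  have Evr: "Ev \<in> ring_hom P K" unfolding Ev_def by (rule V.eval_ring_hom[OF x])
  interpret Ev: ring_hom_cring P K Ev
    by (intro UnivPoly.ring_hom_cringI U.P.cring_axioms K.cring_axioms Evr)
  have Ec: "Ev (up_ring.monom P a 0) = a" if "a \<in> A" for a
    unfolding Ev_def using that x by (subst V.eval_const) (auto simp: s)
  have Es: "Ev (a \<odot>\<^sub>P p) = a \<otimes> Ev p" if "a \<in> A" "p \<in> carrier P" for a p
    using that Ec[OF that(1)] Ev.hom_mult[of "up_ring.monom P a 0" p] by (simp add: U.monom_mult_is_smult s)
  \<comment> \<open>\<open>B\<close> is A[x]; \<open>I\<close> is the ideal of all polynomial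
    relations that \<open>x\<close> satisfies over \<open>A\<close>.\<close>
  define B where "B = Ev ` carrier P"
  define I where "I = {p \<in> carrier P. Ev p = \<zero>}"
  have I0: "a \<ominus>\<^sub>P b \<in> I" if "a \<in> carrier P" "b \<in> carrier P" "Ev a = Ev b" for a b
    using that by (auto simp: I_def a_minus_def K.r_neg)
  have Bsub: "subring B K" unfolding B_def
    by (rule ring_hom_ring.img_is_subring[OF ring_hom_ringI2[OF U.P.ring_axioms K.ring_axioms Evr] U.P.carrier_is_subring])
  have AB: "A \<subseteq> B"
  proof
    fix a assume "a \<in> A"
    thus "a \<in> B" unfolding B_def using Ec[of a] s by (intro image_eqI[of _ _ "up_ring.monom P a 0"]) auto
  qed
  have "x \<in> B" unfolding B_def
    using V.eval_monom1[OF x] by (intro image_eqI[of _ _ "up_ring.monom P \<one>\<^sub>KA 1"]) (auto simp: Ev_def simp del: s)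
  moreover have "\<exists>a\<in>A. a \<noteq> \<zero> \<and> (\<forall>ph\<in>ring_hom KA k. ph a \<noteq> \<zero>\<^sub>k \<longrightarrow>
      (\<exists>ps\<in>ring_hom (K\<lparr>carrier := B\<rparr>) k. (\<forall>c\<in>A. ps c = ph c) \<and> ps b \<noteq> \<zero>\<^sub>k))"
    if bB: "b \<in> B" and b0: "b \<noteq> \<zero>" for b
  proof -
    obtain bt where bt: "bt \<in> carrier P" "b = Ev bt" using bB by (auto simp: B_def)
    have univ: "UP_pre_univ_prop KA k ph" if "ph \<in> ring_hom KA k" for ph
      using that KAc by (auto intro!: UP_pre_univ_prop.intro UnivPoly.ring_hom_cringI UP_cring.intro L.cring_axioms simp: P_def)
    \<comment> \<open>Extending \<open>ph\<close> to A[x] amounts to choosing an image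
      \<open>xe\<close> of \<open>x\<close> at which all relations, with their coefficients moved by
      \<open>ph\<close>, vanish.\<close>
    have ext: "\<exists>ps\<in>ring_hom (K\<lparr>carrier := B\<rparr>) k. (\<forall>p\<in>carrier P. ps (Ev p) = UnivPoly.eval KA k ph xe p) \<and> (\<forall>c\<in>A. ps c = ph c)"
      if ph: "ph \<in> ring_hom KA k" and xe: "xe \<in> carrier k"
        and v: "\<And>p. p \<in> I \<Longrightarrow> UnivPoly.eval KA k ph xe p = \<zero>\<^sub>k" for ph xe
    proof -
      interpret W: UP_pre_univ_prop KA k ph P
        by (rule univ[OF ph]) (simp add: P_def)
      let ?F = "UnivPoly.eval KA k ph xe"
      interpret F: ring_hom_cring P k ?F
        by (intro UnivPoly.ring_hom_cringI U.P.cring_axioms L.cring_axioms W.eval_ring_hom xe)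
      define ps where "ps y = ?F (SOME p. p \<in> carrier P \<and> Ev p = y)" for y
      have ps: "ps (Ev p) = ?F p" if p: "p \<in> carrier P" for p
      proof -
        define q where "q = (SOME q. q \<in> carrier P \<and> Ev q = Ev p)"
        have q: "q \<in> carrier P \<and> Ev q = Ev p" unfolding q_def by (rule someI[of _ p]) (use p in auto)
        hence "?F (q \<ominus>\<^sub>P p) = \<zero>\<^sub>k" using v I0 p by blast
        hence "?F q \<ominus>\<^sub>k ?F p = \<zero>\<^sub>k" using p q by (simp add: a_minus_def)
        hence "?F q = ?F p" using p q by (simp add: L.r_right_minus_eq)
        thus ?thesis by (simp add: ps_def q_def)
      qed
      have "ps \<in> ring_hom (K\<lparr>carrier := B\<rparr>) k"
        by (rule ring_hom_memI)
          (auto simp: B_def ps simp flip: Ev.hom_mult Ev.hom_add Ev.hom_one)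
      moreover have "ps c = ph c" if "c \<in> A" for c
        using ps[of "up_ring.monom P c 0"] Ec[OF that] that xe by (simp add: s W.eval_const)
      ultimately show ?thesis using ps by blast
    qed
    have ev: "UnivPoly.eval KA k ph xe p = (\<Oplus>\<^sub>k i\<in>{..deg KA p}. ph (up_ring.coeff P p i) \<otimes>\<^sub>k xe [^]\<^sub>k i)"
      if "p \<in> carrier P" for ph xe p
      using that by (rule U.eval_on_carrier)
    have phc: "ph (up_ring.coeff P p i) \<in> carrier k" if "ph \<in> ring_hom KA k" "p \<in> carrier P" for ph p i
      using that ring_hom_closed[OF that(1)] by auto
    let ?lc = "\<lambda>p. up_ring.coeff P p (deg KA p)"
    have bt0: "bt \<noteq> \<zero>\<^sub>P" using b0 bt by auto
    show ?thesis
    proof (cases "I = {\<zero>\<^sub>P}")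
      case True
      \<comment> \<open>\<open>x\<close> is transcendental over \<open>A\<close>, so
        \<open>xe\<close> is unconstrained. The required \<open>a\<close> is the leading coefficient
        of a polynomial representing \<open>b\<close>: if it survives, some \<open>xe\<close> is not
        a root of that polynomial.\<close>
      have "\<exists>ps\<in>ring_hom (K\<lparr>carrier := B\<rparr>) k. (\<forall>c\<in>A. ps c = ph c) \<and> ps b \<noteq> \<zero>\<^sub>k"
        if ph: "ph \<in> ring_hom KA k" and nz: "ph (?lc bt) \<noteq> \<zero>\<^sub>k" for ph
      proof -
        obtain xe where xe: "xe \<in> carrier k" "UnivPoly.eval KA k ph xe bt \<noteq> \<zero>\<^sub>k"
          using L.nonroot_exists[of "\<lambda>i. ph (up_ring.coeff P bt i)" "deg KA bt"] phc[OF ph bt(1)] nz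
          by (auto simp: ev[OF bt(1)])
        interpret W: UP_pre_univ_prop KA k ph P
          by (rule univ[OF ph]) (simp add: P_def)
        interpret F: ring_hom_cring P k "UnivPoly.eval KA k ph xe"
          by (intro UnivPoly.ring_hom_cringI U.P.cring_axioms L.cring_axioms W.eval_ring_hom xe)
        show ?thesis using ext[OF ph xe(1)] True xe(2) bt by auto
      qed
      moreover have "?lc bt \<in> A" "?lc bt \<noteq> \<zero>" using bt bt0 U.lcoeff_nonzero2[of bt] U.lcoeff_closed[of bt] by (auto simp: s)
      ultimately show ?thesis by blast
    next
      case False
      have "\<zero>\<^sub>P \<in> I" by (simp add: I_def)
      hence "\<exists>p. p \<in> I \<and> p \<noteq> \<zero>\<^sub>P" using False by blast
      then obtain p where p: "p \<in> I" "p \<noteq> \<zero>\<^sub>P"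
        and pmin: "\<And>q. q \<in> I \<Longrightarrow> q \<noteq> \<zero>\<^sub>P \<Longrightarrow> deg KA p \<le> deg KA q"
        using ex_has_least_nat[of "\<lambda>p. p \<in> I \<and> p \<noteq> \<zero>\<^sub>P" _ "deg KA"] by blast
      have pc: "p \<in> carrier P" and Ep: "Ev p = \<zero>" using p by (auto simp: I_def)
      \<comment> \<open>\<open>J\<close> is the preimage in A[X] of the ideal of A[x] generated by
        \<open>b\<close>; both \<open>p\<close> and \<open>bt\<close> lie in it. An element of least
        degree turns out to be a constant \<open>c\<close>, so that c = b w in A[x], and
        \<open>b\<close> cannot be killed as long as \<open>c\<close> survives.\<close>
      define J where "J = {q \<in> carrier P. \<exists>w\<in>carrier P. Ev q = b \<otimes> Ev w}"
      have bK: "b \<in> carrier K" using bt by simp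
      have IJ: "I \<subseteq> J" using bK by (auto simp: I_def J_def intro!: bexI[of _ "\<zero>\<^sub>P"])
      have btJ: "bt \<in> J" using bt bK by (auto simp: J_def intro!: bexI[of _ "\<one>\<^sub>P"])
      have "p \<in> J \<and> p \<noteq> \<zero>\<^sub>P" using p IJ by blast
      then obtain h where h: "h \<in> J" "h \<noteq> \<zero>\<^sub>P"
        and hmin: "\<And>q. q \<in> J \<Longrightarrow> q \<noteq> \<zero>\<^sub>P \<Longrightarrow> deg KA h \<le> deg KA q"
        using ex_has_least_nat[of "\<lambda>p. p \<in> J \<and> p \<noteq> \<zero>\<^sub>P" _ "deg KA"] by blast
      have hc: "h \<in> carrier P" using h by (auto simp: J_def)
      have lcA: "?lc q \<in> A" if "q \<in> carrier P" for q using U.lcoeff_closed[OF that] by (simp add: s)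
      have lc0: "?lc q \<noteq> \<zero>" if "q \<in> carrier P" "q \<noteq> \<zero>\<^sub>P" for q
        using U.lcoeff_nonzero2[OF that] by (simp add: s)
      have powA: "a [^]\<^sub>KA m \<in> A" if "a \<in> A" for a and m :: nat
        using KA.nat_pow_closed[of a m] that by (simp add: s)
      have pow0: "a [^]\<^sub>KA m \<noteq> \<zero>" if "a \<in> A" "a \<noteq> \<zero>" for a and m :: nat
      proof (induction m)
        case (Suc m)
        thus ?case using KA.integral[of "a [^]\<^sub>KA m" a] powA[of a m] that by (simp only: s KA.nat_pow_Suc) auto
      qed (use KA.one_not_zero s in simp)
      \<comment> \<open>Pseudo-division by an element \<open>d\<close> of least degree in a set
        closed under these combinations leaves no remainder. The factor \<open>a\<close> is a power
        of the leading coefficient of \<open>d\<close>; this form matters later, when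
        \<open>ph\<close> must not kill it.\<close>
      have division: "\<exists>q\<in>carrier P. \<exists>a\<in>A. a \<noteq> \<zero> \<and> (\<exists>m::nat. a = ?lc d [^]\<^sub>KA m) \<and> a \<odot>\<^sub>P g = d \<otimes>\<^sub>P q"
        if d: "d \<in> S" "d \<noteq> \<zero>\<^sub>P" and dmin: "\<And>q. q \<in> S \<Longrightarrow> q \<noteq> \<zero>\<^sub>P \<Longrightarrow> deg KA d \<le> deg KA q"
          and g: "g \<in> S" and S: "S \<subseteq> carrier P"
          and cl: "\<And>a q. a \<in> A \<Longrightarrow> q \<in> carrier P \<Longrightarrow> a \<odot>\<^sub>P g \<ominus>\<^sub>P d \<otimes>\<^sub>P q \<in> S" for S d g
      proof -
        have dc: "d \<in> carrier P" and gc: "g \<in> carrier P" using d g S by auto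
        obtain q r m where q: "q \<in> carrier P" "r \<in> carrier P"
            "(?lc d) [^]\<^sub>KA (m::nat) \<odot>\<^sub>P g = d \<otimes>\<^sub>P q \<oplus>\<^sub>P r" "r = \<zero>\<^sub>P \<or> deg KA r < deg KA d"
          using U.long_div_theorem[OF dc gc d(2)] by blast
        have a: "(?lc d) [^]\<^sub>KA m \<in> A" "(?lc d) [^]\<^sub>KA m \<noteq> \<zero>"
          by (rule powA[OF lcA[OF dc]], rule pow0[OF lcA[OF dc] lc0[OF dc d(2)]])
        have "(?lc d) [^]\<^sub>KA m \<odot>\<^sub>P g \<ominus>\<^sub>P d \<otimes>\<^sub>P q = r"
          unfolding q(3) using q(1,2) dc by (simp add: a_minus_def U.P.a_ac) (simp add: U.P.r_neg flip: U.P.a_assoc)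
        hence "r \<in> S" using cl[OF a(1) q(1)] by simp
        hence "r = \<zero>\<^sub>P" using q(4) dmin by force
        thus ?thesis using a q dc by force
      qed
      have Jcl: "a \<odot>\<^sub>P g \<ominus>\<^sub>P h \<otimes>\<^sub>P q \<in> J" if gJ: "g \<in> J" and aA: "a \<in> A" and qP: "q \<in> carrier P" for g a q
      proof -
        obtain w where w: "w \<in> carrier P" "Ev g = b \<otimes> Ev w" "g \<in> carrier P" using gJ by (auto simp: J_def)
        obtain v where v: "v \<in> carrier P" "Ev h = b \<otimes> Ev v" using h by (auto simp: J_def)
        have aK: "a \<in> carrier K" using aA AK by auto
        note that = gJ aA qP
        have "Ev (a \<odot>\<^sub>P g \<ominus>\<^sub>P h \<otimes>\<^sub>P q) = a \<otimes> (b \<otimes> Ev w) \<ominus> b \<otimes> Ev v \<otimes> Ev q"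
          using that w v hc by (simp add: a_minus_def Es s)
        also have "\<dots> = b \<otimes> (a \<otimes> Ev w \<ominus> Ev v \<otimes> Ev q)"
          using aK bK w v that Ev.hom_closed[OF w(1)] Ev.hom_closed[OF v(1)] Ev.hom_closed[OF that(3)] by algebra
        also have "\<dots> = b \<otimes> Ev (a \<odot>\<^sub>P w \<ominus>\<^sub>P v \<otimes>\<^sub>P q)"
          using that w v by (simp add: a_minus_def Es s)
        finally show ?thesis using that w v hc by (auto simp: J_def s intro!: bexI[of _ "a \<odot>\<^sub>P w \<ominus>\<^sub>P v \<otimes>\<^sub>P q"])
      qed
      have Icl: "a \<odot>\<^sub>P g \<ominus>\<^sub>P p \<otimes>\<^sub>P q \<in> I" if "g \<in> I" "a \<in> A" "q \<in> carrier P" for g a q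
        using that p AK by (auto simp: I_def a_minus_def Es s)
      have JP: "J \<subseteq> carrier P" and IP: "I \<subseteq> carrier P" by (auto simp: J_def I_def)
      \<comment> \<open>Division of \<open>bt\<close> by \<open>h\<close> shows that
        \<open>h\<close> is not itself a relation. Division of \<open>p\<close> by \<open>h\<close>
        then has a quotient \<open>q\<close> that is a relation, and deg p = deg h + deg q together
        with the minimality of \<open>p\<close> forces deg h = 0.\<close>
      have degh: "deg KA h = 0"
      proof -
        obtain q a where q: "q \<in> carrier P" "a \<in> A" "a \<noteq> \<zero>" "a \<odot>\<^sub>P p = h \<otimes>\<^sub>P q"
          using division[OF h hmin _ JP Jcl, of p] p IJ by blast
        obtain q' a' where q': "q' \<in> carrier P" "a' \<in> A" "a' \<noteq> \<zero>" "a' \<odot>\<^sub>P bt = h \<otimes>\<^sub>P q'"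
          using division[OF h hmin _ JP Jcl, of bt] btJ by blast
        have "a' \<otimes> b = Ev h \<otimes> Ev q'" using arg_cong[OF q'(4), of Ev] q'(1,2) hc bt by (simp add: Es)
        hence Eh: "Ev h \<noteq> \<zero>" using q' b0 bK AK K.integral[of a' b] by auto
        have "Ev h \<otimes> Ev q = \<zero>" using arg_cong[OF q(4), of Ev] q(1,2) hc pc AK by (auto simp: Es Ep)
        hence "Ev q = \<zero>" using Eh K.integral[of "Ev h" "Ev q"] q hc by auto
        hence qI: "q \<in> I" using q by (simp add: I_def)
        have dp: "deg KA (a \<odot>\<^sub>P p) = deg KA p" using q pc by (subst U.deg_smult) (auto simp: s)
        have "a \<odot>\<^sub>P p \<noteq> \<zero>\<^sub>P"
        proof
          assume "a \<odot>\<^sub>P p = \<zero>\<^sub>P"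
          hence "a \<otimes> ?lc p = \<zero>" using U.coeff_smult[of a p "deg KA p"] q pc by (simp add: s)
          thus False using K.integral[of a "?lc p"] q lc0[OF pc p(2)] lcA[OF pc] AK by auto
        qed
        hence q0: "q \<noteq> \<zero>\<^sub>P" using q hc by auto
        have "deg KA p = deg KA h + deg KA q" using dp q h(2) hc q0 by (simp add: U.deg_mult)
        thus ?thesis using pmin[OF qI q0] by simp
      qed
      define c where "c = up_ring.coeff P h 0"
      have hm: "h = up_ring.monom P c 0" using U.deg_zero_impl_monom[OF hc degh] by (simp add: c_def)
      have cA: "c \<in> A" using U.coeff_closed[OF hc, of 0] by (simp add: c_def s)
      have c0: "c \<noteq> \<zero>" using lc0[OF hc h(2)] degh by (simp add: c_def)
      obtain w where w: "w \<in> carrier P" "c = b \<otimes> Ev w" using h(1) Ec[OF cA] hm by (auto simp: J_def)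
      \<comment> \<open>If the leading coefficient survives, the image of \<open>p\<close> keeps its
        positive degree and pseudo-division by \<open>p\<close> can be undone; if \<open>c\<close>
        survives, so does \<open>b\<close>.\<close>
      define a where "a = ?lc p \<otimes>\<^sub>KA c"
      have aA: "a \<in> A" "a \<noteq> \<zero>"
        using KA.m_closed[of "?lc p" c] KA.integral[of "?lc p" c] lcA[OF pc] lc0[OF pc p(2)] cA c0 by (auto simp: a_def s)
      have "\<exists>ps\<in>ring_hom (K\<lparr>carrier := B\<rparr>) k. (\<forall>c\<in>A. ps c = ph c) \<and> ps b \<noteq> \<zero>\<^sub>k"
        if ph: "ph \<in> ring_hom KA k" and "ph a \<noteq> \<zero>\<^sub>k" for ph
      proof -
        interpret W: UP_pre_univ_prop KA k ph P
          by (rule univ[OF ph]) (simp add: P_def)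
        have "ph a = ph (?lc p) \<otimes>\<^sub>k ph c"
          unfolding a_def using lcA[OF pc] cA by (intro ring_hom_mult[OF ph]) (auto simp: s)
        moreover have "ph (?lc p) \<in> carrier k" "ph c \<in> carrier k" using lcA[OF pc] cA ring_hom_closed[OF ph] by (auto simp: s)
        ultimately have nz: "ph (?lc p) \<noteq> \<zero>\<^sub>k" "ph c \<noteq> \<zero>\<^sub>k" using that(2) by auto
        have "deg KA p > 0"
        proof (rule ccontr)
          assume "\<not> deg KA p > 0"
          hence "p = up_ring.monom P (?lc p) 0" using U.deg_zero_impl_monom[OF pc] by simp
          hence "?lc p = \<zero>" using Ec[OF lcA[OF pc]] Ep by simp
          thus False using lc0[OF pc p(2)] by simp
        qed
        then obtain xe where xe: "xe \<in> carrier k" "UnivPoly.eval KA k ph xe p = \<zero>\<^sub>k"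
          using L.root_exists[of "\<lambda>i. ph (up_ring.coeff P p i)" "deg KA p"] phc[OF ph pc] nz(1)
          by (auto simp: ev[OF pc])
        let ?F = "UnivPoly.eval KA k ph xe"
        interpret F: ring_hom_cring P k "UnivPoly.eval KA k ph xe"
          by (intro UnivPoly.ring_hom_cringI U.P.cring_axioms L.cring_axioms W.eval_ring_hom xe)
        have Fs: "?F (a \<odot>\<^sub>P p) = ph a \<otimes>\<^sub>k ?F p" if "a \<in> A" "p \<in> carrier P" for a p
          using that W.eval_const[OF xe(1), of a] F.hom_mult[of "up_ring.monom P a 0" p] by (simp add: U.monom_mult_is_smult s)
        \<comment> \<open>It suffices that \<open>xe\<close> is a root of \<open>p\<close>: for a
          relation \<open>g\<close>, a power of the leading coefficient times \<open>g\<close> is a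
          multiple of \<open>p\<close>, and \<open>ph\<close> does not kill that power.\<close>
        have "?F g = \<zero>\<^sub>k" if g: "g \<in> I" for g
        proof -
          have gc: "g \<in> carrier P" using g by (simp add: I_def)
          obtain q l where q: "q \<in> carrier P" "l \<in> A" "l \<odot>\<^sub>P g = p \<otimes>\<^sub>P q" "\<exists>m::nat. l = ?lc p [^]\<^sub>KA m"
            using division[OF p pmin g IP Icl] g by blast
          then obtain m :: nat where m: "l = ?lc p [^]\<^sub>KA m" by blast
          have Lpow: "y [^]\<^sub>k m \<noteq> \<zero>\<^sub>k" if "y \<in> carrier k" "y \<noteq> \<zero>\<^sub>k" for y and m :: nat
            using that by (induction m) (auto dest: L.integral)
          have "ph l \<noteq> \<zero>\<^sub>k" "ph l \<in> carrier k"
            unfolding m using W.hom_pow[of "?lc p" m] pc nz(1) Lpow[of "ph (?lc p)" m] by auto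
          moreover have "ph l \<otimes>\<^sub>k ?F g = \<zero>\<^sub>k" using arg_cong[OF q(3), of ?F] q(1,2) gc pc xe by (simp add: Fs)
          ultimately show ?thesis using L.integral[of "ph l" "?F g"] F.hom_closed[OF gc] by auto
        qed
        then obtain ps where ps: "ps \<in> ring_hom (K\<lparr>carrier := B\<rparr>) k" "\<forall>p\<in>carrier P. ps (Ev p) = ?F p" "\<forall>c\<in>A. ps c = ph c"
          using ext[OF ph xe(1)] by blast
        have "ps c = ps b \<otimes>\<^sub>k ps (Ev w)"
          using ring_hom_mult[OF ps(1), of b "Ev w"] bB w by (auto simp: B_def)
        moreover have "ps (Ev w) \<in> carrier k" using ps(2) w by auto
        ultimately have "ps b \<noteq> \<zero>\<^sub>k" using ps(3) cA nz(2) by auto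
        thus ?thesis using ps by blast
      qed
      thus ?thesis using aA by blast
    qed
  qed
  ultimately show ?thesis using AB Bsub unfolding KA_def by blast
qed

text \<open>A ring record has no scalar multiplication, so \<open>k\<close> has to be repackaged
  before it can be the target of \<open>alg_hom\<close>: a closed point of R is an element of
  \<open>alg_hom k R (self_algebra k)\<close>. Over R the same construction serves as the free
  module of rank one.\<close>

definition self_algebra :: "('k, 'c) ring_scheme \<Rightarrow> ('k, 'k) module"
  where "self_algebra k = \<lparr>carrier = carrier k, monoid.mult = monoid.mult k, one = one k,
    zero = zero k, add = add k, smult = monoid.mult k\<rparr>"

lemma self_algebra_simps [simp]:
  "carrier (self_algebra k) = carrier k" "x \<otimes>\<^bsub>self_algebra k\<^esub> y = x \<otimes>\<^sub>k y"
  "\<one>\<^bsub>self_algebra k\<^esub> = \<one>\<^sub>k" "\<zero>\<^bsub>self_algebra k\<^esub> = \<zero>\<^sub>k" "x \<oplus>\<^bsub>self_algebra k\<^esub> y = x \<oplus>\<^sub>k y"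
  "x \<odot>\<^bsub>self_algebra k\<^esub> y = x \<otimes>\<^sub>k y"
  by (simp_all add: self_algebra_def)

lemma algebra_self_algebra:
  assumes "cring k" shows "algebra k (self_algebra k)"
proof -
  interpret cring k by fact
  have ab: "abelian_group (self_algebra k)"
    by (rule abelian_groupI) (auto simp: a_ac intro: add.l_inv_ex)
  have "comm_monoid (self_algebra k)"
    by (rule comm_monoidI) (auto simp: m_ac)
  with ab have "cring (self_algebra k)"
    by (intro cringI) (auto simp: l_distr)
  thus ?thesis using ab
    by (intro algebra.intro algebra_axioms.intro moduleI is_cring) (auto simp: l_distr r_distr m_ac)
qed

section \<open>Maximal ideals and the Nullstellensatz\<close>

lemma (in ring) maximal_ideal_exists:
  assumes J: "ideal J R" "J \<noteq> carrier R"
  shows "\<exists>M. maximalideal M R \<and> J \<subseteq> M"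
proof -
  define W where "W = {I. ideal I R \<and> J \<subseteq> I \<and> \<one> \<notin> I}"
  have one: "I = carrier R" if "ideal I R" "\<one> \<in> I" for I
    using ideal.one_imp_carrier[OF that] .
  have "\<exists>N\<in>W. \<forall>Z\<in>W. N \<subseteq> Z \<longrightarrow> Z = N"
  proof (rule subset_Zorn_nonempty)
    show "W \<noteq> {}" using J one[OF J(1)] unfolding W_def by blast
    fix C assume C: "C \<noteq> {}" "subset.chain W C"
    hence "subset.chain {I. ideal I R} C" by (auto simp: subset.chain_def W_def)
    hence "ideal (\<Union>C) R" using chain_Union_is_ideal[of C] C(1) by simp
    thus "\<Union>C \<in> W" using C by (fastforce simp: subset.chain_def W_def)
  qed
  then obtain M where M: "M \<in> W" "\<And>Z. Z \<in> W \<Longrightarrow> M \<subseteq> Z \<Longrightarrow> Z = M" by blast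
  have "maximalideal M R"
  proof (rule maximalidealI)
    show "carrier R \<noteq> M" using M(1) one_closed unfolding W_def by blast
    fix I assume "ideal I R" "M \<subseteq> I"
    thus "I = M \<or> I = carrier R" using M one[of I] unfolding W_def by blast
  qed (use M in \<open>simp add: W_def\<close>)
  thus ?thesis using M(1) unfolding W_def by blast
qed

lemma domain_quot_algebra:
  assumes Q: "algebra k Q" and M: "primeideal M Q"
  shows "domain (quot_algebra Q M)"
proof -
  interpret Qc: cring Q by (rule algebra.M_cring[OF Q])
  interpret Q: algebra k Q by fact
  interpret M: primeideal M Q by fact
  have I: "ideal M Q" by (rule M.ideal_axioms)
  note qs = quot_algebra_simps[OF Q.is_assoc_algebra I]
  have eq0: "M +>\<^sub>Q x = M +>\<^sub>Q \<zero>\<^sub>Q \<longleftrightarrow> x \<in> M" if "x \<in> carrier Q" for x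
    using M.a_rcos_self[OF that] M.a_rcos_const[of x] M.a_rcos_const[OF M.zero_closed] by auto
  show ?thesis
  proof (intro domain.intro domain_axioms.intro)
    show "cring (quot_algebra Q M)" by (rule algebra.M_cring[OF algebra_quot_algebra[OF Q I]])
    have "\<one>\<^sub>Q \<notin> M" using M.I_notcarr M.one_imp_carrier by auto
    thus "\<one>\<^bsub>quot_algebra Q M\<^esub> \<noteq> \<zero>\<^bsub>quot_algebra Q M\<^esub>" using eq0[of "\<one>\<^sub>Q"] by (simp add: qs)
    fix a b assume ab: "a \<otimes>\<^bsub>quot_algebra Q M\<^esub> b = \<zero>\<^bsub>quot_algebra Q M\<^esub>"
      "a \<in> carrier (quot_algebra Q M)" "b \<in> carrier (quot_algebra Q M)"
    then obtain x y where xy: "x \<in> carrier Q" "y \<in> carrier Q" "a = M +>\<^sub>Q x" "b = M +>\<^sub>Q y"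
      unfolding qs by blast
    have "x \<otimes>\<^sub>Q y \<in> M" using ab(1) eq0[of "x \<otimes>\<^sub>Q y"] xy(1,2) unfolding xy(3,4) by (simp only: qs Qc.m_closed)
    thus "a = \<zero>\<^bsub>quot_algebra Q M\<^esub> \<or> b = \<zero>\<^bsub>quot_algebra Q M\<^esub>"
      using M.I_prime[OF xy(1,2)] eq0[OF xy(1)] eq0[OF xy(2)] unfolding xy(3,4) qs by blast
  qed
qed

lemma alg_generated_image:
  assumes h: "h \<in> alg_hom k A B" and A: "assoc_algebra k A" and B: "assoc_algebra k B" and S: "S \<subseteq> carrier A"
  shows "h ` alg_generated k A S \<subseteq> alg_generated k B (h ` S)"
proof -
  interpret A: assoc_algebra k A by fact
  interpret B: assoc_algebra k B by fact
  have hr: "h \<in> ring_hom A B" using h by (simp add: alg_hom_def)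
  have gen: "x \<in> carrier A" if "x \<in> alg_generated k A S" for x
    using that by induction (use S in auto)
  have "h x \<in> alg_generated k B (h ` S)" if "x \<in> alg_generated k A S" for x
    using that
  proof induction
    case zero thus ?case using ring_hom_zero[OF hr A.ring_axioms B.ring_axioms] by (simp add: alg_generated.zero)
  next
    case one thus ?case using ring_hom_one[OF hr] by (simp add: alg_generated.one)
  next
    case (smult c x) thus ?case using h gen[of x] by (auto simp: alg_hom_def intro: alg_generated.smult)
  next
    case (add x y) thus ?case using gen[of x] gen[of y] by (auto simp: ring_hom_add[OF hr] intro: alg_generated.add)
  next
    case (mult x y) thus ?case using gen[of x] gen[of y] by (auto simp: ring_hom_mult[OF hr] intro: alg_generated.mult)
  qed (auto intro: alg_generated.incl)
  thus ?thesis by blast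
qed

lemma alg_hom_comp:
  assumes "f \<in> alg_hom k A B" "g \<in> alg_hom k B C"
  shows "(\<lambda>x. g (f x)) \<in> alg_hom k A C"
proof -
  have f: "f \<in> ring_hom A B" and g: "g \<in> ring_hom B C" using assms by (simp_all add: alg_hom_def)
  have "(\<lambda>x. g (f x)) \<in> ring_hom A C" using ring_hom_trans[OF f g] by (simp add: comp_def)
  thus ?thesis using assms ring_hom_closed[OF f] by (simp add: alg_hom_def)
qed

text \<open>Nullstellensatz for domains: the generators are adjoined to the copy of \<open>k\<close>
  one at a time by \<open>extend_hom_one_generator\<close>.\<close>

lemma domain_hom_to_closed_field_exists:
  fixes K :: "('k, 'q, 'd) module_scheme" (structure)
  assumes L: "algebraically_closed k" and Kd: "domain K" and Kalg: "algebra k K"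
    and fg: "finitely_generated_algebra k K"
  shows "\<exists>ph. ph \<in> alg_hom k K (self_algebra k)"
proof -
  interpret L: algebraically_closed k by fact
  interpret K: domain K by fact
  interpret Ka: algebra k K by fact
  interpret Kaa: assoc_algebra k K by (rule Ka.is_assoc_algebra)
  obtain S where S: "finite S" "S \<subseteq> carrier K" "alg_generated k K S = carrier K"
    using fg by (auto simp: finitely_generated_algebra_def)
  obtain xs where xs: "set xs = S" using finite_list[OF S(1)] by blast
  define io where "io c = c \<odot> \<one>" for c
  have ioc: "io c \<in> carrier K" if "c \<in> carrier k" for c using that by (simp add: io_def)
  have io0: "c = \<zero>\<^sub>k" if "c \<in> carrier k" "io c = \<zero>" for c
  proof (rule ccontr)
    assume "c \<noteq> \<zero>\<^sub>k"
    hence "inv\<^bsub>k\<^esub> c \<in> carrier k" "inv\<^bsub>k\<^esub> c \<otimes>\<^sub>k c = \<one>\<^sub>k" using that L.field_Units by auto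
    hence "\<one> = inv\<^bsub>k\<^esub> c \<odot> io c" using that(1) by (simp add: io_def flip: Ka.smult_assoc1)
    thus False using that(2) \<open>inv\<^bsub>k\<^esub> c \<in> carrier k\<close> by simp
  qed
  have ioinj: "c = d" if "c \<in> carrier k" "d \<in> carrier k" "io c = io d" for c d
  proof -
    have "io (c \<ominus>\<^sub>k d) = io c \<ominus> io d"
      using that(1,2) by (simp add: io_def a_minus_def Ka.smult_l_distr Ka.smult_l_minus)
    also have "\<dots> = \<zero>" using that ioc by (simp add: a_minus_def K.r_neg)
    finally show ?thesis using io0[of "c \<ominus>\<^sub>k d"] that(1,2) by simp
  qed
  have iom: "io c \<otimes> x = c \<odot> x" if "c \<in> carrier k" "x \<in> carrier K" for c x
    using that by (simp add: io_def Kaa.smult_assoc_l)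
  have iomult: "io c \<otimes> io d = io (c \<otimes>\<^sub>k d)" if "c \<in> carrier k" "d \<in> carrier k" for c d
    using that iom[OF that(1) ioc[OF that(2)]] by (simp add: io_def Ka.smult_assoc1)
  have ioadd: "io c \<oplus> io d = io (c \<oplus>\<^sub>k d)" if "c \<in> carrier k" "d \<in> carrier k" for c d
    using that by (simp add: io_def Ka.smult_l_distr)
  have ioone: "\<one> = io \<one>\<^sub>k" by (simp add: io_def)
  \<comment> \<open>The induction has to treat all nonzero \<open>b\<close> at once, since keeping
    \<open>b\<close> alive after the next generator means keeping some other element
    \<open>a\<close> alive before it. In the base case the subring is the copy of \<open>k\<close>,
    and \<open>ph\<close> inverts the embedding \<open>io\<close>.\<close>
  have ext: "\<exists>A. subring A K \<and> io ` carrier k \<subseteq> A \<and> set xs \<subseteq> A \<and> (\<forall>b\<in>A. b \<noteq> \<zero> \<longrightarrow>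
      (\<exists>ph\<in>ring_hom (K\<lparr>carrier := A\<rparr>) k. (\<forall>c\<in>carrier k. ph (io c) = c) \<and> ph b \<noteq> \<zero>\<^sub>k))"
    if "set xs \<subseteq> carrier K" for xs
    using that
  proof (induction xs)
    case Nil
    let ?A = "io ` carrier k"
    have "subring ?A K"
    proof (rule K.subringI)
      fix h assume "h \<in> ?A"
      then obtain c where c: "c \<in> carrier k" "h = io c" by blast
      hence "\<ominus> h = io (\<ominus>\<^sub>k c)" by (simp add: io_def Ka.smult_l_minus)
      thus "\<ominus> h \<in> ?A" using c by blast
    qed (use ioc ioone ioadd iomult in auto)
    moreover define ph where "ph = inv_into (carrier k) io"
    have inj: "inj_on io (carrier k)" using ioinj by (auto intro: inj_onI)
    have ph: "ph (io c) = c" if "c \<in> carrier k" for c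
      unfolding ph_def by (rule inv_into_f_f[OF inj that])
    have "ph \<in> ring_hom (K\<lparr>carrier := ?A\<rparr>) k"
      by (rule ring_hom_memI) (auto simp: ph iomult ioadd ioone)
    moreover have "ph b \<noteq> \<zero>\<^sub>k" if "b \<in> ?A" "b \<noteq> \<zero>" for b
      using that ph by (auto simp: io_def)
    ultimately have "\<forall>b\<in>?A. b \<noteq> \<zero> \<longrightarrow>
        (\<exists>ph\<in>ring_hom (K\<lparr>carrier := ?A\<rparr>) k. (\<forall>c\<in>carrier k. ph (io c) = c) \<and> ph b \<noteq> \<zero>\<^sub>k)"
      using ph by blast
    moreover have "set [] \<subseteq> ?A" by simp
    ultimately show ?case using \<open>subring ?A K\<close> by blast
  next
    case (Cons x xs)
    then obtain A where A: "subring A K" "io ` carrier k \<subseteq> A" "set xs \<subseteq> A"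
      and hom: "\<And>b. b \<in> A \<Longrightarrow> b \<noteq> \<zero> \<Longrightarrow> \<exists>ph\<in>ring_hom (K\<lparr>carrier := A\<rparr>) k. (\<forall>c\<in>carrier k. ph (io c) = c) \<and> ph b \<noteq> \<zero>\<^sub>k"
      by (metis (no_types, lifting) set_subset_Cons subset_trans)
    from Cons.prems have "x \<in> carrier K" by simp
    from extend_hom_one_generator[OF L K.domain_axioms A(1) this] obtain B where
      B: "subring B K" "A \<subseteq> B" "x \<in> B"
      and ext: "\<And>b. b\<in>B \<Longrightarrow> b \<noteq> \<zero> \<Longrightarrow> \<exists>a\<in>A. a \<noteq> \<zero> \<and> (\<forall>ph\<in>ring_hom (K\<lparr>carrier := A\<rparr>) k. ph a \<noteq> \<zero>\<^sub>k \<longrightarrow>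
      (\<exists>ps\<in>ring_hom (K\<lparr>carrier := B\<rparr>) k. (\<forall>c\<in>A. ps c = ph c) \<and> ps b \<noteq> \<zero>\<^sub>k))"
      by blast
    have "\<exists>ps\<in>ring_hom (K\<lparr>carrier := B\<rparr>) k. (\<forall>c\<in>carrier k. ps (io c) = c) \<and> ps b \<noteq> \<zero>\<^sub>k"
      if b: "b \<in> B" "b \<noteq> \<zero>" for b
    proof -
      obtain a where a: "a \<in> A" "a \<noteq> \<zero>" and e: "\<And>ph. ph \<in> ring_hom (K\<lparr>carrier := A\<rparr>) k \<Longrightarrow> ph a \<noteq> \<zero>\<^sub>k \<Longrightarrow>
        \<exists>ps\<in>ring_hom (K\<lparr>carrier := B\<rparr>) k. (\<forall>c\<in>A. ps c = ph c) \<and> ps b \<noteq> \<zero>\<^sub>k" using ext[OF b] by blast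
      obtain ph where ph: "ph \<in> ring_hom (K\<lparr>carrier := A\<rparr>) k" "\<forall>c\<in>carrier k. ph (io c) = c" "ph a \<noteq> \<zero>\<^sub>k" using hom[OF a] by blast
      from e[OF ph(1,3)] obtain ps where ps: "ps \<in> ring_hom (K\<lparr>carrier := B\<rparr>) k" "\<forall>c\<in>A. ps c = ph c" "ps b \<noteq> \<zero>\<^sub>k" by blast
      have "ps (io c) = c" if "c \<in> carrier k" for c using ps(2) ph(2) A(2) that by auto
      thus ?thesis using ps by blast
    qed
    moreover have "io ` carrier k \<subseteq> B" "set (x # xs) \<subseteq> B" using A B by auto
    ultimately show ?case using B(1) by blast
  qed
  have "set xs \<subseteq> carrier K" using xs S(2) by auto
  hence "\<exists>A. subring A K \<and> io ` carrier k \<subseteq> A \<and> set xs \<subseteq> A \<and> (\<forall>b\<in>A. b \<noteq> \<zero> \<longrightarrow>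
      (\<exists>ph\<in>ring_hom (K\<lparr>carrier := A\<rparr>) k. (\<forall>c\<in>carrier k. ph (io c) = c) \<and> ph b \<noteq> \<zero>\<^sub>k))"
    by (rule ext)
  then obtain A where A: "subring A K" "io ` carrier k \<subseteq> A" "set xs \<subseteq> A"
      and hom: "\<forall>b\<in>A. b \<noteq> \<zero> \<longrightarrow> (\<exists>ph\<in>ring_hom (K\<lparr>carrier := A\<rparr>) k. (\<forall>c\<in>carrier k. ph (io c) = c) \<and> ph b \<noteq> \<zero>\<^sub>k)"
    by (elim exE conjE)
  note AA = subringE[OF A(1)]
  have SA: "s \<in> A" if "s \<in> S" for s using A(3) xs that by blast
  have "x \<in> A" if "x \<in> alg_generated k K S" for x
    using that
  proof induction
    case (smult c x)
    hence "io c \<otimes> x \<in> A" using A(2) AA by blast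
    thus ?case using iom[of c x] smult AA(1) by auto
  next
    case zero show ?case by (rule AA(2))
  next
    case one show ?case by (rule AA(3))
  next
    case (incl x) thus ?case by (rule SA)
  next
    case (add x y) show ?case by (rule AA(7)[OF add.IH])
  next
    case (mult x y) show ?case by (rule AA(6)[OF mult.IH])
  qed
  hence AK: "A = carrier K" using S(3) AA(1) by auto
  \<comment> \<open>The subring is now all of \<open>K\<close>, and \<one> serves as the element to
    be kept alive.\<close>
  obtain ph where "ph \<in> ring_hom (K\<lparr>carrier := A\<rparr>) k" and phio: "\<And>c. c \<in> carrier k \<Longrightarrow> ph (io c) = c"
    using hom AA(3) K.one_not_zero by blast
  hence ph: "ph \<in> ring_hom K k" by (simp add: AK)
  have phs: "ph (c \<odot> x) = c \<otimes>\<^sub>k ph x" if "c \<in> carrier k" "x \<in> carrier K" for c x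
    using that ring_hom_mult[OF ph ioc[OF that(1)] that(2)] by (simp add: iom phio)
  have "ph \<in> alg_hom k K (self_algebra k)"
    unfolding alg_hom_def
    by (auto intro!: ring_hom_memI simp: ring_hom_closed[OF ph] ring_hom_mult[OF ph]
       ring_hom_add[OF ph] ring_hom_one[OF ph] phs)
  thus ?thesis by blast
qed

text \<open>Weak Nullstellensatz, as the existence of a zero of \<open>J\<close>: the quotient by a
  maximal ideal containing \<open>J\<close> is a finitely generated domain, and a homomorphism from
  it to \<open>k\<close> gives a point at which \<open>J\<close> vanishes.\<close>

lemma alg_hom_to_closed_field_exists:
  fixes Q :: "('k, 'q, 'd) module_scheme"
  assumes L: "algebraically_closed k" and Q: "algebra k Q" and fg: "finitely_generated_algebra k Q"
    and J: "ideal J Q" "J \<noteq> carrier Q"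
  shows "\<exists>x\<in>alg_hom k Q (self_algebra k). \<forall>c\<in>J. x c = \<zero>\<^sub>k"
proof -
  interpret L: algebraically_closed k by fact
  interpret Qc: cring Q by (rule algebra.M_cring[OF Q])
  interpret Q: algebra k Q by fact
  obtain M where M: "maximalideal M Q" "J \<subseteq> M" using ring.maximal_ideal_exists[OF cring.axioms(1)[OF Q.M_cring] J] by blast
  have MI: "ideal M Q" using M(1) by (rule maximalideal.axioms(1))
  define K where "K = quot_algebra Q M"
  define pr where "pr = (\<lambda>x. M +>\<^sub>Q x)"
  have pr: "pr \<in> alg_hom k Q K" unfolding pr_def K_def by (rule quot_algebra_proj[OF Q.is_assoc_algebra MI])
  interpret K: domain K unfolding K_def
    by (rule domain_quot_algebra[OF Q cring.maximalideal_prime[OF Q.M_cring M(1)]])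
  interpret Ka: algebra k K unfolding K_def by (rule algebra_quot_algebra[OF Q MI])
  interpret Kaa: assoc_algebra k K by (rule Ka.is_assoc_algebra)
  obtain S where S: "finite S" "S \<subseteq> carrier Q" "alg_generated k Q S = carrier Q"
    using fg by (auto simp: finitely_generated_algebra_def)
  have car: "carrier K = pr ` carrier Q"
    unfolding K_def pr_def by (rule quot_algebra_simps(1)[OF Q.is_assoc_algebra MI])
  hence gen: "carrier K \<subseteq> alg_generated k K (pr ` S)"
    using alg_generated_image[OF pr Q.is_assoc_algebra Kaa.assoc_algebra_axioms S(2)] S(3) by simp
  have "finitely_generated_algebra k K"
  proof -
    have "alg_generated k K (pr ` S) \<subseteq> carrier K"
    proof
      fix x assume "x \<in> alg_generated k K (pr ` S)"
      thus "x \<in> carrier K"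
      proof induction
        case (incl x) thus ?case using S(2) unfolding car by blast
      qed simp_all
    qed
    thus ?thesis using gen S(1,2) car unfolding finitely_generated_algebra_def
      by (intro exI[of _ "pr ` S"]) blast
  qed
  then obtain ph where ph: "ph \<in> alg_hom k K (self_algebra k)"
    using domain_hom_to_closed_field_exists[OF L K.domain_axioms Ka.algebra_axioms] by blast
  hence phr: "ph \<in> ring_hom K (self_algebra k)" and phs: "\<And>c x. c \<in> carrier k \<Longrightarrow> x \<in> carrier K \<Longrightarrow> ph (c \<odot>\<^sub>K x) = c \<otimes>\<^sub>k ph x"
    by (simp_all add: alg_hom_def)
  have "(\<lambda>x. ph (pr x)) \<in> alg_hom k Q (self_algebra k)"
    by (rule alg_hom_comp[OF pr ph])
  moreover have "ph (pr c) = \<zero>\<^sub>k" if "c \<in> J" for c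
  proof -
    interpret M: ideal M Q by (rule MI)
    have "c \<in> M" using that M(2) by blast
    hence "pr c = \<zero>\<^sub>K" unfolding pr_def K_def
      by (simp add: quot_algebra_simps[OF Q.is_assoc_algebra MI] M.a_rcos_const)
    thus ?thesis using ring_hom_zero[OF phr K.ring_axioms] algebra.M_cring[OF algebra_self_algebra[OF L.cring_axioms]] by (simp add: cring_def)
  qed
  ultimately show ?thesis by (intro bexI[of _ "\<lambda>x. ph (pr x)"] ballI)
qed

subsection \<open>Dickson's lemma and Hilbert's basis theorem\<close>

text \<open>A monotone subsequence that is not increasing is decreasing, hence constant from the
  point on where it attains its minimum.\<close>

lemma nat_seq_mono_subseq:
  fixes f :: "nat \<Rightarrow> nat"
  shows "\<exists>r. strict_mono r \<and> incseq (\<lambda>i. f (r i))"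
proof -
  obtain g :: "nat \<Rightarrow> nat" where g: "strict_mono g" "monoseq (\<lambda>i. f (g i))" using seq_monosub[of f] by blast
  show ?thesis
  proof (cases "incseq (\<lambda>i. f (g i))")
    case False
    hence dec: "decseq (\<lambda>i. f (g i))" using g(2) by (auto simp: monoseq_iff)
    obtain n0 where n0: "\<And>n. f (g n0) \<le> f (g n)"
      using ex_has_least_nat[of "\<lambda>_. True" 0 "\<lambda>n. f (g n)"] by blast
    have "f (g (n0 + n)) = f (g n0)" for n
      using n0[of "n0 + n"] decseqD[OF dec, of n0 "n0 + n"] by simp
    thus ?thesis using g(1) by (intro exI[of _ "\<lambda>n. g (n0 + n)"]) (auto simp: strict_mono_def incseq_def)
  qed (use g in blast)
qed

text \<open>Subsequences are refined one variable at a time; monotonicity in the variables already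
  treated passes to the refinement.\<close>

lemma dickson_seq:
  fixes s :: "nat \<Rightarrow> nat multiset"
  shows "\<exists>r. strict_mono r \<and> (\<forall>v<n. incseq (\<lambda>i. count (s (r i)) v))"
proof (induction n)
  case 0 show ?case by (intro exI[of _ id]) (auto simp: strict_mono_def)
next
  case (Suc n)
  then obtain r where r: "strict_mono r" "\<forall>v<n. incseq (\<lambda>i. count (s (r i)) v)" by blast
  obtain q where q: "strict_mono q" "incseq (\<lambda>i. count (s (r (q i))) n)"
    using nat_seq_mono_subseq[of "\<lambda>i. count (s (r i)) n"] by blast
  have "incseq (\<lambda>i. count (s (r (q i))) v)" if "v < n" for v
    using r(2) that q(1) by (auto simp: incseq_def strict_mono_less_eq)
  thus ?case using r(1) q by (intro exI[of _ "\<lambda>i. r (q i)"]) (auto simp: strict_mono_def less_Suc_eq)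
qed

text \<open>\<open>D\<close> consists of the elements minimal for divisibility. In an infinite set
  of such elements \<open>dickson_seq\<close> would find two different ones of which the first
  divides the second.\<close>

lemma dickson:
  fixes L :: "nat multiset set"
  assumes L: "\<And>m. m \<in> L \<Longrightarrow> set_mset m \<subseteq> {..<n}"
  shows "\<exists>D. finite D \<and> D \<subseteq> L \<and> (\<forall>m\<in>L. \<exists>d\<in>D. d \<subseteq># m)"
proof -
  define D where "D = {d \<in> L. \<forall>d'\<in>L. d' \<subseteq># d \<longrightarrow> d' = d}"
  have "\<exists>d\<in>D. d \<subseteq># m" if "m \<in> L" for m
    using that
  proof (induction "size m" arbitrary: m rule: less_induct)
    case less
    show ?case
    proof (cases "m \<in> D")
      case False
      then obtain d where d: "d \<in> L" "d \<subset># m" using less.prems by (auto simp: D_def subset_mset_def)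
      show ?thesis using less.hyps[OF mset_subset_size[OF d(2)] d(1)] d(2)
        by (meson subset_mset.dual_order.trans subset_mset.less_imp_le)
    qed auto
  qed
  moreover have "finite D"
  proof (rule ccontr)
    assume "infinite D"
    then obtain s :: "nat \<Rightarrow> nat multiset" where s: "inj s" "range s \<subseteq> D"
      using infinite_countable_subset by blast
    obtain r where r: "strict_mono r" "\<forall>v<n. incseq (\<lambda>i. count (s (r i)) v)" using dickson_seq[of n s] by blast
    have "s (r 0) \<subseteq># s (r 1)"
    proof (rule mset_subset_eqI)
      fix v
      have sL: "s (r 0) \<in> L" using s(2) by (auto simp: D_def)
      show "count (s (r 0)) v \<le> count (s (r 1)) v"
      proof (cases "v < n")
        case False
        hence "v \<notin># s (r 0)" using L[OF sL] by auto
        thus ?thesis by (simp add: not_in_iff)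
      qed (use r(2) in \<open>simp add: incseq_def\<close>)
    qed
    moreover have "s (r 0) \<in> D" "s (r 1) \<in> D" using s(2) by auto
    ultimately have "s (r 0) = s (r 1)" by (auto simp: D_def)
    hence "r 0 = r 1" using s(1) by (auto dest: injD)
    thus False using r(1) by (metis strict_mono_eq zero_neq_one)
  qed
  ultimately show ?thesis by (intro exI[of _ D]) (auto simp: D_def)
qed

context
  fixes k :: "('k, 'c) ring_scheme" and n :: nat
  assumes k: "field k"
begin

interpretation k: field k by (rule k)
interpretation P: monoid_algebra_loc k "monomials {..<n}"
  by (rule monoid_algebra_loc_monomials) (rule k.cring_axioms)

lemma poly_single_mult:
  assumes h: "h \<in> carrier P.P" and m: "set_mset m \<subseteq> {..<n}"
  shows "(msingle k m \<otimes>\<^sub>P.P h) z = (if m \<subseteq># z then h (z - m) else \<zero>\<^sub>k)"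
proof -
  have mc: "m \<in> carrier (monomials {..<n})" using m by (simp add: monomials_def)
  have fin: "finite (msupp k h)" using h by (simp add: P.P_carrier)
  have hc: "h x \<in> carrier k" for x using P.P_coeff[OF h] .
  \<comment> \<open>The exponent \<open>z - m\<close> is added to the index set because it need not
    lie in the support of \<open>h\<close>.\<close>
  let ?T = "if m \<subseteq># z then insert (z - m) (msupp k h) else msupp k h"
  have "(msingle k m \<otimes>\<^sub>P.P h) z = finsum k (\<lambda>p. if fst p \<otimes>\<^bsub>monomials {..<n}\<^esub> snd p = z
      then msingle k m (fst p) \<otimes>\<^sub>k h (snd p) else \<zero>\<^sub>k) ({m} \<times> ?T)"
    by (rule P.P_mult[OF P.msingle_closed[OF mc] h]) (use fin in \<open>auto simp: msupp_def msingle_def\<close>)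
  also have "\<dots> = finsum k (\<lambda>p. if (if m \<subseteq># z then (m, z - m) = p else False) then h (z - m) else \<zero>\<^sub>k) ({m} \<times> ?T)"
    by (rule k.add.finprod_cong') (use hc in \<open>auto simp: monomials_def msingle_def\<close>)
  also have "\<dots> = (if m \<subseteq># z then h (z - m) else \<zero>\<^sub>k)"
  proof (cases "m \<subseteq># z")
    case True
    thus ?thesis using k.add.finprod_singleton[of "(m, z - m)" "{m} \<times> insert (z - m) (msupp k h)" "\<lambda>_. h (z - m)"] fin hc
      by simp
  qed simp
  finally show ?thesis .
qed

text \<open>Hilbert's basis theorem by a Groebner basis: one element of \<open>J\<close> is taken
  for each of the finitely many minimal leading monomials, and division by these elements lowers the
  leading monomial until nothing is left.\<close>

lemma poly_ideal_finitely_generated: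
  assumes J: "ideal J P.P"
  shows "\<exists>S. finite S \<and> S \<subseteq> carrier P.P \<and> Idl\<^bsub>P.P\<^esub> S = J"
proof -
  interpret Pr: ring P.P by (rule P.P_ring)
  interpret J: ideal J P.P by fact
  have mon: "set_mset m \<subseteq> {..<n}" if "f \<in> carrier P.P" "m \<in> msupp k f" for f m
  proof -
    have "m \<in> carrier (monomials {..<n})" using that unfolding P.P_carrier by blast
    thus ?thesis by (simp add: monomials_def)
  qed
  \<comment> \<open>\<open>Max\<close> refers to the multiset order on exponents. It is linear and
    well-founded, and adding a multiset preserves it, as a monomial order must.\<close>
  define lead where "lead f = Max (msupp k f)" for f :: "nat multiset \<Rightarrow> 'k"
  have JP: "f \<in> carrier P.P" if "f \<in> J" for f using that J.a_subset by blast
  have lead: "lead f \<in> msupp k f" "\<And>x. x \<in> msupp k f \<Longrightarrow> x \<le> lead f" if "f \<in> carrier P.P" "f \<noteq> \<zero>\<^sub>P.P" for f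
  proof -
    have "finite (msupp k f)" "msupp k f \<noteq> {}" using that by (auto simp: P.P_carrier P.P_zero msupp_def)
    thus "lead f \<in> msupp k f" "\<And>x. x \<in> msupp k f \<Longrightarrow> x \<le> lead f" by (auto simp: lead_def)
  qed
  define L where "L = {lead f | f. f \<in> J \<and> f \<noteq> \<zero>\<^sub>P.P}"
  have "set_mset m \<subseteq> {..<n}" if mL: "m \<in> L" for m
  proof -
    obtain f where f: "f \<in> J" "f \<noteq> \<zero>\<^sub>P.P" "m = lead f" using mL by (auto simp: L_def)
    have "m \<in> msupp k f" using lead(1)[OF JP[OF f(1)] f(2)] f(3) by simp
    thus ?thesis using mon[OF JP[OF f(1)]] by simp
  qed
  hence "\<exists>D. finite D \<and> D \<subseteq> L \<and> (\<forall>m\<in>L. \<exists>d\<in>D. d \<subseteq># m)" by (rule dickson)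
  then obtain D where D: "finite D" "D \<subseteq> L" "\<forall>m\<in>L. \<exists>d\<in>D. d \<subseteq># m" by (elim exE conjE)
  have "\<forall>d\<in>D. \<exists>f. f \<in> J \<and> f \<noteq> \<zero>\<^sub>P.P \<and> lead f = d" using D(2) by (auto simp: L_def)
  from bchoice[OF this] obtain F where
    F0: "\<forall>d\<in>D. F d \<in> J \<and> F d \<noteq> \<zero>\<^sub>P.P \<and> lead (F d) = d"
    by (rule exE)
  have F: "F d \<in> J" "F d \<noteq> \<zero>\<^sub>P.P" "lead (F d) = d" if "d \<in> D" for d
    using bspec[OF F0 that] by simp_all
  define S where "S = F ` D"
  have SP: "S \<subseteq> carrier P.P" and SJ: "S \<subseteq> J" using F JP by (auto simp: S_def)
  interpret I: ideal "Idl\<^bsub>P.P\<^esub> S" P.P by (rule Pr.genideal_ideal[OF SP])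
  have "f \<in> Idl\<^bsub>P.P\<^esub> S" if "f \<in> J" "f \<noteq> \<zero>\<^sub>P.P" for f
    using that
  proof (induction "lead f" arbitrary: f rule: less_induct)
    case less
    note fP = JP[OF less.prems(1)]
    have "lead f \<in> L" using less.prems by (auto simp: L_def)
    then obtain d where d: "d \<in> D" "d \<subseteq># lead f" using bspec[OF D(3)] by blast
    have hP: "F d \<in> carrier P.P" using F d JP by blast
    note ld = lead[OF hP F(2)[OF d(1)], unfolded F(3)[OF d(1)]]
    note lf = lead[OF fP less.prems(2)]
    have nz: "F d d \<noteq> \<zero>\<^sub>k" "F d d \<in> carrier k" using ld(1) P.P_coeff[OF hP] by (auto simp: msupp_def)
    define c where "c = f (lead f) \<otimes>\<^sub>k inv\<^bsub>k\<^esub> (F d d)"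
    have cc: "c \<in> carrier k" using nz P.P_coeff[OF fP] k.field_Units by (auto simp: c_def)
    have cF: "c \<otimes>\<^sub>k F d d = f (lead f)" using nz P.P_coeff[OF fP] k.field_Units by (simp add: c_def k.m_assoc)
    define m where "m = lead f - d"
    have ms: "set_mset m \<subseteq> {..<n}"
    proof -
      have "set_mset (lead f) \<subseteq> {..<n}" by (rule mon[OF fP lf(1)])
      thus ?thesis by (auto simp: m_def dest: in_diffD)
    qed
    hence mP: "msingle k m \<in> carrier P.P" by (intro P.msingle_closed) (simp add: monomials_def)
    define u where "u = msingle k m \<otimes>\<^sub>P.P F d"
    \<comment> \<open>\<open>c\<close> and \<open>m\<close> are chosen so that the leading term of
      \<open>f\<close> cancels against that of the multiple of \<open>F d\<close>.\<close>
    define g where "g = f \<ominus>\<^sub>P.P c \<odot>\<^sub>P.P u"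
    have uP: "u \<in> carrier P.P" using mP hP by (simp add: u_def)
    have uI: "u \<in> Idl\<^bsub>P.P\<^esub> S"
      using I.I_l_closed[OF _ mP] Pr.genideal_self[OF SP] d(1) by (auto simp: u_def S_def)
    have sI: "c \<odot>\<^sub>P.P x \<in> K" if "ideal K P.P" "x \<in> K" for K x
    proof -
      interpret K: ideal K P.P by fact
      have xP: "x \<in> carrier P.P" using K.a_subset that by blast
      have "c \<odot>\<^sub>P.P x = (c \<odot>\<^sub>P.P \<one>\<^sub>P.P) \<otimes>\<^sub>P.P x" using P.P_smult_mult[OF P.P_one_closed xP cc] xP by simp
      thus ?thesis using K.I_l_closed[OF that(2)] cc P.P_one_closed by (simp add: P.P_smult_closed)
    qed
    have cuI: "c \<odot>\<^sub>P.P u \<in> Idl\<^bsub>P.P\<^esub> S" by (rule sI[OF I.ideal_axioms uI])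
    have "u \<in> J" using J.I_l_closed[OF F(1)[OF d(1)] mP] by (simp add: u_def)
    hence gJ: "g \<in> J" unfolding g_def a_minus_def
      using less.prems(1) sI[OF J.ideal_axioms] by (intro J.a_closed J.a_inv_closed) auto
    have cuP: "c \<odot>\<^sub>P.P u \<in> carrier P.P" using uP cc by (simp add: P.P_smult_closed)
    have fg: "f = g \<oplus>\<^sub>P.P c \<odot>\<^sub>P.P u"
      using fP cuP by (simp add: g_def a_minus_def abelian_monoid.a_assoc[OF abelian_group.axioms(1)[OF P.P_abelian_group]] abelian_group.l_neg[OF P.P_abelian_group])
    have "g \<in> Idl\<^bsub>P.P\<^esub> S"
    proof (cases "g = \<zero>\<^sub>P.P")
      case False
      have gP: "g \<in> carrier P.P" using gJ JP by blast
      have gz: "f z = g z \<oplus>\<^sub>k c \<otimes>\<^sub>k u z" for z by (subst fg) (simp add: P.P_add P.P_smult)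
      have uz: "u z = (if m \<subseteq># z then F d (z - m) else \<zero>\<^sub>k)" for z
        unfolding u_def by (rule poly_single_mult[OF hP ms])
      have md: "m + d = lead f" using d(2) by (simp add: m_def)
      have gc: "g z \<in> carrier k" for z using P.P_coeff[OF gP] .
      have "u (lead f) = F d d" using uz[of "lead f"] md by (metis add_diff_cancel_left' mset_subset_eq_add_left)
      hence "g (lead f) \<oplus>\<^sub>k f (lead f) = f (lead f)" using gz[of "lead f"] cF by simp
      hence g0: "g (lead f) = \<zero>\<^sub>k" using gc P.P_coeff[OF fP] by (simp add: k.add.r_cancel_one)
      \<comment> \<open>No exponent above \<open>lead f\<close> occurs in \<open>f\<close>, and none
        in the shifted \<open>F d\<close>, because adding \<open>m\<close> preserves the
        order.\<close>
      have "lead g \<le> lead f"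
      proof (rule ccontr)
        assume "\<not> lead g \<le> lead f"
        hence gt: "lead f < lead g" by simp
        hence f0: "f (lead g) = \<zero>\<^sub>k" using lf(2)[of "lead g"] by (auto simp: msupp_def dest: leD)
        have "u (lead g) = \<zero>\<^sub>k"
        proof (cases "m \<subseteq># lead g")
          case True
          have "d < lead g - m" using gt True md by (metis add_less_cancel_left subset_mset.add_diff_inverse)
          hence "F d (lead g - m) = \<zero>\<^sub>k" using ld(2)[of "lead g - m"] by (auto simp: msupp_def dest: leD)
          thus ?thesis using uz by simp
        qed (simp add: uz)
        hence "g (lead g) = \<zero>\<^sub>k" using gz[of "lead g"] f0 cc gc by simp
        thus False using lead(1)[OF gP False] by (simp add: msupp_def)
      qed
      moreover have "lead g \<noteq> lead f" using g0 lead(1)[OF gP False] by (auto simp: msupp_def)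
      ultimately show ?thesis using less.hyps gJ False by simp
    qed simp
    thus ?case using I.a_closed[OF _ cuI] fg by metis
  qed
  hence "J \<subseteq> Idl\<^bsub>P.P\<^esub> S" using I.zero_closed by blast
  moreover have "Idl\<^bsub>P.P\<^esub> S \<subseteq> J" by (rule Pr.genideal_minimal[OF J SJ])
  ultimately show ?thesis using D(1) SP by (intro exI[of _ S]) (auto simp: S_def)
qed

end

text \<open>The polynomial algebra on the generators is Noetherian, so the ideal of relations
  between them is finitely generated.\<close>

lemma finitely_presented_algebraI:
  fixes R :: "('k, 'r, 'd) module_scheme"
  assumes k: "field k" and R: "algebra k R" and fg: "finitely_generated_algebra k R"
  shows "finitely_presented_algebra k R"
proof -
  interpret k: field k by fact
  interpret Rc: cring R by (rule algebra.M_cring[OF R])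
  interpret R: algebra k R by fact
  obtain S where S: "finite S" "S \<subseteq> carrier R" "alg_generated k R S = carrier R"
    using fg by (auto simp: finitely_generated_algebra_def)
  obtain xs where xs: "set xs = S" using finite_list[OF S(1)] by blast
  let ?m = "length xs"
  define P where "P = poly_algebra k {..<?m}"
  interpret P: monoid_algebra_loc k "monomials {..<?m}"
    by (rule monoid_algebra_loc_monomials) (rule k.cring_axioms)
  interpret Pr: ring P unfolding P_def by (rule P.P_ring)
  have aP: "assoc_algebra k P" unfolding P_def by (rule P.assoc_algebra_monoid_algebra)
  interpret Pa: assoc_algebra k P by (rule aP)
  have "\<exists>h\<in>alg_hom k P R. \<forall>v\<in>{..<?m}. h (poly_var k v) = xs ! v"
    unfolding P_def by (rule poly_algebra_lift[OF R]) (use xs S(2) nth_mem in auto)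
  then obtain h where h: "h \<in> alg_hom k P R" and "\<forall>v\<in>{..<?m}. h (poly_var k v) = xs ! v"
    by (elim bexE)
  hence hx: "h (poly_var k v) = xs ! v" if "v < ?m" for v using that by simp
  have hr: "h \<in> ring_hom P R" using h by (simp add: alg_hom_def)
  interpret h: ring_hom_ring P R h by (rule ring_hom_ringI2[OF Pr.ring_axioms Rc.ring_axioms hr])
  define J where "J = a_kernel P R h"
  have J: "ideal J P" unfolding J_def by (rule h.kernel_is_ideal)
  obtain T where T: "finite T" "T \<subseteq> carrier P" "Idl\<^bsub>P\<^esub> T = J"
    using poly_ideal_finitely_generated[OF k J[unfolded P_def]] unfolding P_def by (elim exE conjE)
  have Jh: "x \<in> J \<longleftrightarrow> x \<in> carrier P \<and> h x = \<zero>\<^sub>R" for x unfolding J_def a_kernel_def' by simp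
  have "\<exists>f\<in>alg_hom k (quot_algebra P J) R. \<forall>x\<in>carrier P. f (J +>\<^sub>P x) = h x"
    by (rule quot_algebra_lift[OF aP J R.is_assoc_algebra h]) (simp add: Jh)
  then obtain f where f: "f \<in> alg_hom k (quot_algebra P J) R" and fh: "\<And>x. x \<in> carrier P \<Longrightarrow> f (J +>\<^sub>P x) = h x"
    by blast
  note car = quot_algebra_simps(1)[OF aP J]
  have "inj_on f (carrier (quot_algebra P J))"
  proof (rule inj_onI)
    fix a b assume "a \<in> carrier (quot_algebra P J)" "b \<in> carrier (quot_algebra P J)" and e: "f a = f b"
    then obtain x y where xy: "x \<in> carrier P" "y \<in> carrier P" "a = J +>\<^sub>P x" "b = J +>\<^sub>P y" unfolding car by blast
    have "h x = h y" using e xy fh by metis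
    hence "x \<ominus>\<^sub>P y \<in> J" using xy by (simp add: Jh a_minus_def Rc.r_neg)
    thus "a = b" using quot_algebra_eq[OF aP J xy(1,2)] xy by simp
  qed
  moreover have "f ` carrier (quot_algebra P J) = carrier R"
  proof -
    have "x \<in> h ` carrier P" if "x \<in> alg_generated k R S" for x
      using that
    proof induction
      case zero show ?case by (rule image_eqI[of _ _ "\<zero>\<^sub>P"]) simp_all
    next
      case one show ?case by (rule image_eqI[of _ _ "\<one>\<^sub>P"]) simp_all
    next
      case (incl x)
      then obtain i where "i < ?m" "x = xs ! i" using xs by (metis in_set_conv_nth)
      thus ?case using hx by (intro image_eqI[of _ _ "poly_var k i"]) (auto simp: P_def intro!: poly_var_closed k.cring_axioms)
    next
      case (smult c x)
      then obtain y where "y \<in> carrier P" "x = h y" by blast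
      thus ?case using smult h by (intro image_eqI[of _ _ "c \<odot>\<^sub>P y"]) (auto simp: alg_hom_def)
    next
      case (add x y)
      then obtain a b where "a \<in> carrier P" "x = h a" "b \<in> carrier P" "y = h b" by blast
      thus ?case by (intro image_eqI[of _ _ "a \<oplus>\<^sub>P b"]) auto
    next
      case (mult x y)
      then obtain a b where "a \<in> carrier P" "x = h a" "b \<in> carrier P" "y = h b" by blast
      thus ?case by (intro image_eqI[of _ _ "a \<otimes>\<^sub>P b"]) auto
    qed
    hence "carrier R \<subseteq> h ` carrier P" unfolding S(3)[symmetric] by (rule subsetI)
    moreover have "f ` carrier (quot_algebra P J) = h ` carrier P"
      unfolding car image_image by (rule image_cong) (simp_all add: fh)
    moreover have "h ` carrier P \<subseteq> carrier R" by (rule image_subsetI) simp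
    ultimately show ?thesis by simp
  qed
  ultimately have "bij_betw f (carrier (quot_algebra P J)) (carrier R)" by (simp add: bij_betw_def)
  hence "\<exists>f\<in>alg_hom k (quot_algebra P (Idl\<^bsub>P\<^esub> T)) R. bij_betw f (carrier (quot_algebra P (Idl\<^bsub>P\<^esub> T))) (carrier R)"
    using f T(3) by (intro bexI[of _ f]) simp_all
  hence "finite T \<and> T \<subseteq> carrier P \<and> (\<exists>f\<in>alg_hom k (quot_algebra P (Idl\<^bsub>P\<^esub> T)) R. bij_betw f (carrier (quot_algebra P (Idl\<^bsub>P\<^esub> T))) (carrier R))"
    using T(1,2) by (intro conjI)
  thus ?thesis unfolding finitely_presented_algebra_def Let_def P_def by - (rule exI[of _ ?m], rule exI[of _ T], assumption)
qed

subsection \<open>Generators of the coordinate ring\<close>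

lemma poly_algebra_generated:
  assumes k: "cring k"
  shows "carrier (poly_algebra k V) \<subseteq> alg_generated k (poly_algebra k V) (poly_var k ` V)"
proof
  interpret P: monoid_algebra_loc k "monomials V" by (rule monoid_algebra_loc_monomials[OF k])
  have mono: "msingle k m \<in> alg_generated k P.P (poly_var k ` V)" if "set_mset m \<subseteq> V" for m
    using that
  proof (induction m)
    case empty
    have "\<one>\<^sub>P.P = msingle k {#}" by (simp add: P.P_one) (simp add: monomials_def)
    thus ?case using alg_generated.one[of P.P k] by simp
  next
    case (add v m)
    have c: "m \<in> carrier (monomials V)" "{#v#} \<in> carrier (monomials V)"
      using add.prems by (auto simp: monomials_def)
    have "msingle k (add_mset v m) = poly_var k v \<otimes>\<^sub>P.P msingle k m"
      using P.msingle_mult[OF c(2,1) P.k.one_closed P.k.one_closed] c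
      by (simp add: P.msingle_closed P.G.m_closed) (simp add: monomials_def)
    moreover have "poly_var k v \<in> alg_generated k P.P (poly_var k ` V)"
      using add.prems by (intro alg_generated.incl) auto
    ultimately show ?case using add by (auto intro: alg_generated.mult)
  qed
  fix f assume "f \<in> carrier P.P"
  thus "f \<in> alg_generated k P.P (poly_var k ` V)"
  proof (induction rule: P.P_induct)
    case (single c x)
    hence "set_mset x \<subseteq> V" by (simp add: monomials_def)
    thus ?case using single by (intro alg_generated.smult mono)
  qed (auto intro: alg_generated.intros)
qed

text \<open>\<open>R\<close> is presented with variables for all elements of \<open>A\<close>. The
  relations express the entries of a sum, product or scalar multiple through those of its parts, so
  the entries at a finite set of generators of \<open>A\<close> suffice.\<close>

lemma finitely_generated_rep_coord_ring:
  assumes k: "cring k" and A: "assoc_algebra k A" and fg: "finitely_generated_algebra k A"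
  shows "finitely_generated_algebra k (rep_coord_ring k A n)"
proof -
  define R where "R = rep_coord_ring k A n"
  interpret A: assoc_algebra k A by fact
  have algR: "algebra k R" unfolding R_def by (rule rep_coord_ring_represents(1)[OF k A])
  interpret Rc: cring R by (rule algebra.M_cring[OF algR])
  interpret R: algebra k R by (rule algR)
  have gen: "generic_rep k A n \<in> alg_hom k A (mat_algebra R n)"
    unfolding R_def by (rule rep_coord_ring_represents(2)[OF k A])
  obtain S where S: "finite S" "S \<subseteq> carrier A" "alg_generated k A S = carrier A"
    using fg by (auto simp: finitely_generated_algebra_def)
  define y where "y a i j = generic_rep k A n a (i, j)" for a i j
  define T where "T = (\<lambda>(a, i, j). y a i j) ` (S \<times> {..<n} \<times> {..<n})"
  have yc: "y a i j \<in> carrier R" if "a \<in> carrier A" "i < n" "j < n" for a i j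
    using gen that by (auto simp: y_def alg_hom_def mat_algebra_def ring_hom_def Let_def Pi_iff)
  have y_add: "y (a \<oplus>\<^sub>A b) i j = y a i j \<oplus>\<^sub>R y b i j"
    and y_mult: "y (a \<otimes>\<^sub>A b) i j = (\<Oplus>\<^sub>R l<n. y a i l \<otimes>\<^sub>R y b l j)"
    if "a \<in> carrier A" "b \<in> carrier A" "i < n" "j < n" for a b i j
    using gen that by (auto simp: y_def alg_hom_def mat_algebra_def ring_hom_def Let_def)
  have y_smult: "y (c \<odot>\<^sub>A a) i j = c \<odot>\<^sub>R y a i j"
    if "c \<in> carrier k" "a \<in> carrier A" "i < n" "j < n" for a c i j
    using gen that by (auto simp: y_def alg_hom_def mat_algebra_def Let_def)
  have y_one: "y \<one>\<^sub>A i j = (if i = j then \<one>\<^sub>R else \<zero>\<^sub>R)" if "i < n" "j < n" for i j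
    using gen that by (auto simp: y_def alg_hom_def mat_algebra_def ring_hom_def Let_def)
  have y_zero: "y \<zero>\<^sub>A i j = \<zero>\<^sub>R" if "i < n" "j < n" for i j
    using y_smult[of "\<zero>\<^sub>k" "\<zero>\<^sub>A" i j] that yc by simp
  let ?G = "alg_generated k R T"
  have Gc: "x \<in> carrier R" if "x \<in> ?G" for x
    using that by induction (use S(2) yc in \<open>auto simp: T_def\<close>)
  have Gsum: "(\<Oplus>\<^sub>R l<m. f l) \<in> ?G" if "\<And>l. l < m \<Longrightarrow> f l \<in> ?G" for f and m :: nat
    using that
  proof (induction m)
    case (Suc m)
    thus ?case using Gc by (simp add: lessThan_Suc Pi_iff alg_generated.add)
  qed (simp add: alg_generated.zero)
  have AG: "a \<in> carrier A" if "a \<in> alg_generated k A S" for a using that S(3) by simp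
  have Gy: "\<forall>i<n. \<forall>j<n. y a i j \<in> ?G" if "a \<in> alg_generated k A S" for a
    using that
  proof induction
    case zero thus ?case by (simp add: y_zero alg_generated.zero)
  next
    case one thus ?case by (auto simp: y_one intro: alg_generated.zero alg_generated.one)
  next
    case (incl x) thus ?case by (auto simp: T_def intro!: alg_generated.incl)
  next
    case (smult c x) thus ?case using AG by (auto simp: y_smult intro!: alg_generated.smult)
  next
    case (add x z) thus ?case using AG by (auto simp: y_add intro!: alg_generated.add)
  next
    case (mult x z) thus ?case using AG by (auto simp: y_mult intro!: Gsum alg_generated.mult)
  qed
  let ?V = "carrier A \<times> {..<n} \<times> {..<n}"
  define P where "P = poly_algebra k ?V"
  have algP: "algebra k P" unfolding P_def by (rule algebra_poly_algebra[OF k])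
  interpret Pc: cring P by (rule algebra.M_cring[OF algP])
  interpret P: algebra k P by (rule algP)
  define I where "I = Idl\<^bsub>P\<^esub> (rep_relations k A n)"
  have I: "ideal I P" unfolding I_def P_def
    using rep_relations_closed[OF k A, of n] Pc.genideal_ideal unfolding P_def by blast
  have RQ: "R = quot_algebra P I" by (simp add: R_def rep_coord_ring_def P_def I_def Let_def)
  have yv: "y a i j = I +>\<^sub>P poly_var k (a, i, j)" if "i < n" "j < n" for a i j
    using that by (simp add: y_def generic_rep_def P_def I_def Let_def)
  have "I +>\<^sub>P f \<in> ?G" if "f \<in> alg_generated k P (poly_var k ` ?V)" for f
  proof -
    have vc: "x \<in> carrier P" if "x \<in> alg_generated k P (poly_var k ` ?V)" for x
      using that
    proof induction
      case (incl x) thus ?case unfolding P_def by (auto intro!: poly_var_closed k)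
    qed simp_all
    note qs = quot_algebra_simps[OF P.is_assoc_algebra I] quot_algebra_smult[OF P.is_assoc_algebra I]
    show ?thesis using that
    proof induction
      case zero thus ?case using alg_generated.zero[of R k T] by (simp add: RQ qs)
    next
      case one thus ?case using alg_generated.one[of R k T] by (simp add: RQ qs)
    next
      case (incl x) thus ?case using Gy S(3) yv by auto
    next
      case (smult c x) thus ?case using alg_generated.smult[of c k "I +>\<^sub>P x" R T] vc by (simp add: RQ qs)
    next
      case (add x z) thus ?case using alg_generated.add[of "I +>\<^sub>P x" k R T "I +>\<^sub>P z"] vc by (simp add: RQ qs)
    next
      case (mult x z) thus ?case using alg_generated.mult[of "I +>\<^sub>P x" k R T "I +>\<^sub>P z"] vc by (simp add: RQ qs)
    qed
  qed
  hence "I +>\<^sub>P f \<in> ?G" if "f \<in> carrier P" for f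
    using subsetD[OF poly_algebra_generated[OF k, of ?V]] that unfolding P_def[symmetric] by simp
  hence "(\<lambda>x. I +>\<^sub>P x) ` carrier P \<subseteq> ?G" by (rule image_subsetI)
  moreover have "carrier R = (\<lambda>x. I +>\<^sub>P x) ` carrier P"
    unfolding RQ by (rule quot_algebra_simps(1)[OF P.is_assoc_algebra I])
  ultimately have "carrier R \<subseteq> ?G" by simp
  moreover have "T \<subseteq> carrier R" using S(2) yc by (auto simp: T_def)
  moreover have "finite T" using S(1) by (simp add: T_def)
  ultimately show ?thesis unfolding finitely_generated_algebra_def R_def[symmetric]
    using Gc by (intro exI[of _ T]) auto
qed

subsection \<open>Linear maps over a field\<close>

lemma (in abelian_group) add_eq_imp_minus_eq:
  assumes "a \<in> carrier G" "b \<in> carrier G" "d \<in> carrier G" "e \<in> carrier G" and eq: "a \<oplus> d = b \<oplus> e"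
  shows "a \<ominus> b = e \<ominus> d"
proof -
  have "(a \<ominus> b) \<oplus> (b \<oplus> d) = a \<oplus> d" using assms by (simp add: a_minus_def a_assoc r_neg1)
  also have "\<dots> = e \<oplus> b" using assms by (simp add: a_comm)
  also have "\<dots> = (e \<ominus> d) \<oplus> (d \<oplus> b)" using assms(2-4) by (simp add: a_minus_def a_assoc r_neg1)
  also have "d \<oplus> b = b \<oplus> d" using assms by (simp add: a_comm)
  finally show ?thesis using assms(1-4) add.right_cancel[of "b \<oplus> d" "a \<ominus> b" "e \<ominus> d"] by simp
qed

lemma (in abelian_group) minus_eq_zero_iff:
  "a \<in> carrier G \<Longrightarrow> b \<in> carrier G \<Longrightarrow> a \<ominus> b = \<zero> \<longleftrightarrow> a = b"
proof
  assume ab: "a \<in> carrier G" "b \<in> carrier G" and "a \<ominus> b = \<zero>"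
  moreover have "a = (a \<ominus> b) \<oplus> b" using ab by (simp add: a_minus_def a_assoc l_neg)
  ultimately show "a = b" by simp
qed (simp add: a_minus_def r_neg)

lemma lmod_homD:
  assumes "h \<in> lmod_hom R M N"
  shows "x \<in> carrier M \<Longrightarrow> h x \<in> carrier N"
    and "x \<in> carrier M \<Longrightarrow> y \<in> carrier M \<Longrightarrow> h (x \<oplus>\<^sub>M y) = h x \<oplus>\<^sub>N h y"
    and "r \<in> carrier R \<Longrightarrow> x \<in> carrier M \<Longrightarrow> h (r \<odot>\<^sub>M x) = r \<odot>\<^sub>N h x"
  using assms by (auto simp: lmod_hom_def)

lemma lmod_homI:
  assumes "\<And>x. x \<in> carrier M \<Longrightarrow> h x \<in> carrier N"
    and "\<And>x y. x \<in> carrier M \<Longrightarrow> y \<in> carrier M \<Longrightarrow> h (x \<oplus>\<^sub>M y) = h x \<oplus>\<^sub>N h y"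
    and "\<And>r x. r \<in> carrier R \<Longrightarrow> x \<in> carrier M \<Longrightarrow> h (r \<odot>\<^sub>M x) = r \<odot>\<^sub>N h x"
  shows "h \<in> lmod_hom R M N"
  using assms by (auto simp: lmod_hom_def)

lemma lmod_hom_zero:
  assumes h: "h \<in> lmod_hom R M N" and M: "abelian_group M" and N: "abelian_group N"
  shows "h \<zero>\<^sub>M = \<zero>\<^sub>N"
proof -
  interpret M: abelian_group M by fact
  interpret N: abelian_group N by fact
  have c: "h \<zero>\<^sub>M \<in> carrier N" using lmod_homD(1)[OF h] by simp
  have "h \<zero>\<^sub>M \<oplus>\<^sub>N h \<zero>\<^sub>M = h \<zero>\<^sub>M"
    using lmod_homD(2)[OF h, of "\<zero>\<^sub>M" "\<zero>\<^sub>M"] by simp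
  thus ?thesis using c by (simp add: N.add.r_cancel_one)
qed

lemma lmod_hom_minus:
  assumes h: "h \<in> lmod_hom R M N" and M: "abelian_group M" and N: "abelian_group N"
    and xy: "x \<in> carrier M" "y \<in> carrier M"
  shows "h (x \<ominus>\<^sub>M y) = h x \<ominus>\<^sub>N h y"
proof -
  interpret M: abelian_group M by fact
  interpret N: abelian_group N by fact
  note c = lmod_homD(1)[OF h]
  have "h (x \<ominus>\<^sub>M y) \<oplus>\<^sub>N h y = h x"
    using xy by (subst lmod_homD(2)[OF h, symmetric]) (auto simp: a_minus_def M.a_assoc M.l_neg)
  thus ?thesis using c xy by (metis M.minus_closed N.add.inv_solve_right' a_minus_def)
qed

lemma lmod_hom_finsum:
  assumes h: "h \<in> lmod_hom R M N" and M: "abelian_group M" and N: "abelian_group N"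
    and f: "\<And>i. i \<in> I \<Longrightarrow> f i \<in> carrier M"
  shows "h (\<Oplus>\<^sub>M i\<in>I. f i) = (\<Oplus>\<^sub>N i\<in>I. h (f i))"
proof -
  interpret M: abelian_group M by fact
  interpret N: abelian_group N by fact
  note c = lmod_homD(1)[OF h]
  show ?thesis using f
  proof (induction I rule: infinite_finite_induct)
    case (insert x F)
    thus ?case using c by (simp add: lmod_homD(2)[OF h] Pi_iff)
  qed (use lmod_hom_zero[OF h M N] in auto)
qed

section \<open>Complements of subspaces and generalised inverses\<close>

lemma (in module) submodule_iff:
  "submodule H R M \<longleftrightarrow> H \<subseteq> carrier M \<and> \<zero>\<^sub>M \<in> H \<and> (\<forall>x\<in>H. \<forall>y\<in>H. x \<oplus>\<^sub>M y \<in> H)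
    \<and> (\<forall>c\<in>carrier R. \<forall>x\<in>H. c \<odot>\<^sub>M x \<in> H)" (is "_ \<longleftrightarrow> ?S")
proof
  assume "submodule H R M"
  then interpret H: submodule H R M .
  show ?S using H.subset H.one_closed H.m_closed H.smult_closed by auto
next
  assume H: ?S
  have "\<ominus>\<^sub>M x \<in> H" if "x \<in> H" for x
  proof -
    have "x \<in> carrier M" "(\<ominus> \<one>) \<odot>\<^sub>M x \<in> H" using H that by auto
    thus ?thesis by (simp add: smult_l_minus)
  qed
  thus "submodule H R M" using H
    by (intro submodule.intro submodule_axioms.intro M.add.subgroupI) (auto simp: a_inv_def)
qed

text \<open>By Zorn's lemma some submodule \<open>M\<close> is maximal among those meeting
  \<open>U\<close> only in zero. A vector \<open>w\<close> outside U + M could be adjoined to it: a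
  nonzero element of \<open>U\<close> in the larger submodule would, after division by the
  coefficient of \<open>w\<close>, put \<open>w\<close> into U + M.\<close>

lemma subspace_complement:
  fixes W (structure)
  assumes k: "field k" and W: "module k W" and U: "submodule U k W"
  shows "\<exists>C. submodule C k W \<and> U \<inter> C = {\<zero>} \<and> (\<forall>w\<in>carrier W. \<exists>u\<in>U. \<exists>c\<in>C. w = u \<oplus> c)"
proof -
  interpret k: field k by fact
  interpret W: module k W by fact
  interpret U: submodule U k W by fact
  note sub = W.submodule_iff
  define \<C> where "\<C> = {C. submodule C k W \<and> U \<inter> C \<subseteq> {\<zero>}}"
  have "\<exists>M\<in>\<C>. \<forall>Y\<in>\<C>. M \<subseteq> Y \<longrightarrow> Y = M"
  proof (rule subset_Zorn_nonempty)
    have "{\<zero>} \<in> \<C>" by (auto simp: \<C>_def sub)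
    thus "\<C> \<noteq> {}" by blast
    fix D assume D: "D \<noteq> {}" "subset.chain \<C> D"
    have DC: "\<And>C. C \<in> D \<Longrightarrow> C \<in> \<C>" and ch: "\<And>C C'. C \<in> D \<Longrightarrow> C' \<in> D \<Longrightarrow> C \<subseteq> C' \<or> C' \<subseteq> C"
      using D(2) unfolding subset.chain_def by blast+
    have SD: "submodule (\<Union>D) k W" unfolding sub
    proof (intro conjI ballI)
      show "\<Union>D \<subseteq> carrier W" using DC unfolding \<C>_def sub by blast
      show "\<zero> \<in> \<Union>D" using DC D(1) unfolding \<C>_def sub by blast
      fix x assume "x \<in> \<Union>D"
      then obtain C where C: "C \<in> D" "x \<in> C" by blast
      { fix y assume "y \<in> \<Union>D"
        then obtain C' where C': "C' \<in> D" "y \<in> C'" by blast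
        have "\<exists>E\<in>D. x \<in> E \<and> y \<in> E" using ch[OF C(1) C'(1)] C C' by blast
        then obtain E where E: "E \<in> D" "x \<in> E" "y \<in> E" by blast
        hence "x \<oplus> y \<in> E" using DC[OF E(1)] by (auto simp: \<C>_def sub)
        thus "x \<oplus> y \<in> \<Union>D" using E by blast }
      fix c assume "c \<in> carrier k"
      hence "c \<odot> x \<in> C" using DC[OF C(1)] C by (auto simp: \<C>_def sub)
      thus "c \<odot> x \<in> \<Union>D" using C by blast
    qed
    have "U \<inter> C \<subseteq> {\<zero>}" if "C \<in> D" for C using DC[OF that] by (simp add: \<C>_def)
    hence "U \<inter> \<Union>D \<subseteq> {\<zero>}" by blast
    thus "\<Union>D \<in> \<C>" using SD by (simp add: \<C>_def)
  qed
  then obtain M where M: "M \<in> \<C>" and max: "\<forall>Y\<in>\<C>. M \<subseteq> Y \<longrightarrow> Y = M" by (elim bexE)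
  have Ms: "M \<subseteq> carrier W \<and> \<zero> \<in> M \<and> (\<forall>x\<in>M. \<forall>y\<in>M. x \<oplus> y \<in> M)
      \<and> (\<forall>c\<in>carrier k. \<forall>x\<in>M. c \<odot> x \<in> M)" and MU: "U \<inter> M \<subseteq> {\<zero>}" using M by (auto simp: \<C>_def sub)
  have Us: "U \<subseteq> carrier W \<and> \<zero> \<in> U \<and> (\<forall>x\<in>U. \<forall>y\<in>U. x \<oplus> y \<in> U)
      \<and> (\<forall>c\<in>carrier k. \<forall>x\<in>U. c \<odot> x \<in> U)" using U.submodule_axioms unfolding sub .
  have "\<exists>u\<in>U. \<exists>c\<in>M. w = u \<oplus> c" if w: "w \<in> carrier W" for w
  proof (rule ccontr)
    assume no: "\<not> ?thesis"
    define M' where "M' = {m \<oplus> c \<odot> w | m c. m \<in> M \<and> c \<in> carrier k}"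
    have MW: "m \<in> carrier W" if "m \<in> M" for m using Ms that by blast
    have MM': "M \<subseteq> M'"
    proof
      fix m assume "m \<in> M"
      thus "m \<in> M'" unfolding M'_def using MW w by (intro CollectI exI[of _ m] exI[of _ "\<zero>\<^sub>k"]) simp
    qed
    have wM': "w \<in> M'" unfolding M'_def using Ms w by (intro CollectI exI[of _ "\<zero>"] exI[of _ "\<one>\<^sub>k"]) simp
    have "submodule M' k W" unfolding sub
    proof (intro conjI ballI)
      show "M' \<subseteq> carrier W" using MW w by (auto simp: M'_def)
      show "\<zero> \<in> M'" using MM' Ms by blast
      fix x assume "x \<in> M'"
      then obtain m c where x: "x = m \<oplus> c \<odot> w" "m \<in> M" "c \<in> carrier k" by (auto simp: M'_def)
      { fix y assume "y \<in> M'"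
        then obtain n d where y: "y = n \<oplus> d \<odot> w" "n \<in> M" "d \<in> carrier k" by (auto simp: M'_def)
        have "x \<oplus> y = (m \<oplus> n) \<oplus> (c \<oplus>\<^sub>k d) \<odot> w"
          using x y w MW by (simp add: W.smult_l_distr W.M.add.m_ac)
        moreover have "m \<oplus> n \<in> M" using x y Ms by blast
        ultimately show "x \<oplus> y \<in> M'" unfolding M'_def using x y by blast }
      fix d assume d: "d \<in> carrier k"
      have "d \<odot> x = d \<odot> m \<oplus> (d \<otimes>\<^sub>k c) \<odot> w"
        using x d w MW by (simp add: W.smult_r_distr W.smult_assoc1)
      moreover have "d \<odot> m \<in> M" using x d Ms by blast
      ultimately show "d \<odot> x \<in> M'" unfolding M'_def using x d by blast
    qed
    moreover have "U \<inter> M' \<subseteq> {\<zero>}"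
    proof
      fix u assume u: "u \<in> U \<inter> M'"
      then obtain m c where x: "u = m \<oplus> c \<odot> w" "m \<in> M" "c \<in> carrier k" by (auto simp: M'_def)
      have uW: "u \<in> carrier W" using u Us by blast
      show "u \<in> {\<zero>}"
      proof (cases "c = \<zero>\<^sub>k")
        case True
        hence "u = m" using x MW w by simp
        thus ?thesis using u x MU by blast
      next
        case False
        define d where "d = inv\<^bsub>k\<^esub> c"
        have d: "d \<in> carrier k" "d \<otimes>\<^sub>k c = \<one>\<^sub>k" using False x(3) k.field_Units by (auto simp: d_def)
        have "d \<odot> u = d \<odot> m \<oplus> w"
          using x d w MW by (simp add: W.smult_r_distr flip: W.smult_assoc1)
        hence "w = d \<odot> u \<oplus> (\<ominus>\<^sub>k d) \<odot> m"
          using d x w MW uW by (simp add: W.smult_l_minus W.M.a_assoc W.M.r_neg1 W.M.r_neg2 W.M.a_comm[of w])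
        moreover have "d \<odot> u \<in> U" "(\<ominus>\<^sub>k d) \<odot> m \<in> M" using d u x Us Ms by auto
        ultimately show ?thesis using no by blast
      qed
    qed
    ultimately have "M' \<in> \<C>" by (simp add: \<C>_def)
    hence "w \<in> M" using max MM' wM' by blast
    moreover have "w = \<zero> \<oplus> w" using w by simp
    ultimately show False using no Us by blast
  qed
  moreover have "U \<inter> M = {\<zero>}" using MU Ms Us by blast
  moreover have "submodule M k W" using Ms sub by blast
  ultimately show ?thesis by blast
qed

text \<open>Complements of the kernel and of the image split \<open>f\<close> into an isomorphism
  and zero. This is the source of all linear sections and homotopies over \<open>k\<close>; for
  surjective \<open>f\<close>, the map \<open>g\<close> is a section.\<close>

lemma linear_generalized_inverse:
  fixes Y (structure)
  assumes k: "field k" and W: "module k W" and Y: "module k Y" and f: "f \<in> lmod_hom k W Y"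
  shows "\<exists>g. g \<in> lmod_hom k Y W \<and> (\<forall>w\<in>carrier W. f (g (f w)) = f w)"
proof -
  interpret k: field k by fact
  interpret W: module k W by fact
  interpret Y: module k Y by fact
  note fD = lmod_homD[OF f]
  note f0 = lmod_hom_zero[OF f W.abelian_group_axioms Y.abelian_group_axioms]
  note fm = lmod_hom_minus[OF f W.abelian_group_axioms Y.abelian_group_axioms]
  define N where "N = {w \<in> carrier W. f w = \<zero>}"
  have "submodule N k W"
    unfolding W.submodule_iff by (auto simp: N_def f0 fD)
  from subspace_complement[OF k W this] obtain C where C: "submodule C k W" "N \<inter> C = {\<zero>\<^sub>W}"
    and Cd: "\<forall>w\<in>carrier W. \<exists>u\<in>N. \<exists>c\<in>C. w = u \<oplus>\<^sub>W c" by (elim exE conjE)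
  interpret C: submodule C k W by (rule C(1))
  have CW: "c \<in> carrier W" if "c \<in> C" for c using C.subset that by auto
  define I where "I = f ` carrier W"
  have "submodule I k Y"
    unfolding Y.submodule_iff
  proof (intro conjI ballI)
    show "I \<subseteq> carrier Y" using fD by (auto simp: I_def)
    show "\<zero> \<in> I" using f0 unfolding I_def by (intro image_eqI[of _ _ "\<zero>\<^sub>W"]) simp_all
    fix a assume "a \<in> I"
    then obtain x where x: "x \<in> carrier W" "a = f x" by (auto simp: I_def)
    { fix b assume "b \<in> I"
      then obtain y where y: "y \<in> carrier W" "b = f y" by (auto simp: I_def)
      show "a \<oplus> b \<in> I" using x y fD(2)[OF x(1) y(1)] unfolding I_def
        by (intro image_eqI[of _ _ "x \<oplus>\<^sub>W y"]) simp_all }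
    fix c assume c: "c \<in> carrier k"
    show "c \<odot> a \<in> I" using x c fD(3)[OF c x(1)] unfolding I_def
      by (intro image_eqI[of _ _ "c \<odot>\<^sub>W x"]) simp_all
  qed
  from subspace_complement[OF k Y this] obtain D where D: "submodule D k Y" "I \<inter> D = {\<zero>}"
    and Dd: "\<forall>w\<in>carrier Y. \<exists>u\<in>I. \<exists>c\<in>D. w = u \<oplus> c" by (elim exE conjE)
  interpret D: submodule D k Y by (rule D(1))
  have DY: "c \<in> carrier Y" if "c \<in> D" for c using D.subset that by auto
  have ex: "\<exists>c. c \<in> C \<and> (\<exists>d\<in>D. y = f c \<oplus> d)" if y: "y \<in> carrier Y" for y
  proof -
    obtain w d where w: "w \<in> carrier W" "d \<in> D" "y = f w \<oplus> d" using Dd y by (auto simp: I_def)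
    obtain u c where u: "u \<in> N" "c \<in> C" "w = u \<oplus>\<^sub>W c" using Cd w(1) by blast
    have "f w = f c" using u CW fD by (auto simp: N_def)
    thus ?thesis using w u by auto
  qed
  have uniq: "c = c'" if c: "c \<in> C" "d \<in> D" "c' \<in> C" "d' \<in> D" "f c \<oplus> d = f c' \<oplus> d'" for c c' d d'
  proof -
    have dm: "d' \<ominus> d \<in> D" using D.m_closed[OF c(4) D.m_inv_closed[OF c(2)]] by (simp add: a_minus_def a_inv_def)
    have cm: "c \<ominus>\<^sub>W c' \<in> C" using C.m_closed[OF c(1) C.m_inv_closed[OF c(3)]] by (simp add: a_minus_def a_inv_def)
    have cl: "f c \<in> carrier Y" "f c' \<in> carrier Y" "d \<in> carrier Y" "d' \<in> carrier Y" using c CW DY fD by auto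
    have "f (c \<ominus>\<^sub>W c') = f c \<ominus> f c'" using c CW by (simp add: fm)
    also have "\<dots> = d' \<ominus> d" by (rule Y.M.add_eq_imp_minus_eq[OF cl(1,2,3,4) c(5)])
    finally have e: "f (c \<ominus>\<^sub>W c') = d' \<ominus> d" .
    have "f (c \<ominus>\<^sub>W c') \<in> I" using CW[OF cm] by (simp add: I_def)
    hence "f (c \<ominus>\<^sub>W c') = \<zero>" using dm e D(2) by auto
    hence "c \<ominus>\<^sub>W c' \<in> N \<inter> C" using cm CW by (simp add: N_def)
    hence "c \<ominus>\<^sub>W c' = \<zero>\<^sub>W" using C(2) by simp
    thus ?thesis using CW c by (simp add: W.M.minus_eq_zero_iff)
  qed
  \<comment> \<open>Each \<open>y\<close> is \<open>f c \<oplus> d\<close> with \<open>c\<close> in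
    the complement of the kernel and \<open>d\<close> in the complement of the image;
    \<open>uniq\<close> says that this determines \<open>c\<close>.\<close>
  define g where "g y = (SOME c. c \<in> C \<and> (\<exists>d\<in>D. y = f c \<oplus> d))" for y
  have g01: "g y \<in> C \<and> (\<exists>d\<in>D. y = f (g y) \<oplus> d)" if "y \<in> carrier Y" for y
    unfolding g_def by (rule someI_ex[OF ex[OF that]])
  note g = conjunct1[OF g01] conjunct2[OF g01]
  have geq: "g y = c" if y: "y \<in> carrier Y" and c: "c \<in> C" "d \<in> D" and e: "y = f c \<oplus> d" for y c d
  proof -
    obtain d' where "d' \<in> D" "y = f (g y) \<oplus> d'" using g(2)[OF y] by blast
    thus ?thesis using uniq[OF g(1)[OF y] _ c] e by simp
  qed
  have "g \<in> lmod_hom k Y W"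
  proof (rule lmod_homI)
    fix y assume y: "y \<in> carrier Y"
    show "g y \<in> carrier W" using g(1)[OF y] CW by blast
    obtain d where d: "d \<in> D" "y = f (g y) \<oplus> d" using g(2)[OF y] by blast
    { fix z assume z: "z \<in> carrier Y"
      obtain e where e: "e \<in> D" "z = f (g z) \<oplus> e" using g(2)[OF z] by blast
      note cl = CW[OF g(1)[OF y]] CW[OF g(1)[OF z]] DY[OF d(1)] DY[OF e(1)]
      have eq: "y \<oplus> z = f (g y \<oplus>\<^sub>W g z) \<oplus> (d \<oplus> e)"
        using cl fD by (subst d(2), subst e(2)) (simp add: Y.M.a_ac)
      show "g (y \<oplus> z) = g y \<oplus>\<^sub>W g z"
        using C.m_closed[OF g(1)[OF y] g(1)[OF z]] D.m_closed[OF d(1) e(1)] Y.M.a_closed[OF y z]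
        by (intro geq[OF _ _ _ eq]) simp_all }
    fix c assume c: "c \<in> carrier k"
    note cl = CW[OF g(1)[OF y]] DY[OF d(1)]
    have eq: "c \<odot> y = f (c \<odot>\<^sub>W g y) \<oplus> c \<odot> d"
      using cl fD c by (subst d(2)) (simp add: Y.smult_r_distr)
    show "g (c \<odot> y) = c \<odot>\<^sub>W g y"
      using C.smult_closed[OF c g(1)[OF y]] D.smult_closed[OF c d(1)] Y.smult_closed[OF c y] by (intro geq[OF _ _ _ eq])
  qed
  moreover have "f (g (f w)) = f w" if w: "w \<in> carrier W" for w
  proof -
    have y: "f w \<in> carrier Y" using w fD by simp
    obtain d where d: "d \<in> D" "f w = f (g (f w)) \<oplus> d" using g(2)[OF y] by blast
    have gw: "g (f w) \<in> carrier W" using g(1)[OF y] CW by blast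
    have "f (w \<ominus>\<^sub>W g (f w)) = f w \<ominus> f (g (f w))" using w gw by (simp add: fm)
    also have "\<dots> = d" using d(2) DY[OF d(1)] fD(1)[OF gw] y
      by (metis Y.M.a_comm Y.M.add.inv_solve_right a_minus_def)
    finally have "d \<in> I" using w gw unfolding I_def by (metis W.M.minus_closed imageI)
    hence "d = \<zero>" using d(1) D(2) by auto
    thus ?thesis using d(2) fD(1)[OF gw] by simp
  qed
  ultimately show ?thesis by (intro exI[of _ g]) simp
qed


subsection \<open>Tensor products and enveloping algebras\<close>

context monoid_algebra_loc
begin

text \<open>As a k-module the monoid algebra is free on \<open>G\<close>. This linear form of the
  universal property is the one that applies to cochains, which are not multiplicative.\<close>

lemma linear_lift:
  fixes N :: "('k, 'n, 'e) module_scheme"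
  assumes N: "module k N" and ph: "\<And>x. x \<in> carrier G \<Longrightarrow> ph x \<in> carrier N"
  shows "\<exists>h. h \<in> lmod_hom k P N \<and> (\<forall>x\<in>carrier G. h (msingle k x) = ph x)"
proof -
  interpret N: module k N by fact
  define E where "E f = finsum N (\<lambda>x. f x \<odot>\<^sub>N ph x) (msupp k f)" for f
  have E: "E f = finsum N (\<lambda>x. f x \<odot>\<^sub>N ph x) S"
    if f: "f \<in> carrier P" and S: "finite S" "msupp k f \<subseteq> S" "S \<subseteq> carrier G" for f S
    unfolding E_def
  proof (rule N.M.add.finprod_mono_neutral_cong_left)
    show "\<And>i. i \<in> S - msupp k f \<Longrightarrow> f i \<odot>\<^sub>N ph i = \<zero>\<^sub>N"
      using ph S by (auto simp: msupp_def subset_iff)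
  qed (use that ph in \<open>auto simp: P_coeff intro!: N.smult_closed\<close>)
  have closed: "E f \<in> carrier N" if "f \<in> carrier P" for f
    unfolding E_def using that ph by (intro N.M.add.finprod_closed) (auto simp: P_carrier)
  have add: "E (f \<oplus>\<^sub>P g) = E f \<oplus>\<^sub>N E g" if f: "f \<in> carrier P" and g: "g \<in> carrier P" for f g
  proof -
    let ?S = "msupp k f \<union> msupp k g"
    have S: "finite ?S" "?S \<subseteq> carrier G" using f g by (auto simp: P_carrier)
    have "E (f \<oplus>\<^sub>P g) = finsum N (\<lambda>x. f x \<odot>\<^sub>N ph x \<oplus>\<^sub>N g x \<odot>\<^sub>N ph x) ?S"
      unfolding E[OF P_add_closed[OF f g] S(1) msupp_add[OF f g] S(2)]
      using f g S ph
      by (intro N.M.add.finprod_cong') (auto simp: P_add N.smult_l_distr P_coeff Pi_iff subset_iff)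
    also have "\<dots> = E f \<oplus>\<^sub>N E g"
      unfolding E[OF f S(1) Un_upper1 S(2)] E[OF g S(1) Un_upper2 S(2)]
      using f g S ph by (intro N.M.add.finprod_multf) (auto simp: P_coeff Pi_iff subset_iff)
    finally show ?thesis .
  qed
  have smult: "E (c \<odot>\<^sub>P f) = c \<odot>\<^sub>N E f" if c: "c \<in> carrier k" and f: "f \<in> carrier P" for c f
  proof -
    have S: "finite (msupp k f)" "msupp k f \<subseteq> carrier G" using f by (auto simp: P_carrier)
    have "msupp k (c \<odot>\<^sub>P f) \<subseteq> msupp k f" using c f by (auto simp: msupp_def P_smult)
    hence "E (c \<odot>\<^sub>P f) = finsum N (\<lambda>x. (c \<otimes>\<^sub>k f x) \<odot>\<^sub>N ph x) (msupp k f)"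
      using E[OF P_smult_closed[OF c f] S(1) _ S(2)] by (simp add: P_smult)
    also have "\<dots> = finsum N (\<lambda>x. c \<odot>\<^sub>N (f x \<odot>\<^sub>N ph x)) (msupp k f)"
      using S c f ph by (intro N.M.add.finprod_cong') (auto simp: P_coeff N.smult_assoc1 subset_iff intro!: N.smult_closed)
    also have "\<dots> = c \<odot>\<^sub>N E f" unfolding E_def
      using S c f ph by (intro N.finsum_smult_ldistr[symmetric]) (auto simp: P_coeff subset_iff intro!: N.smult_closed)
    finally show ?thesis .
  qed
  have "E (msingle k x) = ph x" if x: "x \<in> carrier G" for x
  proof -
    have "E (msingle k x) = finsum N (\<lambda>y. msingle k x y \<odot>\<^sub>N ph y) {x}"
      using x by (intro E msingle_closed) (auto simp: msupp_def msingle_def)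
    thus ?thesis using ph[OF x] by (simp add: msingle_def)
  qed
  moreover have "E \<in> lmod_hom k P N" by (rule lmod_homI) (simp_all add: closed add smult)
  ultimately show ?thesis by (intro exI[of _ E]) simp
qed

end

lemma quot_algebra_linear_lift:
  fixes N :: "('k, 'n, 'e) module_scheme"
  assumes A: "assoc_algebra k A" and I: "ideal I A" and N: "module k N"
    and h: "h \<in> lmod_hom k A N" and h0: "\<And>x. x \<in> I \<Longrightarrow> h x = \<zero>\<^sub>N"
  shows "\<exists>g. g \<in> lmod_hom k (quot_algebra A I) N \<and> (\<forall>x\<in>carrier A. g (I +>\<^sub>A x) = h x)"
proof -
  interpret A: assoc_algebra k A by fact
  interpret I: ideal I A by fact
  interpret N: module k N by fact
  note hD = lmod_homD[OF h]
  define g where "g Y = h (SOME x. x \<in> Y)" for Y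
  have g: "g (I +>\<^sub>A x) = h x" if x: "x \<in> carrier A" for x
  proof -
    have "(SOME y. y \<in> I +>\<^sub>A x) \<in> I +>\<^sub>A x" using I.a_rcos_self[OF x] by (rule someI)
    then obtain i where i: "i \<in> I" "(SOME y. y \<in> I +>\<^sub>A x) = i \<oplus>\<^sub>A x" by (auto simp: a_r_coset_def')
    hence "i \<in> carrier A" using I.a_subset by auto
    thus ?thesis unfolding g_def i(2) using x h0[OF i(1)] hD by simp
  qed
  note qs = quot_algebra_simps[OF A I] quot_algebra_smult[OF A I]
  have "g \<in> lmod_hom k (quot_algebra A I) N"
  proof (rule lmod_homI)
    fix Y assume "Y \<in> carrier (quot_algebra A I)"
    then obtain x where x: "x \<in> carrier A" "Y = I +>\<^sub>A x" unfolding qs by blast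
    show "g Y \<in> carrier N" using x g hD by simp
    { fix Z assume "Z \<in> carrier (quot_algebra A I)"
      then obtain z where z: "z \<in> carrier A" "Z = I +>\<^sub>A z" unfolding qs by blast
      show "g (Y \<oplus>\<^bsub>quot_algebra A I\<^esub> Z) = g Y \<oplus>\<^sub>N g Z" using x z g hD by (simp add: qs) }
    fix c assume "c \<in> carrier k"
    thus "g (c \<odot>\<^bsub>quot_algebra A I\<^esub> Y) = c \<odot>\<^sub>N g Y" using x g hD by (simp add: qs)
  qed
  thus ?thesis using g by (intro exI[of _ g]) simp
qed

section \<open>Tensor products of algebras: universal property and pure tensors\<close>

locale tensor_loc = A?: assoc_algebra k A + B?: assoc_algebra k B
  for k :: "('k, 'c) ring_scheme" and A :: "('k, 'a, 'd) module_scheme" and B :: "('k, 'b, 'e) module_scheme"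
begin

sublocale P: monoid_algebra_loc k "A \<times>\<times> B"
  by (rule monoid_algebra_loc_DirProd[OF A.assoc_algebra_axioms B.assoc_algebra_axioms])

abbreviation "I \<equiv> Idl\<^bsub>P.P\<^esub> (tensor_relations k A B)"
abbreviation "t a b \<equiv> msingle k (a, b)"

lemma rel: "tensor_relations k A B \<subseteq> carrier P.P"
  by (rule tensor_relations_closed[OF A.assoc_algebra_axioms B.assoc_algebra_axioms])

lemma I_ideal: "ideal I P.P" by (rule ring.genideal_ideal[OF P.P_ring rel])

lemma t_closed: "a \<in> carrier A \<Longrightarrow> b \<in> carrier B \<Longrightarrow> t a b \<in> carrier P.P"
  by (intro P.msingle_closed) (simp add: DirProd_def)

lemma t_mult:
  assumes "a \<in> carrier A" "b \<in> carrier B" "a' \<in> carrier A" "b' \<in> carrier B"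
  shows "t a b \<otimes>\<^sub>P.P t a' b' = t (a \<otimes>\<^sub>A a') (b \<otimes>\<^sub>B b')"
proof -
  have c: "(a, b) \<in> carrier (A \<times>\<times> B)" "(a', b') \<in> carrier (A \<times>\<times> B)" using assms by (auto simp: DirProd_def)
  have "(a, b) \<otimes>\<^bsub>A \<times>\<times> B\<^esub> (a', b') = (a \<otimes>\<^sub>A a', b \<otimes>\<^sub>B b')" by (simp add: DirProd_def)
  thus ?thesis using P.msingle_mult[OF c A.R.one_closed A.R.one_closed] assms
    by (simp add: t_closed)
qed

text \<open>The tensor product is formed modulo the ideal generated by the bilinearity relations, so
  the linear extension \<open>h\<close> of \<open>bt\<close> has to be shown to vanish on this ideal
  and not merely on the relations.\<close>

lemma bilinear_lift:
  fixes N :: "('k, 'n, 'f) module_scheme"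
  assumes N: "module k N"
    and bt: "\<And>a b. a \<in> carrier A \<Longrightarrow> b \<in> carrier B \<Longrightarrow> bt a b \<in> carrier N"
    and btl: "\<And>a a' b. a \<in> carrier A \<Longrightarrow> a' \<in> carrier A \<Longrightarrow> b \<in> carrier B \<Longrightarrow> bt (a \<oplus>\<^sub>A a') b = bt a b \<oplus>\<^sub>N bt a' b"
    and btr: "\<And>a b b'. a \<in> carrier A \<Longrightarrow> b \<in> carrier B \<Longrightarrow> b' \<in> carrier B \<Longrightarrow> bt a (b \<oplus>\<^sub>B b') = bt a b \<oplus>\<^sub>N bt a b'"
    and btsl: "\<And>c a b. c \<in> carrier k \<Longrightarrow> a \<in> carrier A \<Longrightarrow> b \<in> carrier B \<Longrightarrow> bt (c \<odot>\<^sub>A a) b = c \<odot>\<^sub>N bt a b"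
    and btsr: "\<And>c a b. c \<in> carrier k \<Longrightarrow> a \<in> carrier A \<Longrightarrow> b \<in> carrier B \<Longrightarrow> bt a (c \<odot>\<^sub>B b) = c \<odot>\<^sub>N bt a b"
  shows "\<exists>h. h \<in> lmod_hom k (tensor_algebra k A B) N \<and>
    (\<forall>a\<in>carrier A. \<forall>b\<in>carrier B. h (tensor_pure k A B a b) = bt a b)"
proof -
  interpret N: module k N by fact
  interpret Pr: ring P.P by (rule P.P_ring)
  have "\<exists>h. h \<in> lmod_hom k P.P N \<and> (\<forall>x\<in>carrier (A \<times>\<times> B). h (msingle k x) = bt (fst x) (snd x))"
    by (rule P.linear_lift[OF N]) (use bt in \<open>auto simp: DirProd_def\<close>)
  then obtain h where h: "h \<in> lmod_hom k P.P N"
    and h1: "\<forall>x\<in>carrier (A \<times>\<times> B). h (msingle k x) = bt (fst x) (snd x)" by (elim exE conjE)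
  have ht: "h (t a b) = bt a b" if "a \<in> carrier A" "b \<in> carrier B" for a b
    using bspec[OF h1, of "(a, b)"] that by (simp add: DirProd_def)
  note hD = lmod_homD[OF h]
  note h0 = lmod_hom_zero[OF h P.P_abelian_group N.abelian_group_axioms]
  note hm = lmod_hom_minus[OF h P.P_abelian_group N.abelian_group_axioms]
  have ab: "abelian_group P.P" by (rule P.P_abelian_group)
  \<comment> \<open>\<open>Z\<close> consists of the \<open>f\<close> all of whose translates by
    symbols on both sides are killed by \<open>h\<close>. It is an ideal; it contains the relations
    because a translate of a relation is a relation of the same kind; and with units as symbols it
    yields \<open>hI\<close>.\<close>
  define Z where "Z = {f \<in> carrier P.P. \<forall>a\<in>carrier A. \<forall>b\<in>carrier B. \<forall>a'\<in>carrier A. \<forall>b'\<in>carrier B.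
    h (t a b \<otimes>\<^sub>P.P f \<otimes>\<^sub>P.P t a' b') = \<zero>\<^sub>N}"
  have ZD: "h (t a b \<otimes>\<^sub>P.P f \<otimes>\<^sub>P.P t a' b') = \<zero>\<^sub>N"
    if "f \<in> Z" "a \<in> carrier A" "b \<in> carrier B" "a' \<in> carrier A" "b' \<in> carrier B" for f a b a' b'
    using that by (simp add: Z_def)
  have Zc: "f \<in> carrier P.P" if "f \<in> Z" for f using that by (simp add: Z_def)
  have Zadd: "f \<oplus>\<^sub>P.P g \<in> Z" if "f \<in> Z" "g \<in> Z" for f g
    using that Zc ZD unfolding Z_def mem_Collect_eq
    by (intro conjI ballI) (simp_all add: P.P_simps t_closed hD)
  have Zs: "c \<odot>\<^sub>P.P f \<in> Z" if "f \<in> Z" "c \<in> carrier k" for c f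
    using that Zc ZD unfolding Z_def mem_Collect_eq
    by (intro conjI ballI) (simp_all add: P.P_simps P.P_smult_mult t_closed hD)
  have Z0: "\<zero>\<^sub>P.P \<in> Z" unfolding Z_def mem_Collect_eq
    by (intro conjI ballI) (simp_all add: P.P_simps t_closed h0)
  have subm: "submodule Z k P.P"
    unfolding P.Pm.submodule_iff using Z0 Zadd Zs Zc by blast
  have tcar: "\<exists>a b. x = (a, b) \<and> a \<in> carrier A \<and> b \<in> carrier B" if "x \<in> carrier (A \<times>\<times> B)" for x
    using that by (auto simp: DirProd_def)
  have Zl: "g \<otimes>\<^sub>P.P f \<in> Z" if f: "f \<in> Z" and g: "g \<in> carrier P.P" for f g
    using g
  proof (induction rule: P.P_induct)
    case (single c x)
    obtain a b where x: "x = (a, b)" "a \<in> carrier A" "b \<in> carrier B" using tcar[OF single(2)] by blast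
    have "t a b \<otimes>\<^sub>P.P f \<in> Z" using Zc[OF f] x ZD[OF f] unfolding Z_def mem_Collect_eq
      by (intro conjI ballI) (simp_all add: P.P_simps t_closed t_mult flip: P.P_assoc)
    thus ?case using Zs[of "t a b \<otimes>\<^sub>P.P f" c] single x Zc[OF f] by (simp add: P.P_smult_mult t_closed)
  qed (use Zadd Z0 Zc[OF f] in \<open>simp_all add: P.P_simps\<close>)
  have Zr: "f \<otimes>\<^sub>P.P g \<in> Z" if f: "f \<in> Z" and g: "g \<in> carrier P.P" for f g
    using g
  proof (induction rule: P.P_induct)
    case (single c x)
    obtain a b where x: "x = (a, b)" "a \<in> carrier A" "b \<in> carrier B" using tcar[OF single(2)] by blast
    have "f \<otimes>\<^sub>P.P t a b \<in> Z" using Zc[OF f] x ZD[OF f] unfolding Z_def mem_Collect_eq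
      by (intro conjI ballI) (simp_all add: P.P_simps t_closed t_mult P.P_assoc)
    thus ?case using Zs[of "f \<otimes>\<^sub>P.P t a b" c] single x Zc[OF f] by (simp add: P.P_smult_mult t_closed)
  qed (use Zadd Z0 Zc[OF f] in \<open>simp_all add: P.P_simps\<close>)
  have Zi: "ideal Z P.P"
    using Zl Zr subm by (intro idealI P.P_ring) (auto simp: submodule_def)
  have mm: "t x y \<otimes>\<^sub>P.P (u \<ominus>\<^sub>P.P v) \<otimes>\<^sub>P.P t x' y' =
     (t x y \<otimes>\<^sub>P.P u \<otimes>\<^sub>P.P t x' y') \<ominus>\<^sub>P.P (t x y \<otimes>\<^sub>P.P v \<otimes>\<^sub>P.P t x' y')"
    if "u \<in> carrier P.P" "v \<in> carrier P.P" "x \<in> carrier A" "y \<in> carrier B" "x' \<in> carrier A" "y' \<in> carrier B" for x y u v x' y'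
    using that by (simp add: a_minus_def P.P_simps t_closed Pr.l_minus Pr.r_minus)
  have Zrel: "u \<ominus>\<^sub>P.P v \<in> Z" if uv: "u \<in> carrier P.P" "v \<in> carrier P.P" and
    e: "\<And>x y x' y'. x \<in> carrier A \<Longrightarrow> y \<in> carrier B \<Longrightarrow> x' \<in> carrier A \<Longrightarrow> y' \<in> carrier B \<Longrightarrow>
      h (t x y \<otimes>\<^sub>P.P u \<otimes>\<^sub>P.P t x' y') = h (t x y \<otimes>\<^sub>P.P v \<otimes>\<^sub>P.P t x' y')" for u v
    unfolding Z_def mem_Collect_eq
    using uv by (intro conjI ballI) (simp_all add: mm hm e P.P_simps t_closed hD N.M.minus_eq_zero_iff)
  have relZ: "tensor_relations k A B \<subseteq> Z"
    unfolding tensor_relations_def Let_def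
    by (intro Un_least subsetI; elim CollectE exE conjE; hypsubst; intro Zrel)
      (simp_all add: P.P_simps t_closed t_mult P.P_smult_mult hD ht btl btr btsl btsr
        A.l_distr A.r_distr B.l_distr B.r_distr A.smult_assoc_l A.smult_assoc_r B.smult_assoc_l B.smult_assoc_r)
  have "I \<subseteq> Z" by (rule Pr.genideal_minimal[OF Zi relZ])
  have hI: "h f = \<zero>\<^sub>N" if "f \<in> I" for f
  proof -
    have fZ: "f \<in> Z" using that \<open>I \<subseteq> Z\<close> by blast
    have one: "t \<one>\<^sub>A \<one>\<^sub>B = \<one>\<^sub>P.P" by (simp add: P.P_one)
    show ?thesis using ZD[OF fZ, of "\<one>\<^sub>A" "\<one>\<^sub>B" "\<one>\<^sub>A" "\<one>\<^sub>B"] Zc[OF fZ] by (simp add: one P.P_one_mult)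
  qed
  have "\<exists>g. g \<in> lmod_hom k (quot_algebra P.P I) N \<and> (\<forall>x\<in>carrier P.P. g (I +>\<^sub>P.P x) = h x)"
    by (rule quot_algebra_linear_lift[OF P.assoc_algebra_monoid_algebra I_ideal N h]) (rule hI)
  then obtain g where g: "g \<in> lmod_hom k (quot_algebra P.P I) N" "\<forall>x\<in>carrier P.P. g (I +>\<^sub>P.P x) = h x"
    by (elim exE conjE)
  have "g (tensor_pure k A B a b) = bt a b" if "a \<in> carrier A" "b \<in> carrier B" for a b
    using bspec[OF g(2) t_closed[OF that]] ht[OF that] by (simp add: tensor_pure_def Let_def)
  thus ?thesis using g(1) by (intro exI[of _ g]) (simp add: tensor_algebra_def Let_def)
qed

abbreviation "T \<equiv> tensor_algebra k A B"
abbreviation "pure \<equiv> tensor_pure k A B"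

lemma T_eq: "T = quot_algebra P.P I" by (simp add: tensor_algebra_def Let_def)

lemma pure_eq: "pure a b = I +>\<^sub>P.P t a b" by (simp add: tensor_pure_def Let_def)

lemmas T_simps = quot_algebra_simps[OF P.assoc_algebra_monoid_algebra I_ideal, folded T_eq]
  quot_algebra_smult[OF P.assoc_algebra_monoid_algebra I_ideal, folded T_eq]

lemma pure_closed: "a \<in> carrier A \<Longrightarrow> b \<in> carrier B \<Longrightarrow> pure a b \<in> carrier T"
  unfolding pure_eq T_simps by (intro imageI t_closed)

lemma T_eqI:
  assumes "u \<in> carrier P.P" "v \<in> carrier P.P" "u \<ominus>\<^sub>P.P v \<in> tensor_relations k A B"
  shows "I +>\<^sub>P.P u = I +>\<^sub>P.P v"
proof -
  interpret Pr: ring P.P by (rule P.P_ring)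
  show ?thesis
    using assms Pr.genideal_self[OF rel] by (intro quot_algebra_eq[OF P.assoc_algebra_monoid_algebra I_ideal]) auto
qed

lemma pure_add_l: "a \<in> carrier A \<Longrightarrow> a' \<in> carrier A \<Longrightarrow> b \<in> carrier B \<Longrightarrow> pure (a \<oplus>\<^sub>A a') b = pure a b \<oplus>\<^sub>T pure a' b"
  unfolding pure_eq by (simp add: T_simps t_closed, rule T_eqI) (auto simp: t_closed P.P_simps tensor_relations_def Let_def)

lemma pure_add_r: "a \<in> carrier A \<Longrightarrow> b \<in> carrier B \<Longrightarrow> b' \<in> carrier B \<Longrightarrow> pure a (b \<oplus>\<^sub>B b') = pure a b \<oplus>\<^sub>T pure a b'"
  unfolding pure_eq by (simp add: T_simps t_closed, rule T_eqI) (auto simp: t_closed P.P_simps tensor_relations_def Let_def)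

lemma pure_smult_l: "c \<in> carrier k \<Longrightarrow> a \<in> carrier A \<Longrightarrow> b \<in> carrier B \<Longrightarrow> pure (c \<odot>\<^sub>A a) b = c \<odot>\<^sub>T pure a b"
  unfolding pure_eq by (simp add: T_simps t_closed, rule T_eqI) (auto simp: t_closed P.P_simps tensor_relations_def Let_def)

lemma pure_smult_r: "c \<in> carrier k \<Longrightarrow> a \<in> carrier A \<Longrightarrow> b \<in> carrier B \<Longrightarrow> pure a (c \<odot>\<^sub>B b) = c \<odot>\<^sub>T pure a b"
  unfolding pure_eq by (simp add: T_simps t_closed, rule T_eqI) (auto simp: t_closed P.P_simps tensor_relations_def Let_def)

lemma pure_mult:
  assumes "a \<in> carrier A" "b \<in> carrier B" "a' \<in> carrier A" "b' \<in> carrier B"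
  shows "pure a b \<otimes>\<^sub>T pure a' b' = pure (a \<otimes>\<^sub>A a') (b \<otimes>\<^sub>B b')"
  unfolding pure_eq using assms by (simp add: T_simps t_closed t_mult)

lemma pure_one: "\<one>\<^sub>T = pure \<one>\<^sub>A \<one>\<^sub>B"
  unfolding pure_eq T_simps by (simp add: P.P_one)

text \<open>Scalars are absorbed into the left factor, so sums of pure tensors already exhaust the
  algebra.\<close>

lemma T_induct:
  assumes e: "e \<in> carrier T" and z: "Q \<zero>\<^sub>T" and p: "\<And>a b. a \<in> carrier A \<Longrightarrow> b \<in> carrier B \<Longrightarrow> Q (pure a b)"
    and add: "\<And>x y. x \<in> carrier T \<Longrightarrow> y \<in> carrier T \<Longrightarrow> Q x \<Longrightarrow> Q y \<Longrightarrow> Q (x \<oplus>\<^sub>T y)"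
  shows "Q e"
proof -
  obtain f where f: "f \<in> carrier P.P" and e: "e = I +>\<^sub>P.P f" using e unfolding T_simps by blast
  have "Q (I +>\<^sub>P.P f)" using f
  proof (induction rule: P.P_induct)
    case zero thus ?case using z by (simp add: T_simps)
  next
    case (single c x)
    then obtain a b where x: "x = (a, b)" "a \<in> carrier A" "b \<in> carrier B" by (auto simp: DirProd_def)
    have "I +>\<^sub>P.P (c \<odot>\<^sub>P.P msingle k x) = pure (c \<odot>\<^sub>A a) b"
      using x single by (simp add: pure_smult_l) (simp add: pure_eq T_simps t_closed)
    thus ?case using p x single by simp
  next
    case (add f g)
    thus ?case using assms(4)[of "I +>\<^sub>P.P f" "I +>\<^sub>P.P g"] by (simp add: T_simps)
  qed
  thus ?thesis using e by simp
qed

end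

text \<open>\<open>E\<close> stands for the enveloping algebra and \<open>pure a b\<close> for a
  \<otimes> b, hiding the representation by cosets. The second factor is opposite, hence
  \<open>b' \<otimes>\<^sub>A b\<close> in \<open>pure_mult\<close>. \<open>E_induct\<close> says
  that pure tensors span; the universal property is kept apart in
  \<open>bilinear_lifts\<close>.\<close>

locale enveloping = A: assoc_algebra k A + E: assoc_algebra k E
  for k :: "'k ring" and A :: "('k, 'a) module" and E :: "('k, 'e) module" (structure) +
  fixes pure :: "'a \<Rightarrow> 'a \<Rightarrow> 'e"
  assumes field_k: "field k"
    and pure_closed: "\<lbrakk>a \<in> carrier A; b \<in> carrier A\<rbrakk> \<Longrightarrow> pure a b \<in> carrier E"
    and pure_add_l: "\<lbrakk>a \<in> carrier A; a' \<in> carrier A; b \<in> carrier A\<rbrakk> \<Longrightarrow> pure (a \<oplus>\<^sub>A a') b = pure a b \<oplus> pure a' b"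
    and pure_add_r: "\<lbrakk>a \<in> carrier A; b \<in> carrier A; b' \<in> carrier A\<rbrakk> \<Longrightarrow> pure a (b \<oplus>\<^sub>A b') = pure a b \<oplus> pure a b'"
    and pure_smult_l: "\<lbrakk>c \<in> carrier k; a \<in> carrier A; b \<in> carrier A\<rbrakk> \<Longrightarrow> pure (c \<odot>\<^sub>A a) b = c \<odot> pure a b"
    and pure_smult_r: "\<lbrakk>c \<in> carrier k; a \<in> carrier A; b \<in> carrier A\<rbrakk> \<Longrightarrow> pure a (c \<odot>\<^sub>A b) = c \<odot> pure a b"
    and pure_mult: "\<lbrakk>a \<in> carrier A; b \<in> carrier A; a' \<in> carrier A; b' \<in> carrier A\<rbrakk> \<Longrightarrow>
      pure a b \<otimes> pure a' b' = pure (a \<otimes>\<^sub>A a') (b' \<otimes>\<^sub>A b)"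
    and pure_one: "pure \<one>\<^sub>A \<one>\<^sub>A = \<one>"
    and E_induct: "\<lbrakk>e \<in> carrier E; Q \<zero>; \<And>a b. \<lbrakk>a \<in> carrier A; b \<in> carrier A\<rbrakk> \<Longrightarrow> Q (pure a b);
      \<And>x y. \<lbrakk>x \<in> carrier E; y \<in> carrier E; Q x; Q y\<rbrakk> \<Longrightarrow> Q (x \<oplus> y)\<rbrakk> \<Longrightarrow> Q e"

definition bilinear_on ::
  "('k, 'c) ring_scheme \<Rightarrow> ('k, 'a, 'd) module_scheme \<Rightarrow> ('k, 'n, 'f) module_scheme \<Rightarrow> ('a \<Rightarrow> 'a \<Rightarrow> 'n) \<Rightarrow> bool"
  where "bilinear_on k A N bt \<longleftrightarrow>
    (\<forall>a\<in>carrier A. \<forall>b\<in>carrier A. bt a b \<in> carrier N) \<and>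
    (\<forall>a\<in>carrier A. \<forall>a'\<in>carrier A. \<forall>b\<in>carrier A. bt (a \<oplus>\<^sub>A a') b = bt a b \<oplus>\<^sub>N bt a' b) \<and>
    (\<forall>a\<in>carrier A. \<forall>b\<in>carrier A. \<forall>b'\<in>carrier A. bt a (b \<oplus>\<^sub>A b') = bt a b \<oplus>\<^sub>N bt a b') \<and>
    (\<forall>c\<in>carrier k. \<forall>a\<in>carrier A. \<forall>b\<in>carrier A. bt (c \<odot>\<^sub>A a) b = c \<odot>\<^sub>N bt a b) \<and>
    (\<forall>c\<in>carrier k. \<forall>a\<in>carrier A. \<forall>b\<in>carrier A. bt a (c \<odot>\<^sub>A b) = c \<odot>\<^sub>N bt a b)"

text \<open>The universal property of the tensor product for a single target. A locale assumption
  could not state it for all targets together, because they range over different types.\<close>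

definition bilinear_lifts ::
  "('k, 'c) ring_scheme \<Rightarrow> ('k, 'a, 'd) module_scheme \<Rightarrow> ('k, 'e, 'g) module_scheme \<Rightarrow> ('a \<Rightarrow> 'a \<Rightarrow> 'e)
    \<Rightarrow> ('k, 'n, 'f) module_scheme \<Rightarrow> bool"
  where "bilinear_lifts k A E pure N \<longleftrightarrow> (\<forall>bt. bilinear_on k A N bt \<longrightarrow>
    (\<exists>h. h \<in> lmod_hom k E N \<and> (\<forall>a\<in>carrier A. \<forall>b\<in>carrier A. h (pure a b) = bt a b)))"

lemma opposite_algebra_simps:
  "carrier (opposite_algebra A) = carrier A" "\<zero>\<^bsub>opposite_algebra A\<^esub> = \<zero>\<^sub>A"
  "\<one>\<^bsub>opposite_algebra A\<^esub> = \<one>\<^sub>A" "x \<oplus>\<^bsub>opposite_algebra A\<^esub> y = x \<oplus>\<^sub>A y"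
  "x \<otimes>\<^bsub>opposite_algebra A\<^esub> y = y \<otimes>\<^sub>A x" "c \<odot>\<^bsub>opposite_algebra A\<^esub> x = c \<odot>\<^sub>A x"
  by (simp_all add: opposite_algebra_def)

context
  fixes k :: "'k ring" and A :: "('k, 'a) module"
  assumes k: "field k" and A: "assoc_algebra k A"
begin

interpretation tensor_loc k A "opposite_algebra A"
  by (intro tensor_loc.intro A assoc_algebra_opposite_algebra)

lemma enveloping_enveloping_algebra:
  "enveloping k A (enveloping_algebra k A) (tensor_pure k A (opposite_algebra A))"
  unfolding enveloping_algebra_def
proof (intro enveloping.intro enveloping_axioms.intro)
  fix e Q assume "e \<in> carrier T" "Q \<zero>\<^sub>T" "\<And>a b. \<lbrakk>a \<in> carrier A; b \<in> carrier A\<rbrakk> \<Longrightarrow> Q (pure a b)"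
      "\<And>x y. \<lbrakk>x \<in> carrier T; y \<in> carrier T; Q x; Q y\<rbrakk> \<Longrightarrow> Q (x \<oplus>\<^sub>T y)"
  thus "Q e" using T_induct[of e Q] by (simp add: opposite_algebra_simps)
qed (use pure_closed pure_add_l pure_add_r pure_smult_l pure_smult_r pure_mult pure_one k A
    assoc_algebra_tensor_algebra[OF A assoc_algebra_opposite_algebra[OF A]] in \<open>simp_all add: opposite_algebra_simps\<close>)

lemma bilinear_lifts_enveloping_algebra:
  assumes N: "module k N"
  shows "bilinear_lifts k A (enveloping_algebra k A) (tensor_pure k A (opposite_algebra A)) N"
  unfolding bilinear_lifts_def enveloping_algebra_def
proof (intro allI impI)
  fix bt assume "bilinear_on k A N bt"
  thus "\<exists>h. h \<in> lmod_hom k T N \<and> (\<forall>a\<in>carrier A. \<forall>b\<in>carrier A. h (pure a b) = bt a b)"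
    using bilinear_lift[OF N, of bt] by (simp add: opposite_algebra_simps bilinear_on_def)
qed

end

subsection \<open>Bimodules\<close>

lemma (in abelian_group) finsum_swap:
  assumes "finite I" "finite J" "\<And>i j. i \<in> I \<Longrightarrow> j \<in> J \<Longrightarrow> f i j \<in> carrier G"
  shows "(\<Oplus>i\<in>I. \<Oplus>j\<in>J. f i j) = (\<Oplus>j\<in>J. \<Oplus>i\<in>I. f i j)"
  using assms(1,3)
proof (induction I rule: finite_induct)
  case empty
  thus ?case by simp
next
  case (insert x F)
  hence "(\<Oplus>i\<in>insert x F. \<Oplus>j\<in>J. f i j) = (\<Oplus>j\<in>J. f x j) \<oplus> (\<Oplus>j\<in>J. \<Oplus>i\<in>F. f i j)"
    using assms(2) by (subst finsum_insert) (auto intro!: finsum_closed)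
  also have "\<dots> = (\<Oplus>j\<in>J. f x j \<oplus> (\<Oplus>i\<in>F. f i j))"
    using insert by (intro finsum_addf[symmetric]) (auto intro!: finsum_closed)
  also have "\<dots> = (\<Oplus>j\<in>J. \<Oplus>i\<in>insert x F. f i j)"
    using insert by (intro finsum_cong') (auto intro!: finsum_closed simp: finsum_insert)
  finally show ?case .
qed

lemma (in abelian_group) finsum_minus:
  assumes "\<And>i. i \<in> I \<Longrightarrow> f i \<in> carrier G" "\<And>i. i \<in> I \<Longrightarrow> g i \<in> carrier G"
  shows "(\<Oplus>i\<in>I. f i \<ominus> g i) = (\<Oplus>i\<in>I. f i) \<ominus> (\<Oplus>i\<in>I. g i)"
  using assms
proof (induction I rule: infinite_finite_induct)
  case (insert x F)
  hence c: "f x \<in> carrier G" "g x \<in> carrier G" "(\<Oplus>i\<in>F. f i) \<in> carrier G" "(\<Oplus>i\<in>F. g i) \<in> carrier G"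
    "(\<lambda>i. f i \<ominus> g i) \<in> F \<rightarrow> carrier G"
    by (auto intro!: finsum_closed)
  show ?case using insert c by (simp add: a_minus_def minus_add a_ac Pi_iff)
qed (use minus_eq_zero_iff[of \<zero> \<zero>] in simp_all)

lemma (in abelian_group) finsum_add_eqI:
  assumes "\<And>i. i \<in> I \<Longrightarrow> f i \<in> carrier G" "\<And>i. i \<in> I \<Longrightarrow> g i \<in> carrier G" "\<And>i. i \<in> I \<Longrightarrow> h i = f i \<oplus> g i"
  shows "(\<Oplus>i\<in>I. h i) = (\<Oplus>i\<in>I. f i) \<oplus> (\<Oplus>i\<in>I. g i)"
proof -
  have "(\<Oplus>i\<in>I. h i) = (\<Oplus>i\<in>I. f i \<oplus> g i)" using assms by (intro finsum_cong') auto
  thus ?thesis using assms by (simp add: finsum_addf Pi_iff)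
qed

lemma (in abelian_group) finsum_minus_eqI:
  assumes "\<And>i. i \<in> I \<Longrightarrow> f i \<in> carrier G" "\<And>i. i \<in> I \<Longrightarrow> g i \<in> carrier G" "\<And>i. i \<in> I \<Longrightarrow> h i = f i \<ominus> g i"
  shows "(\<Oplus>i\<in>I. h i) = (\<Oplus>i\<in>I. f i) \<ominus> (\<Oplus>i\<in>I. g i)"
proof -
  have "(\<Oplus>i\<in>I. h i) = (\<Oplus>i\<in>I. f i \<ominus> g i)" using assms by (intro finsum_cong') auto
  thus ?thesis using assms by (simp add: finsum_minus)
qed

lemma (in abelian_group) finsum_delta:
  assumes "finite I" "j \<in> I" "x \<in> carrier G"
  shows "(\<Oplus>i\<in>I. if i = j then x else \<zero>) = x"
  using finsum_singleton[of j I "\<lambda>_. x"] assms by (simp add: eq_commute)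

lemma lmod_hom_diff:
  assumes N: "module k N" and f: "f \<in> lmod_hom k E N" and g: "g \<in> lmod_hom k E N"
  shows "(\<lambda>x. f x \<ominus>\<^sub>N g x) \<in> lmod_hom k E N"
proof -
  interpret N: module k N by fact
  show ?thesis
    by (rule lmod_homI) (simp_all add: lmod_homD[OF f] lmod_homD[OF g] a_minus_def N.M.minus_add N.M.a_ac
       N.smult_r_distr N.smult_r_minus)
qed

abbreviation (in enveloping) pureL where "pureL a \<equiv> pure a \<one>\<^sub>A"
abbreviation (in enveloping) pureR where "pureR a \<equiv> pure \<one>\<^sub>A a"

lemmas (in enveloping) E_ab = E.M.abelian_group_axioms
lemmas (in enveloping) env_induct [consumes 1, case_names zero pure add] = E_induct

text \<open>A bimodule is given by its two actions, the form in which matrices come;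
  \<open>act\<close> reassembles them into an action of \<open>E\<close>. The last assumption is the
  universal property for maps into \<open>N\<close> itself.\<close>

locale env_bimodule = enveloping k A E pure + N: module k N
  for k :: "'k ring" and A :: "('k, 'a) module" and E :: "('k, 'e) module" (structure) and pure
    and N :: "('k, 'n, 'f) module_scheme" +
  fixes la :: "'a \<Rightarrow> 'n \<Rightarrow> 'n" and ra :: "'a \<Rightarrow> 'n \<Rightarrow> 'n"
  assumes la_hom: "a \<in> carrier A \<Longrightarrow> la a \<in> lmod_hom k N N"
    and ra_hom: "a \<in> carrier A \<Longrightarrow> ra a \<in> lmod_hom k N N"
    and la_add: "\<lbrakk>a \<in> carrier A; b \<in> carrier A; x \<in> carrier N\<rbrakk> \<Longrightarrow> la (a \<oplus>\<^sub>A b) x = la a x \<oplus>\<^sub>N la b x"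
    and ra_add: "\<lbrakk>a \<in> carrier A; b \<in> carrier A; x \<in> carrier N\<rbrakk> \<Longrightarrow> ra (a \<oplus>\<^sub>A b) x = ra a x \<oplus>\<^sub>N ra b x"
    and la_smult: "\<lbrakk>c \<in> carrier k; a \<in> carrier A; x \<in> carrier N\<rbrakk> \<Longrightarrow> la (c \<odot>\<^sub>A a) x = c \<odot>\<^sub>N la a x"
    and ra_smult: "\<lbrakk>c \<in> carrier k; a \<in> carrier A; x \<in> carrier N\<rbrakk> \<Longrightarrow> ra (c \<odot>\<^sub>A a) x = c \<odot>\<^sub>N ra a x"
    and la_mult: "\<lbrakk>a \<in> carrier A; b \<in> carrier A; x \<in> carrier N\<rbrakk> \<Longrightarrow> la (a \<otimes>\<^sub>A b) x = la a (la b x)"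
    and ra_mult: "\<lbrakk>a \<in> carrier A; b \<in> carrier A; x \<in> carrier N\<rbrakk> \<Longrightarrow> ra (a \<otimes>\<^sub>A b) x = ra b (ra a x)"
    and la_one: "x \<in> carrier N \<Longrightarrow> la \<one>\<^sub>A x = x"
    and ra_one: "x \<in> carrier N \<Longrightarrow> ra \<one>\<^sub>A x = x"
    and la_ra: "\<lbrakk>a \<in> carrier A; b \<in> carrier A; x \<in> carrier N\<rbrakk> \<Longrightarrow> la a (ra b x) = ra b (la a x)"
    and lifts_N: "bilinear_lifts k A E pure N"
begin

lemmas N_ab = N.M.abelian_group_axioms

text \<open>For fixed \<open>x\<close> this is the linear extension of a \<otimes> b \<mapsto> a x b
  from pure tensors to \<open>E\<close>; \<open>act_spec\<close> justifies the choice.\<close>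

definition act :: "'e \<Rightarrow> 'n \<Rightarrow> 'n" where
  "act e x = (SOME h. h \<in> lmod_hom k E N \<and> (\<forall>a\<in>carrier A. \<forall>b\<in>carrier A. h (pure a b) = la a (ra b x))) e"

lemmas laD = lmod_homD[OF la_hom]
lemmas raD = lmod_homD[OF ra_hom]

lemma act_spec:
  assumes x: "x \<in> carrier N"
  shows "(\<lambda>e. act e x) \<in> lmod_hom k E N \<and> (\<forall>a\<in>carrier A. \<forall>b\<in>carrier A. act (pure a b) x = la a (ra b x))"
proof -
  have "bilinear_on k A N (\<lambda>a b. la a (ra b x))"
    unfolding bilinear_on_def
    by (intro conjI ballI) (simp_all add: x laD raD la_add ra_add la_smult ra_smult)
  hence "\<exists>h. h \<in> lmod_hom k E N \<and> (\<forall>a\<in>carrier A. \<forall>b\<in>carrier A. h (pure a b) = la a (ra b x))"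
    using lifts_N unfolding bilinear_lifts_def by simp
  from someI_ex[OF this] show ?thesis unfolding act_def .
qed

lemma act_hom: "x \<in> carrier N \<Longrightarrow> (\<lambda>e. act e x) \<in> lmod_hom k E N"
  and act_pure: "\<lbrakk>a \<in> carrier A; b \<in> carrier A; x \<in> carrier N\<rbrakk> \<Longrightarrow> act (pure a b) x = la a (ra b x)"
  using act_spec by simp_all

lemmas actD = lmod_homD[OF act_hom]

lemma act_zero: "x \<in> carrier N \<Longrightarrow> act \<zero> x = \<zero>\<^sub>N"
  using lmod_hom_zero[OF act_hom E_ab N_ab] .

lemma la_zero: "a \<in> carrier A \<Longrightarrow> la a \<zero>\<^sub>N = \<zero>\<^sub>N"
  using lmod_hom_zero[OF la_hom N_ab N_ab] .

lemma ra_zero: "a \<in> carrier A \<Longrightarrow> ra a \<zero>\<^sub>N = \<zero>\<^sub>N"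
  using lmod_hom_zero[OF ra_hom N_ab N_ab] .

lemma act_add:
  assumes e: "e \<in> carrier E" and xy: "x \<in> carrier N" "y \<in> carrier N"
  shows "act e (x \<oplus>\<^sub>N y) = act e x \<oplus>\<^sub>N act e y"
  using e by (induction rule: env_induct) (simp_all add: xy act_zero act_pure actD laD raD N.M.a_ac)

lemma act_smult:
  assumes e: "e \<in> carrier E" and x: "x \<in> carrier N" and c: "c \<in> carrier k"
  shows "act e (c \<odot>\<^sub>N x) = c \<odot>\<^sub>N act e x"
  using e by (induction rule: env_induct) (simp_all add: x c act_zero act_pure actD laD raD N.smult_r_distr)

lemma act_hom_r: "e \<in> carrier E \<Longrightarrow> act e \<in> lmod_hom k N N"
  by (rule lmod_homI) (simp_all add: act_add act_smult actD)

lemma act_zero_r: "e \<in> carrier E \<Longrightarrow> act e \<zero>\<^sub>N = \<zero>\<^sub>N"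
  using lmod_hom_zero[OF act_hom_r N_ab N_ab] .

lemma act_mult:
  assumes e: "e \<in> carrier E" and e': "e' \<in> carrier E" and x: "x \<in> carrier N"
  shows "act (e \<otimes> e') x = act e (act e' x)"
  using e
proof (induction rule: env_induct)
  case (pure a b)
  note ab = this
  show ?case using e'
  proof (induction rule: env_induct)
    case (pure a' b')
    thus ?case using ab x by (simp add: pure_mult act_pure laD raD la_mult ra_mult la_ra)
  qed (simp_all add: x ab E.r_distr actD act_add act_zero act_zero_r pure_closed)
qed (simp_all add: x e' E.l_distr actD act_zero)

lemma act_finsum:
  assumes "e \<in> carrier E" "\<And>i. i \<in> I \<Longrightarrow> x i \<in> carrier N"
  shows "act e (\<Oplus>\<^sub>N i\<in>I. x i) = (\<Oplus>\<^sub>N i\<in>I. act e (x i))"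
  using assms by (intro lmod_hom_finsum[OF act_hom_r N_ab N_ab])

lemma finsum_act:
  assumes "x \<in> carrier N" "\<And>i. i \<in> I \<Longrightarrow> e i \<in> carrier E"
  shows "act (\<Oplus>i\<in>I. e i) x = (\<Oplus>\<^sub>N i\<in>I. act (e i) x)"
  using assms by (intro lmod_hom_finsum[OF act_hom E_ab N_ab])

text \<open>Normalised Hochschild 2-cocycles, with the terms moved so that no sign occurs. Since the
  values at the unit vanish, scalars of \<open>k\<close> can be ignored in both arguments.\<close>

definition cocycle :: "('a \<Rightarrow> 'a \<Rightarrow> 'n) \<Rightarrow> bool" where
  "cocycle ga \<longleftrightarrow> bilinear_on k A N ga \<and>
    (\<forall>a\<in>carrier A. \<forall>b\<in>carrier A. \<forall>c\<in>carrier A.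
      la a (ga b c) \<oplus>\<^sub>N ga a (b \<otimes>\<^sub>A c) = ga (a \<otimes>\<^sub>A b) c \<oplus>\<^sub>N ra c (ga a b)) \<and>
    (\<forall>c\<in>carrier A. ga \<one>\<^sub>A c = \<zero>\<^sub>N \<and> ga c \<one>\<^sub>A = \<zero>\<^sub>N)"

text \<open>\<open>ga\<close> is the failure of \<open>h\<close> to be a derivation, that is, the
  Hochschild differential of \<open>-h\<close>.\<close>

definition coboundary :: "('a \<Rightarrow> 'a \<Rightarrow> 'n) \<Rightarrow> bool" where
  "coboundary ga \<longleftrightarrow> (\<exists>h. h \<in> lmod_hom k A N \<and> (\<forall>a\<in>carrier A. \<forall>b\<in>carrier A.
      h (a \<otimes>\<^sub>A b) = la a (h b) \<oplus>\<^sub>N ra b (h a) \<oplus>\<^sub>N ga a b))"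

end

subsection \<open>Cocycles and the bimodule resolution\<close>

text \<open>
  The rows of \<open>f\<close> generate the kernel of \<open>E\<^sup>p \<rightarrow> E\<close>, \<open>xe \<mapsto> \<Sum>\<^sub>i xe\<^sub>i (s\<^sub>i \<otimes> 1 - 1 \<otimes> s\<^sub>i)\<close>,
  and the rows of \<open>g\<close> generate the relations among the rows of \<open>f\<close>.
\<close>

locale env_resolution = enveloping k A E pure
  for k :: "'k ring" and A :: "('k, 'a) module" and E :: "('k, 'e) module" (structure) and pure +
  fixes p q r :: nat and s :: "nat \<Rightarrow> 'a" and f g :: "nat \<Rightarrow> nat \<Rightarrow> 'e"
  assumes s_closed: "i < p \<Longrightarrow> s i \<in> carrier A"
    and s_generate: "alg_generated k A (s ` {..<p}) = carrier A"
    and f_closed: "\<lbrakk>l < q; i < p\<rbrakk> \<Longrightarrow> f l i \<in> carrier E"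
    and f_rel: "l < q \<Longrightarrow> (\<Oplus>i<p. f l i \<otimes> (pureL (s i) \<ominus> pureR (s i))) = \<zero>"
    and f_span: "\<lbrakk>\<forall>i<p. xe i \<in> carrier E;
        (\<Oplus>i<p. xe i \<otimes> (pureL (s i) \<ominus> pureR (s i))) = \<zero>\<rbrakk> \<Longrightarrow>
      \<exists>et. (\<forall>l<q. et l \<in> carrier E) \<and> (\<forall>i<p. xe i = (\<Oplus>l<q. et l \<otimes> f l i))"
    and g_closed: "\<lbrakk>m < r; l < q\<rbrakk> \<Longrightarrow> g m l \<in> carrier E"
    and g_rel: "\<lbrakk>m < r; i < p\<rbrakk> \<Longrightarrow> (\<Oplus>l<q. g m l \<otimes> f l i) = \<zero>"
    and g_span: "\<lbrakk>\<forall>l<q. et l \<in> carrier E; \<forall>i<p. (\<Oplus>l<q. et l \<otimes> f l i) = \<zero>\<rbrakk> \<Longrightarrow>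
      \<exists>th. (\<forall>m<r. th m \<in> carrier E) \<and> (\<forall>l<q. et l = (\<Oplus>m<r. th m \<otimes> g m l))"
begin

definition ds :: "nat \<Rightarrow> 'e" where "ds i = pureL (s i) \<ominus> pureR (s i)"

abbreviation vec :: "(nat \<Rightarrow> 'e) \<Rightarrow> bool" where "vec xe \<equiv> \<forall>i<p. xe i \<in> carrier E"

definition D :: "(nat \<Rightarrow> 'e) \<Rightarrow> 'e" where "D xe = (\<Oplus>i<p. xe i \<otimes> ds i)"

text \<open>The universal derivation of \<open>A\<close>, with values in the kernel of the
  multiplication E \<rightarrow> A; \<open>dA_mult\<close> is its Leibniz rule.\<close>

definition dA :: "'a \<Rightarrow> 'e" where "dA b = pureL b \<ominus> pureR b"

lemma ds_closed: "i < p \<Longrightarrow> ds i \<in> carrier E"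
  by (simp add: ds_def pure_closed s_closed)

lemma dA_closed: "b \<in> carrier A \<Longrightarrow> dA b \<in> carrier E"
  by (simp add: dA_def pure_closed)

lemma D_closed: "vec xe \<Longrightarrow> D xe \<in> carrier E"
  unfolding D_def by (intro E.finsum_closed) (auto simp: ds_closed)

lemma D_add: "vec xe \<Longrightarrow> vec xe' \<Longrightarrow> D (\<lambda>i. xe i \<oplus> xe' i) = D xe \<oplus> D xe'"
  unfolding D_def by (rule E.M.finsum_add_eqI) (simp_all add: ds_closed E.l_distr)

lemma D_minus: "vec xe \<Longrightarrow> vec xe' \<Longrightarrow> D (\<lambda>i. xe i \<ominus> xe' i) = D xe \<ominus> D xe'"
  unfolding D_def by (rule E.M.finsum_minus_eqI) (simp_all add: ds_closed E.l_distr a_minus_def E.l_minus)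

lemma D_mult: "vec xe \<Longrightarrow> e \<in> carrier E \<Longrightarrow> D (\<lambda>i. e \<otimes> xe i) = e \<otimes> D xe"
  unfolding D_def by (subst E.finsum_rdistr) (auto simp: ds_closed E.m_assoc intro!: E.finsum_cong')

lemma D_smult: "vec xe \<Longrightarrow> c \<in> carrier k \<Longrightarrow> D (\<lambda>i. c \<odot> xe i) = c \<odot> D xe"
  unfolding D_def by (subst E.finsum_smult_ldistr) (auto simp: ds_closed E.smult_assoc_l intro!: E.finsum_cong')

lemma D_zero: "D (\<lambda>i. \<zero>) = \<zero>"
  unfolding D_def by (rule E.add.finprod_one_eqI) (simp add: ds_closed)

lemma D_unit: "j < p \<Longrightarrow> D (\<lambda>i. if i = j then \<one> else \<zero>) = ds j"
proof -
  assume j: "j < p"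
  have "D (\<lambda>i. if i = j then \<one> else \<zero>) = (\<Oplus>i<p. if i = j then ds j else \<zero>)"
    unfolding D_def using j by (intro E.finsum_cong') (auto simp: ds_closed)
  thus ?thesis using j by (simp add: E.finsum_delta ds_closed)
qed

lemma pure_zero: "b \<in> carrier A \<Longrightarrow> pure b \<zero>\<^sub>A = \<zero>" "b \<in> carrier A \<Longrightarrow> pure \<zero>\<^sub>A b = \<zero>"
  using pure_smult_r[of "\<zero>\<^sub>k" b "\<zero>\<^sub>A"] pure_smult_l[of "\<zero>\<^sub>k" "\<zero>\<^sub>A" b] by (simp_all add: pure_closed)

lemma dA_add: "a \<in> carrier A \<Longrightarrow> b \<in> carrier A \<Longrightarrow> dA (a \<oplus>\<^sub>A b) = dA a \<oplus> dA b"
  by (simp add: dA_def pure_add_l pure_add_r pure_closed a_minus_def E.minus_add E.a_ac)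

lemma dA_smult: "c \<in> carrier k \<Longrightarrow> b \<in> carrier A \<Longrightarrow> dA (c \<odot>\<^sub>A b) = c \<odot> dA b"
  by (simp add: dA_def pure_smult_l pure_smult_r pure_closed a_minus_def E.smult_r_distr E.smult_r_minus)

lemma dA_one: "dA \<one>\<^sub>A = \<zero>"
  by (simp add: dA_def pure_one a_minus_def E.r_neg)

lemma dA_mult:
  assumes "b \<in> carrier A" "c \<in> carrier A"
  shows "dA (b \<otimes>\<^sub>A c) = pureL b \<otimes> dA c \<oplus> pureR c \<otimes> dA b"
proof -
  have "pureL b \<otimes> dA c \<oplus> pureR c \<otimes> dA b
    = (pureL (b \<otimes>\<^sub>A c) \<oplus> \<ominus> pure b c) \<oplus> (pure b c \<oplus> \<ominus> pureR (b \<otimes>\<^sub>A c))"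
    using assms by (simp add: dA_def a_minus_def E.r_distr E.r_minus pure_closed pure_mult)
  also have "\<dots> = dA (b \<otimes>\<^sub>A c)"
    using assms by (simp add: dA_def a_minus_def pure_closed E.a_assoc E.r_neg1)
  finally show ?thesis by simp
qed

text \<open>By the Leibniz rule the \<open>b\<close> with \<open>dA b\<close> in the image of
  \<open>D\<close> form a subalgebra, and it contains the generators \<open>s i\<close>.\<close>

lemma dA_in_range: "b \<in> carrier A \<Longrightarrow> \<exists>xe. vec xe \<and> D xe = dA b"
proof -
  have gen: "x \<in> carrier A" if "x \<in> alg_generated k A (s ` {..<p})" for x
    using that s_generate by simp
  have "\<exists>xe. vec xe \<and> D xe = dA b" if "b \<in> alg_generated k A (s ` {..<p})" for b
    using that
  proof induction
    case zero
    have "dA \<zero>\<^sub>A = \<zero>" by (simp add: dA_def pure_zero a_minus_def)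
    thus ?case using D_zero by (intro exI[of _ "\<lambda>i. \<zero>"]) simp
  next
    case one
    show ?case using D_zero dA_one by (intro exI[of _ "\<lambda>i. \<zero>"]) simp
  next
    case (incl x)
    then obtain j where j: "j < p" "x = s j" by blast
    show ?case using D_unit[OF j(1)] j by (intro exI[of _ "\<lambda>i. if i = j then \<one> else \<zero>"]) (simp add: dA_def ds_def)
  next
    case (smult c x)
    then obtain xe where "vec xe" "D xe = dA x" by blast
    thus ?case using smult gen D_smult[of xe c] by (intro exI[of _ "\<lambda>i. c \<odot> xe i"]) (simp add: dA_smult)
  next
    case (add x y)
    then obtain xe xe' where "vec xe" "D xe = dA x" "vec xe'" "D xe' = dA y" by blast
    thus ?case using add gen D_add[of xe xe'] by (intro exI[of _ "\<lambda>i. xe i \<oplus> xe' i"]) (simp add: dA_add)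
  next
    case (mult x y)
    then obtain xe xe' where x: "vec xe" "D xe = dA x" "vec xe'" "D xe' = dA y" by blast
    let ?ze = "\<lambda>i. (pureL x \<otimes> xe' i) \<oplus> (pureR y \<otimes> xe i)"
    have c: "pureL x \<in> carrier E" "pureR y \<in> carrier E" using gen mult by (simp_all add: pure_closed)
    have "D ?ze = dA (x \<otimes>\<^sub>A y)"
      using x c gen[OF mult.hyps(1)] gen[OF mult.hyps(2)] by (subst D_add) (simp_all add: D_mult dA_mult)
    thus ?case using x c by (intro exI[of _ ?ze]) simp
  qed
  thus "b \<in> carrier A \<Longrightarrow> ?thesis" using s_generate by simp
qed

end

locale env_problem = env_bimodule k A E pure N la ra + env_resolution k A E pure p q r s f g
  for k :: "'k ring" and A :: "('k, 'a) module" and E :: "('k, 'e) module" (structure) and pure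
    and N :: "('k, 'n, 'z) module_scheme" and la ra p q r s f g
begin

text \<open>Exactness at the middle of N^p \<rightarrow> N^q \<rightarrow> N^r, the complex of
  E-linear maps from the resolution to \<open>N\<close>; an E-linear map on E^p is given by its
  values on the unit vectors.\<close>

definition exact_at_N :: bool where
  "exact_at_N \<longleftrightarrow> (\<forall>Y. (\<forall>l<q. Y l \<in> carrier N) \<and> (\<forall>m<r. (\<Oplus>\<^sub>N l<q. act (g m l) (Y l)) = \<zero>\<^sub>N) \<longrightarrow>
    (\<exists>Z. (\<forall>i<p. Z i \<in> carrier N) \<and> (\<forall>l<q. Y l = (\<Oplus>\<^sub>N i<p. act (f l i) (Z i)))))"

text \<open>The map E^p \<rightarrow> N with components \<open>ph i\<close>. The components in use
  are linear over \<open>k\<close> but in general not over \<open>E\<close>, so they cannot be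
  replaced by a vector of elements of \<open>N\<close>.\<close>

definition lsum :: "(nat \<Rightarrow> 'e \<Rightarrow> 'n) \<Rightarrow> (nat \<Rightarrow> 'e) \<Rightarrow> 'n" where
  "lsum ph xe = (\<Oplus>\<^sub>N i<p. ph i (xe i))"

context
  fixes ph :: "nat \<Rightarrow> 'e \<Rightarrow> 'n"
  assumes ph: "\<And>i. i < p \<Longrightarrow> ph i \<in> lmod_hom k E N"
begin

lemma lsum_closed: "vec xe \<Longrightarrow> lsum ph xe \<in> carrier N"
  unfolding lsum_def by (intro N.M.finsum_closed) (auto simp: lmod_homD[OF ph])

lemma lsum_add: "vec xe \<Longrightarrow> vec xe' \<Longrightarrow> lsum ph (\<lambda>i. xe i \<oplus> xe' i) = lsum ph xe \<oplus>\<^sub>N lsum ph xe'"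
  unfolding lsum_def by (rule N.M.finsum_add_eqI) (simp_all add: lmod_homD[OF ph])

lemma lsum_minus: "vec xe \<Longrightarrow> vec xe' \<Longrightarrow> lsum ph (\<lambda>i. xe i \<ominus> xe' i) = lsum ph xe \<ominus>\<^sub>N lsum ph xe'"
  unfolding lsum_def by (rule N.M.finsum_minus_eqI)
    (simp_all add: lmod_homD[OF ph] lmod_hom_minus[OF ph E_ab N_ab])

lemma lsum_smult: "vec xe \<Longrightarrow> c \<in> carrier k \<Longrightarrow> lsum ph (\<lambda>i. c \<odot> xe i) = c \<odot>\<^sub>N lsum ph xe"
  unfolding lsum_def by (subst N.finsum_smult_ldistr) (auto simp: lmod_homD[OF ph] intro!: N.M.finsum_cong')

lemma lsum_finsum:
  assumes "finite I" "\<And>j. j \<in> I \<Longrightarrow> vec (xe j)"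
  shows "lsum ph (\<lambda>i. \<Oplus>j\<in>I. xe j i) = (\<Oplus>\<^sub>N j\<in>I. lsum ph (xe j))"
proof -
  have "lsum ph (\<lambda>i. \<Oplus>j\<in>I. xe j i) = (\<Oplus>\<^sub>N i<p. \<Oplus>\<^sub>N j\<in>I. ph i (xe j i))"
    unfolding lsum_def using assms
    by (intro N.M.finsum_cong') (auto simp: lmod_homD[OF ph]
      lmod_hom_finsum[OF ph E_ab N_ab] intro!: N.M.finsum_closed)
  also have "\<dots> = (\<Oplus>\<^sub>N j\<in>I. lsum ph (xe j))"
    unfolding lsum_def using assms by (intro N.M.finsum_swap) (auto simp: lmod_homD[OF ph])
  finally show ?thesis .
qed

end

end

lemma (in abelian_group) add_eq_solve:
  assumes "x \<in> carrier G" "y \<in> carrier G" "z \<in> carrier G" "w \<in> carrier G" and "x \<oplus> y = z \<oplus> w"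
  shows "y = w \<ominus> (x \<ominus> z)"
proof -
  have "y \<ominus> w = z \<ominus> x" using assms by (intro add_eq_imp_minus_eq) (simp_all add: a_comm)
  moreover have "y = (y \<ominus> w) \<oplus> w" using assms(1-4) by (simp add: a_minus_def a_assoc l_neg)
  ultimately show ?thesis using assms(1-4) by (simp add: a_minus_def minus_add a_ac)
qed

lemma (in abelian_group) add_minus_cancel_left:
  "x \<in> carrier G \<Longrightarrow> y \<in> carrier G \<Longrightarrow> x \<oplus> y \<ominus> x = y"
  by (simp add: a_minus_def a_comm[of x y] a_assoc r_neg)

lemma (in abelian_group) minus_eq_uminus_add:
  assumes "x \<in> carrier G" "w \<in> carrier G" "u \<in> carrier G"
  shows "x \<ominus> w = \<ominus> (u \<oplus> (w \<ominus> x \<ominus> u))"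
proof -
  have "u \<oplus> (w \<ominus> x \<ominus> u) = w \<ominus> x"
    using assms add_minus_cancel_left[of u "w \<ominus> x"] by (simp add: a_minus_def a_assoc)
  thus ?thesis using assms by (simp add: a_minus_def minus_add a_comm)
qed

text \<open>Both sides equal v - y - w - u: the terms \<open>x\<close> cancel on the left and the
  terms \<open>t\<close> on the right. This is the arithmetic behind the cocycle identity for the
  failure of a linear map to be a derivation.\<close>

lemma (in abelian_group) cocycle_arith:
  assumes "x \<in> carrier G" "y \<in> carrier G" "w \<in> carrier G" "v \<in> carrier G" "u \<in> carrier G" "t \<in> carrier G"
  shows "(x \<ominus> y \<ominus> w) \<oplus> (v \<ominus> x \<ominus> u) = (v \<ominus> y \<ominus> t) \<oplus> (t \<ominus> w \<ominus> u)"
proof -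
  have "(x \<ominus> y \<ominus> w) \<oplus> (v \<ominus> x \<ominus> u) = (v \<ominus> y \<ominus> w \<ominus> u) \<oplus> (\<ominus> x \<oplus> x)"
    using assms by (simp add: a_minus_def a_ac)
  also have "\<dots> = (v \<ominus> y \<ominus> w \<ominus> u) \<oplus> (\<ominus> t \<oplus> t)" using assms by (simp add: l_neg)
  also have "\<dots> = (v \<ominus> y \<ominus> t) \<oplus> (t \<ominus> w \<ominus> u)" using assms by (simp add: a_minus_def a_ac)
  finally show ?thesis .
qed

context enveloping
begin

definition blift :: "('k, 'm, 'z) module_scheme \<Rightarrow> ('a \<Rightarrow> 'a \<Rightarrow> 'm) \<Rightarrow> 'e \<Rightarrow> 'm" where
  "blift M bt = (SOME h. h \<in> lmod_hom k E M \<and> (\<forall>a\<in>carrier A. \<forall>b\<in>carrier A. h (pure a b) = bt a b))"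

lemma blift:
  assumes "bilinear_lifts k A E pure M" "bilinear_on k A M bt"
  shows "blift M bt \<in> lmod_hom k E M"
    and "\<And>a b. a \<in> carrier A \<Longrightarrow> b \<in> carrier A \<Longrightarrow> blift M bt (pure a b) = bt a b"
proof -
  have "\<exists>h. h \<in> lmod_hom k E M \<and> (\<forall>a\<in>carrier A. \<forall>b\<in>carrier A. h (pure a b) = bt a b)"
    using assms unfolding bilinear_lifts_def by simp
  from someI_ex[OF this] show "blift M bt \<in> lmod_hom k E M"
    "\<And>a b. a \<in> carrier A \<Longrightarrow> b \<in> carrier A \<Longrightarrow> blift M bt (pure a b) = bt a b"
    unfolding blift_def by simp_all
qed

end

section \<open>From exactness to coboundaries\<close>

context env_problem
begin

lemma lsum_cong: "vec xe' \<Longrightarrow> (\<And>i. i < p \<Longrightarrow> ph i \<in> lmod_hom k E N) \<Longrightarrow> (\<And>i. i < p \<Longrightarrow> xe i = xe' i) \<Longrightarrow> lsum ph xe = lsum ph xe'"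
  unfolding lsum_def by (intro N.M.finsum_cong') (auto intro: lmod_homD(1))

lemma cocycleD:
  assumes "cocycle ga"
  shows "\<And>a b. a \<in> carrier A \<Longrightarrow> b \<in> carrier A \<Longrightarrow> ga a b \<in> carrier N"
    and "\<And>a a' b. a \<in> carrier A \<Longrightarrow> a' \<in> carrier A \<Longrightarrow> b \<in> carrier A \<Longrightarrow> ga (a \<oplus>\<^sub>A a') b = ga a b \<oplus>\<^sub>N ga a' b"
    and "\<And>a b b'. a \<in> carrier A \<Longrightarrow> b \<in> carrier A \<Longrightarrow> b' \<in> carrier A \<Longrightarrow> ga a (b \<oplus>\<^sub>A b') = ga a b \<oplus>\<^sub>N ga a b'"
    and "\<And>c a b. c \<in> carrier k \<Longrightarrow> a \<in> carrier A \<Longrightarrow> b \<in> carrier A \<Longrightarrow> ga (c \<odot>\<^sub>A a) b = c \<odot>\<^sub>N ga a b"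
    and "\<And>c a b. c \<in> carrier k \<Longrightarrow> a \<in> carrier A \<Longrightarrow> b \<in> carrier A \<Longrightarrow> ga a (c \<odot>\<^sub>A b) = c \<odot>\<^sub>N ga a b"
    and "\<And>a b c. a \<in> carrier A \<Longrightarrow> b \<in> carrier A \<Longrightarrow> c \<in> carrier A \<Longrightarrow>
      la a (ga b c) \<oplus>\<^sub>N ga a (b \<otimes>\<^sub>A c) = ga (a \<otimes>\<^sub>A b) c \<oplus>\<^sub>N ra c (ga a b)"
    and "\<And>c. c \<in> carrier A \<Longrightarrow> ga \<one>\<^sub>A c = \<zero>\<^sub>N"
    and "\<And>c. c \<in> carrier A \<Longrightarrow> ga c \<one>\<^sub>A = \<zero>\<^sub>N"
  using assms by (simp_all add: cocycle_def bilinear_on_def)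

lemma act_left: "a \<in> carrier A \<Longrightarrow> x \<in> carrier N \<Longrightarrow> act (pureL a) x = la a x"
  and act_right: "a \<in> carrier A \<Longrightarrow> x \<in> carrier N \<Longrightarrow> act (pureR a) x = ra a x"
  by (simp_all add: act_pure la_one ra_one raD)

lemma pure_split: "a \<in> carrier A \<Longrightarrow> b \<in> carrier A \<Longrightarrow> pure a b = pureL a \<otimes> pureR b"
  by (simp add: pure_mult)

text \<open>
  The families \<open>ph\<^sub>i : E \<rightarrow> N\<close> below are \<open>A\<close>-linear on the left, and fail to be so on the right by the
  cocycle. If their sum vanishes on the kernel of \<open>D\<close>, it factors through the image of \<open>D\<close>, and its
  value on \<open>b \<otimes> 1 - 1 \<otimes> b\<close> is the required cochain.
\<close>

context
  fixes ga Ga ph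
  assumes ga: "cocycle ga"
    and Ga: "\<And>c. c \<in> carrier A \<Longrightarrow> Ga c \<in> lmod_hom k E N"
      "\<And>a b c. \<lbrakk>a \<in> carrier A; b \<in> carrier A; c \<in> carrier A\<rbrakk> \<Longrightarrow> Ga c (pure a b) = la a (ga b c)"
    and ph: "\<And>i. i < p \<Longrightarrow> ph i \<in> lmod_hom k E N"
    and phl: "\<And>i a e. \<lbrakk>i < p; a \<in> carrier A; e \<in> carrier E\<rbrakk> \<Longrightarrow> ph i (pureL a \<otimes> e) = la a (ph i e)"
    and phr: "\<And>i c e. \<lbrakk>i < p; c \<in> carrier A; e \<in> carrier E\<rbrakk> \<Longrightarrow>
      ph i (pureR c \<otimes> e) = ra c (ph i e) \<ominus>\<^sub>N Ga c (e \<otimes> ds i)"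
begin

lemma lsum_left:
  assumes xe: "vec xe" and a: "a \<in> carrier A"
  shows "lsum ph (\<lambda>i. pureL a \<otimes> xe i) = la a (lsum ph xe)"
proof -
  have "la a (lsum ph xe) = (\<Oplus>\<^sub>N i<p. la a (ph i (xe i)))"
    unfolding lsum_def using xe a
    by (intro lmod_hom_finsum[OF la_hom N_ab N_ab]) (auto simp: lmod_homD[OF ph])
  also have "\<dots> = lsum ph (\<lambda>i. pureL a \<otimes> xe i)"
    unfolding lsum_def using xe a by (intro N.M.finsum_cong') (auto simp: phl laD lmod_homD[OF ph])
  finally show ?thesis by simp
qed

text \<open>The defects of the single components add up to \<open>Ga c (D xe)\<close>, because
  \<open>D\<close> is the sum of the \<open>xe i \<otimes> ds i\<close>.\<close>

lemma lsum_right: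
  assumes xe: "vec xe" and c: "c \<in> carrier A"
  shows "lsum ph (\<lambda>i. pureR c \<otimes> xe i) = ra c (lsum ph xe) \<ominus>\<^sub>N Ga c (D xe)"
proof -
  have r: "ra c (lsum ph xe) = (\<Oplus>\<^sub>N i<p. ra c (ph i (xe i)))"
    unfolding lsum_def using xe c
    by (intro lmod_hom_finsum[OF ra_hom N_ab N_ab]) (auto simp: lmod_homD[OF ph])
  have g: "Ga c (D xe) = (\<Oplus>\<^sub>N i<p. Ga c (xe i \<otimes> ds i))"
    unfolding D_def using xe c
    by (intro lmod_hom_finsum[OF Ga(1) E_ab N_ab]) (auto simp: ds_closed)
  show ?thesis unfolding r g unfolding lsum_def using xe c
    by (intro N.M.finsum_minus_eqI) (simp_all add: phr raD lmod_homD[OF ph] lmod_homD[OF Ga(1)] ds_closed)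
qed

text \<open>The defect \<open>Ga c (D xe)\<close> is zero on the kernel of \<open>D\<close>, so
  there the sum respects both actions and hence that of \<open>E\<close>.\<close>

lemma lsum_mult:
  assumes xe: "vec xe" "D xe = \<zero>" and e: "e \<in> carrier E"
  shows "lsum ph (\<lambda>i. e \<otimes> xe i) = act e (lsum ph xe)"
  using e
proof (induction rule: env_induct)
  case zero
  have "lsum ph (\<lambda>i. \<zero> \<otimes> xe i) = \<zero>\<^sub>N"
    unfolding lsum_def using xe
    by (intro N.M.add.finprod_one_eqI) (simp add: lmod_hom_zero[OF ph E_ab N_ab])
  thus ?case using lsum_closed[OF ph xe(1)] by (simp add: act_zero)
next
  case (pure a b)
  have c: "pureL a \<in> carrier E" "pureR b \<in> carrier E" using pure by (simp_all add: pure_closed)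
  have v: "vec (\<lambda>i. pureR b \<otimes> xe i)" using xe c by simp
  have "lsum ph (\<lambda>i. pure a b \<otimes> xe i) = lsum ph (\<lambda>i. pureL a \<otimes> (pureR b \<otimes> xe i))"
    using pure xe c by (intro lsum_cong ph) (simp_all add: pure_split[of a b] E.m_assoc)
  also have "\<dots> = la a (lsum ph (\<lambda>i. pureR b \<otimes> xe i))" by (rule lsum_left[OF v pure(1)])
  also have "lsum ph (\<lambda>i. pureR b \<otimes> xe i) = ra b (lsum ph xe)"
    using lsum_closed[OF ph xe(1)] pure
    by (simp add: lsum_right[OF xe(1) pure(2)] xe(2) raD
      lmod_hom_zero[OF Ga(1) E_ab N_ab] a_minus_def)
  finally show ?case using pure lsum_closed[OF ph xe(1)] by (simp add: act_pure)
next
  case (add x y)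
  have "lsum ph (\<lambda>i. (x \<oplus> y) \<otimes> xe i) = lsum ph (\<lambda>i. (x \<otimes> xe i) \<oplus> (y \<otimes> xe i))"
    using add xe by (intro lsum_cong ph) (simp_all add: E.l_distr)
  also have "\<dots> = lsum ph (\<lambda>i. x \<otimes> xe i) \<oplus>\<^sub>N lsum ph (\<lambda>i. y \<otimes> xe i)"
    using add xe by (intro lsum_add ph) simp_all
  finally show ?case using add lsum_closed[OF ph xe(1)] by (simp add: actD)
qed

lemma coboundary_if_vanishing:
  assumes van: "\<And>xe. vec xe \<Longrightarrow> D xe = \<zero> \<Longrightarrow> lsum ph xe = \<zero>\<^sub>N"
  shows "coboundary ga"
proof -
  note gaD = cocycleD[OF ga]
  \<comment> \<open>An arbitrary preimage of \<open>dA b\<close> under \<open>D\<close>. By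
    \<open>heq\<close> the value \<open>h b\<close> does not depend on it, since the sum vanishes on
    the kernel of \<open>D\<close>; linearity and the product formula follow by choosing convenient
    preimages.\<close>
  define kp where "kp b = (SOME xe. vec xe \<and> D xe = dA b)" for b
  have kp: "vec (kp b)" "D (kp b) = dA b" if "b \<in> carrier A" for b
    using someI_ex[OF dA_in_range[OF that]] unfolding kp_def by simp_all
  define h where "h b = lsum ph (kp b)" for b
  have heq: "h b = lsum ph xe" if "vec xe" "D xe = dA b" "b \<in> carrier A" for xe b
  proof -
    have "D (\<lambda>i. kp b i \<ominus> xe i) = \<zero>"
      using that kp[OF that(3)] D_minus[of "kp b" xe] by (simp add: dA_closed E.M.minus_eq_zero_iff)
    hence "lsum ph (\<lambda>i. kp b i \<ominus> xe i) = \<zero>\<^sub>N" using that kp[OF that(3)] by (intro van) simp_all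
    hence "lsum ph (kp b) \<ominus>\<^sub>N lsum ph xe = \<zero>\<^sub>N" using lsum_minus[OF ph kp(1)[OF that(3)] that(1)] by simp
    thus ?thesis unfolding h_def using lsum_closed[OF ph] that(1) kp(1)[OF that(3)] by (simp add: N.M.minus_eq_zero_iff)
  qed
  have hc: "h b \<in> carrier N" if "b \<in> carrier A" for b
    unfolding h_def using lsum_closed[OF ph] kp(1)[OF that] by simp
  have "h \<in> lmod_hom k A N"
  proof (rule lmod_homI)
    fix x y assume xy: "x \<in> carrier A" "y \<in> carrier A"
    have "h (x \<oplus>\<^sub>A y) = lsum ph (\<lambda>i. kp x i \<oplus> kp y i)"
      using xy kp by (intro heq) (simp_all add: D_add dA_add)
    thus "h (x \<oplus>\<^sub>A y) = h x \<oplus>\<^sub>N h y" using lsum_add[OF ph] kp xy by (simp add: h_def)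
  next
    fix c x assume cx: "c \<in> carrier k" "x \<in> carrier A"
    have "h (c \<odot>\<^sub>A x) = lsum ph (\<lambda>i. c \<odot> kp x i)"
      using cx kp by (intro heq) (simp_all add: D_smult dA_smult)
    thus "h (c \<odot>\<^sub>A x) = c \<odot>\<^sub>N h x" using lsum_smult[OF ph] kp cx by (simp add: h_def)
  qed (simp add: hc)
  moreover have "h (b \<otimes>\<^sub>A c) = la b (h c) \<oplus>\<^sub>N ra c (h b) \<oplus>\<^sub>N ga b c"
    if b: "b \<in> carrier A" and c: "c \<in> carrier A" for b c
  proof -
    have cl: "pureL b \<in> carrier E" "pureR c \<in> carrier E" using b c by (simp_all add: pure_closed)
    let ?x = "\<lambda>i. pureL b \<otimes> kp c i" and ?y = "\<lambda>i. pureR c \<otimes> kp b i"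
    have v: "vec ?x" "vec ?y" using cl kp b c by simp_all
    have "h (b \<otimes>\<^sub>A c) = lsum ph (\<lambda>i. ?x i \<oplus> ?y i)"
      using v cl kp b c by (intro heq) (simp_all add: D_add D_mult dA_mult)
    also have "\<dots> = la b (h c) \<oplus>\<^sub>N (ra c (h b) \<ominus>\<^sub>N Ga c (dA b))"
      using lsum_add[OF ph v] lsum_left[OF kp(1)[OF c] b] lsum_right[OF kp(1)[OF b] c] kp(2)[OF b] by (simp add: h_def)
    \<comment> \<open>Of the two terms of \<open>dA b\<close>, the term b \<otimes> 1 contributes
      \<open>la b (ga \<one>\<^sub>A c)\<close>, which is zero by normalisation, and the term 1
      \<otimes> b contributes \<open>ga b c\<close>.\<close>
    also have "Ga c (dA b) = \<ominus>\<^sub>N ga b c"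
      unfolding dA_def using b c gaD
      by (subst lmod_hom_minus[OF Ga(1) E_ab N_ab])
        (simp_all add: Ga(2) pure_closed a_minus_def la_zero la_one)
    finally show ?thesis using b c hc gaD by (simp add: a_minus_def laD raD N.M.a_assoc)
  qed
  ultimately show ?thesis unfolding coboundary_def by (intro exI[of _ h]) simp
qed

end

text \<open>The family \<open>ph0\<close> has the right defects, but its sum need not vanish on the
  kernel of \<open>D\<close>. There the sum is E-linear, so it is determined by its values
  \<open>Y\<close> on the rows of \<open>f\<close>. These values satisfy the equations
  \<open>g\<close>, and exactness provides an E-linear family with the same values, to be
  subtracted.\<close>

lemma coboundary_if_exact:
  assumes ex: exact_at_N and ga: "cocycle ga"
  shows "coboundary ga"
proof -
  note gaD = cocycleD[OF ga]
  define Ga where "Ga c = blift N (\<lambda>a b. la a (ga b c))" for c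
  have bGa: "bilinear_on k A N (\<lambda>a b. la a (ga b c))" if "c \<in> carrier A" for c
    unfolding bilinear_on_def using that by (intro conjI ballI) (simp_all add: gaD laD la_add la_smult)
  have Ga: "Ga c \<in> lmod_hom k E N" if "c \<in> carrier A" for c
    unfolding Ga_def by (rule blift[OF lifts_N bGa[OF that]])
  have Gap: "Ga c (pure a b) = la a (ga b c)" if "a \<in> carrier A" "b \<in> carrier A" "c \<in> carrier A" for a b c
    unfolding Ga_def using blift(2)[OF lifts_N bGa[OF that(3)] that(1,2)] .
  \<comment> \<open>\<open>ph0 i\<close> sends a \<otimes> b to a ga(s_i, b). The cocycle identity
    for the triple (s_i, b, c) computes its defect under right multiplication by
    \<open>c\<close>.\<close>
  define ph0 where "ph0 i = blift N (\<lambda>a b. la a (ga (s i) b))" for i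
  have bph: "bilinear_on k A N (\<lambda>a b. la a (ga (s i) b))" if "i < p" for i
    unfolding bilinear_on_def using s_closed[OF that] by (intro conjI ballI) (simp_all add: gaD laD la_add la_smult)
  have ph0: "ph0 i \<in> lmod_hom k E N" if "i < p" for i
    unfolding ph0_def by (rule blift[OF lifts_N bph[OF that]])
  have ph0p: "ph0 i (pure a b) = la a (ga (s i) b)" if "a \<in> carrier A" "b \<in> carrier A" "i < p" for a b i
    unfolding ph0_def using blift(2)[OF lifts_N bph[OF that(3)] that(1,2)] .
  note hz = lmod_hom_zero[OF _ E_ab N_ab]
  note hm = lmod_hom_minus[OF _ E_ab N_ab]
  have ph0l: "ph0 i (pureL a \<otimes> e) = la a (ph0 i e)" if i: "i < p" and a: "a \<in> carrier A" and e: "e \<in> carrier E" for i a e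
    using e
  proof (induction rule: env_induct)
    case (pure u v)
    thus ?case using i a s_closed by (simp add: pure_mult ph0p la_mult gaD)
  qed (use i a in \<open>simp_all add: pure_closed hz[OF ph0] la_zero E.r_distr lmod_homD[OF ph0] laD\<close>)
  have ph0r: "ph0 i (pureR c \<otimes> e) = ra c (ph0 i e) \<ominus>\<^sub>N Ga c (e \<otimes> ds i)"
    if i: "i < p" and c: "c \<in> carrier A" and e: "e \<in> carrier E" for i c e
    using e
  proof (induction rule: env_induct)
    case zero
    show ?case using i c by (simp add: pure_closed hz[OF ph0] hz[OF Ga] ds_closed ra_zero N.M.minus_eq_zero_iff[THEN iffD2])
  next
    case (pure a b)
    note si = s_closed[OF i]
    have G: "Ga c (pure a b \<otimes> ds i) = la a (la (s i) (ga b c)) \<ominus>\<^sub>N la a (ga (s i \<otimes>\<^sub>A b) c)"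
    proof -
      have "pure a b \<otimes> ds i = pure (a \<otimes>\<^sub>A s i) b \<ominus> pure a (s i \<otimes>\<^sub>A b)"
        using pure si by (simp add: ds_def a_minus_def E.r_distr E.r_minus pure_closed pure_mult)
      thus ?thesis using pure si c by (simp add: hm[OF Ga] pure_closed Gap la_mult gaD)
    qed
    have "ga (s i) (b \<otimes>\<^sub>A c) = ra c (ga (s i) b) \<ominus>\<^sub>N (la (s i) (ga b c) \<ominus>\<^sub>N ga (s i \<otimes>\<^sub>A b) c)"
      using si pure c by (intro N.M.add_eq_solve) (simp_all add: gaD laD raD)
    hence "la a (ga (s i) (b \<otimes>\<^sub>A c)) = la a (ra c (ga (s i) b)) \<ominus>\<^sub>N (la a (la (s i) (ga b c)) \<ominus>\<^sub>N la a (ga (s i \<otimes>\<^sub>A b) c))"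
      using si pure c
      by (simp add: lmod_hom_minus[OF la_hom N_ab N_ab] gaD laD raD)
    thus ?case using si pure c i by (simp add: pure_mult ph0p G la_ra gaD)
  next
    case (add x y)
    thus ?case using i c
      by (simp add: pure_closed E.r_distr E.l_distr lmod_homD[OF ph0] lmod_homD[OF Ga] raD ds_closed
        a_minus_def N.M.minus_add N.M.a_ac)
  qed
  note l0 = Ga Gap ph0 ph0l ph0r
  have mult0: "lsum ph0 (\<lambda>i. e \<otimes> xe i) = act e (lsum ph0 xe)" if "vec xe" "D xe = \<zero>" "e \<in> carrier E" for xe e
    by (rule lsum_mult[OF ga l0 that])
  define Y where "Y l = lsum ph0 (f l)" for l
  have fK: "vec (f l)" "D (f l) = \<zero>" if "l < q" for l
    using f_rel[OF that] f_closed[OF that] by (simp_all add: D_def ds_def)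
  have Yc: "Y l \<in> carrier N" if "l < q" for l unfolding Y_def using lsum_closed[OF ph0 fK(1)[OF that]] .
  have comb: "lsum ph0 (\<lambda>i. \<Oplus>l<q. et l \<otimes> f l i) = (\<Oplus>\<^sub>N l<q. act (et l) (Y l))"
    if "\<forall>l<q. et l \<in> carrier E" for et
  proof -
    have "lsum ph0 (\<lambda>i. \<Oplus>l<q. et l \<otimes> f l i) = (\<Oplus>\<^sub>N l<q. lsum ph0 (\<lambda>i. et l \<otimes> f l i))"
      using that fK(1) by (intro lsum_finsum ph0) auto
    also have "\<dots> = (\<Oplus>\<^sub>N l<q. act (et l) (Y l))"
      using that fK Yc by (intro N.M.finsum_cong') (auto simp: mult0 Y_def actD)
    finally show ?thesis .
  qed
  have "(\<Oplus>\<^sub>N l<q. act (g m l) (Y l)) = \<zero>\<^sub>N" if m: "m < r" for m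
  proof -
    have "lsum ph0 (\<lambda>i. \<Oplus>l<q. g m l \<otimes> f l i) = \<zero>\<^sub>N"
      unfolding lsum_def using m by (intro N.M.add.finprod_one_eqI) (simp add: g_rel hz[OF ph0])
    thus ?thesis using comb[of "g m"] m g_closed by simp
  qed
  then obtain Z where Z: "\<forall>i<p. Z i \<in> carrier N" and YZ: "\<forall>l<q. Y l = (\<Oplus>\<^sub>N i<p. act (f l i) (Z i))"
    using ex Yc unfolding exact_at_N_def by blast
  \<comment> \<open>Being linear for both actions, \<open>ps i\<close> can be subtracted without
    changing any defect.\<close>
  define ps where "ps i e = act e (Z i)" for i e
  have ps: "ps i \<in> lmod_hom k E N" if "i < p" for i unfolding ps_def using Z that by (intro act_hom) simp
  define ph where "ph i e = ph0 i e \<ominus>\<^sub>N ps i e" for i e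
  have ph: "ph i \<in> lmod_hom k E N" if "i < p" for i
    unfolding ph_def by (rule lmod_hom_diff[OF N.module_axioms ph0[OF that] ps[OF that]])
  have phl: "ph i (pureL a \<otimes> e) = la a (ph i e)" if i: "i < p" and a: "a \<in> carrier A" and e: "e \<in> carrier E" for i a e
    using Z that by (simp add: ph_def ph0l ps_def act_mult pure_closed act_left actD lmod_homD[OF ph0]
      lmod_hom_minus[OF la_hom N_ab N_ab])
  have phr: "ph i (pureR c \<otimes> e) = ra c (ph i e) \<ominus>\<^sub>N Ga c (e \<otimes> ds i)"
    if i: "i < p" and c: "c \<in> carrier A" and e: "e \<in> carrier E" for i c e
  proof -
    have "ra c (ph i e) = ra c (ph0 i e) \<ominus>\<^sub>N ra c (ps i e)"
      unfolding ph_def using that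
      by (intro lmod_hom_minus[OF ra_hom N_ab N_ab])
        (simp_all add: lmod_homD[OF ph0] lmod_homD[OF ps])
    moreover have "ph i (pureR c \<otimes> e) = (ra c (ph0 i e) \<ominus>\<^sub>N Ga c (e \<otimes> ds i)) \<ominus>\<^sub>N ra c (ps i e)"
      using Z that by (simp add: ph_def ph0r ps_def act_mult pure_closed act_right actD)
    moreover have "ra c (ps i e) \<in> carrier N" using that by (simp add: raD lmod_homD[OF ps])
    ultimately show ?thesis using that
      by (simp add: a_minus_def N.M.a_ac lmod_homD[OF ph0] lmod_homD[OF Ga] ds_closed raD)
  qed
  have van: "lsum ph xe = \<zero>\<^sub>N" if xe: "vec xe" "D xe = \<zero>" for xe
  proof -
    obtain et where et: "\<forall>l<q. et l \<in> carrier E" "\<forall>i<p. xe i = (\<Oplus>l<q. et l \<otimes> f l i)"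
      using f_span[OF xe(1)] xe(2) unfolding D_def ds_def by blast
    let ?xe = "\<lambda>i. \<Oplus>l<q. et l \<otimes> f l i"
    have v: "vec ?xe" using xe(1) et(2) by simp
    have eq: "lsum ph' xe = lsum ph' ?xe" if "\<And>i. i < p \<Longrightarrow> ph' i \<in> lmod_hom k E N" for ph'
      using et(2) by (intro lsum_cong[OF v that]) simp_all
    have "lsum ps ?xe = (\<Oplus>\<^sub>N l<q. lsum ps (\<lambda>i. et l \<otimes> f l i))"
      using et(1) fK(1) by (intro lsum_finsum ps) auto
    also have "\<dots> = (\<Oplus>\<^sub>N l<q. act (et l) (Y l))"
    proof (rule N.M.finsum_cong'[OF refl])
      show "(\<lambda>l. act (et l) (Y l)) \<in> {..<q} \<rightarrow> carrier N" using et Yc by (auto simp: actD)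
      fix l assume "l \<in> {..<q}"
      hence l: "l < q" by simp
      have "lsum ps (\<lambda>i. et l \<otimes> f l i) = (\<Oplus>\<^sub>N i<p. act (et l) (act (f l i) (Z i)))"
        unfolding lsum_def ps_def using et(1) f_closed Z l by (intro N.M.finsum_cong') (auto simp: act_mult actD)
      also have "\<dots> = act (et l) (\<Oplus>\<^sub>N i<p. act (f l i) (Z i))"
        using et(1) f_closed Z l by (intro act_finsum[symmetric]) (auto simp: actD)
      finally show "lsum ps (\<lambda>i. et l \<otimes> f l i) = act (et l) (Y l)" using YZ l by simp
    qed
    finally have "lsum ps xe = lsum ph0 xe" using eq[OF ps] eq[OF ph0] comb[OF et(1)] by simp
    moreover have "lsum ph xe = lsum ph0 xe \<ominus>\<^sub>N lsum ps xe"
      unfolding lsum_def using xe(1) by (intro N.M.finsum_minus_eqI) (simp_all add: lmod_homD[OF ph0] lmod_homD[OF ps] ph_def)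
    ultimately show ?thesis using lsum_closed[OF ph0 xe(1)] by (simp add: N.M.minus_eq_zero_iff)
  qed
  show ?thesis by (rule coboundary_if_vanishing[OF ga Ga Gap ph phl phr van])
qed

section \<open>From coboundaries to exactness\<close>

definition vec_module :: "('k, nat \<Rightarrow> 'e) module" where
  "vec_module = \<lparr>carrier = {xe. vec xe \<and> (\<forall>i. \<not> i < p \<longrightarrow> xe i = \<zero>)}, monoid.mult = undefined, one = undefined,
    zero = \<lambda>_. \<zero>, add = \<lambda>xe xe' i. xe i \<oplus> xe' i, smult = \<lambda>c xe i. c \<odot> xe i\<rparr>"

lemma vec_module_simps:
  "xe \<in> carrier vec_module \<longleftrightarrow> vec xe \<and> (\<forall>i. \<not> i < p \<longrightarrow> xe i = \<zero>)"
  "\<zero>\<^sub>vec_module = (\<lambda>_. \<zero>)" "xe \<oplus>\<^sub>vec_module xe' = (\<lambda>i. xe i \<oplus> xe' i)"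
  "c \<odot>\<^sub>vec_module xe = (\<lambda>i. c \<odot> xe i)"
  by (simp_all add: vec_module_def)

lemma vec_module_vals: "xe \<in> carrier vec_module \<Longrightarrow> xe i \<in> carrier E"
  by (cases "i < p") (simp_all add: vec_module_simps)

lemma vec_module_module: "module k vec_module"
proof (rule moduleI)
  show "abelian_group vec_module"
  proof (rule abelian_groupI)
    fix x assume x: "x \<in> carrier vec_module"
    show "\<exists>y\<in>carrier vec_module. y \<oplus>\<^sub>vec_module x = \<zero>\<^sub>vec_module"
      using vec_module_vals[OF x] x
      by (intro bexI[of _ "\<lambda>i. \<ominus> x i"]) (simp_all add: vec_module_simps E.l_neg)
  qed (use vec_module_vals in \<open>simp_all add: vec_module_simps(2-) E.a_ac\<close>, simp_all add: vec_module_simps)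
qed (use vec_module_vals in \<open>simp_all add: vec_module_simps(2-) E.smult_l_distr E.smult_r_distr E.smult_assoc1 A.R.cring_axioms\<close>,
     simp_all add: vec_module_simps)

text \<open>Every \<open>dA a\<close> lies in the image of the k-linear map \<open>D\<close>, so a
  generalised inverse of \<open>D\<close> gives preimages that depend linearly on \<open>a\<close>.
  At the unit the preimage is zero because \<open>dA \<one>\<^sub>A\<close> is.\<close>

lemma linear_section_exists:
  "\<exists>kp. (\<forall>a\<in>carrier A. vec (kp a) \<and> D (kp a) = dA a) \<and>
     (\<forall>i<p. (\<lambda>a. kp a i) \<in> lmod_hom k A E) \<and> (\<forall>i. kp \<one>\<^sub>A i = \<zero>)"
proof -
  have "D \<in> lmod_hom k vec_module E"
    by (rule lmod_homI) (simp_all add: vec_module_simps D_closed D_add D_smult)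
  from linear_generalized_inverse[OF field_k vec_module_module E.module_axioms this]
  obtain gi where gi: "gi \<in> lmod_hom k E vec_module" "\<forall>w\<in>carrier vec_module. D (gi (D w)) = D w" by (elim exE conjE)
  note gD = lmod_homD[OF gi(1)]
  define kp where "kp a = gi (dA a)" for a
  have "vec (kp a) \<and> D (kp a) = dA a" if a: "a \<in> carrier A" for a
  proof -
    obtain xe where xe: "vec xe" "D xe = dA a" using dA_in_range[OF a] by blast
    let ?w = "\<lambda>i. if i < p then xe i else \<zero>"
    have w: "?w \<in> carrier vec_module" using xe by (simp add: vec_module_simps)
    have "D ?w = D xe" unfolding D_def using xe by (intro E.M.finsum_cong') (auto simp: ds_closed)
    hence "D (kp a) = dA a" using bspec[OF gi(2) w] xe by (simp add: kp_def)
    moreover have "kp a \<in> carrier vec_module" unfolding kp_def by (rule gD(1)[OF dA_closed[OF a]])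
    ultimately show ?thesis by (simp add: vec_module_simps)
  qed
  moreover have "(\<lambda>a. kp a i) \<in> lmod_hom k A E" if "i < p" for i
  proof (rule lmod_homI)
    fix x assume x: "x \<in> carrier A"
    show "kp x i \<in> carrier E" using gD(1)[OF dA_closed[OF x]] that by (simp add: kp_def vec_module_simps)
    { fix y assume y: "y \<in> carrier A"
      show "kp (x \<oplus>\<^sub>A y) i = kp x i \<oplus> kp y i"
        using x y by (simp add: kp_def dA_add dA_closed gD vec_module_simps) }
    fix c assume c: "c \<in> carrier k"
    show "kp (c \<odot>\<^sub>A x) i = c \<odot> kp x i"
      using x c by (simp add: kp_def dA_smult dA_closed gD vec_module_simps)
  qed
  moreover have "kp \<one>\<^sub>A i = \<zero>" for i
    using lmod_hom_zero[OF gi(1) E_ab module.axioms(2)[OF vec_module_module]]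
    by (simp add: kp_def dA_one vec_module_simps)
  ultimately show ?thesis by (intro exI[of _ kp]) simp
qed

text \<open>A solution \<open>Y\<close> of the equations \<open>g\<close> defines an E-linear map
  \<open>Ph\<close> from the kernel of \<open>D\<close> to \<open>N\<close> that sends the rows of
  \<open>f\<close> to \<open>Y\<close>. It has to be extended E-linearly to E^p; the values on the
  unit vectors are then \<open>Z\<close>. Composition with a projection onto the kernel of
  \<open>D\<close> gives an extension that respects the right action only. Its defect for the left
  action comes from a cocycle with values in \<open>N\<close>, and a cochain bounding this cocycle
  provides the correction.\<close>

lemma exact_if_coboundary:
  assumes lifts_E: "bilinear_lifts k A E pure E"
    and cob: "\<And>ga. cocycle ga \<Longrightarrow> coboundary ga"
  shows exact_at_N
  unfolding exact_at_N_def
proof (intro allI impI, elim conjE)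
  fix Y assume Y: "\<forall>l<q. Y l \<in> carrier N" and gY: "\<forall>m<r. (\<Oplus>\<^sub>N l<q. act (g m l) (Y l)) = \<zero>\<^sub>N"
  define ev where "ev et = (\<Oplus>\<^sub>N l<q. act (et l) (Y l))" for et
  let ?vq = "\<lambda>et. \<forall>l<q. et l \<in> carrier E"
  define row where "row et i = (\<Oplus>l<q. et l \<otimes> f l i)" for et i
  have row_closed: "row et i \<in> carrier E" if "?vq et" "i < p" for et i
    unfolding row_def using that f_closed by (intro E.finsum_closed) auto
  have row_add: "row (\<lambda>l. et l \<oplus> et' l) i = row et i \<oplus> row et' i" if "?vq et" "?vq et'" "i < p" for et et' i
    unfolding row_def using that f_closed by (intro E.M.finsum_add_eqI) (simp_all add: E.l_distr)
  have row_minus: "row (\<lambda>l. et l \<ominus> et' l) i = row et i \<ominus> row et' i" if "?vq et" "?vq et'" "i < p" for et et' i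
    unfolding row_def using that f_closed by (intro E.M.finsum_minus_eqI) (simp_all add: a_minus_def E.l_distr E.l_minus)
  have row_mult: "row (\<lambda>l. e \<otimes> et l) i = e \<otimes> row et i" if "?vq et" "e \<in> carrier E" "i < p" for et e i
    unfolding row_def using that f_closed by (subst E.finsum_rdistr) (auto simp: E.m_assoc intro!: E.M.finsum_cong')
  have ev_closed: "ev et \<in> carrier N" if "?vq et" for et
    unfolding ev_def using that Y by (intro N.M.finsum_closed) (auto simp: actD)
  have ev_add: "ev (\<lambda>l. et l \<oplus> et' l) = ev et \<oplus>\<^sub>N ev et'" if "?vq et" "?vq et'" for et et'
    unfolding ev_def using that Y by (intro N.M.finsum_add_eqI) (simp_all add: actD)
  have ev_minus: "ev (\<lambda>l. et l \<ominus> et' l) = ev et \<ominus>\<^sub>N ev et'" if "?vq et" "?vq et'" for et et'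
    unfolding ev_def using that Y
    by (intro N.M.finsum_minus_eqI) (simp_all add: actD lmod_hom_minus[OF act_hom E_ab N_ab])
  have ev_mult: "ev (\<lambda>l. e \<otimes> et l) = act e (ev et)" if "?vq et" "e \<in> carrier E" for et e
    unfolding ev_def using that Y by (subst act_finsum) (auto simp: act_mult actD intro!: N.M.finsum_cong')
  \<comment> \<open>\<open>ev et\<close> depends only on the vector \<open>row et\<close>: relations
    between the rows of \<open>f\<close> are combinations of the rows of \<open>g\<close>, and these
    annihilate \<open>Y\<close>.\<close>
  have ev0: "ev et = \<zero>\<^sub>N" if et: "?vq et" and 0: "\<forall>i<p. row et i = \<zero>" for et
  proof -
    obtain th where th: "\<forall>m<r. th m \<in> carrier E" "\<forall>l<q. et l = (\<Oplus>m<r. th m \<otimes> g m l)"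
      using g_span[OF et] 0 unfolding row_def by blast
    have "ev et = (\<Oplus>\<^sub>N l<q. \<Oplus>\<^sub>N m<r. act (th m) (act (g m l) (Y l)))"
      unfolding ev_def
    proof (rule N.M.finsum_cong'[OF refl])
      show "(\<lambda>l. \<Oplus>\<^sub>N m<r. act (th m) (act (g m l) (Y l))) \<in> {..<q} \<rightarrow> carrier N"
        using th(1) Y g_closed by (intro Pi_I N.M.finsum_closed) (simp add: actD)
      fix l assume "l \<in> {..<q}"
      hence l: "l < q" by simp
      have "act (et l) (Y l) = (\<Oplus>\<^sub>N m<r. act (th m \<otimes> g m l) (Y l))"
        using th Y g_closed l finsum_act[of "Y l" "{..<r}" "\<lambda>m. th m \<otimes> g m l"] by simp
      also have "\<dots> = (\<Oplus>\<^sub>N m<r. act (th m) (act (g m l) (Y l)))"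
        using th(1) Y g_closed l by (intro N.M.finsum_cong') (auto simp: act_mult actD)
      finally show "act (et l) (Y l) = (\<Oplus>\<^sub>N m<r. act (th m) (act (g m l) (Y l)))" .
    qed
    also have "\<dots> = (\<Oplus>\<^sub>N m<r. \<Oplus>\<^sub>N l<q. act (th m) (act (g m l) (Y l)))"
      using th(1) Y g_closed by (intro N.M.finsum_swap) (auto simp: actD)
    also have "\<dots> = \<zero>\<^sub>N"
    proof (rule N.M.add.finprod_one_eqI)
      fix m assume "m \<in> {..<r}"
      hence m: "m < r" by simp
      have "(\<Oplus>\<^sub>N l<q. act (th m) (act (g m l) (Y l))) = act (th m) (\<Oplus>\<^sub>N l<q. act (g m l) (Y l))"
        using th(1) Y g_closed m by (intro act_finsum[symmetric]) (auto simp: actD)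
      thus "(\<Oplus>\<^sub>N l<q. act (th m) (act (g m l) (Y l))) = \<zero>\<^sub>N" using gY m th(1) by (simp add: act_zero_r)
    qed
    finally show ?thesis .
  qed
  define pick where "pick xe = (SOME et. ?vq et \<and> (\<forall>i<p. xe i = row et i))" for xe
  define Ph where "Ph xe = ev (pick xe)" for xe
  have pick: "?vq (pick xe)" "\<And>i. i < p \<Longrightarrow> xe i = row (pick xe) i" if "vec xe" "D xe = \<zero>" for xe
  proof -
    have "\<exists>et. ?vq et \<and> (\<forall>i<p. xe i = row et i)"
      using f_span[OF that(1)] that(2) unfolding row_def D_def ds_def by blast
    hence "?vq (pick xe) \<and> (\<forall>i<p. xe i = row (pick xe) i)" unfolding pick_def by (rule someI_ex)
    thus "?vq (pick xe)" "\<And>i. i < p \<Longrightarrow> xe i = row (pick xe) i" by blast+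
  qed
  have Pheq: "Ph xe = ev et" if xe: "vec xe" "D xe = \<zero>" and et: "?vq et" "\<And>i. i < p \<Longrightarrow> xe i = row et i" for xe et
  proof -
    note pk = pick[OF xe]
    have "row (\<lambda>l. pick xe l \<ominus> et l) i = \<zero>" if "i < p" for i
      using row_minus[OF pk(1) et(1) that] pk(2)[OF that] et(2)[OF that] row_closed[OF et(1) that]
      by (metis E.M.minus_eq_zero_iff)
    hence "ev (\<lambda>l. pick xe l \<ominus> et l) = \<zero>\<^sub>N" using pk(1) et(1) by (intro ev0) simp_all
    thus ?thesis using ev_minus[OF pk(1) et(1)] ev_closed[OF pk(1)] ev_closed[OF et(1)]
      by (simp add: Ph_def N.M.minus_eq_zero_iff)
  qed
  let ?K = "\<lambda>xe. vec xe \<and> D xe = \<zero>"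
  have Ph_closed: "Ph xe \<in> carrier N" if "?K xe" for xe
    unfolding Ph_def using ev_closed pick(1) that by simp
  have Ph_cong: "Ph xe = Ph xe'" if "\<And>i. i < p \<Longrightarrow> xe i = xe' i" for xe xe'
  proof -
    have "pick xe = pick xe'" unfolding pick_def using that by simp
    thus ?thesis by (simp add: Ph_def)
  qed
  have K_add: "?K (\<lambda>i. xe i \<oplus> xe' i)" if "?K xe" "?K xe'" for xe xe' using that by (simp add: D_add)
  have K_minus: "?K (\<lambda>i. xe i \<ominus> xe' i)" if "?K xe" "?K xe'" for xe xe'
    using that by (simp add: D_minus E.M.minus_eq_zero_iff)
  have K_mult: "?K (\<lambda>i. e \<otimes> xe i)" if "?K xe" "e \<in> carrier E" for xe e using that by (simp add: D_mult)
  have Ph_add: "Ph (\<lambda>i. xe i \<oplus> xe' i) = Ph xe \<oplus>\<^sub>N Ph xe'" if "?K xe" "?K xe'" for xe xe'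
  proof -
    have "Ph (\<lambda>i. xe i \<oplus> xe' i) = ev (\<lambda>l. pick xe l \<oplus> pick xe' l)"
      using K_add[OF that] pick that pick(2)[symmetric] by (intro Pheq) (simp_all add: row_add)
    thus ?thesis using pick(1) that by (simp add: ev_add Ph_def)
  qed
  have Ph_minus: "Ph (\<lambda>i. xe i \<ominus> xe' i) = Ph xe \<ominus>\<^sub>N Ph xe'" if "?K xe" "?K xe'" for xe xe'
  proof -
    have "Ph (\<lambda>i. xe i \<ominus> xe' i) = ev (\<lambda>l. pick xe l \<ominus> pick xe' l)"
      using K_minus[OF that] pick that pick(2)[symmetric] by (intro Pheq) (simp_all add: row_minus)
    thus ?thesis using pick(1) that by (simp add: ev_minus Ph_def)
  qed
  have Ph_mult: "Ph (\<lambda>i. e \<otimes> xe i) = act e (Ph xe)" if "?K xe" "e \<in> carrier E" for xe e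
  proof -
    have "Ph (\<lambda>i. e \<otimes> xe i) = ev (\<lambda>l. e \<otimes> pick xe l)"
      using K_mult[OF that] pick that pick(2)[symmetric] by (intro Pheq) (simp_all add: row_mult)
    thus ?thesis using pick(1) that by (simp add: ev_mult Ph_def)
  qed
  have Ph_smult: "Ph (\<lambda>i. c \<odot> xe i) = c \<odot>\<^sub>N Ph xe" if "?K xe" "c \<in> carrier k" for xe c
  proof -
    have "Ph (\<lambda>i. c \<odot> xe i) = Ph (\<lambda>i. (c \<odot> \<one>) \<otimes> xe i)"
      using that by (intro Ph_cong) (simp add: E.smult_assoc_l)
    moreover have "act (c \<odot> \<one>) (Ph xe) = c \<odot>\<^sub>N Ph xe"
      using Ph_closed[OF that(1)] that(2) by (simp add: actD pure_one[symmetric] pure_closed act_pure la_one ra_one)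
    ultimately show ?thesis using Ph_mult[OF that(1), of "c \<odot> \<one>"] that(2) by simp
  qed
  have fK: "?K (f l)" "Ph (f l) = Y l" if l: "l < q" for l
  proof -
    show K: "?K (f l)" using f_rel[OF l] f_closed[OF l] by (simp add: D_def ds_def)
    let ?et = "\<lambda>j. if j = l then \<one> else \<zero>"
    have "row ?et i = f l i" if "i < p" for i
    proof -
      have "row ?et i = (\<Oplus>j<q. if j = l then f l i else \<zero>)"
        unfolding row_def using f_closed that l by (intro E.M.finsum_cong') auto
      thus ?thesis using f_closed that l by (simp add: E.M.finsum_delta)
    qed
    hence "Ph (f l) = ev ?et" using K by (intro Pheq) simp_all
    also have "\<dots> = (\<Oplus>\<^sub>N j<q. if j = l then Y l else \<zero>\<^sub>N)"
      unfolding ev_def using Y l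
      by (intro N.M.finsum_cong') (auto simp: act_zero pure_one[symmetric] act_pure la_one ra_one)
    finally show "Ph (f l) = Y l" using Y l by (simp add: N.M.finsum_delta)
  qed
  obtain kp where kp: "\<And>a. a \<in> carrier A \<Longrightarrow> vec (kp a)" "\<And>a. a \<in> carrier A \<Longrightarrow> D (kp a) = dA a"
    and kphom: "\<And>i. i < p \<Longrightarrow> (\<lambda>a. kp a i) \<in> lmod_hom k A E" and kp1: "\<And>i. kp \<one>\<^sub>A i = \<zero>"
    using linear_section_exists by blast
  note kpD = lmod_homD[OF kphom]
  note L = pure_closed[OF _ A.one_closed] and Rr = pure_closed[OF A.one_closed]
  \<comment> \<open>The failure of \<open>kp\<close> to be a derivation. Since \<open>D\<close> maps
    \<open>kp\<close> to the derivation \<open>dA\<close>, it lies in the kernel of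
    \<open>D\<close>, where \<open>Ph\<close> is defined.\<close>
  define z where "z a b i = kp (a \<otimes>\<^sub>A b) i \<ominus> pureL a \<otimes> kp b i \<ominus> pureR b \<otimes> kp a i" for a b i
  have zc: "z a b i \<in> carrier E" if "a \<in> carrier A" "b \<in> carrier A" "i < p" for a b i
    using that kp(1) by (simp add: z_def L Rr)
  have Kz: "?K (z a b)" if ab: "a \<in> carrier A" "b \<in> carrier A" for a b
  proof -
    have v: "vec (kp (a \<otimes>\<^sub>A b))" "vec (\<lambda>i. pureL a \<otimes> kp b i)" "vec (\<lambda>i. pureR b \<otimes> kp a i)"
      using ab kp(1) by (simp_all add: L Rr)
    have "D (z a b) = dA (a \<otimes>\<^sub>A b) \<ominus> pureL a \<otimes> dA b \<ominus> pureR b \<otimes> dA a"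
      unfolding z_def using v ab kp by (simp add: D_minus D_mult L Rr)
    also have "\<dots> = \<zero>"
      using ab by (simp add: dA_mult L Rr dA_closed E.M.add_minus_cancel_left E.M.minus_eq_zero_iff)
    finally show ?thesis using zc ab by simp
  qed
  have z_add_l: "z (a \<oplus>\<^sub>A a') b i = z a b i \<oplus> z a' b i"
    and z_add_r: "z b (a \<oplus>\<^sub>A a') i = z b a i \<oplus> z b a' i"
    if "a \<in> carrier A" "a' \<in> carrier A" "b \<in> carrier A" "i < p" for a a' b i
    using that kp(1) by (simp_all add: z_def A.l_distr A.r_distr kpD pure_add_l pure_add_r L Rr E.l_distr E.r_distr
      a_minus_def E.minus_add E.a_ac)
  have z_smult_l: "z (c \<odot>\<^sub>A a) b i = c \<odot> z a b i"
    and z_smult_r: "z a (c \<odot>\<^sub>A b) i = c \<odot> z a b i"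
    if "c \<in> carrier k" "a \<in> carrier A" "b \<in> carrier A" "i < p" for a b c i
    using that kp(1) by (simp_all add: z_def A.smult_assoc_l A.smult_assoc_r kpD pure_smult_l pure_smult_r L Rr
      E.smult_assoc_l E.smult_assoc_r a_minus_def E.smult_r_distr E.smult_r_minus)
  have z_cocycle: "pureL a \<otimes> z b c i \<oplus> z a (b \<otimes>\<^sub>A c) i = z (a \<otimes>\<^sub>A b) c i \<oplus> pureR c \<otimes> z a b i"
    if abc: "a \<in> carrier A" "b \<in> carrier A" "c \<in> carrier A" and i: "i < p" for a b c i
  proof -
    have kc: "\<And>x. x \<in> carrier A \<Longrightarrow> kp x i \<in> carrier E" using kp(1) i by simp
    have e1: "pureL a \<otimes> z b c i = pureL a \<otimes> kp (b \<otimes>\<^sub>A c) i \<ominus> pureL (a \<otimes>\<^sub>A b) \<otimes> kp c i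
        \<ominus> pure a c \<otimes> kp b i"
      using abc kc by (simp add: z_def a_minus_def E.r_distr E.r_minus L Rr pure_closed pure_mult flip: E.m_assoc)
    have e2: "pureR c \<otimes> z a b i = pureR c \<otimes> kp (a \<otimes>\<^sub>A b) i \<ominus> pure a c \<otimes> kp b i
        \<ominus> pureR (b \<otimes>\<^sub>A c) \<otimes> kp a i"
      using abc kc by (simp add: z_def a_minus_def E.r_distr E.r_minus L Rr pure_closed pure_mult flip: E.m_assoc)
    show ?thesis unfolding e1 e2 unfolding z_def A.m_assoc[OF abc]
      using abc kc by (intro E.M.cocycle_arith) (simp_all add: L Rr pure_closed)
  qed
  \<comment> \<open>The E-linear map \<open>Ph\<close> carries the cocycle \<open>z\<close> to
    \<open>N\<close>.\<close>
  define ga where "ga a b = Ph (z a b)" for a b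
  have "cocycle ga"
    unfolding cocycle_def bilinear_on_def
  proof (intro conjI ballI)
    fix a b assume a: "a \<in> carrier A" and b: "b \<in> carrier A"
    show "ga a b \<in> carrier N" unfolding ga_def by (rule Ph_closed[OF Kz[OF a b]])
    { fix a' assume a': "a' \<in> carrier A"
      have "Ph (z (a \<oplus>\<^sub>A a') b) = Ph (\<lambda>i. z a b i \<oplus> z a' b i)" using a b a' z_add_l by (intro Ph_cong) simp
      thus "ga (a \<oplus>\<^sub>A a') b = ga a b \<oplus>\<^sub>N ga a' b" using Ph_add[OF Kz[OF a b] Kz[OF a' b]] by (simp add: ga_def) }
    { fix a' assume a': "a' \<in> carrier A"
      have "Ph (z a (b \<oplus>\<^sub>A a')) = Ph (\<lambda>i. z a b i \<oplus> z a a' i)" using a b a' z_add_r by (intro Ph_cong) simp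
      thus "ga a (b \<oplus>\<^sub>A a') = ga a b \<oplus>\<^sub>N ga a a'" using Ph_add[OF Kz[OF a b] Kz[OF a a']] by (simp add: ga_def) }
    { fix c assume c: "c \<in> carrier A"
      have "la a (ga b c) \<oplus>\<^sub>N ga a (b \<otimes>\<^sub>A c) = Ph (\<lambda>i. pureL a \<otimes> z b c i \<oplus> z a (b \<otimes>\<^sub>A c) i)"
        using a b c by (subst Ph_add) (simp_all add: K_mult Kz L Ph_mult ga_def act_left Ph_closed)
      also have "\<dots> = Ph (\<lambda>i. z (a \<otimes>\<^sub>A b) c i \<oplus> pureR c \<otimes> z a b i)"
        by (rule Ph_cong) (simp add: z_cocycle a b c)
      also have "\<dots> = ga (a \<otimes>\<^sub>A b) c \<oplus>\<^sub>N ra c (ga a b)"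
        using a b c by (subst Ph_add) (simp_all add: K_mult Kz Rr Ph_mult ga_def act_right Ph_closed)
      finally show "la a (ga b c) \<oplus>\<^sub>N ga a (b \<otimes>\<^sub>A c) = ga (a \<otimes>\<^sub>A b) c \<oplus>\<^sub>N ra c (ga a b)" . }
  next
    fix c a b assume c: "c \<in> carrier k" and a: "a \<in> carrier A" and b: "b \<in> carrier A"
    have "Ph (z (c \<odot>\<^sub>A a) b) = Ph (\<lambda>i. c \<odot> z a b i)" using a b c z_smult_l by (intro Ph_cong) simp
    thus "ga (c \<odot>\<^sub>A a) b = c \<odot>\<^sub>N ga a b" using Ph_smult[OF Kz[OF a b] c] by (simp add: ga_def)
    have "Ph (z a (c \<odot>\<^sub>A b)) = Ph (\<lambda>i. c \<odot> z a b i)" using a b c z_smult_r by (intro Ph_cong) simp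
    thus "ga a (c \<odot>\<^sub>A b) = c \<odot>\<^sub>N ga a b" using Ph_smult[OF Kz[OF a b] c] by (simp add: ga_def)
  next
    fix c assume c: "c \<in> carrier A"
    have zero: "Ph (\<lambda>i. \<zero>) = \<zero>\<^sub>N"
    proof -
      have K0: "?K (\<lambda>i. \<zero>)" by (simp add: D_zero)
      have "Ph (\<lambda>i. \<zero> \<otimes> \<zero>) = act \<zero> (Ph (\<lambda>i. \<zero>))" by (rule Ph_mult[OF K0 E.zero_closed])
      thus ?thesis using Ph_closed[OF K0] by (simp add: act_zero)
    qed
    have "z \<one>\<^sub>A c i = \<zero>" "z c \<one>\<^sub>A i = \<zero>" if "i < p" for i
      using c kp(1)[OF c] that by (simp_all add: z_def kp1 pure_one L Rr a_minus_def E.r_neg)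
    hence "Ph (z \<one>\<^sub>A c) = Ph (\<lambda>i. \<zero>)" "Ph (z c \<one>\<^sub>A) = Ph (\<lambda>i. \<zero>)"
      by - (rule Ph_cong, simp)+
    thus "ga \<one>\<^sub>A c = \<zero>\<^sub>N" "ga c \<one>\<^sub>A = \<zero>\<^sub>N" using zero by (simp_all add: ga_def)
  qed
  from cob[OF this] obtain h where h: "h \<in> lmod_hom k A N"
    and hm: "\<forall>a\<in>carrier A. \<forall>b\<in>carrier A. h (a \<otimes>\<^sub>A b) = la a (h b) \<oplus>\<^sub>N ra b (h a) \<oplus>\<^sub>N ga a b"
    unfolding coboundary_def by (elim exE conjE)
  note gaD = cocycleD[OF \<open>cocycle ga\<close>]
  note hD = lmod_homD[OF h]
  note zE = lmod_hom_zero[OF _ E_ab E_ab]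
  note zN = lmod_hom_zero[OF _ E_ab N_ab]
  \<comment> \<open>\<open>ta\<close> extends \<open>kp\<close> to E \<rightarrow> E^p by a
    \<otimes> b \<mapsto> kp(a) b, linearly for the right action. Then
    \<open>D (ta e) = e \<ominus> nu e\<close>, where \<open>nu\<close> sends a \<otimes> b to 1
    \<otimes> ab and vanishes on the image of \<open>D\<close>; on this image \<open>ta\<close> is
    therefore a section of \<open>D\<close>.\<close>
  define ta where "ta i = blift E (\<lambda>a b. pureR b \<otimes> kp a i)" for i
  have bta: "bilinear_on k A E (\<lambda>a b. pureR b \<otimes> kp a i)" if "i < p" for i
    unfolding bilinear_on_def using kp(1) that
    by (intro conjI ballI) (simp_all add: Rr kpD pure_add_r pure_smult_r E.l_distr E.r_distr E.smult_assoc_l E.smult_assoc_r)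
  have ta: "ta i \<in> lmod_hom k E E" if "i < p" for i unfolding ta_def by (rule blift[OF lifts_E bta[OF that]])
  have tap: "ta i (pure a b) = pureR b \<otimes> kp a i" if "i < p" "a \<in> carrier A" "b \<in> carrier A" for a b i
    unfolding ta_def using blift(2)[OF lifts_E bta[OF that(1)] that(2,3)] .
  define nu where "nu = blift E (\<lambda>a b. pureR (a \<otimes>\<^sub>A b))"
  have bnu: "bilinear_on k A E (\<lambda>a b. pureR (a \<otimes>\<^sub>A b))"
    unfolding bilinear_on_def
    by (intro conjI ballI) (simp_all add: Rr A.l_distr A.r_distr A.smult_assoc_l A.smult_assoc_r pure_add_r pure_smult_r)
  have nu: "nu \<in> lmod_hom k E E" unfolding nu_def by (rule blift[OF lifts_E bnu])
  have nup: "nu (pure a b) = pureR (a \<otimes>\<^sub>A b)" if "a \<in> carrier A" "b \<in> carrier A" for a b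
    unfolding nu_def using blift(2)[OF lifts_E bnu that] .
  \<comment> \<open>\<open>hx\<close> extends \<open>h\<close> to \<open>E\<close>, linearly for the
    right action; \<open>ze\<close> and \<open>G\<close> extend \<open>z\<close> and
    \<open>ga\<close> in their second argument in the same way.\<close>
  define hx where "hx = blift N (\<lambda>a b. ra b (h a))"
  have bh: "bilinear_on k A N (\<lambda>a b. ra b (h a))"
    unfolding bilinear_on_def by (intro conjI ballI) (simp_all add: hD raD ra_add ra_smult)
  have hx: "hx \<in> lmod_hom k E N" unfolding hx_def by (rule blift[OF lifts_N bh])
  have hxp: "hx (pure a b) = ra b (h a)" if "a \<in> carrier A" "b \<in> carrier A" for a b
    unfolding hx_def using blift(2)[OF lifts_N bh that] .
  define ze where "ze a i = blift E (\<lambda>u v. pureR v \<otimes> z a u i)" for a i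
  have bze: "bilinear_on k A E (\<lambda>u v. pureR v \<otimes> z a u i)" if "i < p" "a \<in> carrier A" for a i
    unfolding bilinear_on_def using that
    by (intro conjI ballI) (simp_all add: Rr zc z_add_r z_smult_r pure_add_r pure_smult_r E.l_distr E.r_distr E.smult_assoc_l E.smult_assoc_r)
  have ze: "ze a i \<in> lmod_hom k E E" if "i < p" "a \<in> carrier A" for a i
    unfolding ze_def by (rule blift[OF lifts_E bze[OF that]])
  have zep: "ze a i (pure u v) = pureR v \<otimes> z a u i" if "i < p" "a \<in> carrier A" "u \<in> carrier A" "v \<in> carrier A" for a u v i
    unfolding ze_def using blift(2)[OF lifts_E bze[OF that(1,2)] that(3,4)] .
  define G where "G a = blift N (\<lambda>u v. ra v (ga a u))" for a
  have bG: "bilinear_on k A N (\<lambda>u v. ra v (ga a u))" if "a \<in> carrier A" for a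
    unfolding bilinear_on_def using that by (intro conjI ballI) (simp_all add: gaD raD ra_add ra_smult)
  have G: "G a \<in> lmod_hom k E N" if "a \<in> carrier A" for a unfolding G_def by (rule blift[OF lifts_N bG[OF that]])
  have Gp: "G a (pure u v) = ra v (ga a u)" if "a \<in> carrier A" "u \<in> carrier A" "v \<in> carrier A" for a u v
    unfolding G_def using blift(2)[OF lifts_N bG[OF that(1)] that(2,3)] .
  have tav: "vec (\<lambda>i. ta i e)" if "e \<in> carrier E" for e using that by (simp add: lmod_homD[OF ta])
  have Dta: "D (\<lambda>i. ta i e) = e \<ominus> nu e" if e: "e \<in> carrier E" for e
    using e
  proof (induction rule: env_induct)
    case zero
    have "D (\<lambda>i. ta i \<zero>) = \<zero>" unfolding D_def by (rule E.add.finprod_one_eqI) (simp add: zE[OF ta] ds_closed)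
    moreover have "\<zero> \<ominus> \<zero> = \<zero>" by (simp add: E.M.minus_eq_zero_iff)
    ultimately show ?case by (simp only: zE[OF nu])
  next
    case (pure a b)
    have "D (\<lambda>i. ta i (pure a b)) = D (\<lambda>i. pureR b \<otimes> kp a i)"
      unfolding D_def using pure kp(1) by (intro E.M.finsum_cong') (auto simp: tap ds_closed Rr)
    also have "\<dots> = pureR b \<otimes> dA a" using pure kp by (simp add: D_mult Rr)
    also have "\<dots> = pure a b \<ominus> nu (pure a b)"
      using pure by (simp add: dA_def a_minus_def E.r_distr E.r_minus L Rr pure_mult nup)
    finally show ?case .
  next
    case (add x y)
    have "D (\<lambda>i. ta i (x \<oplus> y)) = D (\<lambda>i. ta i x \<oplus> ta i y)"
      unfolding D_def using add by (intro E.M.finsum_cong') (auto simp: lmod_homD[OF ta] ds_closed)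
    also have "\<dots> = D (\<lambda>i. ta i x) \<oplus> D (\<lambda>i. ta i y)" using add tav by (simp add: D_add)
    finally show ?case using add by (simp add: lmod_homD[OF nu] a_minus_def E.minus_add E.a_ac)
  qed
  have nuD: "nu (D xe) = \<zero>" if xe: "vec xe" for xe
  proof -
    have nuds: "nu (e \<otimes> ds i) = \<zero>" if e: "e \<in> carrier E" and i: "i < p" for e i
      using e
    proof (induction rule: env_induct)
      case (pure a b)
      have "pure a b \<otimes> ds i = pure (a \<otimes>\<^sub>A s i) b \<ominus> pure a (s i \<otimes>\<^sub>A b)"
        using pure s_closed[OF i] by (simp add: ds_def a_minus_def E.r_distr E.r_minus pure_closed pure_mult)
      thus ?case using pure s_closed[OF i]
        by (simp add: lmod_hom_minus[OF nu E_ab E_ab] pure_closed nup A.m_assoc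
          E.M.minus_eq_zero_iff)
    qed (use i in \<open>simp_all add: ds_closed zE[OF nu] E.l_distr lmod_homD[OF nu]\<close>)
    have "nu (D xe) = (\<Oplus>i<p. nu (xe i \<otimes> ds i))"
      unfolding D_def using xe by (intro lmod_hom_finsum[OF nu E_ab E_ab]) (auto simp: ds_closed)
    also have "\<dots> = \<zero>" using xe by (intro E.add.finprod_one_eqI) (simp add: nuds)
    finally show ?thesis .
  qed
  have tar: "ta i (pureR c \<otimes> e) = pureR c \<otimes> ta i e" if i: "i < p" and c: "c \<in> carrier A" and e: "e \<in> carrier E" for i c e
    using e
  proof (induction rule: env_induct)
    case (pure a b)
    thus ?case using i c kp(1) by (simp add: pure_mult tap Rr flip: E.m_assoc)
  qed (use i c in \<open>simp_all add: Rr zE[OF ta] E.r_distr lmod_homD[OF ta]\<close>)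
  \<comment> \<open>On pure tensors this is the definition of \<open>z\<close>. The term with
    \<open>nu e\<close> disappears when \<open>e\<close> lies in the image of \<open>D\<close>,
    which is the case where the identity is applied.\<close>
  have tal: "pureL a \<otimes> ta i e \<ominus> ta i (pureL a \<otimes> e) = \<ominus> (nu e \<otimes> kp a i \<oplus> ze a i e)"
    if i: "i < p" and a: "a \<in> carrier A" and e: "e \<in> carrier E" for i a e
    using e
  proof (induction rule: env_induct)
    case zero
    show ?case using i a kp(1)[OF a] by (simp add: L zE[OF ta] zE[OF nu] zE[OF ze] a_minus_def)
  next
    case (pure u v)
    have kc: "\<And>x. x \<in> carrier A \<Longrightarrow> kp x i \<in> carrier E" using kp(1) i by simp
    have "pureL a \<otimes> ta i (pure u v) = pure a v \<otimes> kp u i"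
      using a i pure kc by (simp add: tap L Rr pure_mult flip: E.m_assoc)
    moreover have "ta i (pureL a \<otimes> pure u v) = pureR v \<otimes> kp (a \<otimes>\<^sub>A u) i"
      using a i pure by (simp add: pure_mult tap)
    moreover have "ze a i (pure u v) = pureR v \<otimes> kp (a \<otimes>\<^sub>A u) i \<ominus> pure a v \<otimes> kp u i \<ominus> pureR (u \<otimes>\<^sub>A v) \<otimes> kp a i"
      using a i pure kc
      by (simp add: zep z_def a_minus_def E.r_distr E.r_minus L Rr pure_mult pure_closed flip: E.m_assoc)
    ultimately show ?case using a pure kc E.M.minus_eq_uminus_add
      by (simp add: nup L Rr pure_closed)
  next
    case (add x y)
    have kc: "kp a i \<in> carrier E" using kp(1) i a by simp
    have c: "pureL a \<otimes> x \<in> carrier E" "pureL a \<otimes> y \<in> carrier E" using add a by (simp_all add: L)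
    have "pureL a \<otimes> ta i (x \<oplus> y) \<ominus> ta i (pureL a \<otimes> (x \<oplus> y)) =
      (pureL a \<otimes> ta i x \<ominus> ta i (pureL a \<otimes> x)) \<oplus> (pureL a \<otimes> ta i y \<ominus> ta i (pureL a \<otimes> y))"
      using i a add(1,2) c by (simp add: lmod_homD[OF ta] L E.r_distr a_minus_def E.minus_add E.a_ac)
    also have "\<dots> = \<ominus> (nu (x \<oplus> y) \<otimes> kp a i \<oplus> ze a i (x \<oplus> y))"
      unfolding add.IH using i a add(1,2) kc by (simp add: lmod_homD[OF nu] lmod_homD[OF ze] E.l_distr E.minus_add E.a_ac)
    finally show ?case .
  qed
  have hxr: "hx (pureR c \<otimes> e) = ra c (hx e)" if c: "c \<in> carrier A" and e: "e \<in> carrier E" for c e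
    using e
  proof (induction rule: env_induct)
    case (pure a b)
    thus ?case using c by (simp add: pure_mult hxp ra_mult hD)
  qed (use c in \<open>simp_all add: Rr zN[OF hx] ra_zero E.r_distr lmod_homD[OF hx] raD\<close>)
  \<comment> \<open>This is the coboundary equation for \<open>h\<close>, extended to
    \<open>E\<close>.\<close>
  have hxl: "hx (pureL a \<otimes> e) = la a (hx e) \<oplus>\<^sub>N act (nu e) (h a) \<oplus>\<^sub>N G a e" if a: "a \<in> carrier A" and e: "e \<in> carrier E" for a e
    using e
  proof (induction rule: env_induct)
    case zero
    thus ?case using a by (simp add: L zN[OF hx] la_zero zE[OF nu] act_zero hD zN[OF G])
  next
    case (pure u v)
    thus ?case using a hm by (simp add: pure_mult hxp nup Gp act_right hD raD laD gaD ra_mult la_ra)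
  next
    case (add x y)
    thus ?case using a by (simp add: L E.r_distr lmod_homD[OF hx] laD lmod_homD[OF nu] actD hD lmod_homD[OF G] N.M.a_ac)
  qed
  \<comment> \<open>\<open>Ph\<close> carries the extension of \<open>z\<close> to the extension of
    \<open>ga\<close>, since it respects the right action.\<close>
  have zeK: "?K (\<lambda>i. ze a i e) \<and> Ph (\<lambda>i. ze a i e) = G a e" if a: "a \<in> carrier A" and e: "e \<in> carrier E" for a e
    using e
  proof (induction rule: env_induct)
    case zero
    have K0: "?K (\<lambda>i. \<zero>)" by (simp add: D_zero)
    have eq: "\<And>i. i < p \<Longrightarrow> ze a i \<zero> = \<zero>" using a by (simp add: zE[OF ze])
    have "D (\<lambda>i. ze a i \<zero>) = D (\<lambda>i. \<zero>)" unfolding D_def by (rule E.M.finsum_cong') (auto simp: eq ds_closed)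
    moreover have "Ph (\<lambda>i. ze a i \<zero>) = Ph (\<lambda>i. \<zero> \<otimes> \<zero>)" using eq by (intro Ph_cong) simp
    moreover have "Ph (\<lambda>i. \<zero> \<otimes> \<zero>) = act \<zero> (Ph (\<lambda>i. \<zero>))" by (rule Ph_mult[OF K0 E.zero_closed])
    ultimately show ?case using eq a Ph_closed[OF K0] by (simp add: D_zero zN[OF G] act_zero)
  next
    case (pure u v)
    have eq: "\<And>i. i < p \<Longrightarrow> ze a i (pure u v) = pureR v \<otimes> z a u i" using a pure by (simp add: zep)
    have K1: "?K (\<lambda>i. pureR v \<otimes> z a u i)" using a pure by (intro K_mult Kz Rr)
    have "D (\<lambda>i. ze a i (pure u v)) = D (\<lambda>i. pureR v \<otimes> z a u i)"
      unfolding D_def using K1 by (intro E.M.finsum_cong') (auto simp: eq ds_closed)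
    moreover have "Ph (\<lambda>i. ze a i (pure u v)) = Ph (\<lambda>i. pureR v \<otimes> z a u i)" by (rule Ph_cong[OF eq])
    moreover have "Ph (\<lambda>i. pureR v \<otimes> z a u i) = act (pureR v) (Ph (z a u))"
      using a pure by (intro Ph_mult Kz Rr)
    ultimately show ?case using K1 eq a pure gaD by (simp add: Gp act_right ga_def[symmetric])
  next
    case (add x y)
    have eq: "\<And>i. i < p \<Longrightarrow> ze a i (x \<oplus> y) = ze a i x \<oplus> ze a i y" using a add by (simp add: lmod_homD[OF ze])
    have K1: "?K (\<lambda>i. ze a i x \<oplus> ze a i y)" using add.IH by (intro K_add) simp_all
    have "D (\<lambda>i. ze a i (x \<oplus> y)) = D (\<lambda>i. ze a i x \<oplus> ze a i y)"
      unfolding D_def using K1 by (intro E.M.finsum_cong') (auto simp: eq ds_closed)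
    moreover have "Ph (\<lambda>i. ze a i (x \<oplus> y)) = Ph (\<lambda>i. ze a i x \<oplus> ze a i y)" by (rule Ph_cong[OF eq])
    ultimately show ?case using K1 eq a add by (simp add: Ph_add lmod_homD[OF G])
  qed
  \<comment> \<open>A projection of E^p onto the kernel of \<open>D\<close> that respects the right
    action.\<close>
  define res where "res xe i = xe i \<ominus> ta i (D xe)" for xe i
  have resK: "?K (res xe)" if xe: "vec xe" for xe
  proof -
    have "D (res xe) = D xe \<ominus> (D xe \<ominus> nu (D xe))"
      unfolding res_def using xe tav[OF D_closed[OF xe]] by (simp add: D_minus Dta D_closed)
    also have "\<dots> = \<zero>" using xe D_closed[OF xe] by (simp add: nuD) (simp add: a_minus_def E.r_neg)
    finally show ?thesis using xe tav[OF D_closed[OF xe]] by (simp add: res_def)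
  qed
  \<comment> \<open>Under left multiplication by \<open>a\<close> the summand
    \<open>Ph (res xe)\<close> has the defect \<open>- G a (D xe)\<close> and the summand
    \<open>hx (D xe)\<close> has the defect \<open>G a (D xe)\<close>. The sum is therefore
    E-linear, and it agrees with \<open>Ph\<close> on the kernel of \<open>D\<close>.\<close>
  define Ph' where "Ph' xe = Ph (res xe) \<oplus>\<^sub>N hx (D xe)" for xe
  have Ph'c: "Ph' xe \<in> carrier N" if "vec xe" for xe
    unfolding Ph'_def using Ph_closed[OF resK[OF that]] D_closed[OF that] by (simp add: lmod_homD[OF hx])
  have Ph'_add: "Ph' (\<lambda>i. xe i \<oplus> xe' i) = Ph' xe \<oplus>\<^sub>N Ph' xe'" if xe: "vec xe" "vec xe'" for xe xe'
  proof -
    have "Ph (res (\<lambda>i. xe i \<oplus> xe' i)) = Ph (\<lambda>i. res xe i \<oplus> res xe' i)"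
      using xe by (intro Ph_cong) (simp add: res_def D_add D_closed lmod_homD[OF ta] a_minus_def E.minus_add E.a_ac)
    also have "\<dots> = Ph (res xe) \<oplus>\<^sub>N Ph (res xe')" by (rule Ph_add[OF resK[OF xe(1)] resK[OF xe(2)]])
    finally show ?thesis using xe Ph_closed[OF resK[OF xe(1)]] Ph_closed[OF resK[OF xe(2)]]
      by (simp add: Ph'_def D_add D_closed lmod_homD[OF hx] N.M.a_ac)
  qed
  have Ph'_right: "Ph' (\<lambda>i. pureR c \<otimes> xe i) = ra c (Ph' xe)" if c: "c \<in> carrier A" and xe: "vec xe" for c xe
  proof -
    have "Ph (res (\<lambda>i. pureR c \<otimes> xe i)) = Ph (\<lambda>i. pureR c \<otimes> res xe i)"
      using c xe by (intro Ph_cong) (simp add: res_def D_mult Rr D_closed tar lmod_homD[OF ta] a_minus_def E.r_distr E.r_minus)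
    also have "\<dots> = ra c (Ph (res xe))"
      using Ph_mult[OF resK[OF xe] Rr[OF c]] Ph_closed[OF resK[OF xe]] c by (simp add: act_right)
    finally show ?thesis using c xe Ph_closed[OF resK[OF xe]]
      by (simp add: Ph'_def D_mult Rr hxr D_closed raD lmod_homD[OF hx])
  qed
  have Ph'_left: "Ph' (\<lambda>i. pureL a \<otimes> xe i) = la a (Ph' xe)" if a: "a \<in> carrier A" and xe: "vec xe" for a xe
  proof -
    note Dc = D_closed[OF xe]
    have Ka: "?K (\<lambda>i. pureL a \<otimes> res xe i)" using K_mult[OF resK[OF xe] L[OF a]] .
    have "Ph (res (\<lambda>i. pureL a \<otimes> xe i)) = Ph (\<lambda>i. pureL a \<otimes> res xe i \<ominus> ze a i (D xe))"
    proof (rule Ph_cong)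
      fix i assume i: "i < p"
      have t: "ta i (D xe) \<in> carrier E" "ze a i (D xe) \<in> carrier E" "ta i (pureL a \<otimes> D xe) \<in> carrier E" "xe i \<in> carrier E" "kp a i \<in> carrier E"
        using i a Dc xe kp(1)[OF a] by (simp_all add: lmod_homD[OF ta] lmod_homD[OF ze] L)
      have "pureL a \<otimes> ta i (D xe) \<ominus> ta i (pureL a \<otimes> D xe) = \<ominus> ze a i (D xe)"
        unfolding tal[OF i a Dc] using t by (simp add: nuD[OF xe])
      hence "\<ominus> ta i (pureL a \<otimes> D xe) = \<ominus> (pureL a \<otimes> ta i (D xe)) \<oplus> \<ominus> ze a i (D xe)"
        using t L[OF a] by (metis E.M.r_neg1 E.a_inv_closed E.m_closed a_minus_def)
      thus "res (\<lambda>i. pureL a \<otimes> xe i) i = pureL a \<otimes> res xe i \<ominus> ze a i (D xe)"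
        using t L[OF a] xe by (simp add: res_def D_mult a_minus_def E.r_distr E.r_minus E.a_assoc)
    qed
    also have "\<dots> = la a (Ph (res xe)) \<ominus>\<^sub>N G a (D xe)"
      using Ph_minus[OF Ka conjunct1[OF zeK[OF a Dc]]] zeK[OF a Dc] Ph_mult[OF resK[OF xe] L[OF a]] Ph_closed[OF resK[OF xe]] a
      by (simp add: act_left)
    finally have "Ph' (\<lambda>i. pureL a \<otimes> xe i) = (la a (Ph (res xe)) \<ominus>\<^sub>N G a (D xe)) \<oplus>\<^sub>N (la a (hx (D xe)) \<oplus>\<^sub>N G a (D xe))"
      using a xe Dc by (simp add: Ph'_def D_mult L hxl nuD act_zero hD laD lmod_homD[OF hx])
    also have "\<dots> = la a (Ph (res xe)) \<oplus>\<^sub>N la a (hx (D xe))"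
    proof -
      have c: "la a (Ph (res xe)) \<in> carrier N" "G a (D xe) \<in> carrier N" "la a (hx (D xe)) \<in> carrier N"
        using a Ph_closed[OF resK[OF xe]] Dc by (simp_all add: laD lmod_homD[OF hx] lmod_homD[OF G])
      show ?thesis using c N.M.a_comm[of "la a (hx (D xe))" "G a (D xe)"] by (simp add: a_minus_def N.M.a_assoc N.M.r_neg1)
    qed
    finally show ?thesis using a Ph_closed[OF resK[OF xe]] Dc by (simp add: Ph'_def laD lmod_homD[OF hx])
  qed
  have Ph'_cong: "Ph' xe = Ph' xe'" if "vec xe'" "\<And>i. i < p \<Longrightarrow> xe i = xe' i" for xe xe'
  proof -
    have "D xe = D xe'" unfolding D_def using that by (intro E.M.finsum_cong') (auto simp: ds_closed)
    moreover have "Ph (res xe) = Ph (res xe')" using that \<open>D xe = D xe'\<close> by (intro Ph_cong) (simp add: res_def)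
    ultimately show ?thesis by (simp add: Ph'_def)
  qed
  have Ph'_mult: "Ph' (\<lambda>i. e \<otimes> xe i) = act e (Ph' xe)" if xe: "vec xe" and e: "e \<in> carrier E" for e xe
    using e
  proof (induction rule: env_induct)
    case zero
    have 0: "Ph' (\<lambda>i. \<zero>) \<oplus>\<^sub>N Ph' (\<lambda>i. \<zero>) = Ph' (\<lambda>i. \<zero>)" using Ph'_add[of "\<lambda>i. \<zero>" "\<lambda>i. \<zero>"] by simp
    have "Ph' (\<lambda>i. \<zero> \<otimes> xe i) = Ph' (\<lambda>i. \<zero>)" using xe by (intro Ph'_cong) simp_all
    thus ?case using 0 Ph'c[of "\<lambda>i. \<zero>"] Ph'c[OF xe] by (simp add: act_zero)
  next
    case (pure a b)
    have v: "vec (\<lambda>i. pureR b \<otimes> xe i)" using pure xe by (simp add: Rr)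
    have "Ph' (\<lambda>i. pure a b \<otimes> xe i) = Ph' (\<lambda>i. pureL a \<otimes> (pureR b \<otimes> xe i))"
      using pure xe v by (intro Ph'_cong) (simp_all add: pure_split[of a b] E.m_assoc L Rr)
    thus ?case using pure xe v Ph'c[OF xe] by (simp add: Ph'_left Ph'_right act_pure)
  next
    case (add x y)
    have v: "vec (\<lambda>i. x \<otimes> xe i)" "vec (\<lambda>i. y \<otimes> xe i)" using add xe by simp_all
    have "Ph' (\<lambda>i. (x \<oplus> y) \<otimes> xe i) = Ph' (\<lambda>i. x \<otimes> xe i \<oplus> y \<otimes> xe i)"
      using add xe v by (intro Ph'_cong) (simp_all add: E.l_distr)
    thus ?case using Ph'_add[OF v] add Ph'c[OF xe] by (simp add: actD)
  qed
  let ?u = "\<lambda>j i. if i = j then \<one> else \<zero>"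
  have vu: "vec (?u j)" for j by simp
  have Ph'_expand: "Ph' xe = (\<Oplus>\<^sub>N j<p. act (xe j) (Ph' (?u j)))" if xe: "vec xe" for xe
  proof -
    have step: "Ph' (\<lambda>i. if i < n then xe i else \<zero>) = (\<Oplus>\<^sub>N j<n. act (xe j) (Ph' (?u j)))" if "n \<le> p" for n
      using that
    proof (induction n)
      case 0
      have "Ph' (\<lambda>i. \<zero>) = Ph' (\<lambda>i. \<zero> \<otimes> ?u 0 i)" by (rule Ph'_cong) simp_all
      also have "\<dots> = \<zero>\<^sub>N" using Ph'_mult[OF vu[of 0] E.zero_closed] Ph'c[OF vu[of 0]] by (simp add: act_zero)
      finally show ?case by simp
    next
      case (Suc n)
      have v: "vec (\<lambda>i. if i < n then xe i else \<zero>)" "vec (\<lambda>i. xe n \<otimes> ?u n i)" using xe Suc.prems by simp_all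
      have xn: "xe n \<in> carrier E" using xe Suc.prems by simp
      have "Ph' (\<lambda>i. if i < Suc n then xe i else \<zero>) = Ph' (\<lambda>i. (if i < n then xe i else \<zero>) \<oplus> xe n \<otimes> ?u n i)"
        using v xn xe by (intro Ph'_cong) (auto simp: less_Suc_eq)
      also have "\<dots> = (\<Oplus>\<^sub>N j<n. act (xe j) (Ph' (?u j))) \<oplus>\<^sub>N act (xe n) (Ph' (?u n))"
        using Ph'_add[OF v] Ph'_mult[OF vu xn] Suc by simp
      also have "\<dots> = (\<Oplus>\<^sub>N j\<in>{..<Suc n}. act (xe j) (Ph' (?u j)))"
      proof -
        have c: "\<And>j. j < Suc n \<Longrightarrow> act (xe j) (Ph' (?u j)) \<in> carrier N" using xe Suc.prems Ph'c[OF vu] by (simp add: actD)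
        hence "(\<Oplus>\<^sub>N j<n. act (xe j) (Ph' (?u j))) \<in> carrier N" by (intro N.M.finsum_closed) auto
        thus ?thesis unfolding lessThan_Suc using c by (subst N.M.finsum_insert) (auto simp: N.M.a_comm)
      qed
      finally show ?case .
    qed
    have "Ph' (\<lambda>i. if i < p then xe i else \<zero>) = Ph' xe" using xe by (intro Ph'_cong) simp_all
    thus ?thesis using step[of p] by simp
  qed
  show "\<exists>Z. (\<forall>i<p. Z i \<in> carrier N) \<and> (\<forall>l<q. Y l = (\<Oplus>\<^sub>N i<p. act (f l i) (Z i)))"
  proof (intro exI[of _ "\<lambda>j. Ph' (?u j)"] conjI allI impI)
    show "Ph' (?u i) \<in> carrier N" for i by (rule Ph'c[OF vu])
    fix l assume l: "l < q"
    have v: "vec (f l)" and D0: "D (f l) = \<zero>" using fK(1)[OF l] by simp_all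
    have "Ph (res (f l)) = Ph (f l)"
      using v by (intro Ph_cong) (simp add: res_def D0 zE[OF ta] a_minus_def)
    hence "Ph' (f l) = Y l" using fK(2)[OF l] Y l by (simp add: Ph'_def D0 zN[OF hx])
    thus "Y l = (\<Oplus>\<^sub>N i<p. act (f l i) (Ph' (?u i)))" using Ph'_expand[OF v] by simp
  qed
qed

end

subsection \<open>Coherent algebras\<close>

lemma free_module_simps:
  "f \<in> carrier (free_module R V) \<longleftrightarrow> range f \<subseteq> carrier R \<and> finite (msupp R f) \<and> msupp R f \<subseteq> V"
  "\<zero>\<^bsub>free_module R V\<^esub> = (\<lambda>_. \<zero>\<^sub>R)" "f \<oplus>\<^bsub>free_module R V\<^esub> g = (\<lambda>x. f x \<oplus>\<^sub>R g x)"
  "c \<odot>\<^bsub>free_module R V\<^esub> f = (\<lambda>x. c \<otimes>\<^sub>R f x)"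
  by (simp_all add: free_module_def)

lemma free_module_finite_iff:
  assumes "finite V" "\<zero>\<^sub>R \<in> carrier R"
  shows "f \<in> carrier (free_module R V) \<longleftrightarrow> (\<forall>i\<in>V. f i \<in> carrier R) \<and> (\<forall>i. i \<notin> V \<longrightarrow> f i = \<zero>\<^sub>R)"
proof
  assume "f \<in> carrier (free_module R V)"
  thus "(\<forall>i\<in>V. f i \<in> carrier R) \<and> (\<forall>i. i \<notin> V \<longrightarrow> f i = \<zero>\<^sub>R)"
    by (auto simp: free_module_simps msupp_def)
next
  assume f: "(\<forall>i\<in>V. f i \<in> carrier R) \<and> (\<forall>i. i \<notin> V \<longrightarrow> f i = \<zero>\<^sub>R)"
  have "f i \<in> carrier R" for i using f assms(2) by (cases "i \<in> V") simp_all
  moreover have "msupp R f \<subseteq> V" using f by (auto simp: msupp_def)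
  ultimately show "f \<in> carrier (free_module R V)" using finite_subset[OF _ assms(1)] by (auto simp: free_module_simps)
qed

lemma free_module_val: "f \<in> carrier (free_module R V) \<Longrightarrow> f i \<in> carrier R"
  by (auto simp: free_module_simps)

context ring
begin

lemma free_module_abelian_group: "abelian_group (free_module R V)"
proof (rule abelian_groupI)
  fix f g assume f: "f \<in> carrier (free_module R V)" and g: "g \<in> carrier (free_module R V)"
  have "msupp R (\<lambda>x. f x \<oplus> g x) \<subseteq> msupp R f \<union> msupp R g" by (auto simp: msupp_def)
  thus "f \<oplus>\<^bsub>free_module R V\<^esub> g \<in> carrier (free_module R V)"
    using f g free_module_val[OF f] free_module_val[OF g] unfolding free_module_simps
    by (intro conjI image_subsetI finite_subset[of "msupp R (\<lambda>x. f x \<oplus> g x)" "msupp R f \<union> msupp R g"] a_closed) blast+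
  show "f \<oplus>\<^bsub>free_module R V\<^esub> g = g \<oplus>\<^bsub>free_module R V\<^esub> f"
    using free_module_val[OF f] free_module_val[OF g] by (simp add: free_module_simps a_comm)
  fix h assume h: "h \<in> carrier (free_module R V)"
  show "(f \<oplus>\<^bsub>free_module R V\<^esub> g) \<oplus>\<^bsub>free_module R V\<^esub> h = f \<oplus>\<^bsub>free_module R V\<^esub> (g \<oplus>\<^bsub>free_module R V\<^esub> h)"
    using free_module_val[OF f] free_module_val[OF g] free_module_val[OF h] by (simp add: free_module_simps a_assoc)
next
  show "\<zero>\<^bsub>free_module R V\<^esub> \<in> carrier (free_module R V)" by (auto simp: free_module_simps msupp_def)
  fix f assume f: "f \<in> carrier (free_module R V)"
  show "\<zero>\<^bsub>free_module R V\<^esub> \<oplus>\<^bsub>free_module R V\<^esub> f = f"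
    using free_module_val[OF f] by (simp add: free_module_simps)
  have "msupp R (\<lambda>x. \<ominus> f x) \<subseteq> msupp R f" by (auto simp: msupp_def)
  hence "(\<lambda>x. \<ominus> f x) \<in> carrier (free_module R V)"
    using f free_module_val[OF f] unfolding free_module_simps
    by (intro conjI image_subsetI finite_subset[of "msupp R (\<lambda>x. \<ominus> f x)" "msupp R f"] a_inv_closed) blast+
  thus "\<exists>g\<in>carrier (free_module R V). g \<oplus>\<^bsub>free_module R V\<^esub> f = \<zero>\<^bsub>free_module R V\<^esub>"
    using free_module_val[OF f] by (intro bexI[of _ "\<lambda>x. \<ominus> f x"]) (simp_all add: free_module_simps l_neg)
qed

lemma free_module_left_module: "left_module R (free_module R V)"
proof (intro left_module.intro left_module_axioms.intro ring_axioms free_module_abelian_group)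
  fix r f assume r: "r \<in> carrier R" and f: "f \<in> carrier (free_module R V)"
  have "msupp R (\<lambda>x. r \<otimes> f x) \<subseteq> msupp R f" using r by (auto simp: msupp_def)
  thus "r \<odot>\<^bsub>free_module R V\<^esub> f \<in> carrier (free_module R V)"
    using r f free_module_val[OF f] unfolding free_module_simps
    by (intro conjI image_subsetI finite_subset[of "msupp R (\<lambda>x. r \<otimes> f x)" "msupp R f"] m_closed) blast+
qed (simp_all add: free_module_simps(2-) free_module_val l_distr r_distr m_assoc)

lemma row_hom:
  fixes p q :: nat
  assumes W: "\<And>i j. i < p \<Longrightarrow> j < q \<Longrightarrow> W i j \<in> carrier R"
  shows "(\<lambda>xe j. if j < q then (\<Oplus>i<p. xe i \<otimes> W i j) else \<zero>)
    \<in> lmod_hom R (free_module R {..<p}) (free_module R {..<q :: nat})"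
proof (rule lmod_homI)
  fix xe assume x: "xe \<in> carrier (free_module R {..<p})"
  note xv = free_module_val[OF x]
  show "(\<lambda>j. if j < q then (\<Oplus>i<p. xe i \<otimes> W i j) else \<zero>) \<in> carrier (free_module R {..<q})"
    using xv W by (subst free_module_finite_iff) (auto intro!: finsum_closed)
  { fix xe' assume x': "xe' \<in> carrier (free_module R {..<p})"
    note xv' = free_module_val[OF x']
    have "(\<Oplus>i<p. (xe i \<oplus> xe' i) \<otimes> W i j) = (\<Oplus>i<p. xe i \<otimes> W i j) \<oplus> (\<Oplus>i<p. xe' i \<otimes> W i j)"
      if "j < q" for j
      using xv xv' W that by (intro finsum_add_eqI) (simp_all add: l_distr)
    thus "(\<lambda>j. if j < q then (\<Oplus>i<p. (xe \<oplus>\<^bsub>free_module R {..<p}\<^esub> xe') i \<otimes> W i j) else \<zero>) =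
      (\<lambda>j. if j < q then (\<Oplus>i<p. xe i \<otimes> W i j) else \<zero>) \<oplus>\<^bsub>free_module R {..<q}\<^esub>
      (\<lambda>j. if j < q then (\<Oplus>i<p. xe' i \<otimes> W i j) else \<zero>)"
      by (auto simp: free_module_simps fun_eq_iff) }
  fix r assume r: "r \<in> carrier R"
  have "(\<Oplus>i<p. (r \<otimes> xe i) \<otimes> W i j) = r \<otimes> (\<Oplus>i<p. xe i \<otimes> W i j)" if "j < q" for j
    using xv W that r by (subst finsum_rdistr) (auto simp: m_assoc intro!: finsum_cong')
  thus "(\<lambda>j. if j < q then (\<Oplus>i<p. (r \<odot>\<^bsub>free_module R {..<p}\<^esub> xe) i \<otimes> W i j) else \<zero>) =
      r \<odot>\<^bsub>free_module R {..<q}\<^esub> (\<lambda>j. if j < q then (\<Oplus>i<p. xe i \<otimes> W i j) else \<zero>)"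
    using r by (auto simp: free_module_simps fun_eq_iff)
qed

text \<open>Coherence in matrix form: multiplying row vectors by \<open>W\<close> from the right is
  linear for the left module structure, and the rows of \<open>G\<close> are generators of its
  kernel.\<close>

lemma coherent_matrix:
  fixes p q :: nat
  assumes coh: "\<And>(p :: nat) (q :: nat) h. h \<in> lmod_hom R (free_module R {..<p}) (free_module R {..<q}) \<Longrightarrow>
      fg_submodule R (free_module R {..<p}) (a_kernel (free_module R {..<p}) (free_module R {..<q}) h)"
    and W: "\<And>i j. i < p \<Longrightarrow> j < q \<Longrightarrow> W i j \<in> carrier R"
  shows "\<exists>m G. (\<forall>l<m. \<forall>i<p. G l i \<in> carrier R) \<and> (\<forall>l<m. \<forall>j<q. (\<Oplus>i<p. G l i \<otimes> W i j) = \<zero>) \<and>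
    (\<forall>xe. (\<forall>i<p. xe i \<in> carrier R) \<and> (\<forall>j<q. (\<Oplus>i<p. xe i \<otimes> W i j) = \<zero>) \<longrightarrow>
      (\<exists>et. (\<forall>l<m. et l \<in> carrier R) \<and> (\<forall>i<p. xe i = (\<Oplus>l\<in>{..<m :: nat}. et l \<otimes> G l i))))"
proof -
  let ?F = "\<lambda>p :: nat. free_module R {..<p}"
  define h where "h = (\<lambda>xe j. if j < q then (\<Oplus>i<p. xe i \<otimes> W i j) else \<zero>)"
  have "h \<in> lmod_hom R (?F p) (?F q)" unfolding h_def by (rule row_hom[OF W])
  from coh[OF this] obtain S where S: "finite S" "S \<subseteq> carrier (?F p)"
    "lmod_span R (?F p) S = a_kernel (?F p) (?F q) h"
    unfolding fg_submodule_def by (elim exE conjE)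
  obtain xs where xs: "set xs = S" using finite_list[OF S(1)] by blast
  define m where "m = length xs"
  define G where "G l = xs ! l" for l
  have GS: "G l \<in> S" if "l < m" for l using that xs by (auto simp: G_def m_def)
  have GF: "G l \<in> carrier (?F p)" if "l < m" for l using GS[OF that] S(2) by blast
  have Gc: "G l i \<in> carrier R" if "l < m" for l i using free_module_val[OF GF[OF that]] .
  have ker: "xe \<in> a_kernel (?F p) (?F q) h \<longleftrightarrow> xe \<in> carrier (?F p) \<and> (\<forall>j<q. (\<Oplus>i<p. xe i \<otimes> W i j) = \<zero>)" for xe
  proof -
    have "h xe = \<zero>\<^bsub>?F q\<^esub> \<longleftrightarrow> (\<forall>j<q. (\<Oplus>i<p. xe i \<otimes> W i j) = \<zero>)"
      by (auto simp: free_module_simps h_def fun_eq_iff)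
    thus ?thesis unfolding a_kernel_def' by simp
  qed
  have rel: "(\<Oplus>i<p. G l i \<otimes> W i j) = \<zero>" if "l < m" "j < q" for l j
  proof -
    have "\<one> \<odot>\<^bsub>?F p\<^esub> G l \<oplus>\<^bsub>?F p\<^esub> \<zero>\<^bsub>?F p\<^esub> \<in> lmod_span R (?F p) S"
      by (intro lmod_span.step lmod_span.zero GS that one_closed)
    moreover have "\<one> \<odot>\<^bsub>?F p\<^esub> G l \<oplus>\<^bsub>?F p\<^esub> \<zero>\<^bsub>?F p\<^esub> = G l"
      using Gc[OF that(1)] by (simp add: free_module_simps)
    ultimately show ?thesis using that(2) unfolding S(3) ker by simp
  qed
  have sp: "\<exists>et. (\<forall>l<m. et l \<in> carrier R) \<and> (\<forall>i. xe i = (\<Oplus>l<m. et l \<otimes> G l i))"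
    if "xe \<in> lmod_span R (?F p) S" for xe
    using that
  proof induction
    case zero
    have "(\<Oplus>l<m. \<zero> \<otimes> G l i) = \<zero>" for i by (intro add.finprod_one_eqI) (simp add: Gc)
    thus ?case by (intro exI[of _ "\<lambda>_. \<zero>"]) (simp add: free_module_simps)
  next
    case (step r x y)
    obtain et where et: "\<forall>l<m. et l \<in> carrier R" "\<forall>i. y i = (\<Oplus>l<m. et l \<otimes> G l i)" using step.IH by blast
    obtain j where j: "j < m" "x = G j" using step(2) xs by (metis G_def m_def in_set_conv_nth)
    let ?et = "\<lambda>l. (if l = j then r else \<zero>) \<oplus> et l"
    have "(\<Oplus>l<m. ?et l \<otimes> G l i) = r \<otimes> x i \<oplus> y i" for i
    proof -
      have "(\<Oplus>l<m. ?et l \<otimes> G l i) = (\<Oplus>l<m. if l = j then r \<otimes> G j i else \<zero>) \<oplus> (\<Oplus>l<m. et l \<otimes> G l i)"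
        using step(1) et(1) Gc by (intro finsum_add_eqI) (auto simp: l_distr)
      thus ?thesis using et(2) j step(1) Gc by (simp add: finsum_delta)
    qed
    thus ?case using et(1) step(1) by (intro exI[of _ ?et]) (simp add: free_module_simps)
  qed
  have "\<exists>et. (\<forall>l<m. et l \<in> carrier R) \<and> (\<forall>i<p. xe i = (\<Oplus>l<m. et l \<otimes> G l i))"
    if xe: "\<forall>i<p. xe i \<in> carrier R" "\<forall>j<q. (\<Oplus>i<p. xe i \<otimes> W i j) = \<zero>" for xe
  proof -
    let ?x = "\<lambda>i. if i < p then xe i else \<zero>"
    have "(\<Oplus>i<p. ?x i \<otimes> W i j) = \<zero>" if "j < q" for j
    proof -
      have "(\<Oplus>i<p. ?x i \<otimes> W i j) = (\<Oplus>i<p. xe i \<otimes> W i j)"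
        using xe(1) W that by (intro finsum_cong') auto
      thus ?thesis using xe(2) that by simp
    qed
    moreover have "?x \<in> carrier (?F p)" using xe(1) by (subst free_module_finite_iff) auto
    ultimately have "?x \<in> lmod_span R (?F p) S" unfolding S(3) ker by simp
    from sp[OF this] obtain et where e: "\<forall>l<m. et l \<in> carrier R" "\<forall>i. ?x i = (\<Oplus>l<m. et l \<otimes> G l i)" by (elim exE conjE)
    have "xe i = (\<Oplus>l<m. et l \<otimes> G l i)" if "i < p" for i using spec[OF e(2), of i] that by simp
    thus ?thesis using e(1) by (intro exI[of _ et]) simp
  qed
  thus ?thesis using Gc rel by (intro exI[of _ m] exI[of _ G]) simp
qed

end

text \<open>Two syzygy computations: the rows of \<open>f\<close> generate the relations between the
  elements s \<otimes> 1 - 1 \<otimes> s for the generators s of \<open>A\<close>, and the rows of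
  \<open>g\<close> generate the relations between the rows of \<open>f\<close>.\<close>

lemma env_resolution_exists:
  assumes k: "field k" and A: "assoc_algebra k A" and fg: "finitely_generated_algebra k A"
    and coh: "coherent_algebra k A"
  shows "\<exists>p q r s f g. env_resolution k A (enveloping_algebra k A) (tensor_pure k A (opposite_algebra A)) p q r s f g"
proof -
  define E where "E = enveloping_algebra k A"
  define pure where "pure = tensor_pure k A (opposite_algebra A)"
  interpret enveloping k A E pure unfolding E_def pure_def by (rule enveloping_enveloping_algebra[OF k A])
  have cohE: "fg_submodule E (free_module E {..<p}) (a_kernel (free_module E {..<p}) (free_module E {..<q}) h)"
    if "h \<in> lmod_hom E (free_module E {..<p}) (free_module E {..<q})" for p q :: nat and h
    using coh that unfolding coherent_algebra_def Let_def E_def[symmetric] by blast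
  obtain S where S: "finite S" "S \<subseteq> carrier A" "alg_generated k A S = carrier A"
    using fg by (auto simp: finitely_generated_algebra_def)
  obtain xs where xs: "set xs = S" using finite_list[OF S(1)] by blast
  define p where "p = length xs"
  define s where "s i = xs ! i" for i
  have sS: "s ` {..<p} = S" using xs by (auto simp: s_def p_def set_conv_nth)
  have sc: "s i \<in> carrier A" if "i < p" for i using that sS S(2) by blast
  define ds where "ds i = pure (s i) \<one>\<^sub>A \<ominus>\<^sub>E pure \<one>\<^sub>A (s i)" for i
  have dsc: "ds i \<in> carrier E" if "i < p" for i using sc[OF that] by (simp add: ds_def pure_closed)
  \<comment> \<open>The column \<open>ds\<close> is treated as a matrix with a single column, hence
    the index range \<open>j < 1\<close>.\<close>
  have "\<exists>q f. (\<forall>l<q. \<forall>i<p. f l i \<in> carrier E) \<and> (\<forall>l<q. \<forall>j<1::nat. (\<Oplus>\<^sub>E i<p. f l i \<otimes>\<^sub>E ds i) = \<zero>\<^sub>E) \<and>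
    (\<forall>xe. (\<forall>i<p. xe i \<in> carrier E) \<and> (\<forall>j<1::nat. (\<Oplus>\<^sub>E i<p. xe i \<otimes>\<^sub>E ds i) = \<zero>\<^sub>E) \<longrightarrow>
      (\<exists>et. (\<forall>l<q. et l \<in> carrier E) \<and> (\<forall>i<p. xe i = (\<Oplus>\<^sub>E l\<in>{..<q :: nat}. et l \<otimes>\<^sub>E f l i))))"
    by (rule E.coherent_matrix[OF cohE]) (simp_all add: dsc)
  then obtain q f where f: "\<forall>l<q. \<forall>i<p. f l i \<in> carrier E" "\<forall>l<q. \<forall>j<1::nat. (\<Oplus>\<^sub>E i<p. f l i \<otimes>\<^sub>E ds i) = \<zero>\<^sub>E"
    "\<forall>xe. (\<forall>i<p. xe i \<in> carrier E) \<and> (\<forall>j<1::nat. (\<Oplus>\<^sub>E i<p. xe i \<otimes>\<^sub>E ds i) = \<zero>\<^sub>E) \<longrightarrow>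
      (\<exists>et. (\<forall>l<q. et l \<in> carrier E) \<and> (\<forall>i<p. xe i = (\<Oplus>\<^sub>E l\<in>{..<q :: nat}. et l \<otimes>\<^sub>E f l i)))"
    by (elim exE conjE)
  have "\<exists>r g. (\<forall>m<r. \<forall>l<q. g m l \<in> carrier E) \<and> (\<forall>m<r. \<forall>j<p. (\<Oplus>\<^sub>E l<q. g m l \<otimes>\<^sub>E f l j) = \<zero>\<^sub>E) \<and>
    (\<forall>xe. (\<forall>i<q. xe i \<in> carrier E) \<and> (\<forall>j<p. (\<Oplus>\<^sub>E i<q. xe i \<otimes>\<^sub>E f i j) = \<zero>\<^sub>E) \<longrightarrow>
      (\<exists>et. (\<forall>l<r. et l \<in> carrier E) \<and> (\<forall>i<q. xe i = (\<Oplus>\<^sub>E l\<in>{..<r :: nat}. et l \<otimes>\<^sub>E g l i))))"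
    by (rule E.coherent_matrix[OF cohE]) (simp_all add: f)
  then obtain r g where g: "\<forall>m<r. \<forall>l<q. g m l \<in> carrier E" "\<forall>m<r. \<forall>j<p. (\<Oplus>\<^sub>E l<q. g m l \<otimes>\<^sub>E f l j) = \<zero>\<^sub>E"
    "\<forall>xe. (\<forall>i<q. xe i \<in> carrier E) \<and> (\<forall>j<p. (\<Oplus>\<^sub>E i<q. xe i \<otimes>\<^sub>E f i j) = \<zero>\<^sub>E) \<longrightarrow>
      (\<exists>et. (\<forall>l<r. et l \<in> carrier E) \<and> (\<forall>i<q. xe i = (\<Oplus>\<^sub>E l\<in>{..<r :: nat}. et l \<otimes>\<^sub>E g l i)))"
    by (elim exE conjE)
  have "env_resolution k A E pure p q r s f g"
    by (intro env_resolution.intro enveloping_axioms env_resolution_axioms.intro)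
      (use sc sS S(3) f[unfolded ds_def] g in simp_all)
  thus ?thesis unfolding E_def pure_def by (intro exI)
qed

subsection \<open>Matrices and contracting homotopies\<close>

abbreviation mprod where "mprod R I U V i j \<equiv> (\<Oplus>\<^sub>R l\<in>I. U i l \<otimes>\<^sub>R V l j)"

text \<open>Square matrices over an index set that need not be an initial segment of the naturals;
  \<open>mat_algebra\<close> is the case of {..<n}. The homotopy argument computes with
  endomorphisms of the middle term of the complex, whose index set consists of triples.\<close>

definition gmat :: "('k, 'b, 'd) module_scheme \<Rightarrow> 'i set \<Rightarrow> ('k, 'i \<times> 'i \<Rightarrow> 'b) module"
  where "gmat B Q =
    \<lparr>carrier = Q \<times> Q \<rightarrow>\<^sub>E carrier B,
     monoid.mult = \<lambda>M L. \<lambda>(i, j)\<in>Q \<times> Q. \<Oplus>\<^sub>B l\<in>Q. M (i, l) \<otimes>\<^sub>B L (l, j),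
     one = \<lambda>(i, j)\<in>Q \<times> Q. if i = j then \<one>\<^sub>B else \<zero>\<^sub>B,
     zero = \<lambda>_\<in>Q \<times> Q. \<zero>\<^sub>B,
     add = \<lambda>M L. \<lambda>p\<in>Q \<times> Q. M p \<oplus>\<^sub>B L p,
     smult = \<lambda>c M. \<lambda>p\<in>Q \<times> Q. c \<odot>\<^sub>B M p\<rparr>"

lemma mat_algebra_eq_gmat: "mat_algebra B n = gmat B {..<n}"
  by (simp add: mat_algebra_def gmat_def Let_def)

lemma gmat_simps:
  "M \<in> carrier (gmat B Q) \<longleftrightarrow> (\<forall>i\<in>Q. \<forall>j\<in>Q. M (i, j) \<in> carrier B) \<and> M \<in> extensional (Q \<times> Q)"
  "\<lbrakk>i \<in> Q; j \<in> Q\<rbrakk> \<Longrightarrow> (M \<otimes>\<^bsub>gmat B Q\<^esub> L) (i, j) = (\<Oplus>\<^sub>B l\<in>Q. M (i, l) \<otimes>\<^sub>B L (l, j))"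
  "\<lbrakk>i \<in> Q; j \<in> Q\<rbrakk> \<Longrightarrow> \<one>\<^bsub>gmat B Q\<^esub> (i, j) = (if i = j then \<one>\<^sub>B else \<zero>\<^sub>B)"
  "\<lbrakk>i \<in> Q; j \<in> Q\<rbrakk> \<Longrightarrow> \<zero>\<^bsub>gmat B Q\<^esub> (i, j) = \<zero>\<^sub>B"
  "\<lbrakk>i \<in> Q; j \<in> Q\<rbrakk> \<Longrightarrow> (M \<oplus>\<^bsub>gmat B Q\<^esub> L) (i, j) = M (i, j) \<oplus>\<^sub>B L (i, j)"
  "\<lbrakk>i \<in> Q; j \<in> Q\<rbrakk> \<Longrightarrow> (c \<odot>\<^bsub>gmat B Q\<^esub> M) (i, j) = c \<odot>\<^sub>B M (i, j)"
  by (auto simp: gmat_def PiE_iff)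

lemma gmat_extensional:
  "M \<otimes>\<^bsub>gmat B Q\<^esub> L \<in> extensional (Q \<times> Q)" "\<one>\<^bsub>gmat B Q\<^esub> \<in> extensional (Q \<times> Q)" "\<zero>\<^bsub>gmat B Q\<^esub> \<in> extensional (Q \<times> Q)"
  "M \<oplus>\<^bsub>gmat B Q\<^esub> L \<in> extensional (Q \<times> Q)" "c \<odot>\<^bsub>gmat B Q\<^esub> M \<in> extensional (Q \<times> Q)"
  by (simp_all add: gmat_def)

lemma gmat_eqI:
  assumes "M \<in> extensional (Q \<times> Q)" "L \<in> extensional (Q \<times> Q)" "\<And>i j. i \<in> Q \<Longrightarrow> j \<in> Q \<Longrightarrow> M (i, j) = L (i, j)"
  shows "M = L"
  using assms by (auto intro!: extensionalityI)

text \<open>Associativity of matrix products entry by entry, in the rectangular case, where the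
  matrices do not form a ring.\<close>

lemma (in ring) finsum_mult_assoc:
  assumes "finite I" "finite J" "\<And>l. l \<in> I \<Longrightarrow> a l \<in> carrier R" "\<And>l m. l \<in> I \<Longrightarrow> m \<in> J \<Longrightarrow> b l m \<in> carrier R"
    "\<And>m. m \<in> J \<Longrightarrow> c m \<in> carrier R"
  shows "(\<Oplus>m\<in>J. (\<Oplus>l\<in>I. a l \<otimes> b l m) \<otimes> c m) = (\<Oplus>l\<in>I. a l \<otimes> (\<Oplus>m\<in>J. b l m \<otimes> c m))"
proof -
  have "(\<Oplus>l\<in>I. a l \<otimes> b l m) \<otimes> c m = (\<Oplus>l\<in>I. a l \<otimes> (b l m \<otimes> c m))" if "m \<in> J" for m
    using assms that by (subst finsum_ldistr) (auto simp: m_assoc intro!: finsum_cong')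
  hence "(\<Oplus>m\<in>J. (\<Oplus>l\<in>I. a l \<otimes> b l m) \<otimes> c m) = (\<Oplus>m\<in>J. \<Oplus>l\<in>I. a l \<otimes> (b l m \<otimes> c m))"
    using assms by (intro finsum_cong') (auto intro!: finsum_closed)
  also have "\<dots> = (\<Oplus>l\<in>I. \<Oplus>m\<in>J. a l \<otimes> (b l m \<otimes> c m))"
    using assms by (intro finsum_swap) auto
  also have "\<dots> = (\<Oplus>l\<in>I. a l \<otimes> (\<Oplus>m\<in>J. b l m \<otimes> c m))"
    using assms by (intro finsum_cong') (auto simp: finsum_rdistr Pi_iff intro!: finsum_closed)
  finally show ?thesis .
qed

lemma assoc_algebra_gmat:
  fixes B (structure)
  assumes B: "algebra k B" and Q: "finite Q"
  shows "assoc_algebra k (gmat B Q)"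
proof -
  interpret Bc: cring B by (rule algebra.M_cring[OF B])
  interpret B: algebra k B by fact
  let ?M = "gmat B Q"
  note s = gmat_simps gmat_extensional
  have delta: "(\<Oplus>l\<in>Q. (if i = l then \<one> else \<zero>) \<otimes> x l) = x i"
    "(\<Oplus>l\<in>Q. x l \<otimes> (if l = i then \<one> else \<zero>)) = x i" if "i \<in> Q" "\<And>l. l \<in> Q \<Longrightarrow> x l \<in> carrier B" for i x
  proof -
    have "(\<Oplus>l\<in>Q. (if i = l then \<one> else \<zero>) \<otimes> x l) = (\<Oplus>l\<in>Q. if l = i then x i else \<zero>)"
      "(\<Oplus>l\<in>Q. x l \<otimes> (if l = i then \<one> else \<zero>)) = (\<Oplus>l\<in>Q. if l = i then x i else \<zero>)"
      using that by (auto intro!: Bc.finsum_cong')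
    thus "(\<Oplus>l\<in>Q. (if i = l then \<one> else \<zero>) \<otimes> x l) = x i"
      "(\<Oplus>l\<in>Q. x l \<otimes> (if l = i then \<one> else \<zero>)) = x i"
      using that Q by (simp_all add: Bc.finsum_delta)
  qed
  have mc: "x \<otimes>\<^sub>?M y \<in> carrier ?M" if "x \<in> carrier ?M" "y \<in> carrier ?M" for x y
    using that by (auto simp: s intro!: Bc.finsum_closed)
  have ab: "abelian_group ?M"
  proof (rule abelian_groupI)
    fix x assume x: "x \<in> carrier ?M"
    show "\<exists>y\<in>carrier ?M. y \<oplus>\<^sub>?M x = \<zero>\<^sub>?M"
      using x by (intro bexI[of _ "\<lambda>p\<in>Q \<times> Q. \<ominus> x p"] gmat_eqI[of _ Q]) (auto simp: s Bc.l_neg)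
  qed (auto simp: s Bc.a_ac intro!: gmat_eqI[of _ Q])
  have "ring ?M"
  proof (rule ringI[OF ab])
    show "Group.monoid ?M"
    proof (rule monoidI)
      fix x y z assume xyz: "x \<in> carrier ?M" "y \<in> carrier ?M" "z \<in> carrier ?M"
      show "x \<otimes>\<^sub>?M y \<otimes>\<^sub>?M z = x \<otimes>\<^sub>?M (y \<otimes>\<^sub>?M z)"
      proof (rule gmat_eqI[of _ Q])
        fix i j assume ij: "i \<in> Q" "j \<in> Q"
        have "(x \<otimes>\<^sub>?M y \<otimes>\<^sub>?M z) (i, j) = (\<Oplus>m\<in>Q. (\<Oplus>l\<in>Q. x (i, l) \<otimes> y (l, m)) \<otimes> z (m, j))"
          using ij xyz by (auto simp: s intro!: Bc.finsum_cong' Bc.finsum_closed)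
        also have "\<dots> = (\<Oplus>l\<in>Q. x (i, l) \<otimes> (\<Oplus>m\<in>Q. y (l, m) \<otimes> z (m, j)))"
          using ij xyz Q by (intro Bc.finsum_mult_assoc) (auto simp: s)
        also have "\<dots> = (x \<otimes>\<^sub>?M (y \<otimes>\<^sub>?M z)) (i, j)"
          using ij xyz by (auto simp: s intro!: Bc.finsum_cong' Bc.finsum_closed)
        finally show "(x \<otimes>\<^sub>?M y \<otimes>\<^sub>?M z) (i, j) = (x \<otimes>\<^sub>?M (y \<otimes>\<^sub>?M z)) (i, j)" .
      qed (simp_all add: s)
    next
      show "\<one>\<^sub>?M \<in> carrier ?M" by (auto simp: s)
      fix x assume x: "x \<in> carrier ?M"
      have "(\<one>\<^sub>?M \<otimes>\<^sub>?M x) (i, j) = x (i, j)" "(x \<otimes>\<^sub>?M \<one>\<^sub>?M) (i, j) = x (i, j)" if ij: "i \<in> Q" "j \<in> Q" for i j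
      proof -
        have "(\<one>\<^sub>?M \<otimes>\<^sub>?M x) (i, j) = (\<Oplus>l\<in>Q. (if i = l then \<one> else \<zero>) \<otimes> x (l, j))"
          "(x \<otimes>\<^sub>?M \<one>\<^sub>?M) (i, j) = (\<Oplus>l\<in>Q. x (i, l) \<otimes> (if l = j then \<one> else \<zero>))"
          using x ij by (auto simp: s intro!: Bc.finsum_cong')
        thus "(\<one>\<^sub>?M \<otimes>\<^sub>?M x) (i, j) = x (i, j)" "(x \<otimes>\<^sub>?M \<one>\<^sub>?M) (i, j) = x (i, j)"
          using x ij delta(1)[of i "\<lambda>l. x (l, j)"] delta(2)[of j "\<lambda>l. x (i, l)"] by (simp_all add: s)
      qed
      thus "\<one>\<^sub>?M \<otimes>\<^sub>?M x = x" "x \<otimes>\<^sub>?M \<one>\<^sub>?M = x" using x by (auto simp: s intro!: gmat_eqI[of _ Q])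
    qed (rule mc)
    fix x y z assume xyz: "x \<in> carrier ?M" "y \<in> carrier ?M" "z \<in> carrier ?M"
    show "(x \<oplus>\<^sub>?M y) \<otimes>\<^sub>?M z = x \<otimes>\<^sub>?M z \<oplus>\<^sub>?M y \<otimes>\<^sub>?M z"
      "z \<otimes>\<^sub>?M (x \<oplus>\<^sub>?M y) = z \<otimes>\<^sub>?M x \<oplus>\<^sub>?M z \<otimes>\<^sub>?M y"
      by (rule gmat_eqI[of _ Q]; (use xyz in \<open>auto simp: s intro!: Bc.finsum_add_eqI Bc.l_distr Bc.r_distr\<close>))+
  qed
  moreover have "module k ?M"
    by (rule moduleI[OF B.R_cring ab])
      (auto simp: s B.smult_l_distr B.smult_r_distr B.smult_assoc1 intro!: gmat_eqI[of _ Q])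
  ultimately show ?thesis
  proof (intro assoc_algebra.intro assoc_algebra_axioms.intro)
    fix c x y assume c: "c \<in> carrier k" and xy: "x \<in> carrier ?M" "y \<in> carrier ?M"
    have "(\<Oplus>l\<in>Q. c \<odot> x (i, l) \<otimes> y (l, j)) = c \<odot> (\<Oplus>l\<in>Q. x (i, l) \<otimes> y (l, j))"
      "(\<Oplus>l\<in>Q. x (i, l) \<otimes> (c \<odot> y (l, j))) = c \<odot> (\<Oplus>l\<in>Q. x (i, l) \<otimes> y (l, j))"
      if "i \<in> Q" "j \<in> Q" for i j
      using that c xy Q assoc_algebra.smult_assoc_r[OF B.is_assoc_algebra]
      by (subst B.finsum_smult_ldistr; auto simp: s B.smult_assoc2 intro!: Bc.finsum_cong')+
    moreover have "(\<Oplus>l\<in>Q. (c \<odot>\<^sub>?M x) (i, l) \<otimes> y (l, j)) = (\<Oplus>l\<in>Q. c \<odot> x (i, l) \<otimes> y (l, j))"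
      "(\<Oplus>l\<in>Q. x (i, l) \<otimes> (c \<odot>\<^sub>?M y) (l, j)) = (\<Oplus>l\<in>Q. x (i, l) \<otimes> (c \<odot> y (l, j)))"
      if "i \<in> Q" "j \<in> Q" for i j
      using that c xy by (auto simp: s intro!: Bc.finsum_cong')
    ultimately show "c \<odot>\<^sub>?M x \<otimes>\<^sub>?M y = c \<odot>\<^sub>?M (x \<otimes>\<^sub>?M y)" "x \<otimes>\<^sub>?M (c \<odot>\<^sub>?M y) = c \<odot>\<^sub>?M (x \<otimes>\<^sub>?M y)"
      by (auto simp: s intro!: gmat_eqI[of _ Q])
  qed
qed

lemma finsum_self_algebra [simp]: "finsum (self_algebra k) h I = finsum k h I"
  by (simp add: finsum_def finprod_def self_algebra_def)

lemma (in cring) free_module_module: "module R (free_module R V)"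
proof -
  interpret F: left_module R "free_module R V" by (rule free_module_left_module)
  show ?thesis
    by (rule moduleI[OF cring_axioms free_module_abelian_group])
      (simp_all add: F.smult_closed F.smult_l_distr F.smult_r_distr F.smult_assoc F.smult_one)
qed

section \<open>Homotopies over a field and over the coordinate ring\<close>

context cring
begin

lemma column_hom:
  assumes P: "finite P" and Q: "finite Q" and W: "\<And>i j. i \<in> Q \<Longrightarrow> j \<in> P \<Longrightarrow> W i j \<in> carrier R"
  shows "(\<lambda>xe i. if i \<in> Q then (\<Oplus>j\<in>P. W i j \<otimes> xe j) else \<zero>) \<in> lmod_hom R (free_module R P) (free_module R Q)"
proof (rule lmod_homI)
  fix xe assume x: "xe \<in> carrier (free_module R P)"
  note xv = free_module_val[OF x]
  show "(\<lambda>i. if i \<in> Q then (\<Oplus>j\<in>P. W i j \<otimes> xe j) else \<zero>) \<in> carrier (free_module R Q)"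
    using xv W Q by (subst free_module_finite_iff) (auto intro!: finsum_closed)
  { fix xe' assume x': "xe' \<in> carrier (free_module R P)"
    note xv' = free_module_val[OF x']
    have "(\<Oplus>j\<in>P. W i j \<otimes> (xe j \<oplus> xe' j)) = (\<Oplus>j\<in>P. W i j \<otimes> xe j) \<oplus> (\<Oplus>j\<in>P. W i j \<otimes> xe' j)"
      if "i \<in> Q" for i
      using xv xv' W that by (intro finsum_add_eqI) (simp_all add: r_distr)
    thus "(\<lambda>i. if i \<in> Q then (\<Oplus>j\<in>P. W i j \<otimes> (xe \<oplus>\<^bsub>free_module R P\<^esub> xe') j) else \<zero>) =
      (\<lambda>i. if i \<in> Q then (\<Oplus>j\<in>P. W i j \<otimes> xe j) else \<zero>) \<oplus>\<^bsub>free_module R Q\<^esub>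
      (\<lambda>i. if i \<in> Q then (\<Oplus>j\<in>P. W i j \<otimes> xe' j) else \<zero>)"
      by (auto simp: free_module_simps fun_eq_iff) }
  fix r assume r: "r \<in> carrier R"
  have "(\<Oplus>j\<in>P. W i j \<otimes> (r \<otimes> xe j)) = r \<otimes> (\<Oplus>j\<in>P. W i j \<otimes> xe j)" if "i \<in> Q" for i
    using xv W that r P by (subst finsum_rdistr) (auto simp: m_lcomm intro!: finsum_cong')
  thus "(\<lambda>i. if i \<in> Q then (\<Oplus>j\<in>P. W i j \<otimes> (r \<odot>\<^bsub>free_module R P\<^esub> xe) j) else \<zero>) =
      r \<odot>\<^bsub>free_module R Q\<^esub> (\<lambda>i. if i \<in> Q then (\<Oplus>j\<in>P. W i j \<otimes> xe j) else \<zero>)"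
    using r by (auto simp: free_module_simps fun_eq_iff)
qed

lemma unit_vector_closed: "finite P \<Longrightarrow> j \<in> P \<Longrightarrow> (\<lambda>i. if i = j then \<one> else \<zero>) \<in> carrier (free_module R P)"
  by (subst free_module_finite_iff) auto

lemma free_module_hom_expand:
  assumes P: "finite P" and h: "h \<in> lmod_hom R (free_module R P) (free_module R Q)"
    and xe: "xe \<in> carrier (free_module R P)"
  shows "h xe i = (\<Oplus>j\<in>P. xe j \<otimes> h (\<lambda>i. if i = j then \<one> else \<zero>) i)"
proof -
  let ?F = "free_module R P" and ?u = "\<lambda>j i. if i = j then \<one> else \<zero>"
  note hD = lmod_homD[OF h]
  note xv = free_module_val[OF xe]
  have uF: "?u j \<in> carrier ?F" if "j \<in> P" for j using unit_vector_closed[OF P that] .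
  have step: "h (\<lambda>i. if i \<in> S then xe i else \<zero>) i = (\<Oplus>j\<in>S. xe j \<otimes> h (?u j) i)" if "S \<subseteq> P" for S
    using finite_subset[OF that P] that
  proof (induction S rule: finite_induct)
    case empty
    have "(\<lambda>i. \<zero>) = \<zero>\<^sub>?F" by (simp add: free_module_simps)
    thus ?case using lmod_hom_zero[OF h free_module_abelian_group free_module_abelian_group]
      by (simp add: free_module_simps)
  next
    case (insert j S)
    let ?S = "\<lambda>i. if i \<in> S then xe i else \<zero>"
    have SF: "?S \<in> carrier ?F" using insert.prems xv P by (subst free_module_finite_iff) auto
    have jP: "j \<in> P" using insert.prems by simp
    have j: "j \<in> P" "xe j \<odot>\<^sub>?F ?u j \<in> carrier ?F"
      by (rule jP) (rule left_module.smult_closed[OF free_module_left_module xv uF[OF jP]])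
    have "(\<lambda>i. if i \<in> insert j S then xe i else \<zero>) = xe j \<odot>\<^sub>?F ?u j \<oplus>\<^sub>?F ?S"
      using insert.hyps xv by (auto simp: free_module_simps fun_eq_iff)
    hence "h (\<lambda>i. if i \<in> insert j S then xe i else \<zero>) i = xe j \<otimes> h (?u j) i \<oplus> h ?S i"
      using hD j SF uF[OF j(1)] xv by (simp add: free_module_simps(3,4))
    moreover have "h (?u j') i \<in> carrier R" if "j' \<in> P" for j' using free_module_val[OF hD(1)[OF uF[OF that]]] .
    ultimately show ?case using insert xv by (subst finsum_insert) auto
  qed
  have "xe i = \<zero>" if "i \<notin> P" for i using xe P that by (subst (asm) free_module_finite_iff) auto
  hence "(\<lambda>i. if i \<in> P then xe i else \<zero>) = xe" by auto
  thus ?thesis using step[of P] by simp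
qed

end

text \<open>Generalised inverses \<open>g1\<close> and \<open>g2\<close> of the two differentials
  give the homotopy. The last condition, U V = 0, and D2 D1 = 0 make the summands D1 U and V D2
  annihilate each other, which is what allows the homotopy to be extended away from the
  point.\<close>

lemma field_homotopy:
  fixes k (structure) and D1 :: "'q \<Rightarrow> 'p \<Rightarrow> 'k" and D2 :: "'s \<Rightarrow> 'q \<Rightarrow> 'k"
  assumes k: "field k" and fin: "finite P" "finite Q" "finite S"
    and D1: "\<And>q p. q \<in> Q \<Longrightarrow> p \<in> P \<Longrightarrow> D1 q p \<in> carrier k" and D2: "\<And>s q. s \<in> S \<Longrightarrow> q \<in> Q \<Longrightarrow> D2 s q \<in> carrier k"
    and ex: "\<And>Y. (\<And>q. q \<in> Q \<Longrightarrow> Y q \<in> carrier k) \<Longrightarrow> (\<And>s. s \<in> S \<Longrightarrow> (\<Oplus>q\<in>Q. D2 s q \<otimes> Y q) = \<zero>) \<Longrightarrow>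
      \<exists>Z. (\<forall>p\<in>P. Z p \<in> carrier k) \<and> (\<forall>q\<in>Q. Y q = (\<Oplus>p\<in>P. D1 q p \<otimes> Z p))"
  shows "\<exists>U V. (\<forall>p\<in>P. \<forall>q\<in>Q. U p q \<in> carrier k) \<and> (\<forall>q\<in>Q. \<forall>s\<in>S. V q s \<in> carrier k) \<and>
    (\<forall>q\<in>Q. \<forall>q'\<in>Q. (\<Oplus>p\<in>P. D1 q p \<otimes> U p q') \<oplus> (\<Oplus>s\<in>S. V q s \<otimes> D2 s q') = (if q = q' then \<one> else \<zero>)) \<and>
    (\<forall>p\<in>P. \<forall>s\<in>S. (\<Oplus>q\<in>Q. U p q \<otimes> V q s) = \<zero>)"
proof -
  interpret k: field k by fact
  let ?P = "free_module k P" and ?Q = "free_module k Q" and ?S = "free_module k S"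
  define d1 where "d1 = (\<lambda>xe i. if i \<in> Q then (\<Oplus>j\<in>P. D1 i j \<otimes> xe j) else \<zero>)"
  define d2 where "d2 = (\<lambda>xe i. if i \<in> S then (\<Oplus>j\<in>Q. D2 i j \<otimes> xe j) else \<zero>)"
  have d1: "d1 \<in> lmod_hom k ?P ?Q" unfolding d1_def by (rule k.column_hom[OF fin(1,2) D1])
  have d2: "d2 \<in> lmod_hom k ?Q ?S" unfolding d2_def by (rule k.column_hom[OF fin(2,3) D2])
  interpret MP: module k ?P by (rule k.free_module_module)
  interpret MQ: module k ?Q by (rule k.free_module_module)
  interpret MS: module k ?S by (rule k.free_module_module)
  obtain g1 where g1: "g1 \<in> lmod_hom k ?Q ?P" "\<forall>w\<in>carrier ?P. d1 (g1 (d1 w)) = d1 w"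
    using linear_generalized_inverse[OF k MP.module_axioms MQ.module_axioms d1] by (elim exE conjE)
  obtain g2 where g2: "g2 \<in> lmod_hom k ?S ?Q" "\<forall>w\<in>carrier ?Q. d2 (g2 (d2 w)) = d2 w"
    using linear_generalized_inverse[OF k MQ.module_axioms MS.module_axioms d2] by (elim exE conjE)
  note hs = lmod_homD[OF d1] lmod_homD[OF d2] lmod_homD[OF g1(1)] lmod_homD[OF g2(1)]
  \<comment> \<open>\<open>g2\<close> is replaced by \<open>g2 d2 g2\<close> in order that
    \<open>t0 d2 t0 = t0\<close>; this makes \<open>s0 t0\<close> zero.\<close>
  define t0 where "t0 Y = g2 (d2 (g2 Y))" for Y
  define s0 where "s0 Y = g1 (Y \<ominus>\<^sub>?Q t0 (d2 Y))" for Y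
  have t0: "t0 \<in> lmod_hom k ?S ?Q" by (rule lmod_homI) (simp_all add: t0_def hs)
  note t0D = lmod_homD[OF t0]
  have s0: "s0 \<in> lmod_hom k ?Q ?P"
    by (rule lmod_homI) (simp_all add: s0_def hs t0D a_minus_def MQ.M.minus_add MQ.M.a_ac MQ.smult_r_distr MQ.smult_r_minus
      flip: lmod_homD(2,3)[OF g1(1)])
  have dtd: "d2 (t0 (d2 Y)) = d2 Y" if "Y \<in> carrier ?Q" for Y using that g2(2) by (simp add: t0_def hs)
  have ker: "d2 (Y \<ominus>\<^sub>?Q t0 (d2 Y)) = \<zero>\<^sub>?S" if "Y \<in> carrier ?Q" for Y
    using that by (simp add: lmod_hom_minus[OF d2 MQ.abelian_group_axioms MS.abelian_group_axioms] t0D hs dtd MS.M.minus_eq_zero_iff)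
  \<comment> \<open>By exactness the part of \<open>Y\<close> that is killed by \<open>d2\<close>
    lies in the image of \<open>d1\<close>, where \<open>d1 g1\<close> is the identity.\<close>
  have ds: "d1 (s0 Y) = Y \<ominus>\<^sub>?Q t0 (d2 Y)" if Y: "Y \<in> carrier ?Q" for Y
  proof -
    let ?Y = "Y \<ominus>\<^sub>?Q t0 (d2 Y)"
    have Yc: "?Y \<in> carrier ?Q" using Y by (simp add: t0D hs)
    have "(\<Oplus>q\<in>Q. D2 s q \<otimes> ?Y q) = \<zero>" if "s \<in> S" for s
      using fun_cong[OF ker[OF Y], of s] that by (simp add: d2_def free_module_simps)
    then obtain Z where Z: "\<forall>p\<in>P. Z p \<in> carrier k" "\<forall>q\<in>Q. ?Y q = (\<Oplus>p\<in>P. D1 q p \<otimes> Z p)"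
      using ex[of ?Y] free_module_val[OF Yc] by blast
    let ?Z = "\<lambda>p. if p \<in> P then Z p else \<zero>"
    have Zc: "?Z \<in> carrier ?P" using Z(1) fin(1) by (subst free_module_finite_iff) auto
    have "?Y = d1 ?Z"
    proof
      fix q
      show "?Y q = d1 ?Z q"
      proof (cases "q \<in> Q")
        case True
        have "(\<Oplus>p\<in>P. D1 q p \<otimes> Z p) = (\<Oplus>p\<in>P. D1 q p \<otimes> ?Z p)"
          using True Z(1) D1 by (intro k.finsum_cong') auto
        thus ?thesis using True Z(2) by (simp add: d1_def)
      next
        case False
        thus ?thesis using Yc fin(2) by (subst (asm) free_module_finite_iff) (auto simp: d1_def)
      qed
    qed
    thus ?thesis using g1(2) Zc by (simp add: s0_def)
  qed
  have st: "s0 (t0 Y) = \<zero>\<^sub>?P" if "Y \<in> carrier ?S" for Y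
  proof -
    have "t0 (d2 (t0 Y)) = t0 Y" using that g2(2) by (simp add: t0_def hs)
    thus ?thesis using that lmod_hom_zero[OF g1(1) MQ.abelian_group_axioms MP.abelian_group_axioms]
      by (simp add: s0_def t0D MQ.M.minus_eq_zero_iff[THEN iffD2])
  qed
  let ?u = "\<lambda>j i. if i = j then \<one> else \<zero>"
  define U where "U p q = s0 (?u q) p" for p q
  define V where "V q s = t0 (?u s) q" for q s
  have uQ: "?u q \<in> carrier ?Q" if "q \<in> Q" for q using k.unit_vector_closed[OF fin(2) that] .
  have uS: "?u q \<in> carrier ?S" if "q \<in> S" for q using k.unit_vector_closed[OF fin(3) that] .
  have Uc: "U p q \<in> carrier k" if "q \<in> Q" for p q unfolding U_def using free_module_val[OF lmod_homD(1)[OF s0 uQ[OF that]]] .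
  have Vc: "V q s \<in> carrier k" if "s \<in> S" for q s unfolding V_def using free_module_val[OF t0D(1)[OF uS[OF that]]] .
  have d2u: "d2 (?u q') s = D2 s q'" if "q' \<in> Q" "s \<in> S" for q' s
  proof -
    have "(\<Oplus>j\<in>Q. D2 s j \<otimes> ?u q' j) = (\<Oplus>j\<in>Q. if j = q' then D2 s q' else \<zero>)"
      using that D2 by (intro k.finsum_cong') auto
    thus ?thesis using that D2 fin(2) by (simp add: d2_def k.finsum_delta)
  qed
  have "(\<Oplus>p\<in>P. D1 q p \<otimes> U p q') \<oplus> (\<Oplus>s\<in>S. V q s \<otimes> D2 s q') = (if q = q' then \<one> else \<zero>)"
    if q: "q \<in> Q" "q' \<in> Q" for q q'
  proof -
    have e1: "(\<Oplus>p\<in>P. D1 q p \<otimes> U p q') = d1 (s0 (?u q')) q" using q by (simp add: d1_def U_def)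
    have e2: "(\<Oplus>s\<in>S. V q s \<otimes> D2 s q') = t0 (d2 (?u q')) q"
      unfolding k.free_module_hom_expand[OF fin(3) t0 lmod_homD(1)[OF d2 uQ[OF q(2)]]] V_def[symmetric]
      using q Vc D2 by (intro k.finsum_cong') (auto simp: d2u k.m_comm)
    have "d1 (s0 (?u q')) \<oplus>\<^sub>?Q t0 (d2 (?u q')) = ?u q'"
      using uQ[OF q(2)] by (simp add: ds a_minus_def MQ.M.a_assoc MQ.M.l_neg t0D hs del: lmod_homD)
    hence e: "(\<lambda>x. d1 (s0 (?u q')) x \<oplus> t0 (d2 (?u q')) x) = ?u q'" by (simp only: free_module_simps(3))
    show ?thesis using fun_cong[OF e, of q] by (simp only: e1 e2)
  qed
  moreover have "(\<Oplus>q\<in>Q. U p q \<otimes> V q s) = \<zero>" if "p \<in> P" "s \<in> S" for p s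
  proof -
    have "s0 (t0 (?u s)) p = (\<Oplus>q\<in>Q. V q s \<otimes> U p q)"
      unfolding k.free_module_hom_expand[OF fin(2) s0 t0D(1)[OF uS[OF that(2)]]] by (simp add: U_def V_def)
    also have "\<dots> = (\<Oplus>q\<in>Q. U p q \<otimes> V q s)"
      using Uc Vc that by (intro k.finsum_cong') (auto simp: k.m_comm)
    finally show ?thesis using st[OF uS[OF that(2)]] by (simp add: free_module_simps)
  qed
  ultimately show ?thesis using Uc Vc by (intro exI[of _ U] exI[of _ V]) simp
qed

text \<open>Gaussian elimination with the entries that are non-zero at the point \<open>x\<close> as pivots.\<close>

lemma left_adjugate_exists:
  fixes R :: "('r, 'c) ring_scheme" (structure) and M :: "'i \<Rightarrow> 'i \<Rightarrow> 'r"
  assumes R: "cring R" and k: "domain k" and x: "x \<in> ring_hom R k" and Q: "finite Q"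
    and M: "\<And>i j. i \<in> Q \<Longrightarrow> j \<in> Q \<Longrightarrow> M i j \<in> carrier R"
    and xM: "\<And>i j. i \<in> Q \<Longrightarrow> j \<in> Q \<Longrightarrow> x (M i j) = (if i = j then \<one>\<^sub>k else \<zero>\<^sub>k)"
  shows "\<exists>M' c. (\<forall>i\<in>Q. \<forall>j\<in>Q. M' i j \<in> carrier R) \<and> c \<in> carrier R \<and> x c \<noteq> \<zero>\<^sub>k \<and>
    (\<forall>i\<in>Q. \<forall>j\<in>Q. (\<Oplus>l\<in>Q. M' i l \<otimes> M l j) = (if i = j then c else \<zero>))"
proof -
  interpret R: cring R by fact
  interpret k: domain k by fact
  interpret x: ring_hom_cring R k x
    by (intro UnivPoly.ring_hom_cringI R k.cring_axioms x)
  \<comment> \<open>\<open>B M'\<close> is the product M' M; the rows of \<open>M'\<close> record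
    the row operations.\<close>
  define B where "B M' i j = (\<Oplus>l\<in>Q. M' i l \<otimes> M l j)" for M' :: "'i \<Rightarrow> 'i \<Rightarrow> 'r" and i j
  have Bc: "B M' i j \<in> carrier R" if "\<forall>i\<in>Q. \<forall>j\<in>Q. M' i j \<in> carrier R" "i \<in> Q" "j \<in> Q" for M' i j
    unfolding B_def using that M by (intro R.finsum_closed) auto
  \<comment> \<open>\<open>F\<close> is the set of columns already cleared. At \<open>x\<close> the
    product stays diagonal with nonzero diagonal entries, so every diagonal entry remains usable as
    a pivot.\<close>
  have "\<exists>M'. (\<forall>i\<in>Q. \<forall>j\<in>Q. M' i j \<in> carrier R) \<and> (\<forall>i\<in>Q. x (B M' i i) \<noteq> \<zero>\<^sub>k) \<and>
      (\<forall>i\<in>Q. \<forall>j\<in>Q. i \<noteq> j \<longrightarrow> x (B M' i j) = \<zero>\<^sub>k) \<and> (\<forall>i\<in>Q. \<forall>j\<in>F. i \<noteq> j \<longrightarrow> B M' i j = \<zero>)"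
    if "F \<subseteq> Q" for F
    using finite_subset[OF that Q] that
  proof (induction F rule: finite_induct)
    case empty
    let ?M = "\<lambda>i j. if j = i then \<one> else \<zero>"
    have "B ?M i j = M i j" if "i \<in> Q" "j \<in> Q" for i j
    proof -
      have "B ?M i j = (\<Oplus>l\<in>Q. if l = i then M i j else \<zero>)"
        unfolding B_def using that M by (intro R.finsum_cong') auto
      thus ?thesis using that M Q by (simp add: R.finsum_delta)
    qed
    thus ?case using xM by (intro exI[of _ ?M]) simp
  next
    case (insert j F)
    then obtain M' where M': "\<forall>i\<in>Q. \<forall>j\<in>Q. M' i j \<in> carrier R" and B1: "\<forall>i\<in>Q. x (B M' i i) \<noteq> \<zero>\<^sub>k"
      and B2: "\<forall>i\<in>Q. \<forall>j\<in>Q. i \<noteq> j \<longrightarrow> x (B M' i j) = \<zero>\<^sub>k" and B3: "\<forall>i\<in>Q. \<forall>j\<in>F. i \<noteq> j \<longrightarrow> B M' i j = \<zero>"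
      by auto
    have j: "j \<in> Q" "F \<subseteq> Q" using insert.prems by auto
    define u where "u = B M' j j"
    have uc: "u \<in> carrier R" unfolding u_def by (rule Bc[OF M' j(1) j(1)])
    \<comment> \<open>Row \<open>i\<close> is multiplied by the pivot \<open>u\<close>, which
      replaces the division of row \<open>j\<close> by it.\<close>
    define N where "N i l = (if i = j then M' j l else u \<otimes> M' i l \<ominus> B M' i j \<otimes> M' j l)" for i l
    have Nc: "\<forall>i\<in>Q. \<forall>l\<in>Q. N i l \<in> carrier R" using M' uc Bc[OF M'] j by (auto simp: N_def)
    have BN: "B N i l = (if i = j then B M' j l else u \<otimes> B M' i l \<ominus> B M' i j \<otimes> B M' j l)" if il: "i \<in> Q" "l \<in> Q" for i l
    proof (cases "i = j")
      case True thus ?thesis by (simp add: B_def N_def)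
    next
      case False
      have c: "B M' i j \<in> carrier R" by (rule Bc[OF M' il(1) j(1)])
      have "B N i l = (\<Oplus>m\<in>Q. u \<otimes> (M' i m \<otimes> M m l)) \<ominus> (\<Oplus>m\<in>Q. B M' i j \<otimes> (M' j m \<otimes> M m l))"
        unfolding B_def[of N] using False M' M il j uc c
        by (intro R.finsum_minus_eqI) (simp_all add: N_def a_minus_def R.l_distr R.l_minus R.m_assoc)
      thus ?thesis using False M' M il j uc c Q unfolding B_def[of M' i l] B_def[of M' j l]
        by (simp add: R.finsum_rdistr Pi_iff)
    qed
    show ?case
    proof (intro exI[of _ N] conjI ballI impI)
      fix i assume i: "i \<in> Q"
      note c = Bc[OF M' i j(1)] Bc[OF M' j(1) i] Bc[OF M' i i] Bc[OF M' j(1) j(1)] uc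
      show "x (B N i i) \<noteq> \<zero>\<^sub>k"
      proof (cases "i = j")
        case False
        have "x (B N i i) = x u \<otimes>\<^sub>k x (B M' i i)"
          using False i j c B2 by (simp add: BN a_minus_def)
        moreover have "x u \<noteq> \<zero>\<^sub>k" "x (B M' i i) \<noteq> \<zero>\<^sub>k" using B1 i j by (auto simp: u_def)
        ultimately show ?thesis using c by (simp add: k.integral_iff)
      qed (use B1 i BN j in simp)
      { fix l assume l: "l \<in> Q" "i \<noteq> l"
        show "x (B N i l) = \<zero>\<^sub>k"
        proof (cases "i = j")
          case True
          thus ?thesis using i j l B2 by (simp add: BN)
        next
          case False
          thus ?thesis using i j l c B2 Bc[OF M' i l(1)] Bc[OF M' j(1) l(1)] by (simp add: BN a_minus_def)
        qed }
      fix l assume l: "l \<in> insert j F" "i \<noteq> l"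
      hence lQ: "l \<in> Q" using j by auto
      show "B N i l = \<zero>"
      proof (cases "l = j")
        case True
        thus ?thesis using l i j c by (simp add: BN u_def R.m_comm R.minus_eq_zero_iff)
      next
        case False
        hence "B M' i l = \<zero>" "B M' j l = \<zero>" using B3 l i j by auto
        thus ?thesis using i lQ c by (simp add: BN a_minus_def)
      qed
    qed (use Nc in auto)
  qed
  from this[OF subset_refl] obtain M' where M': "\<forall>i\<in>Q. \<forall>j\<in>Q. M' i j \<in> carrier R" and B1: "\<forall>i\<in>Q. x (B M' i i) \<noteq> \<zero>\<^sub>k"
    and B3: "\<forall>i\<in>Q. \<forall>j\<in>Q. i \<noteq> j \<longrightarrow> B M' i j = \<zero>" by auto
  note Bcc = Bc[OF M']
  \<comment> \<open>Multiplying row \<open>i\<close> by the diagonal entries of the other rows gives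
    all rows the same diagonal entry, \<open>w Q\<close>.\<close>
  define w where "w S = finprod R (\<lambda>i. B M' i i) S" for S
  have wc: "w S \<in> carrier R" if "S \<subseteq> Q" for S unfolding w_def using Bcc that by (intro R.finprod_closed) auto
  have w0: "x (w S) \<noteq> \<zero>\<^sub>k" if "S \<subseteq> Q" for S
    using finite_subset[OF that Q] that
  proof (induction S rule: finite_induct)
    case (insert i S)
    have "w (insert i S) = B M' i i \<otimes> w S" unfolding w_def using insert Bcc by (intro R.finprod_insert) auto
    thus ?case using insert B1 Bcc wc[of S] by (simp add: k.integral_iff)
  qed (simp add: w_def)
  have wi: "w Q = w (Q - {i}) \<otimes> B M' i i" if "i \<in> Q" for i
  proof -
    have "w (insert i (Q - {i})) = B M' i i \<otimes> w (Q - {i})" unfolding w_def using that Bcc Q by (intro R.finprod_insert) auto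
    thus ?thesis using that Bcc wc[of "Q - {i}"] by (simp add: insert_absorb R.m_comm)
  qed
  have "(\<Oplus>l\<in>Q. (w (Q - {i}) \<otimes> M' i l) \<otimes> M l j) = (if i = j then w Q else \<zero>)" if ij: "i \<in> Q" "j \<in> Q" for i j
  proof -
    have c: "w (Q - {i}) \<in> carrier R" by (rule wc) auto
    have "(\<Oplus>l\<in>Q. (w (Q - {i}) \<otimes> M' i l) \<otimes> M l j) = w (Q - {i}) \<otimes> B M' i j"
      unfolding B_def using c M' M ij Q by (subst R.finsum_rdistr) (auto simp: R.m_assoc intro!: R.finsum_cong')
    thus ?thesis using wi[OF ij(1)] B3 ij c by auto
  qed
  moreover have "w (Q - {i}) \<otimes> M' i l \<in> carrier R" if "i \<in> Q" "l \<in> Q" for i l using that M' wc[of "Q - {i}"] by auto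
  ultimately show ?thesis using wc[OF subset_refl] w0[OF subset_refl]
    by (intro exI[of _ "\<lambda>i l. w (Q - {i}) \<otimes> M' i l"] exI[of _ "w Q"]) simp
qed

text \<open>Transposition, using that \<open>R\<close> is commutative.\<close>

lemma right_adjugate_exists:
  fixes R :: "('r, 'c) ring_scheme" (structure)
  assumes R: "cring R" and k: "domain k" and x: "x \<in> ring_hom R k" and Q: "finite Q"
    and M: "\<And>i j. i \<in> Q \<Longrightarrow> j \<in> Q \<Longrightarrow> M i j \<in> carrier R"
    and xM: "\<And>i j. i \<in> Q \<Longrightarrow> j \<in> Q \<Longrightarrow> x (M i j) = (if i = j then \<one>\<^sub>k else \<zero>\<^sub>k)"
  shows "\<exists>M' c. (\<forall>i\<in>Q. \<forall>j\<in>Q. M' i j \<in> carrier R) \<and> c \<in> carrier R \<and> x c \<noteq> \<zero>\<^sub>k \<and>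
    (\<forall>i\<in>Q. \<forall>j\<in>Q. (\<Oplus>l\<in>Q. M i l \<otimes> M' l j) = (if i = j then c else \<zero>))"
proof -
  interpret R: cring R by fact
  have "\<exists>M' c. (\<forall>i\<in>Q. \<forall>j\<in>Q. M' i j \<in> carrier R) \<and> c \<in> carrier R \<and> x c \<noteq> \<zero>\<^sub>k \<and>
    (\<forall>i\<in>Q. \<forall>j\<in>Q. (\<Oplus>l\<in>Q. M' i l \<otimes> M j l) = (if i = j then c else \<zero>))"
    by (rule left_adjugate_exists[OF R k x Q]) (auto simp: M xM)
  then obtain M' c where M': "\<forall>i\<in>Q. \<forall>j\<in>Q. M' i j \<in> carrier R" and c: "c \<in> carrier R" "x c \<noteq> \<zero>\<^sub>k"
    and eq: "\<forall>i\<in>Q. \<forall>j\<in>Q. (\<Oplus>l\<in>Q. M' i l \<otimes> M j l) = (if i = j then c else \<zero>)" by (elim exE conjE)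
  have "(\<Oplus>l\<in>Q. M i l \<otimes> M' j l) = (if i = j then c else \<zero>)" if "i \<in> Q" "j \<in> Q" for i j
  proof -
    have "(\<Oplus>l\<in>Q. M i l \<otimes> M' j l) = (\<Oplus>l\<in>Q. M' j l \<otimes> M i l)"
      using M M' that by (intro R.finsum_cong') (auto simp: R.m_comm)
    thus ?thesis using eq that by auto
  qed
  thus ?thesis using M' c by (intro exI[of _ "\<lambda>l j. M' j l"] exI[of _ c]) simp
qed

text \<open>The \<open>c\<close> for which c times the identity has the form D1 U + V D2 form an
  ideal \<open>J\<close>. If it were proper, it would vanish at a closed point \<open>x\<close>. A
  homotopy at \<open>x\<close>, read as a pair of constant matrices over \<open>R\<close>, gives a
  matrix M = D1 u + v D2 that is the identity at \<open>x\<close>, hence invertible up to a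
  denominator that does not vanish at \<open>x\<close>. This denominator would lie in
  \<open>J\<close>.\<close>

lemma homotopy_exists:
  fixes k :: "'k ring" and R :: "('k, 'r) module" (structure)
    and D1 :: "'q \<Rightarrow> 'p \<Rightarrow> 'r" and D2 :: "'s \<Rightarrow> 'q \<Rightarrow> 'r"
  assumes k: "algebraically_closed k" and R: "algebra k R" and fg: "finitely_generated_algebra k R"
    and fin: "finite P" "finite Q" "finite S"
    and D1: "\<And>q p. q \<in> Q \<Longrightarrow> p \<in> P \<Longrightarrow> D1 q p \<in> carrier R" and D2: "\<And>s q. s \<in> S \<Longrightarrow> q \<in> Q \<Longrightarrow> D2 s q \<in> carrier R"
    and D21: "\<And>s p. s \<in> S \<Longrightarrow> p \<in> P \<Longrightarrow> (\<Oplus>q\<in>Q. D2 s q \<otimes> D1 q p) = \<zero>"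
    and ex: "\<And>x Y. x \<in> alg_hom k R (self_algebra k) \<Longrightarrow> (\<And>q. q \<in> Q \<Longrightarrow> Y q \<in> carrier k) \<Longrightarrow>
        (\<And>s. s \<in> S \<Longrightarrow> (\<Oplus>\<^sub>k q\<in>Q. x (D2 s q) \<otimes>\<^sub>k Y q) = \<zero>\<^sub>k) \<Longrightarrow>
      \<exists>Z. (\<forall>p\<in>P. Z p \<in> carrier k) \<and> (\<forall>q\<in>Q. Y q = (\<Oplus>\<^sub>k p\<in>P. x (D1 q p) \<otimes>\<^sub>k Z p))"
  shows "\<exists>U V. (\<forall>p\<in>P. \<forall>q\<in>Q. U p q \<in> carrier R) \<and> (\<forall>q\<in>Q. \<forall>s\<in>S. V q s \<in> carrier R) \<and>
    (\<forall>q\<in>Q. \<forall>q'\<in>Q. (\<Oplus>p\<in>P. D1 q p \<otimes> U p q') \<oplus> (\<Oplus>s\<in>S. V q s \<otimes> D2 s q') = (if q = q' then \<one> else \<zero>))"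
proof -
  interpret k: algebraically_closed k by fact
  interpret R: cring R by (rule algebra.M_cring[OF R])
  interpret RA: algebra k R by fact
  define H where "H c U V \<longleftrightarrow> (\<forall>p\<in>P. \<forall>q\<in>Q. U p q \<in> carrier R) \<and> (\<forall>q\<in>Q. \<forall>s\<in>S. V q s \<in> carrier R) \<and>
    (\<forall>q\<in>Q. \<forall>q'\<in>Q. (\<Oplus>p\<in>P. D1 q p \<otimes> U p q') \<oplus> (\<Oplus>s\<in>S. V q s \<otimes> D2 s q') = (if q = q' then c else \<zero>))" for c U V
  have HI: "H c U V" if "\<And>p q. p \<in> P \<Longrightarrow> q \<in> Q \<Longrightarrow> U p q \<in> carrier R" "\<And>q s. q \<in> Q \<Longrightarrow> s \<in> S \<Longrightarrow> V q s \<in> carrier R"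
    "\<And>q q'. q \<in> Q \<Longrightarrow> q' \<in> Q \<Longrightarrow> (\<Oplus>p\<in>P. D1 q p \<otimes> U p q') \<oplus> (\<Oplus>s\<in>S. V q s \<otimes> D2 s q') = (if q = q' then c else \<zero>)"
    for c U V using that by (simp add: H_def)
  have Hc: "U p q \<in> carrier R" if "H c U V" "p \<in> P" "q \<in> Q" for c U V p q
    using that by (auto simp: H_def)
  have Hc2: "V q s \<in> carrier R" if "H c U V" "q \<in> Q" "s \<in> S" for c U V q s
    using that by (auto simp: H_def)
  have He: "(\<Oplus>p\<in>P. D1 q p \<otimes> U p q') \<oplus> (\<Oplus>s\<in>S. V q s \<otimes> D2 s q') = (if q = q' then c else \<zero>)"
    if "H c U V" "q \<in> Q" "q' \<in> Q" for c U V q q' using that by (simp add: H_def)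
  define J where "J = {c \<in> carrier R. \<exists>U V. H c U V}"
  have mulH: "H (a \<otimes> c) (\<lambda>p q. a \<otimes> U p q) (\<lambda>q s. a \<otimes> V q s)" if h: "H c U V" and a: "a \<in> carrier R" "c \<in> carrier R" for a c U V
  proof (rule HI)
    fix q q' assume q: "q \<in> Q" "q' \<in> Q"
    have "(\<Oplus>p\<in>P. D1 q p \<otimes> (a \<otimes> U p q')) = a \<otimes> (\<Oplus>p\<in>P. D1 q p \<otimes> U p q')"
      using q a D1 Hc[OF h] fin by (subst R.finsum_rdistr) (auto simp: R.m_lcomm intro!: R.finsum_cong')
    moreover have "(\<Oplus>s\<in>S. (a \<otimes> V q s) \<otimes> D2 s q') = a \<otimes> (\<Oplus>s\<in>S. V q s \<otimes> D2 s q')"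
      using q a D2 Hc2[OF h] fin by (subst R.finsum_rdistr) (auto simp: R.m_assoc intro!: R.finsum_cong')
    moreover have "(\<Oplus>p\<in>P. D1 q p \<otimes> U p q') \<in> carrier R" "(\<Oplus>s\<in>S. V q s \<otimes> D2 s q') \<in> carrier R"
      using q D1 D2 Hc[OF h] Hc2[OF h] by (auto intro!: R.finsum_closed)
    ultimately show "(\<Oplus>p\<in>P. D1 q p \<otimes> (a \<otimes> U p q')) \<oplus> (\<Oplus>s\<in>S. (a \<otimes> V q s) \<otimes> D2 s q') =
        (if q = q' then a \<otimes> c else \<zero>)"
      using He[OF h q] a by (simp flip: R.r_distr)
  qed (use a Hc[OF h] Hc2[OF h] in auto)
  have addH: "H (c \<oplus> c') (\<lambda>p q. U p q \<oplus> U' p q) (\<lambda>q s. V q s \<oplus> V' q s)" if h: "H c U V" "H c' U' V'" for c U V c' U' V'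
  proof (rule HI)
    fix q q' assume q: "q \<in> Q" "q' \<in> Q"
    have s1: "(\<Oplus>p\<in>P. D1 q p \<otimes> (U p q' \<oplus> U' p q')) = (\<Oplus>p\<in>P. D1 q p \<otimes> U p q') \<oplus> (\<Oplus>p\<in>P. D1 q p \<otimes> U' p q')"
      using q D1 Hc[OF h(1)] Hc[OF h(2)] by (intro R.finsum_add_eqI) (simp_all add: R.r_distr)
    have s2: "(\<Oplus>s\<in>S. (V q s \<oplus> V' q s) \<otimes> D2 s q') = (\<Oplus>s\<in>S. V q s \<otimes> D2 s q') \<oplus> (\<Oplus>s\<in>S. V' q s \<otimes> D2 s q')"
      using q D2 Hc2[OF h(1)] Hc2[OF h(2)] by (intro R.finsum_add_eqI) (simp_all add: R.l_distr)
    have cl: "(\<Oplus>p\<in>P. D1 q p \<otimes> U p q') \<in> carrier R" "(\<Oplus>s\<in>S. V q s \<otimes> D2 s q') \<in> carrier R"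
      "(\<Oplus>p\<in>P. D1 q p \<otimes> U' p q') \<in> carrier R" "(\<Oplus>s\<in>S. V' q s \<otimes> D2 s q') \<in> carrier R"
      using q D1 D2 Hc[OF h(1)] Hc2[OF h(1)] Hc[OF h(2)] Hc2[OF h(2)] by (auto intro!: R.finsum_closed)
    have sw: "(x \<oplus> x') \<oplus> (y \<oplus> y') = (x \<oplus> y) \<oplus> (x' \<oplus> y')"
      if "x \<in> carrier R" "x' \<in> carrier R" "y \<in> carrier R" "y' \<in> carrier R" for x x' y y' using that by (simp add: R.a_ac)
    show "(\<Oplus>p\<in>P. D1 q p \<otimes> (U p q' \<oplus> U' p q')) \<oplus> (\<Oplus>s\<in>S. (V q s \<oplus> V' q s) \<otimes> D2 s q') =
        (if q = q' then c \<oplus> c' else \<zero>)"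
      unfolding s1 s2 sw[OF cl(1,3,2,4)] He[OF h(1) q] He[OF h(2) q] by simp
  qed (use Hc[OF h(1)] Hc2[OF h(1)] Hc[OF h(2)] Hc2[OF h(2)] in auto)
  have JI: "c \<in> J" if "c \<in> carrier R" "H c U V" for c U V using that unfolding J_def by blast
  have zH: "H \<zero> (\<lambda>p q. \<zero>) (\<lambda>q s. \<zero>)"
  proof (rule HI)
    fix q q' assume q: "q \<in> Q" "q' \<in> Q"
    have "(\<Oplus>p\<in>P. D1 q p \<otimes> \<zero>) = \<zero>" "(\<Oplus>s\<in>S. \<zero> \<otimes> D2 s q') = \<zero>"
      using q D1 D2 by (auto intro!: R.add.finprod_one_eqI)
    thus "(\<Oplus>p\<in>P. D1 q p \<otimes> \<zero>) \<oplus> (\<Oplus>s\<in>S. \<zero> \<otimes> D2 s q') = (if q = q' then \<zero> else \<zero>)" by simp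
  qed auto
  have J_mult: "a \<otimes> c \<in> J" if "c \<in> J" "a \<in> carrier R" for a c
    using that mulH unfolding J_def by blast
  have J_add: "c \<oplus> c' \<in> J" if "c \<in> J" "c' \<in> J" for c c'
    using that addH unfolding J_def by blast
  have J_sub: "J \<subseteq> carrier R" by (auto simp: J_def)
  have "ideal J R"
  proof (rule idealI[OF R.ring_axioms])
    show "subgroup J (add_monoid R)"
    proof (unfold_locales, goal_cases)
      case (4 c)
      have "\<ominus> c = (\<ominus> \<one>) \<otimes> c" using 4 J_sub by (simp add: R.l_minus subset_iff)
      thus ?case using J_mult[OF 4, of "\<ominus> \<one>"] by (simp add: a_inv_def)
    qed (use J_sub J_add JI[OF _ zH] in auto)
    fix a c assume "c \<in> J" "a \<in> carrier R"
    thus "a \<otimes> c \<in> J" "c \<otimes> a \<in> J" using J_mult J_sub R.m_comm[of c a] by auto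
  qed
  have "J = carrier R"
  proof (rule ccontr)
    assume "J \<noteq> carrier R"
    from alg_hom_to_closed_field_exists[OF k R fg \<open>ideal J R\<close> this]
    obtain x where x: "x \<in> alg_hom k R (self_algebra k)" and xJ: "\<forall>c\<in>J. x c = \<zero>\<^sub>k" by (elim bexE)
    have xr: "x \<in> ring_hom R k" using x by (simp add: alg_hom_def ring_hom_def)
    interpret x: ring_hom_cring R k x
      by (intro UnivPoly.ring_hom_cringI R.cring_axioms k.cring_axioms xr)
    \<comment> \<open>The entries of the homotopy at \<open>x\<close> are lifted to \<open>R\<close>
      as constants; \<open>x\<close> inverts this embedding of \<open>k\<close>.\<close>
    define io where "io c = c \<odot> \<one>" for c
    have ioc: "io c \<in> carrier R" if "c \<in> carrier k" for c using that by (simp add: io_def)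
    have xio: "x (io c) = c" if "c \<in> carrier k" for c using that x by (simp add: io_def alg_hom_def)
    have iom: "io c \<otimes> io d = io (c \<otimes>\<^sub>k d)" if "c \<in> carrier k" "d \<in> carrier k" for c d
      using that by (simp add: io_def RA.smult_assoc2 RA.smult_assoc1)
    have iof: "(\<Oplus>i\<in>I. io (h i)) = io (\<Oplus>\<^sub>k i\<in>I. h i)" if "finite I" "\<And>i. i \<in> I \<Longrightarrow> h i \<in> carrier k" for h and I :: "'q set"
      using that by (induction I rule: finite_induct) (simp_all add: io_def RA.smult_l_distr Pi_iff RA.smult_l_null)
    obtain u v where u: "\<forall>p\<in>P. \<forall>q\<in>Q. u p q \<in> carrier k" and v: "\<forall>q\<in>Q. \<forall>s\<in>S. v q s \<in> carrier k"
      and uv1: "\<forall>q\<in>Q. \<forall>q'\<in>Q. (\<Oplus>\<^sub>k p\<in>P. x (D1 q p) \<otimes>\<^sub>k u p q') \<oplus>\<^sub>k (\<Oplus>\<^sub>k s\<in>S. v q s \<otimes>\<^sub>k x (D2 s q')) = (if q = q' then \<one>\<^sub>k else \<zero>\<^sub>k)"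
      and uv0: "\<forall>p\<in>P. \<forall>s\<in>S. (mprod k Q u v p s) = \<zero>\<^sub>k"
    proof -
      have "\<exists>U V. (\<forall>p\<in>P. \<forall>q\<in>Q. U p q \<in> carrier k) \<and> (\<forall>q\<in>Q. \<forall>s\<in>S. V q s \<in> carrier k) \<and>
        (\<forall>q\<in>Q. \<forall>q'\<in>Q. (\<Oplus>\<^sub>k p\<in>P. x (D1 q p) \<otimes>\<^sub>k U p q') \<oplus>\<^sub>k (\<Oplus>\<^sub>k s\<in>S. V q s \<otimes>\<^sub>k x (D2 s q')) = (if q = q' then \<one>\<^sub>k else \<zero>\<^sub>k)) \<and>
        (\<forall>p\<in>P. \<forall>s\<in>S. (mprod k Q U V p s) = \<zero>\<^sub>k)"
        by (rule field_homotopy[OF k.field_axioms fin _ _ ex[OF x]]) (use D1 D2 in simp_all)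
      thus thesis using that by (elim exE conjE)
    qed
    let ?G = "gmat (self_algebra R) Q"
    interpret G: assoc_algebra R ?G by (rule assoc_algebra_gmat[OF algebra_self_algebra[OF R.cring_axioms] fin(2)])
    define mk where "mk h = (\<lambda>(i, j)\<in>Q \<times> Q. h i j)" for h :: "'q \<Rightarrow> 'q \<Rightarrow> 'r"
    note gs = gmat_simps gmat_extensional
    have mkc: "mk h \<in> carrier ?G" if "\<And>i j. i \<in> Q \<Longrightarrow> j \<in> Q \<Longrightarrow> h i j \<in> carrier R" for h
      using that by (auto simp: mk_def gs)
    have mke: "mk h (i, j) = h i j" if "i \<in> Q" "j \<in> Q" for h i j using that by (simp add: mk_def)
    have ext: "mk h \<in> extensional (Q \<times> Q)" for h by (simp add: mk_def)
    define e where "e q q' = (\<Oplus>p\<in>P. D1 q p \<otimes> io (u p q'))" for q q'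
    define f where "f q q' = (\<Oplus>s\<in>S. io (v q s) \<otimes> D2 s q')" for q q'
    have ec: "e q q' \<in> carrier R" "f q q' \<in> carrier R" if "q \<in> Q" "q' \<in> Q" for q q'
      using that D1 D2 u v ioc by (auto simp: e_def f_def intro!: R.finsum_closed)
    have sums: "(\<Oplus>l\<in>Q. io (u p l) \<otimes> io (v l s)) = \<zero>" if "p \<in> P" "s \<in> S" for p s
    proof -
      have "(\<Oplus>l\<in>Q. io (u p l) \<otimes> io (v l s)) = (\<Oplus>l\<in>Q. io (u p l \<otimes>\<^sub>k v l s))"
        using that u v by (intro R.finsum_cong') (auto simp: iom ioc)
      also have "\<dots> = io (mprod k Q u v p s)" using that u v fin by (intro iof) auto
      finally show ?thesis using uv0 that by (simp add: io_def RA.smult_l_null)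
    qed
    \<comment> \<open>The product of e = D1 u and f = v D2 vanishes because u v = 0, an identity
      between constants; the product in the other order vanishes because D2 D1 = 0 over
      \<open>R\<close>.\<close>
    have ef: "mk e \<otimes>\<^sub>?G mk f = \<zero>\<^sub>?G"
    proof (rule gmat_eqI[of _ Q])
      fix i j assume ij: "i \<in> Q" "j \<in> Q"
      have "(mk e \<otimes>\<^sub>?G mk f) (i, j) = (\<Oplus>l\<in>Q. (\<Oplus>p\<in>P. D1 i p \<otimes> io (u p l)) \<otimes> f l j)"
        using ij ec by (auto simp: gs mke e_def[symmetric] intro!: R.finsum_cong')
      also have "\<dots> = (\<Oplus>p\<in>P. D1 i p \<otimes> (\<Oplus>l\<in>Q. io (u p l) \<otimes> f l j))"
        using ij D1 u ioc ec fin by (intro R.finsum_mult_assoc) auto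
      also have "\<dots> = \<zero>"
      proof (rule R.add.finprod_one_eqI)
        fix p assume p: "p \<in> P"
        have "(\<Oplus>l\<in>Q. io (u p l) \<otimes> f l j) = (\<Oplus>s\<in>S. (\<Oplus>l\<in>Q. io (u p l) \<otimes> io (v l s)) \<otimes> D2 s j)"
          unfolding f_def using ij p u v ioc D2 fin by (intro R.finsum_mult_assoc[symmetric]) auto
        also have "\<dots> = \<zero>" using sums p D2 ij by (intro R.add.finprod_one_eqI) simp
        finally show "D1 i p \<otimes> (\<Oplus>l\<in>Q. io (u p l) \<otimes> f l j) = \<zero>" using D1 ij p by simp
      qed
      finally show "(mk e \<otimes>\<^sub>?G mk f) (i, j) = \<zero>\<^sub>?G (i, j)" using ij by (simp add: gs)
    qed (simp_all add: gs)
    have fe: "mk f \<otimes>\<^sub>?G mk e = \<zero>\<^sub>?G"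
    proof (rule gmat_eqI[of _ Q])
      fix i j assume ij: "i \<in> Q" "j \<in> Q"
      have "(mk f \<otimes>\<^sub>?G mk e) (i, j) = (\<Oplus>l\<in>Q. (\<Oplus>s\<in>S. io (v i s) \<otimes> D2 s l) \<otimes> e l j)"
        using ij ec by (auto simp: gs mke f_def[symmetric] intro!: R.finsum_cong')
      also have "\<dots> = (\<Oplus>s\<in>S. io (v i s) \<otimes> (\<Oplus>l\<in>Q. D2 s l \<otimes> e l j))"
        using ij D2 v ioc ec fin by (intro R.finsum_mult_assoc) auto
      also have "\<dots> = \<zero>"
      proof (rule R.add.finprod_one_eqI)
        fix s assume s: "s \<in> S"
        have "(\<Oplus>l\<in>Q. D2 s l \<otimes> e l j) = (\<Oplus>p\<in>P. (\<Oplus>l\<in>Q. D2 s l \<otimes> D1 l p) \<otimes> io (u p j))"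
          unfolding e_def using ij s u ioc D1 D2 fin by (intro R.finsum_mult_assoc[symmetric]) auto
        also have "\<dots> = \<zero>" using D21 s u ioc ij by (intro R.add.finprod_one_eqI) simp
        finally show "io (v i s) \<otimes> (\<Oplus>l\<in>Q. D2 s l \<otimes> e l j) = \<zero>" using v ioc ij s by simp
      qed
      finally show "(mk f \<otimes>\<^sub>?G mk e) (i, j) = \<zero>\<^sub>?G (i, j)" using ij by (simp add: gs)
    qed (simp_all add: gs)
    define M where "M q q' = e q q' \<oplus> f q q'" for q q'
    have Mc: "M q q' \<in> carrier R" if "q \<in> Q" "q' \<in> Q" for q q' using ec[OF that] by (simp add: M_def)
    have xM: "x (M q q') = (if q = q' then \<one>\<^sub>k else \<zero>\<^sub>k)" if q: "q \<in> Q" "q' \<in> Q" for q q'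
    proof -
      have "x (e q q') = (\<Oplus>\<^sub>k p\<in>P. x (D1 q p) \<otimes>\<^sub>k u p q')"
        unfolding e_def using q D1 u ioc by (subst x.hom_finsum) (auto simp: o_def xio intro!: k.finsum_cong')
      moreover have "x (f q q') = (\<Oplus>\<^sub>k s\<in>S. v q s \<otimes>\<^sub>k x (D2 s q'))"
        unfolding f_def using q D2 v ioc by (subst x.hom_finsum) (auto simp: o_def xio intro!: k.finsum_cong')
      ultimately show ?thesis using uv1 q ec[OF q] by (simp add: M_def)
    qed
    obtain M' c where M': "\<forall>i\<in>Q. \<forall>j\<in>Q. M' i j \<in> carrier R" and c: "c \<in> carrier R" "x c \<noteq> \<zero>\<^sub>k"
      and eq1: "\<forall>i\<in>Q. \<forall>j\<in>Q. (\<Oplus>l\<in>Q. M' i l \<otimes> M l j) = (if i = j then c else \<zero>)"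
      proof -
      have "\<exists>M' c. (\<forall>i\<in>Q. \<forall>j\<in>Q. M' i j \<in> carrier R) \<and> c \<in> carrier R \<and> x c \<noteq> \<zero>\<^sub>k \<and>
        (\<forall>i\<in>Q. \<forall>j\<in>Q. (\<Oplus>l\<in>Q. M' i l \<otimes> M l j) = (if i = j then c else \<zero>))"
        by (rule left_adjugate_exists[OF R.cring_axioms k.domain_axioms xr fin(2)]) (simp_all add: Mc xM)
      thus thesis using that by (elim exE conjE)
    qed
    obtain M'' c' where M'': "\<forall>i\<in>Q. \<forall>j\<in>Q. M'' i j \<in> carrier R" and c': "c' \<in> carrier R" "x c' \<noteq> \<zero>\<^sub>k"
      and eq2: "\<forall>i\<in>Q. \<forall>j\<in>Q. (\<Oplus>l\<in>Q. M i l \<otimes> M'' l j) = (if i = j then c' else \<zero>)"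
      proof -
      have "\<exists>M'' c'. (\<forall>i\<in>Q. \<forall>j\<in>Q. M'' i j \<in> carrier R) \<and> c' \<in> carrier R \<and> x c' \<noteq> \<zero>\<^sub>k \<and>
        (\<forall>i\<in>Q. \<forall>j\<in>Q. (\<Oplus>l\<in>Q. M i l \<otimes> M'' l j) = (if i = j then c' else \<zero>))"
        by (rule right_adjugate_exists[OF R.cring_axioms k.domain_axioms xr fin(2)]) (simp_all add: Mc xM)
      thus thesis using that by (elim exE conjE)
    qed
    have G: "mk e \<in> carrier ?G" "mk f \<in> carrier ?G" "mk M \<in> carrier ?G" "mk M' \<in> carrier ?G" "mk M'' \<in> carrier ?G"
      using ec Mc M' M'' by (auto intro!: mkc)
    have Mef: "mk M = mk e \<oplus>\<^sub>?G mk f" by (rule gmat_eqI[of _ Q]) (simp_all add: ext gs mke M_def)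
    have scal: "mk a \<otimes>\<^sub>?G mk b = d \<odot>\<^sub>?G \<one>\<^sub>?G"
      if "\<forall>i\<in>Q. \<forall>j\<in>Q. (\<Oplus>l\<in>Q. a i l \<otimes> b l j) = (if i = j then d else \<zero>)" "d \<in> carrier R"
        "\<forall>i\<in>Q. \<forall>j\<in>Q. a i j \<in> carrier R" "\<forall>i\<in>Q. \<forall>j\<in>Q. b i j \<in> carrier R" for a b d
    proof (rule gmat_eqI[of _ Q])
      fix i j assume ij: "i \<in> Q" "j \<in> Q"
      have "(mk a \<otimes>\<^sub>?G mk b) (i, j) = (\<Oplus>l\<in>Q. a i l \<otimes> b l j)"
        using ij that(2-) by (auto simp: gs mke intro!: R.finsum_cong')
      moreover have "(d \<odot>\<^sub>?G \<one>\<^sub>?G) (i, j) = (if i = j then d else \<zero>)" using that(2) ij by (simp add: gs)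
      ultimately show "(mk a \<otimes>\<^sub>?G mk b) (i, j) = (d \<odot>\<^sub>?G \<one>\<^sub>?G) (i, j)" using that(1) ij by simp
    qed (simp_all add: gs)
    have MM: "mk M' \<otimes>\<^sub>?G mk M = c \<odot>\<^sub>?G \<one>\<^sub>?G" "mk M \<otimes>\<^sub>?G mk M'' = c' \<odot>\<^sub>?G \<one>\<^sub>?G"
      using eq1 eq2 c(1) c'(1) M' M'' Mc by (intro scal; simp)+
    \<comment> \<open>Both sides are f f. The inverse of M has to stand to the right of e, where D1
      must stay the left factor, and to the left of f, where D2 must stay the right factor; it can
      be moved across f because f commutes with M.\<close>
    have comm: "mk M \<otimes>\<^sub>?G mk f = mk f \<otimes>\<^sub>?G mk M" using G by (simp add: Mef G.l_distr G.r_distr ef fe)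
    have "c \<odot>\<^sub>?G (mk f \<otimes>\<^sub>?G mk M'') = (c \<odot>\<^sub>?G \<one>\<^sub>?G) \<otimes>\<^sub>?G (mk f \<otimes>\<^sub>?G mk M'')"
      using G c by (simp add: G.smult_assoc_l)
    also have "\<dots> = mk M' \<otimes>\<^sub>?G (mk M \<otimes>\<^sub>?G mk f) \<otimes>\<^sub>?G mk M''" using G by (simp flip: MM add: G.m_assoc)
    also have "\<dots> = mk M' \<otimes>\<^sub>?G mk f \<otimes>\<^sub>?G (mk M \<otimes>\<^sub>?G mk M'')" using G by (simp only: comm G.m_assoc G.m_closed)
    also have "\<dots> = c' \<odot>\<^sub>?G (mk M' \<otimes>\<^sub>?G mk f)" using G c' by (simp add: MM G.smult_assoc_r)
    finally have swap: "c \<odot>\<^sub>?G (mk f \<otimes>\<^sub>?G mk M'') = c' \<odot>\<^sub>?G (mk M' \<otimes>\<^sub>?G mk f)" .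
    have "(c \<otimes> c') \<odot>\<^sub>?G \<one>\<^sub>?G = c \<odot>\<^sub>?G (mk M \<otimes>\<^sub>?G mk M'')" using c c' G by (simp add: MM G.smult_assoc1)
    also have "\<dots> = c \<odot>\<^sub>?G (mk e \<otimes>\<^sub>?G mk M'') \<oplus>\<^sub>?G c' \<odot>\<^sub>?G (mk M' \<otimes>\<^sub>?G mk f)"
      using c c' G by (simp add: Mef G.l_distr G.smult_r_distr flip: swap)
    finally have key: "(c \<otimes> c') \<odot>\<^sub>?G \<one>\<^sub>?G = c \<odot>\<^sub>?G (mk e \<otimes>\<^sub>?G mk M'') \<oplus>\<^sub>?G c' \<odot>\<^sub>?G (mk M' \<otimes>\<^sub>?G mk f)" .
    \<comment> \<open>U = c u M'' and V = c' M' v, read off from \<open>key\<close> with e = D1 u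
      and f = v D2.\<close>
    define U where "U p q = c \<otimes> (\<Oplus>l\<in>Q. io (u p l) \<otimes> M'' l q)" for p q
    define V where "V q s = c' \<otimes> (\<Oplus>l\<in>Q. M' q l \<otimes> io (v l s))" for q s
    have "H (c \<otimes> c') U V"
    proof (rule HI)
      fix p q assume "p \<in> P" "q \<in> Q"
      thus "U p q \<in> carrier R" using u ioc M'' c by (auto simp: U_def intro!: R.finsum_closed)
    next
      fix q s assume "q \<in> Q" "s \<in> S"
      thus "V q s \<in> carrier R" using v ioc M' c' by (auto simp: V_def intro!: R.finsum_closed)
    next
      fix q q' assume q: "q \<in> Q" "q' \<in> Q"
      have sc: "(\<Oplus>l\<in>Q. io (u p l) \<otimes> M'' l q') \<in> carrier R" if "p \<in> P" for p
        using that u ioc M'' q by (auto intro!: R.finsum_closed)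
      have sc': "(\<Oplus>l\<in>Q. M' q l \<otimes> io (v l s)) \<in> carrier R" if "s \<in> S" for s
        using that v ioc M' q by (auto intro!: R.finsum_closed)
      have "(\<Oplus>p\<in>P. D1 q p \<otimes> U p q') = c \<otimes> (\<Oplus>p\<in>P. D1 q p \<otimes> (\<Oplus>l\<in>Q. io (u p l) \<otimes> M'' l q'))"
        unfolding U_def using q c D1 sc fin by (subst R.finsum_rdistr) (auto simp: R.m_lcomm intro!: R.finsum_cong')
      also have "(\<Oplus>p\<in>P. D1 q p \<otimes> (\<Oplus>l\<in>Q. io (u p l) \<otimes> M'' l q')) = (\<Oplus>l\<in>Q. e q l \<otimes> M'' l q')"
        unfolding e_def using q D1 u ioc M'' fin by (intro R.finsum_mult_assoc[symmetric]) auto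
      also have "\<dots> = (mk e \<otimes>\<^sub>?G mk M'') (q, q')" using q ec M'' by (auto simp: gs mke intro!: R.finsum_cong')
      finally have 1: "(\<Oplus>p\<in>P. D1 q p \<otimes> U p q') = (c \<odot>\<^sub>?G (mk e \<otimes>\<^sub>?G mk M'')) (q, q')" using q by (simp add: gs(6))
      have "(\<Oplus>s\<in>S. V q s \<otimes> D2 s q') = c' \<otimes> (\<Oplus>s\<in>S. (\<Oplus>l\<in>Q. M' q l \<otimes> io (v l s)) \<otimes> D2 s q')"
        unfolding V_def using q c' D2 sc' fin by (subst R.finsum_rdistr) (auto simp: R.m_assoc intro!: R.finsum_cong')
      also have "(\<Oplus>s\<in>S. (\<Oplus>l\<in>Q. M' q l \<otimes> io (v l s)) \<otimes> D2 s q') = (\<Oplus>l\<in>Q. M' q l \<otimes> f l q')"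
        unfolding f_def using q D2 v ioc M' fin by (intro R.finsum_mult_assoc) auto
      also have "\<dots> = (mk M' \<otimes>\<^sub>?G mk f) (q, q')" using q ec M' by (auto simp: gs mke intro!: R.finsum_cong')
      finally have 2: "(\<Oplus>s\<in>S. V q s \<otimes> D2 s q') = (c' \<odot>\<^sub>?G (mk M' \<otimes>\<^sub>?G mk f)) (q, q')" using q by (simp add: gs(6))
      show "(\<Oplus>p\<in>P. D1 q p \<otimes> U p q') \<oplus> (\<Oplus>s\<in>S. V q s \<otimes> D2 s q') = (if q = q' then c \<otimes> c' else \<zero>)"
        using fun_cong[OF key, of "(q, q')"] q c c' unfolding 1 2 by (simp add: gs(3,5,6) split: if_splits)
    qed
    hence "x (c \<otimes> c') = \<zero>\<^sub>k" using xJ JI c c' by simp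
    thus False using c c' by (simp add: k.integral_iff)
  qed
  hence "\<one> \<in> J" by simp
  thus ?thesis unfolding J_def H_def by simp
qed

subsection \<open>Hereditary algebras\<close>

context left_module
begin

lemma smult_r_null: "r \<in> carrier R \<Longrightarrow> r \<odot>\<^sub>M \<zero>\<^sub>M = \<zero>\<^sub>M"
proof -
  assume r: "r \<in> carrier R"
  have "r \<odot>\<^sub>M \<zero>\<^sub>M \<oplus>\<^sub>M r \<odot>\<^sub>M \<zero>\<^sub>M = r \<odot>\<^sub>M \<zero>\<^sub>M \<oplus>\<^sub>M \<zero>\<^sub>M"
    using r by (simp add: smult_closed flip: smult_r_distr)
  thus ?thesis using r smult_closed[OF r M.zero_closed] by (metis M.add.l_cancel M.zero_closed)
qed

lemma smult_l_null: "x \<in> carrier M \<Longrightarrow> \<zero> \<odot>\<^sub>M x = \<zero>\<^sub>M"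
proof -
  assume x: "x \<in> carrier M"
  have "\<zero> \<odot>\<^sub>M x \<oplus>\<^sub>M \<zero> \<odot>\<^sub>M x = \<zero> \<odot>\<^sub>M x \<oplus>\<^sub>M \<zero>\<^sub>M"
    using x by (simp add: smult_closed flip: smult_l_distr)
  thus ?thesis using x smult_closed[OF R.zero_closed x] by (metis M.add.l_cancel M.zero_closed)
qed

lemma free_module_expand:
  assumes h: "h \<in> lmod_hom R (free_module R V) M" and xe: "xe \<in> carrier (free_module R V)"
  shows "h xe = (\<Oplus>\<^sub>M v\<in>msupp R xe. xe v \<odot>\<^sub>M h (\<lambda>w. if w = v then \<one> else \<zero>))"
proof -
  let ?F = "free_module R V" and ?u = "\<lambda>v w. if w = v then \<one> else \<zero>"
  interpret F: left_module R ?F by (rule R.free_module_left_module)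
  note xv = free_module_val[OF xe]
  have S: "finite (msupp R xe)" "msupp R xe \<subseteq> V" using xe by (auto simp: free_module_simps)
  have uF: "?u v \<in> carrier ?F" if "v \<in> V" for v
    using that finite_subset[of "msupp R (?u v)" "{v}"] by (auto simp: free_module_simps msupp_def)
  have huc: "h (?u v) \<in> carrier M" if "v \<in> V" for v using lmod_homD(1)[OF h uF[OF that]] .
  have "h (\<lambda>i. if i \<in> S then xe i else \<zero>) = (\<Oplus>\<^sub>M v\<in>S. xe v \<odot>\<^sub>M h (?u v)) \<and> (\<lambda>i. if i \<in> S then xe i else \<zero>) \<in> carrier ?F"
    if "S \<subseteq> msupp R xe" for S
    using finite_subset[OF that S(1)] that
  proof (induction S rule: finite_induct)
    case empty
    have "(\<lambda>i. \<zero>) = \<zero>\<^sub>?F" by (simp add: free_module_simps)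
    thus ?case using lmod_hom_zero[OF h F.M.abelian_group_axioms M.abelian_group_axioms] by simp
  next
    case (insert v S)
    let ?S = "\<lambda>i. if i \<in> S then xe i else \<zero>"
    have v: "v \<in> V" using insert.prems S(2) by auto
    have IH: "h ?S = (\<Oplus>\<^sub>M v\<in>S. xe v \<odot>\<^sub>M h (?u v))" "?S \<in> carrier ?F" using insert by simp_all
    have vF: "xe v \<odot>\<^sub>?F ?u v \<in> carrier ?F" by (rule F.smult_closed[OF xv uF[OF v]])
    have eq: "(\<lambda>i. if i \<in> insert v S then xe i else \<zero>) = xe v \<odot>\<^sub>?F ?u v \<oplus>\<^sub>?F ?S"
      using insert.hyps xv by (auto simp: free_module_simps fun_eq_iff)
    have "h (xe v \<odot>\<^sub>?F ?u v \<oplus>\<^sub>?F ?S) = xe v \<odot>\<^sub>M h (?u v) \<oplus>\<^sub>M h ?S"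
      by (simp only: lmod_homD(2)[OF h vF IH(2)] lmod_homD(3)[OF h xv uF[OF v]])
    moreover have "(\<Oplus>\<^sub>M v\<in>insert v S. xe v \<odot>\<^sub>M h (?u v)) = xe v \<odot>\<^sub>M h (?u v) \<oplus>\<^sub>M (\<Oplus>\<^sub>M v\<in>S. xe v \<odot>\<^sub>M h (?u v))"
      using insert S(2) huc xv by (intro M.finsum_insert) (auto intro!: smult_closed)
    ultimately show ?case unfolding eq using IH F.M.a_closed[OF vF IH(2)] by simp
  qed
  from this[OF subset_refl] have "h (\<lambda>i. if i \<in> msupp R xe then xe i else \<zero>) = (\<Oplus>\<^sub>M v\<in>msupp R xe. xe v \<odot>\<^sub>M h (?u v))" ..
  moreover have "(\<lambda>i. if i \<in> msupp R xe then xe i else \<zero>) = xe" by (auto simp: msupp_def)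
  ultimately show ?thesis by simp
qed

lemma free_module_lift:
  assumes x: "\<And>v. v \<in> V \<Longrightarrow> x v \<in> carrier M"
  shows "\<exists>h\<in>lmod_hom R (free_module R V) M. \<forall>v\<in>V. h (\<lambda>w. if w = v then \<one> else \<zero>) = x v"
proof -
  let ?F = "free_module R V"
  define h where "h xe = (\<Oplus>\<^sub>M v\<in>msupp R xe. xe v \<odot>\<^sub>M x v)" for xe
  have S: "finite (msupp R xe)" "msupp R xe \<subseteq> V" if "xe \<in> carrier ?F" for xe using that by (auto simp: free_module_simps)
  have c: "xe v \<odot>\<^sub>M x v \<in> carrier M" if "xe \<in> carrier ?F" "v \<in> V" for xe v
    using smult_closed[OF free_module_val[OF that(1)] x[OF that(2)]] .
  have hS: "h xe = (\<Oplus>\<^sub>M v\<in>S. xe v \<odot>\<^sub>M x v)" if "xe \<in> carrier ?F" "finite S" "msupp R xe \<subseteq> S" "S \<subseteq> V" for xe S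
    unfolding h_def using that c[OF that(1)] x smult_l_null
    by (intro M.add.finprod_mono_neutral_cong_left) (auto simp: msupp_def)
  have "h \<in> lmod_hom R ?F M"
  proof (rule lmod_homI)
    fix xe assume xi: "xe \<in> carrier ?F"
    show "h xe \<in> carrier M" unfolding h_def using c[OF xi] S[OF xi] by (intro M.finsum_closed) auto
    { fix xe' assume xi': "xe' \<in> carrier ?F"
      let ?S = "msupp R xe \<union> msupp R xe'"
      have sum: "xe \<oplus>\<^sub>?F xe' \<in> carrier ?F"
        using xi xi' by (intro abelian_groupE(1)[OF R.free_module_abelian_group])
      have sub: "msupp R (xe \<oplus>\<^sub>?F xe') \<subseteq> ?S" by (auto simp: msupp_def free_module_simps)
      have fin: "finite ?S" "?S \<subseteq> V" using S[OF xi] S[OF xi'] by auto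
      have "h (xe \<oplus>\<^sub>?F xe') = (\<Oplus>\<^sub>M v\<in>?S. xe v \<odot>\<^sub>M x v) \<oplus>\<^sub>M (\<Oplus>\<^sub>M v\<in>?S. xe' v \<odot>\<^sub>M x v)"
        unfolding hS[OF sum fin(1) sub fin(2)] using fin c[OF xi] c[OF xi'] free_module_val[OF xi] free_module_val[OF xi'] x
        by (intro M.finsum_add_eqI) (auto simp: free_module_simps smult_l_distr subset_iff)
      thus "h (xe \<oplus>\<^sub>?F xe') = h xe \<oplus>\<^sub>M h xe'" using hS[OF xi fin(1) _ fin(2)] hS[OF xi' fin(1) _ fin(2)] by simp }
    fix r assume r: "r \<in> carrier R"
    have rx: "r \<odot>\<^sub>?F xe \<in> carrier ?F" using left_module.smult_closed[OF R.free_module_left_module r xi] .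
    have sub: "msupp R (r \<odot>\<^sub>?F xe) \<subseteq> msupp R xe" using r by (auto simp: msupp_def free_module_simps)
    have rs: "r \<odot>\<^sub>M (\<Oplus>\<^sub>M v\<in>S. y v) = (\<Oplus>\<^sub>M v\<in>S. r \<odot>\<^sub>M y v)" if "finite S" "\<And>v. v \<in> S \<Longrightarrow> y v \<in> carrier M" for S y
      using that by (induction S rule: finite_induct) (simp_all add: r smult_r_null smult_r_distr smult_closed Pi_iff)
    have "h (r \<odot>\<^sub>?F xe) = (\<Oplus>\<^sub>M v\<in>msupp R xe. r \<odot>\<^sub>M (xe v \<odot>\<^sub>M x v))"
      unfolding hS[OF rx S(1)[OF xi] sub S(2)[OF xi]] using r free_module_val[OF xi] x S(2)[OF xi] c[OF xi]
      by (intro M.finsum_cong') (auto simp: free_module_simps smult_assoc smult_closed subset_iff)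
    thus "h (r \<odot>\<^sub>?F xe) = r \<odot>\<^sub>M h xe" unfolding h_def using S[OF xi] c[OF xi] by (subst rs) auto
  qed
  moreover have "h (\<lambda>w. if w = v then \<one> else \<zero>) = x v" if v: "v \<in> V" for v
  proof -
    let ?u = "\<lambda>w. if w = v then \<one> else \<zero>"
    have "?u \<in> carrier ?F" using v finite_subset[of "msupp R ?u" "{v}"] by (auto simp: free_module_simps msupp_def)
    hence "h ?u = (\<Oplus>\<^sub>M w\<in>{v}. ?u w \<odot>\<^sub>M x w)" using v by (intro hS) (auto simp: msupp_def)
    thus ?thesis using x[OF v] by (simp add: smult_one)
  qed
  ultimately show ?thesis by blast
qed

end

section \<open>Lifting through projective modules and splitting of kernels\<close>

lemma free_module_lift_hom:
  assumes Y: "left_module R Y" and L: "left_module R L"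
    and ph: "ph \<in> lmod_hom R L Y" and ps: "ps \<in> lmod_hom R (free_module R V) Y"
    and im: "\<And>xe. xe \<in> carrier (free_module R V) \<Longrightarrow> ps xe \<in> ph ` carrier L"
  shows "\<exists>cx\<in>lmod_hom R (free_module R V) L. \<forall>xe\<in>carrier (free_module R V). ph (cx xe) = ps xe"
proof -
  interpret Y: left_module R Y by fact
  interpret L: left_module R L by fact
  let ?F = "free_module R V" and ?u = "\<lambda>v w. if w = v then \<one>\<^sub>R else \<zero>\<^sub>R"
  have uF: "?u v \<in> carrier ?F" if "v \<in> V" for v
    using that finite_subset[of "msupp R (?u v)" "{v}"] by (auto simp: free_module_simps msupp_def)
  have "\<forall>v\<in>V. \<exists>x\<in>carrier L. ph x = ps (?u v)"
  proof
    fix v assume "v \<in> V"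
    from im[OF uF[OF this]] show "\<exists>x\<in>carrier L. ph x = ps (?u v)" by (elim imageE) (intro bexI, rule sym)
  qed
  hence "\<forall>v\<in>V. \<exists>x. x \<in> carrier L \<and> ph x = ps (?u v)" by (simp only: Bex_def)
  from bchoice[OF this] obtain x where x: "\<forall>v\<in>V. x v \<in> carrier L \<and> ph (x v) = ps (?u v)" by (elim exE)
  have "\<exists>cx\<in>lmod_hom R ?F L. \<forall>v\<in>V. cx (?u v) = x v" using x by (intro L.free_module_lift) simp
  then obtain cx where cx: "cx \<in> lmod_hom R ?F L" "\<forall>v\<in>V. cx (?u v) = x v" by (elim bexE)
  have comp: "(\<lambda>xe. ph (cx xe)) \<in> lmod_hom R ?F Y" by (rule lmod_homI) (simp_all add: lmod_homD[OF ph] lmod_homD[OF cx(1)])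
  have "ph (cx xe) = ps xe" if xi: "xe \<in> carrier ?F" for xe
  proof -
    have sub: "msupp R xe \<subseteq> V" using xi by (simp add: free_module_simps)
    have "(\<Oplus>\<^sub>Y v\<in>msupp R xe. xe v \<odot>\<^sub>Y ph (cx (?u v))) = (\<Oplus>\<^sub>Y v\<in>msupp R xe. xe v \<odot>\<^sub>Y ps (?u v))"
    proof (rule Y.M.finsum_cong')
      show "(\<lambda>v. xe v \<odot>\<^sub>Y ps (?u v)) \<in> msupp R xe \<rightarrow> carrier Y"
        using sub lmod_homD(1)[OF ps uF] Y.smult_closed[OF free_module_val[OF xi]] by blast
    qed (use sub x cx(2) in auto)
    thus ?thesis using Y.free_module_expand[OF comp xi] Y.free_module_expand[OF ps xi] by simp
  qed
  thus ?thesis using cx(1) by blast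
qed

text \<open>The lifting property of the free module passes to its direct summand: lift on the free
  module and restrict along the inclusion \<open>i\<close>.\<close>

lemma projective_module_lift:
  fixes P :: "('r, 'p, 'd) module_scheme"
  assumes P: "projective_module R P" and Y: "left_module R Y" and L: "left_module R L"
    and ph: "ph \<in> lmod_hom R L Y" and ps: "ps \<in> lmod_hom R P Y"
    and im: "\<And>x. x \<in> carrier P \<Longrightarrow> ps x \<in> ph ` carrier L"
  shows "\<exists>cx\<in>lmod_hom R P L. \<forall>x\<in>carrier P. ph (cx x) = ps x"
proof -
  from P obtain V :: "'p set" and i p where i: "i \<in> lmod_hom R P (free_module R V)" and p: "p \<in> lmod_hom R (free_module R V) P"
    and pi: "\<forall>x\<in>carrier P. p (i x) = x"
    unfolding projective_module_def by (elim exE conjE)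
  have "\<exists>cx\<in>lmod_hom R (free_module R V) L. \<forall>xe\<in>carrier (free_module R V). ph (cx xe) = ps (p xe)"
  proof (rule free_module_lift_hom[OF Y L ph])
    show "(\<lambda>xe. ps (p xe)) \<in> lmod_hom R (free_module R V) Y"
      by (rule lmod_homI) (simp_all add: lmod_homD[OF ps] lmod_homD[OF p])
  qed (rule im, rule lmod_homD(1)[OF p])
  then obtain cx where cx: "cx \<in> lmod_hom R (free_module R V) L" "\<forall>xe\<in>carrier (free_module R V). ph (cx xe) = ps (p xe)"
    by (elim bexE)
  have "(\<lambda>x. cx (i x)) \<in> lmod_hom R P L" by (rule lmod_homI) (simp_all add: lmod_homD[OF cx(1)] lmod_homD[OF i])
  thus ?thesis using cx(2) pi lmod_homD(1)[OF i] by (intro bexI[of _ "\<lambda>x. cx (i x)"]) simp_all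
qed

text \<open>\<open>hereditary\<close> quantifies over the modules on one fixed type, so a module has
  to be carried there along an injection of its carrier.\<close>

lemma left_module_transport:
  fixes R :: "('r, 'c) ring_scheme" and V :: "('r, 'v, 'd) module_scheme" and c :: "'v \<Rightarrow> 'w"
  assumes V: "left_module R V" and c: "inj_on c (carrier V)"
  shows "\<exists>W :: ('r, 'w) module. left_module R W \<and> c \<in> lmod_hom R V W \<and> c ` carrier V = carrier W"
proof -
  interpret V: left_module R V by fact
  define d where "d = inv_into (carrier V) c"
  have d: "d (c v) = v" if "v \<in> carrier V" for v using that c by (simp add: d_def)
  define W :: "('r, 'w) module" where "W = \<lparr>carrier = c ` carrier V, monoid.mult = undefined, one = undefined, zero = c \<zero>\<^sub>V,
    add = \<lambda>x y. c (d x \<oplus>\<^sub>V d y), smult = \<lambda>r x. c (r \<odot>\<^sub>V d x)\<rparr>"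
  have W: "carrier W = c ` carrier V" "\<zero>\<^sub>W = c \<zero>\<^sub>V" "x \<oplus>\<^sub>W y = c (d x \<oplus>\<^sub>V d y)" "r \<odot>\<^sub>W x = c (r \<odot>\<^sub>V d x)" for x y r
    by (simp_all add: W_def)
  have ab: "abelian_group W"
  proof (rule abelian_groupI)
    fix x assume "x \<in> carrier W"
    then obtain v where "x = c v" "v \<in> carrier V" by (auto simp: W)
    thus "\<exists>y\<in>carrier W. y \<oplus>\<^sub>W x = \<zero>\<^sub>W" by (intro bexI[of _ "c (\<ominus>\<^sub>V v)"]) (simp_all add: W d V.M.l_neg)
  qed (auto simp: W d V.M.a_ac)
  have "left_module R W"
    by (intro left_module.intro left_module_axioms.intro ab V.R.ring_axioms)
      (auto simp: W d V.smult_closed V.smult_l_distr V.smult_r_distr V.smult_assoc V.smult_one)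
  moreover have "c \<in> lmod_hom R V W" by (rule lmod_homI) (simp_all add: W d)
  ultimately show ?thesis using W(1) by auto
qed

text \<open>Over a hereditary ring the kernel of \<open>pr\<close> is projective, so every
  surjection onto it splits. The splitting is written down directly from comparison maps between the
  free module and \<open>P0\<close> over \<open>V\<close>, in the manner of Schanuel's
  lemma.\<close>

lemma hereditary_kernel_section:
  fixes R :: "('r, 'c) ring_scheme" and n :: nat
  assumes her: "hereditary R" and V: "left_module R V"
    and pr: "pr \<in> lmod_hom R (free_module R {..<n}) V" and surj: "pr ` carrier (free_module R {..<n}) = carrier V"
    and L: "left_module R L" and th: "th \<in> lmod_hom R L (free_module R {..<n})"
    and im: "th ` carrier L = a_kernel (free_module R {..<n}) V pr"
  shows "\<exists>g. (\<forall>m\<in>a_kernel (free_module R {..<n}) V pr. g m \<in> carrier L \<and> th (g m) = m) \<and>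
    (\<forall>m\<in>a_kernel (free_module R {..<n}) V pr. \<forall>m'\<in>a_kernel (free_module R {..<n}) V pr.
      g (m \<oplus>\<^bsub>free_module R {..<n}\<^esub> m') = g m \<oplus>\<^sub>L g m') \<and>
    (\<forall>r\<in>carrier R. \<forall>m\<in>a_kernel (free_module R {..<n}) V pr. g (r \<odot>\<^bsub>free_module R {..<n}\<^esub> m) = r \<odot>\<^sub>L g m)"
proof -
  let ?F = "free_module R {..<n}"
  let ?K = "a_kernel ?F V pr"
  interpret V: left_module R V by fact
  interpret L: left_module R L by fact
  interpret F: left_module R ?F by (rule V.R.free_module_left_module)
  have K: "m \<in> ?K \<longleftrightarrow> m \<in> carrier ?F \<and> pr m = \<zero>\<^sub>V" for m by (simp add: a_kernel_def')
  \<comment> \<open>An element of \<open>V\<close> is encoded by its fibre under \<open>pr\<close>.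
    This is a set of functions on the naturals, which is exactly the type of elements in
    \<open>hereditary\<close>; surjectivity of \<open>pr\<close> makes the encoding
    injective.\<close>
  define c where "c v = {m \<in> carrier ?F. pr m = v}" for v
  have "inj_on c (carrier V)"
  proof (rule inj_onI)
    fix v w assume vw: "v \<in> carrier V" "w \<in> carrier V" "c v = c w"
    from vw(1) obtain m where "m \<in> carrier ?F" "pr m = v" using surj by (metis imageE)
    hence "m \<in> c w" using vw(3) by (auto simp: c_def)
    thus "v = w" using \<open>pr m = v\<close> by (simp add: c_def)
  qed
  from left_module_transport[OF V this] obtain W :: "('r, (nat \<Rightarrow> 'r) set) module" where
    W: "left_module R W" and cW: "c \<in> lmod_hom R V W" and imW: "c ` carrier V = carrier W" by (elim exE conjE)
  interpret W: left_module R W by fact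
  define pr' where "pr' m = c (pr m)" for m
  have pr': "pr' \<in> lmod_hom R ?F W" by (rule lmod_homI) (simp_all add: pr'_def lmod_homD[OF cW] lmod_homD[OF pr])
  have surj': "pr' ` carrier ?F = carrier W" using surj imW unfolding pr'_def by (metis image_image)
  have c0: "c \<zero>\<^sub>V = \<zero>\<^sub>W" by (rule lmod_hom_zero[OF cW V.M.abelian_group_axioms W.M.abelian_group_axioms])
  have K': "m \<in> ?K \<longleftrightarrow> m \<in> carrier ?F \<and> pr' m = \<zero>\<^sub>W" for m
    using \<open>inj_on c (carrier V)\<close> lmod_homD(1)[OF pr, of m] unfolding K pr'_def
    by (metis c0 inj_onD V.M.zero_closed)
  from her W have "proj_dim_le_1 R W" by (simp add: hereditary_def left_gldim_le_1_def)
  then obtain P0 P1 :: "('r, (nat \<Rightarrow> 'r) set \<Rightarrow> 'r) module" and d e where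
    P: "projective_module R P0" "projective_module R P1" and d: "d \<in> lmod_hom R P1 P0" and e: "e \<in> lmod_hom R P0 W"
    and dinj: "inj_on d (carrier P1)" and dim: "d ` carrier P1 = a_kernel P0 W e" and esurj: "e ` carrier P0 = carrier W"
    unfolding proj_dim_le_1_def by (elim exE conjE)
  interpret P0: left_module R P0 using P(1) by (simp add: projective_module_def)
  interpret P1: left_module R P1 using P(2) by (simp add: projective_module_def)
  have "\<exists>u\<in>lmod_hom R ?F P0. \<forall>xe\<in>carrier ?F. e (u xe) = pr' xe"
    using lmod_homD(1)[OF pr'] esurj by (intro free_module_lift_hom[OF W P0.left_module_axioms e pr']) simp
  then obtain u where u: "u \<in> lmod_hom R ?F P0" "\<forall>xe\<in>carrier ?F. e (u xe) = pr' xe" by (elim bexE)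
  have "\<exists>v\<in>lmod_hom R P0 ?F. \<forall>x\<in>carrier P0. pr' (v x) = e x"
    using lmod_homD(1)[OF e] surj' by (intro projective_module_lift[OF P(1) W F.left_module_axioms pr' e]) simp
  then obtain v where v: "v \<in> lmod_hom R P0 ?F" "\<forall>x\<in>carrier P0. pr' (v x) = e x" by (elim bexE)
  note uD = lmod_homD[OF u(1)] and vD = lmod_homD[OF v(1)] and dD = lmod_homD[OF d]
  \<comment> \<open>\<open>u\<close> and \<open>v\<close> lift the identity of \<open>V\<close> in
    the two directions, so \<open>xe\<close> and \<open>w xe\<close> have the same image and differ
    by an element of the kernel.\<close>
  define w where "w xe = v (u xe)" for xe
  have wD: "w xe \<in> carrier ?F" if "xe \<in> carrier ?F" for xe using that by (simp add: w_def uD vD)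
  have sneg: "r \<odot>\<^sub>?F (\<ominus>\<^sub>?F x) = \<ominus>\<^sub>?F (r \<odot>\<^sub>?F x)" if "r \<in> carrier R" "x \<in> carrier ?F" for r x
  proof -
    have "r \<odot>\<^sub>?F (\<ominus>\<^sub>?F x) \<oplus>\<^sub>?F r \<odot>\<^sub>?F x = \<zero>\<^sub>?F"
      using that by (simp add: F.smult_r_null F.M.l_neg flip: F.smult_r_distr)
    thus ?thesis using that by (metis F.M.minus_equality F.smult_closed F.M.a_inv_closed)
  qed
  have "\<exists>al\<in>lmod_hom R ?F L. \<forall>xe\<in>carrier ?F. th (al xe) = xe \<ominus>\<^sub>?F w xe"
  proof (rule free_module_lift_hom[OF F.left_module_axioms L th])
    show "(\<lambda>xe. xe \<ominus>\<^sub>?F w xe) \<in> lmod_hom R ?F ?F"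
      by (rule lmod_homI) (simp_all add: wD a_minus_def F.M.minus_add F.M.a_ac F.smult_r_distr sneg, simp_all add: w_def uD vD F.M.minus_add F.M.a_ac)
    fix xe assume x: "xe \<in> carrier ?F"
    have "pr' (xe \<ominus>\<^sub>?F w xe) = pr' xe \<ominus>\<^sub>W pr' (w xe)"
      using x by (intro lmod_hom_minus[OF pr' F.M.abelian_group_axioms W.M.abelian_group_axioms]) (simp_all add: wD)
    also have "\<dots> = \<zero>\<^sub>W" using x u(2) v(2) lmod_homD(1)[OF pr' x] by (simp add: w_def uD W.M.minus_eq_zero_iff)
    finally show "xe \<ominus>\<^sub>?F w xe \<in> th ` carrier L" unfolding im K' using x by (simp add: wD)
  qed
  then obtain al where al: "al \<in> lmod_hom R ?F L" "\<forall>xe\<in>carrier ?F. th (al xe) = xe \<ominus>\<^sub>?F w xe" by (elim bexE)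
  have ed: "e (d x) = \<zero>\<^sub>W" if "x \<in> carrier P1" for x
    using that dim by (auto simp: a_kernel_def')
  have "\<exists>bt\<in>lmod_hom R P1 L. \<forall>x\<in>carrier P1. th (bt x) = v (d x)"
  proof (rule projective_module_lift[OF P(2) F.left_module_axioms L th])
    show "(\<lambda>x. v (d x)) \<in> lmod_hom R P1 ?F" by (rule lmod_homI) (simp_all add: dD vD)
    fix x assume "x \<in> carrier P1"
    thus "v (d x) \<in> th ` carrier L" unfolding im K' using v(2) ed by (simp add: dD vD)
  qed
  then obtain bt where bt: "bt \<in> lmod_hom R P1 L" "\<forall>x\<in>carrier P1. th (bt x) = v (d x)" by (elim bexE)
  note alD = lmod_homD[OF al(1)] and btD = lmod_homD[OF bt(1)]
  \<comment> \<open>For \<open>m\<close> in the kernel, \<open>u m\<close> comes from a unique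
    element of \<open>P1\<close>; uniqueness makes \<open>de\<close> linear there.\<close>
  define de where "de m = inv_into (carrier P1) d (u m)" for m
  have de: "de m \<in> carrier P1 \<and> d (de m) = u m" if "m \<in> ?K" for m
  proof -
    have "u m \<in> d ` carrier P1" unfolding dim a_kernel_def' using that u(2) by (simp add: K' uD)
    thus ?thesis unfolding de_def by (simp add: inv_into_into f_inv_into_f)
  qed
  have deI: "de m = x" if "m \<in> ?K" "x \<in> carrier P1" "d x = u m" for m x
    using that de[OF that(1)] dinj by (metis inj_onD)
  have Kc: "m \<in> carrier ?F" if "m \<in> ?K" for m using that by (simp add: K)
  have K_add: "m \<oplus>\<^sub>?F m' \<in> ?K" if "m \<in> ?K" "m' \<in> ?K" for m m' using that by (simp add: K lmod_homD[OF pr])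
  have K_smult: "r \<odot>\<^sub>?F m \<in> ?K" if "m \<in> ?K" "r \<in> carrier R" for r m
    using that by (simp add: K lmod_homD[OF pr] F.smult_closed V.smult_r_null)
  \<comment> \<open>\<open>al m\<close> lifts the part \<open>m - w m\<close> of \<open>m\<close> to
    \<open>L\<close>, and \<open>bt (de m)\<close> lifts the part \<open>w m\<close>, which equals
    \<open>v (d (de m))\<close>.\<close>
  define g where "g m = al m \<oplus>\<^sub>L bt (de m)" for m
  have "g m \<in> carrier L \<and> th (g m) = m" if m: "m \<in> ?K" for m
  proof -
    note c = Kc[OF m] de[OF m]
    have "th (g m) = (m \<ominus>\<^sub>?F w m) \<oplus>\<^sub>?F w m" using c al(2) bt(2) by (simp add: g_def lmod_homD[OF th] alD btD w_def)
    also have "\<dots> = m" using c wD by (simp add: a_minus_def F.M.a_assoc F.M.l_neg)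
    finally show ?thesis using c by (simp add: g_def alD btD)
  qed
  moreover have "g (m \<oplus>\<^sub>?F m') = g m \<oplus>\<^sub>L g m'" if m: "m \<in> ?K" "m' \<in> ?K" for m m'
  proof -
    note c = Kc[OF m(1)] de[OF m(1)] Kc[OF m(2)] de[OF m(2)]
    have "de (m \<oplus>\<^sub>?F m') = de m \<oplus>\<^sub>P1 de m'" using c by (intro deI[OF K_add[OF m]]) (simp_all add: dD uD)
    thus ?thesis using c by (simp add: g_def alD btD L.M.a_ac)
  qed
  moreover have "g (r \<odot>\<^sub>?F m) = r \<odot>\<^sub>L g m" if m: "m \<in> ?K" and r: "r \<in> carrier R" for r m
  proof -
    note c = Kc[OF m] de[OF m]
    have "de (r \<odot>\<^sub>?F m) = r \<odot>\<^sub>P1 de m" using c r by (intro deI[OF K_smult[OF m r]]) (simp_all add: dD uD P1.smult_closed)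
    thus ?thesis using c r by (simp add: g_def alD btD L.smult_r_distr)
  qed
  ultimately show ?thesis by (intro exI[of _ g]) simp
qed

text \<open>
  The cocycle \<open>ga\<close> twists \<open>V \<times> M\<close>, where \<open>V = B e\<close> and \<open>M\<close> is the kernel of \<open>A\<^sup>n \<rightarrow> V\<close>, into an
  extension of \<open>M\<close> by \<open>V\<close>.  A splitting of this extension, evaluated at the elements
  \<open>a u\<^sub>j - \<Sum>\<^sub>l kp (rh a) l j u\<^sub>l\<close> of \<open>M\<close>, gives the cochain.
\<close>

lemma hereditary_coboundary:
  fixes k :: "('k, 'c) ring_scheme" and A :: "('k, 'a) module" and B :: "('k, 'b) module" (structure) and n :: nat
  assumes A: "assoc_algebra k A" and her: "hereditary A" and B: "assoc_algebra k B"
    and rh: "rh \<in> alg_hom k A B"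
    and e: "\<And>j. j < n \<Longrightarrow> e j \<in> carrier B" and f: "\<And>j. j < n \<Longrightarrow> f j \<in> carrier B" and ec: "ec \<in> carrier B"
    and kp: "\<And>x l j. x \<in> carrier B \<Longrightarrow> l < n \<Longrightarrow> j < n \<Longrightarrow> kp x l j \<in> carrier k"
    and kp_add: "\<And>x y l j. x \<in> carrier B \<Longrightarrow> y \<in> carrier B \<Longrightarrow> l < n \<Longrightarrow> j < n \<Longrightarrow> kp (x \<oplus> y) l j = kp x l j \<oplus>\<^sub>k kp y l j"
    and kp_smult: "\<And>c x l j. c \<in> carrier k \<Longrightarrow> x \<in> carrier B \<Longrightarrow> l < n \<Longrightarrow> j < n \<Longrightarrow> kp (c \<odot> x) l j = c \<otimes>\<^sub>k kp x l j"
    and kp_mult: "\<And>x y l j. x \<in> carrier B \<Longrightarrow> y \<in> carrier B \<Longrightarrow> l < n \<Longrightarrow> j < n \<Longrightarrow>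
      kp (x \<otimes> y) l j = (\<Oplus>\<^sub>k t<n. kp x l t \<otimes>\<^sub>k kp y t j)"
    and xe: "\<And>x j. x \<in> carrier B \<Longrightarrow> j < n \<Longrightarrow> x \<otimes> e j = (\<Oplus>l<n. kp x l j \<odot> e l)"
    and fx: "\<And>x l. x \<in> carrier B \<Longrightarrow> l < n \<Longrightarrow> f l \<otimes> x = (\<Oplus>j<n. kp x l j \<odot> f j)"
    and ef: "(\<Oplus>j<n. e j \<otimes> f j) = \<one>"
    and eec: "\<And>j. j < n \<Longrightarrow> e j \<otimes> ec = e j"
    and span: "\<And>z. z \<in> carrier B \<Longrightarrow> z \<otimes> ec = z \<Longrightarrow> \<exists>c. (\<forall>j<n. c j \<in> carrier k) \<and> z = (\<Oplus>j<n. c j \<odot> e j)"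
    and ga: "bilinear_on k A B ga"
    and coc: "\<And>a b c. a \<in> carrier A \<Longrightarrow> b \<in> carrier A \<Longrightarrow> c \<in> carrier A \<Longrightarrow>
      rh a \<otimes> ga b c \<oplus> ga a (b \<otimes>\<^sub>A c) = ga (a \<otimes>\<^sub>A b) c \<oplus> ga a b \<otimes> rh c"
    and ga1: "\<And>a. a \<in> carrier A \<Longrightarrow> ga \<one>\<^sub>A a = \<zero>" "\<And>a. a \<in> carrier A \<Longrightarrow> ga a \<one>\<^sub>A = \<zero>"
  shows "\<exists>h\<in>lmod_hom k A B. \<forall>a\<in>carrier A. \<forall>b\<in>carrier A.
    h (a \<otimes>\<^sub>A b) = rh a \<otimes> h b \<oplus> h a \<otimes> rh b \<oplus> ga a b"
proof -
  interpret A: assoc_algebra k A by fact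
  interpret B: assoc_algebra k B by fact
  let ?F = "free_module A {..<n}"
  interpret F: left_module A ?F by (rule A.free_module_left_module)
  have rhc: "rh a \<in> carrier B" if "a \<in> carrier A" for a using rh that by (auto simp: alg_hom_def ring_hom_def)
  have rh_add: "rh (a \<oplus>\<^sub>A b) = rh a \<oplus> rh b" if "a \<in> carrier A" "b \<in> carrier A" for a b using rh that by (auto simp: alg_hom_def ring_hom_def)
  have rh_mult: "rh (a \<otimes>\<^sub>A b) = rh a \<otimes> rh b" if "a \<in> carrier A" "b \<in> carrier A" for a b using rh that by (auto simp: alg_hom_def ring_hom_def)
  have rh_smult: "rh (c \<odot>\<^sub>A a) = c \<odot> rh a" if "c \<in> carrier k" "a \<in> carrier A" for a c using rh that by (auto simp: alg_hom_def)
  have rh_one: "rh \<one>\<^sub>A = \<one>" using rh by (auto simp: alg_hom_def ring_hom_def)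
  note rhs = rhc rh_add rh_mult rh_smult rh_one
  have gac: "ga a b \<in> carrier B" if "a \<in> carrier A" "b \<in> carrier A" for a b using ga that by (simp add: bilinear_on_def)
  have gal: "ga (a \<oplus>\<^sub>A a') b = ga a b \<oplus> ga a' b" if "a \<in> carrier A" "a' \<in> carrier A" "b \<in> carrier A" for a a' b using ga that by (simp add: bilinear_on_def)
  have gar: "ga a (b \<oplus>\<^sub>A b') = ga a b \<oplus> ga a b'" if "a \<in> carrier A" "b' \<in> carrier A" "b \<in> carrier A" for a b b' using ga that by (simp add: bilinear_on_def)
  have gasl: "ga (c \<odot>\<^sub>A a) b = c \<odot> ga a b" if "c \<in> carrier k" "a \<in> carrier A" "b \<in> carrier A" for a b c using ga that by (simp add: bilinear_on_def)
  have gasr: "ga a (c \<odot>\<^sub>A b) = c \<odot> ga a b" if "c \<in> carrier k" "a \<in> carrier A" "b \<in> carrier A" for a b c using ga that by (simp add: bilinear_on_def)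
  define io where "io c = c \<odot>\<^sub>A \<one>\<^sub>A" for c
  have ioc: "io c \<in> carrier A" if "c \<in> carrier k" for c using that by (simp add: io_def)
  have iom: "io c \<otimes>\<^sub>A a = c \<odot>\<^sub>A a" "a \<otimes>\<^sub>A io c = c \<odot>\<^sub>A a" if "c \<in> carrier k" "a \<in> carrier A" for c a
    using that by (simp_all add: io_def A.smult_assoc_l A.smult_assoc_r)
  have rhio: "rh (io c) = c \<odot> \<one>" if "c \<in> carrier k" for c using that by (simp add: io_def rhs)
  have gaio: "ga (io c) a = \<zero>" "ga a (io c) = \<zero>" if "c \<in> carrier k" "a \<in> carrier A" for c a
    using that by (simp_all add: io_def gasl gasr ga1)
  have mF: "m j \<in> carrier A" if "m \<in> carrier ?F" for m j using free_module_val[OF that] .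
  have FI: "m \<in> carrier ?F" if "\<And>j. j < n \<Longrightarrow> m j \<in> carrier A" "\<And>j. \<not> j < n \<Longrightarrow> m j = \<zero>\<^sub>A" for m
    using that by (subst free_module_finite_iff) auto
  have Bm: "(x \<ominus> y) \<otimes> z = x \<otimes> z \<ominus> y \<otimes> z" if "x \<in> carrier B" "y \<in> carrier B" "z \<in> carrier B" for x y z
    using that by (simp add: a_minus_def B.l_distr B.l_minus)
  have B0: "x \<ominus> \<zero> = x" if "x \<in> carrier B" for x using that by (simp add: a_minus_def)
  note Fs = free_module_simps(2-)

  \<comment> \<open>The left ideal \<open>B ec\<close>; if \<open>ec\<close> is the first diagonal
    matrix unit, it is the first column, that is k^n. \<open>A\<close> acts on it through
    \<open>rh\<close>, and \<open>pr\<close> maps the basis vectors of A^n to the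
    \<open>e j\<close>.\<close>
  define V where "V = {z \<in> carrier B. z \<otimes> ec = z}"
  define VM :: "('a, 'b) module" where "VM = \<lparr>carrier = V, monoid.mult = undefined, one = undefined,
    zero = \<zero>, add = (\<oplus>), smult = \<lambda>a z. rh a \<otimes> z\<rparr>"
  have VM: "carrier VM = V" "\<zero>\<^sub>VM = \<zero>" "x \<oplus>\<^sub>VM y = x \<oplus> y" "a \<odot>\<^sub>VM x = rh a \<otimes> x" for a x y
    by (simp_all add: VM_def)
  have V: "x \<in> carrier B" if "x \<in> V" for x using that by (simp add: V_def)
  have V_add: "x \<oplus> y \<in> V" if "x \<in> V" "y \<in> V" for x y using that ec by (simp add: V_def B.l_distr)
  have V_mult: "x \<otimes> y \<in> V" if "x \<in> carrier B" "y \<in> V" for x y using that ec by (simp add: V_def B.m_assoc)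
  have V_zero: "\<zero> \<in> V" using ec by (simp add: V_def)
  have V_neg: "\<ominus> x \<in> V" if "x \<in> V" for x using that ec by (simp add: V_def B.l_minus)
  have eV: "e j \<in> V" if "j < n" for j using that e eec by (simp add: V_def)
  have V_sum: "(\<Oplus>j\<in>S. y j) \<in> V" if "\<And>j. j \<in> S \<Longrightarrow> y j \<in> V" for S :: "nat set" and y
    using that by (induction S rule: infinite_finite_induct) (auto simp: V_zero V_add V Pi_iff)
  have VM_group: "abelian_group VM"
  proof (rule abelian_groupI)
    fix x assume "x \<in> carrier VM"
    thus "\<exists>y\<in>carrier VM. y \<oplus>\<^sub>VM x = \<zero>\<^sub>VM"
      by (intro bexI[of _ "\<ominus> x"]) (simp_all add: VM V V_neg B.l_neg)
  qed (simp_all add: VM V V_add V_zero B.a_ac)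
  have VM_mod: "left_module A VM"
    by (intro left_module.intro left_module_axioms.intro VM_group A.ring_axioms)
      (simp_all add: VM V V_mult rhs B.l_distr B.r_distr B.m_assoc)
  define pr where "pr m = (\<Oplus>j<n. rh (m j) \<otimes> e j)" for m
  have prV: "pr m \<in> V" if "m \<in> carrier ?F" for m
    unfolding pr_def using that by (intro V_sum V_mult) (simp_all add: rhs mF eV)
  have pr: "pr \<in> lmod_hom A ?F VM"
  proof (rule lmod_homI)
    fix m assume m: "m \<in> carrier ?F"
    show "pr m \<in> carrier VM" using prV[OF m] by (simp add: VM)
    { fix m' assume m': "m' \<in> carrier ?F"
      show "pr (m \<oplus>\<^sub>?F m') = pr m \<oplus>\<^sub>VM pr m'"
        unfolding pr_def VM using m m' e by (intro B.finsum_add_eqI) (simp_all add: Fs mF rhs B.l_distr) }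
    fix a assume a: "a \<in> carrier A"
    show "pr (a \<odot>\<^sub>?F m) = a \<odot>\<^sub>VM pr m"
      unfolding pr_def VM using m a e by (subst B.finsum_rdistr) (auto simp: Fs mF rhs B.m_assoc intro!: B.finsum_cong')
  qed
  have surj: "pr ` carrier ?F = carrier VM"
  proof
    show "pr ` carrier ?F \<subseteq> carrier VM" using prV by (auto simp: VM)
    show "carrier VM \<subseteq> pr ` carrier ?F"
    proof
      fix z assume "z \<in> carrier VM"
      hence "z \<in> carrier B" "z \<otimes> ec = z" by (simp_all add: VM V_def)
      from span[OF this] obtain c where c: "\<forall>j<n. c j \<in> carrier k" "z = (\<Oplus>j<n. c j \<odot> e j)" by (elim exE conjE)
      let ?m = "\<lambda>j. if j < n then io (c j) else \<zero>\<^sub>A"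
      have "?m \<in> carrier ?F" using c(1) by (intro FI) (simp_all add: ioc)
      moreover have "pr ?m = z" unfolding pr_def c(2)
        using c(1) e by (intro B.finsum_cong') (auto simp: rhio B.smult_assoc_l)
      ultimately show "z \<in> pr ` carrier ?F" by blast
    qed
  qed

  let ?K = "a_kernel ?F VM pr"
  have K: "m \<in> ?K \<longleftrightarrow> m \<in> carrier ?F \<and> pr m = \<zero>" for m by (simp add: a_kernel_def' VM)
  have KF: "m \<in> carrier ?F" if "m \<in> ?K" for m using that by (simp add: K)
  have Kv: "m j \<in> carrier A" if "m \<in> ?K" for m j using mF[OF KF[OF that]] .
  have K_add: "m \<oplus>\<^sub>?F m' \<in> ?K" if "m \<in> ?K" "m' \<in> ?K" for m m' using that by (simp add: K lmod_homD[OF pr] VM)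
  have K_smult: "a \<odot>\<^sub>?F m \<in> ?K" if "m \<in> ?K" "a \<in> carrier A" for a m
    using that by (simp add: K lmod_homD[OF pr] F.smult_closed VM rhs)
  have pr0: "pr \<zero>\<^sub>?F = \<zero>" using lmod_hom_zero[OF pr F.M.abelian_group_axioms VM_group] by (simp add: VM)
  have K_zero: "\<zero>\<^sub>?F \<in> ?K" by (simp add: K pr0)
  have K_neg: "\<ominus>\<^sub>?F m \<in> ?K" if "m \<in> ?K" for m
  proof -
    have "pr (\<ominus>\<^sub>?F m \<oplus>\<^sub>?F m) = pr (\<ominus>\<^sub>?F m) \<oplus> pr m"
      using that by (subst lmod_homD(2)[OF pr]) (simp_all add: KF VM)
    thus ?thesis using that prV[of "\<ominus>\<^sub>?F m"] by (simp add: K F.M.l_neg pr0 V)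
  qed
  \<comment> \<open>The twist of the extension, obtained by applying \<open>ga a\<close> to the
    coordinates of \<open>m\<close> and combining the results with the \<open>e j\<close>.\<close>
  define c where "c a m = (\<Oplus>j<n. ga a (m j) \<otimes> e j)" for a m
  have cV: "c a m \<in> V" if "a \<in> carrier A" "m \<in> carrier ?F" for a m
    unfolding c_def using that by (intro V_sum V_mult) (simp_all add: gac mF eV)
  note cc = V[OF cV]
  have c_addl: "c (a \<oplus>\<^sub>A b) m = c a m \<oplus> c b m" if "a \<in> carrier A" "b \<in> carrier A" "m \<in> carrier ?F" for a b m
    unfolding c_def using that e by (intro B.finsum_add_eqI) (simp_all add: mF gac gal B.l_distr)
  have c_addr: "c a (m \<oplus>\<^sub>?F m') = c a m \<oplus> c a m'" if "a \<in> carrier A" "m \<in> carrier ?F" "m' \<in> carrier ?F" for a m m'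
    unfolding c_def using that e by (intro B.finsum_add_eqI) (simp_all add: Fs mF gac gar B.l_distr)
  have c_one: "c (io d) m = \<zero>" if "m \<in> carrier ?F" "d \<in> carrier k" for m d
    unfolding c_def using that e by (intro B.add.finprod_one_eqI) (simp add: mF gaio)
  \<comment> \<open>This is associativity of the action on \<open>L\<close>. The cocycle identity
    leaves an extra term \<open>ga a b\<close> times \<open>pr m\<close>, which vanishes because
    \<open>m\<close> lies in the kernel.\<close>
  have c_mult: "c (a \<otimes>\<^sub>A b) m = rh a \<otimes> c b m \<oplus> c a (b \<odot>\<^sub>?F m)"
    if ab: "a \<in> carrier A" "b \<in> carrier A" and m: "m \<in> ?K" for a b m
  proof -
    have t: "ga a b \<otimes> rh (m j) \<otimes> e j \<oplus> ga (a \<otimes>\<^sub>A b) (m j) \<otimes> e j =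
      rh a \<otimes> (ga b (m j) \<otimes> e j) \<oplus> ga a (b \<otimes>\<^sub>A m j) \<otimes> e j" if "j < n" for j
    proof -
      have "ga a b \<otimes> rh (m j) \<otimes> e j \<oplus> ga (a \<otimes>\<^sub>A b) (m j) \<otimes> e j = (ga (a \<otimes>\<^sub>A b) (m j) \<oplus> ga a b \<otimes> rh (m j)) \<otimes> e j"
        using ab Kv[OF m] e[OF that] by (simp add: gac rhs B.l_distr B.a_comm)
      also have "\<dots> = rh a \<otimes> (ga b (m j) \<otimes> e j) \<oplus> ga a (b \<otimes>\<^sub>A m j) \<otimes> e j"
        unfolding coc[OF ab Kv[OF m], symmetric] using ab Kv[OF m] e[OF that] by (simp add: gac rhs B.l_distr B.m_assoc)
      finally show ?thesis .
    qed
    have "ga a b \<otimes> pr m = (\<Oplus>j<n. ga a b \<otimes> rh (m j) \<otimes> e j)"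
      unfolding pr_def using ab Kv[OF m] e by (subst B.finsum_rdistr) (auto simp: gac rhs B.m_assoc intro!: B.finsum_cong')
    hence z: "(\<Oplus>j<n. ga a b \<otimes> rh (m j) \<otimes> e j) = \<zero>" using m ab by (simp add: K gac)
    have "rh a \<otimes> c b m \<oplus> c a (b \<odot>\<^sub>?F m) =
      (\<Oplus>j<n. rh a \<otimes> (ga b (m j) \<otimes> e j)) \<oplus> (\<Oplus>j<n. ga a (b \<otimes>\<^sub>A m j) \<otimes> e j)"
      unfolding c_def using ab Kv[OF m] e by (subst B.finsum_rdistr) (auto simp: gac rhs Fs)
    also have "\<dots> = (\<Oplus>j<n. ga a b \<otimes> rh (m j) \<otimes> e j \<oplus> ga (a \<otimes>\<^sub>A b) (m j) \<otimes> e j)"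
      using ab Kv[OF m] e by (intro B.finsum_add_eqI[symmetric]) (auto simp: gac rhs t)
    also have "\<dots> = (\<Oplus>j<n. ga a b \<otimes> rh (m j) \<otimes> e j) \<oplus> c (a \<otimes>\<^sub>A b) m"
      unfolding c_def using ab Kv[OF m] e by (intro B.finsum_addf) (auto simp: gac rhs)
    finally show ?thesis using z ab m by (simp add: cc KF)
  qed

  \<comment> \<open>As a group the extension is the direct sum of \<open>V\<close> and
    \<open>?K\<close>; only the action is twisted by \<open>c\<close>.\<close>
  define L :: "('a, 'b \<times> (nat \<Rightarrow> 'a)) module" where "L = \<lparr>carrier = V \<times> ?K, monoid.mult = undefined, one = undefined,
    zero = (\<zero>, \<zero>\<^sub>?F), add = \<lambda>x y. (fst x \<oplus> fst y, snd x \<oplus>\<^sub>?F snd y),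
    smult = \<lambda>a x. (rh a \<otimes> fst x \<oplus> c a (snd x), a \<odot>\<^sub>?F snd x)\<rparr>"
  have L: "x \<in> carrier L \<longleftrightarrow> fst x \<in> V \<and> snd x \<in> ?K" "\<zero>\<^sub>L = (\<zero>, \<zero>\<^sub>?F)" "x \<oplus>\<^sub>L y = (fst x \<oplus> fst y, snd x \<oplus>\<^sub>?F snd y)"
    "a \<odot>\<^sub>L x = (rh a \<otimes> fst x \<oplus> c a (snd x), a \<odot>\<^sub>?F snd x)" for x y a
    by (auto simp: L_def mem_Times_iff)
  have "abelian_group L"
  proof (rule abelian_groupI)
    fix x assume "x \<in> carrier L"
    thus "\<exists>y\<in>carrier L. y \<oplus>\<^sub>L x = \<zero>\<^sub>L"
      by (intro bexI[of _ "(\<ominus> fst x, \<ominus>\<^sub>?F snd x)"]) (simp_all add: L V KF V_neg K_neg B.l_neg F.M.l_neg)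
  qed (simp_all add: L V KF V_add K_add V_zero K_zero B.a_ac F.M.a_ac prod_eq_iff)
  moreover have "io \<one>\<^sub>k = \<one>\<^sub>A" by (simp add: io_def)
  ultimately have L_mod: "left_module A L"
    using c_one[of _ "\<one>\<^sub>k"]
    by (intro left_module.intro left_module_axioms.intro A.ring_axioms)
      (simp_all add: L V KF V_add V_mult K_smult cV cc rhs B.l_distr B.r_distr B.m_assoc B.a_ac c_addl c_addr c_mult
         F.smult_closed F.smult_l_distr F.smult_r_distr F.smult_assoc F.smult_one)
  have snd: "snd \<in> lmod_hom A L ?F" by (rule lmod_homI) (simp_all add: L KF)
  have im: "snd ` carrier L = ?K"
  proof (intro equalityI subsetI)
    fix m assume "m \<in> ?K"
    hence "(\<zero>, m) \<in> carrier L" using V_zero by (simp only: L(1) fst_conv snd_conv)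
    thus "m \<in> snd ` carrier L" by force
  qed (auto simp only: L(1))
  have "\<exists>g. (\<forall>m\<in>?K. g m \<in> carrier L \<and> snd (g m) = m) \<and> (\<forall>m\<in>?K. \<forall>m'\<in>?K. g (m \<oplus>\<^sub>?F m') = g m \<oplus>\<^sub>L g m') \<and>
    (\<forall>r\<in>carrier A. \<forall>m\<in>?K. g (r \<odot>\<^sub>?F m) = r \<odot>\<^sub>L g m)"
    by (rule hereditary_kernel_section[OF her VM_mod pr surj L_mod snd im])
  then obtain g where g: "\<forall>m\<in>?K. g m \<in> carrier L \<and> snd (g m) = m" "\<forall>m\<in>?K. \<forall>m'\<in>?K. g (m \<oplus>\<^sub>?F m') = g m \<oplus>\<^sub>L g m'"
    "\<forall>r\<in>carrier A. \<forall>m\<in>?K. g (r \<odot>\<^sub>?F m) = r \<odot>\<^sub>L g m" by (elim exE conjE)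
  \<comment> \<open>The \<open>V\<close>-component of the splitting. By \<open>g1_act\<close> its
    failure to be A-linear is exactly \<open>c\<close>.\<close>
  define g1 where "g1 m = fst (g m)" for m
  have g1c: "g1 m \<in> carrier B" if "m \<in> ?K" for m using g(1) that V by (simp add: L g1_def)
  have g1_add: "g1 (m \<oplus>\<^sub>?F m') = g1 m \<oplus> g1 m'" if "m \<in> ?K" "m' \<in> ?K" for m m'
    using g(2) that by (simp add: L g1_def)
  have g1_act: "g1 (a \<odot>\<^sub>?F m) = rh a \<otimes> g1 m \<oplus> c a m" if "a \<in> carrier A" "m \<in> ?K" for a m
    using g(1,3) that by (simp add: L g1_def)
  have g1_smult: "g1 (io d \<odot>\<^sub>?F m) = d \<odot> g1 m" if "d \<in> carrier k" "m \<in> ?K" for d m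
    using that by (simp add: g1_act ioc c_one KF g1c rhio B.smult_assoc_l)
  have g1_sum: "g1 (\<Oplus>\<^sub>?F l\<in>S. y l) = (\<Oplus>l\<in>S. g1 (y l)) \<and> (\<Oplus>\<^sub>?F l\<in>S. y l) \<in> ?K" if "finite S" "\<And>l. l \<in> S \<Longrightarrow> y l \<in> ?K" for S :: "nat set" and y
    using that
  proof (induction S rule: finite_induct)
    case empty
    have "g1 (\<zero>\<^sub>?F \<oplus>\<^sub>?F \<zero>\<^sub>?F) = g1 \<zero>\<^sub>?F \<oplus> g1 \<zero>\<^sub>?F" by (rule g1_add[OF K_zero K_zero])
    hence "g1 \<zero>\<^sub>?F = \<zero>" using g1c[OF K_zero] by simp
    thus ?case by (simp add: K_zero)
  next
    case (insert l S)
    have "(\<Oplus>\<^sub>?F l\<in>insert l S. y l) = y l \<oplus>\<^sub>?F (\<Oplus>\<^sub>?F l\<in>S. y l)"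
      using insert KF by (intro F.M.finsum_insert) auto
    moreover have "(\<Oplus>l\<in>insert l S. g1 (y l)) = g1 (y l) \<oplus> (\<Oplus>l\<in>S. g1 (y l))"
      using insert g1c by (intro B.finsum_insert) auto
    ultimately show ?case using insert by (simp add: g1_add K_add)
  qed

  \<comment> \<open>The difference between \<open>a\<close> times the j-th basis vector and the
    combination of basis vectors with scalar coefficients that has the same image under
    \<open>pr\<close>.\<close>
  define m where "m j a = (\<lambda>t. if t < n then (if t = j then a else \<zero>\<^sub>A) \<ominus>\<^sub>A io (kp (rh a) t j) else \<zero>\<^sub>A)" for j a
  have iokp: "io (kp (rh a) t j) \<in> carrier A" "kp (rh a) t j \<in> carrier k" if "a \<in> carrier A" "t < n" "j < n" for a t j
    using that by (simp_all add: ioc kp rhs)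
  have mFc: "m j a \<in> carrier ?F" if "j < n" "a \<in> carrier A" for j a
    using that by (intro FI) (simp_all add: m_def iokp)
  have mK: "m j a \<in> ?K" if j: "j < n" and a: "a \<in> carrier A" for j a
  proof -
    have rhz: "rh \<zero>\<^sub>A = \<zero>" using rh_smult[of "\<zero>\<^sub>k" "\<zero>\<^sub>A"] rhc[of "\<zero>\<^sub>A"] by simp
    have rhm: "rh (x \<ominus>\<^sub>A y) = rh x \<ominus> rh y" if "x \<in> carrier A" "y \<in> carrier A" for x y
      by (rule lmod_hom_minus[of rh k, OF _ A.abelian_group_axioms B.abelian_group_axioms that]) (rule lmod_homI; simp add: rhs)
    have "pr (m j a) = (\<Oplus>t<n. if t = j then rh a \<otimes> e j else \<zero>) \<ominus> (\<Oplus>t<n. kp (rh a) t j \<odot> e t)"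
      unfolding pr_def using a j e
      by (intro B.finsum_minus_eqI) (auto simp: m_def rhm iokp rhio rhs rhz Bm B.smult_assoc_l)
    also have "\<dots> = \<zero>" using a j e by (simp add: B.finsum_delta rhs xe[symmetric] B.minus_eq_zero_iff)
    finally show ?thesis using mFc[OF j a] by (simp add: K)
  qed
  have m_add: "m j (a \<oplus>\<^sub>A b) = m j a \<oplus>\<^sub>?F m j b" if "j < n" "a \<in> carrier A" "b \<in> carrier A" for j a b
  proof
    fix t
    have "io (kp (rh (a \<oplus>\<^sub>A b)) t j) = io (kp (rh a) t j) \<oplus>\<^sub>A io (kp (rh b) t j)" if "t < n"
      using that \<open>j < n\<close> \<open>a \<in> carrier A\<close> \<open>b \<in> carrier A\<close> by (simp add: rhs kp_add io_def A.smult_l_distr kp)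
    thus "m j (a \<oplus>\<^sub>A b) t = (m j a \<oplus>\<^sub>?F m j b) t"
      using that by (auto simp: m_def Fs iokp a_minus_def A.minus_add A.a_ac)
  qed
  have m_smult: "m j (d \<odot>\<^sub>A a) = io d \<odot>\<^sub>?F m j a" if "j < n" "a \<in> carrier A" "d \<in> carrier k" for j a d
  proof
    fix t
    have "io (kp (rh (d \<odot>\<^sub>A a)) t j) = d \<odot>\<^sub>A io (kp (rh a) t j)" if "t < n"
      using that \<open>j < n\<close> \<open>a \<in> carrier A\<close> \<open>d \<in> carrier k\<close> by (simp add: rhs kp_smult io_def A.smult_assoc1 kp)
    thus "m j (d \<odot>\<^sub>A a) t = (io d \<odot>\<^sub>?F m j a) t"
      using that by (auto simp: m_def Fs iokp iom a_minus_def A.smult_r_distr A.smult_r_minus)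
  qed
  \<comment> \<open>A Leibniz rule in which the right factor acts through its matrix: the terms with
    the entries of \<open>rh b\<close> times \<open>a\<close> cancel, and \<open>kp_mult\<close>
    collects the scalar terms.\<close>
  have m_mult: "m j (a \<otimes>\<^sub>A b) = a \<odot>\<^sub>?F m j b \<oplus>\<^sub>?F (\<Oplus>\<^sub>?F l<n. io (kp (rh b) l j) \<odot>\<^sub>?F m l a)"
    if j: "j < n" and ab: "a \<in> carrier A" "b \<in> carrier A" for j a b
  proof
    fix t
    have val: "(\<Oplus>\<^sub>?F l\<in>S. y l) t = (\<Oplus>\<^sub>A l\<in>S. y l t)" if "finite S" "\<And>l. l \<in> S \<Longrightarrow> y l \<in> carrier ?F" for S :: "nat set" and y
      using that mF by (induction S rule: finite_induct) (simp_all add: Fs Pi_iff)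
    have yc: "io (kp (rh b) l j) \<odot>\<^sub>?F m l a \<in> carrier ?F" if "l < n" for l
      using that j ab by (intro F.smult_closed iokp mFc)
    have val': "(a \<odot>\<^sub>?F m j b \<oplus>\<^sub>?F (\<Oplus>\<^sub>?F l<n. io (kp (rh b) l j) \<odot>\<^sub>?F m l a)) t =
        (a \<odot>\<^sub>?F m j b) t \<oplus>\<^sub>A (\<Oplus>\<^sub>A l<n. (io (kp (rh b) l j) \<odot>\<^sub>?F m l a) t)"
      by (simp only: Fs(2) val[OF finite_lessThan yc[unfolded lessThan_iff[symmetric]]])
    show "m j (a \<otimes>\<^sub>A b) t = (a \<odot>\<^sub>?F m j b \<oplus>\<^sub>?F (\<Oplus>\<^sub>?F l<n. io (kp (rh b) l j) \<odot>\<^sub>?F m l a)) t"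
    proof (cases "t < n")
      case False
      have "(\<Oplus>\<^sub>A l<n. (io (kp (rh b) l j) \<odot>\<^sub>?F m l a) t) = \<zero>\<^sub>A"
        using False j ab by (intro A.add.finprod_one_eqI) (simp add: Fs m_def iokp)
      moreover have "(a \<odot>\<^sub>?F m j b) t = \<zero>\<^sub>A" "m j (a \<otimes>\<^sub>A b) t = \<zero>\<^sub>A" using False ab by (simp_all add: m_def Fs)
      ultimately show ?thesis unfolding val' by simp
    next
      case True
      have k1: "kp (rh a) t l \<in> carrier k" "kp (rh b) l j \<in> carrier k" if "l < n" for l using that True j ab iokp by auto
      let ?ba = "\<lambda>l. if l = t then kp (rh b) t j \<odot>\<^sub>A a else \<zero>\<^sub>A"
      let ?s = "\<Oplus>\<^sub>A l<n. (kp (rh a) t l \<otimes>\<^sub>k kp (rh b) l j) \<odot>\<^sub>A \<one>\<^sub>A"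
      have "(\<Oplus>\<^sub>A l<n. (io (kp (rh b) l j) \<odot>\<^sub>?F m l a) t) = (\<Oplus>\<^sub>A l<n. ?ba l) \<ominus>\<^sub>A ?s"
      proof (rule A.finsum_minus_eqI)
        fix l assume l: "l \<in> {..<n}"
        have "kp (rh b) l j \<odot>\<^sub>A io (kp (rh a) t l) = (kp (rh a) t l \<otimes>\<^sub>k kp (rh b) l j) \<odot>\<^sub>A \<one>\<^sub>A"
          using l k1 by (simp add: io_def A.R.m_comm flip: A.smult_assoc1)
        thus "(io (kp (rh b) l j) \<odot>\<^sub>?F m l a) t = ?ba l \<ominus>\<^sub>A (kp (rh a) t l \<otimes>\<^sub>k kp (rh b) l j) \<odot>\<^sub>A \<one>\<^sub>A"
          using l k1 ab True by (auto simp: Fs m_def iom ioc a_minus_def A.smult_r_distr A.smult_r_minus)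
      qed (use k1 ab in auto)
      also have "(\<Oplus>\<^sub>A l<n. ?ba l) = kp (rh b) t j \<odot>\<^sub>A a" using k1(2) True ab by (intro A.finsum_delta) auto
      also have "?s = io (kp (rh (a \<otimes>\<^sub>A b)) t j)"
      proof -
        have "(\<Oplus>\<^sub>A l\<in>S. y l \<odot>\<^sub>A \<one>\<^sub>A) = (\<Oplus>\<^sub>k l\<in>S. y l) \<odot>\<^sub>A \<one>\<^sub>A" if "finite S" "\<And>l. l \<in> S \<Longrightarrow> y l \<in> carrier k" for S :: "nat set" and y
          using that by (induction S rule: finite_induct) (simp_all add: A.smult_l_distr Pi_iff)
        from this[of "{..<n}" "\<lambda>l. kp (rh a) t l \<otimes>\<^sub>k kp (rh b) l j"] show ?thesis
          using k1 True j ab by (simp add: io_def rhs kp_mult)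
      qed
      finally have s: "(\<Oplus>\<^sub>A l<n. (io (kp (rh b) l j) \<odot>\<^sub>?F m l a) t) = kp (rh b) t j \<odot>\<^sub>A a \<ominus>\<^sub>A io (kp (rh (a \<otimes>\<^sub>A b)) t j)" .
      let ?d = "if t = j then a \<otimes>\<^sub>A b else \<zero>\<^sub>A"
      have e1: "(a \<odot>\<^sub>?F m j b) t = ?d \<ominus>\<^sub>A kp (rh b) t j \<odot>\<^sub>A a"
        using True j ab iokp[of b t j] by (auto simp: Fs m_def a_minus_def A.r_distr A.r_minus iom)
      have e2: "m j (a \<otimes>\<^sub>A b) t = ?d \<ominus>\<^sub>A io (kp (rh (a \<otimes>\<^sub>A b)) t j)" using True by (simp add: m_def)
      have e3: "x \<ominus>\<^sub>A z = (x \<ominus>\<^sub>A y) \<oplus>\<^sub>A (y \<ominus>\<^sub>A z)" if "x \<in> carrier A" "y \<in> carrier A" "z \<in> carrier A" for x y z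
        using that by (simp add: a_minus_def A.a_assoc A.r_neg1)
      have e4: "?d \<in> carrier A" "kp (rh b) t j \<odot>\<^sub>A a \<in> carrier A" "io (kp (rh (a \<otimes>\<^sub>A b)) t j) \<in> carrier A"
        using True j ab iokp[of b t j] iokp[of "a \<otimes>\<^sub>A b" t j] by auto
      show ?thesis unfolding val' s e1 e2 by (rule e3[OF e4])
    qed
  qed

  \<comment> \<open>The vectors \<open>g1 (m j a)\<close> are the columns of the matrix
    \<open>h a\<close>; multiplication by \<open>f j\<close> puts the j-th of them into its
    place.\<close>
  define h where "h a = (\<Oplus>j<n. g1 (m j a) \<otimes> f j)" for a
  have h: "h \<in> lmod_hom k A B"
  proof (rule lmod_homI)
    fix a assume a: "a \<in> carrier A"
    show "h a \<in> carrier B" unfolding h_def using a f by (intro B.finsum_closed) (auto simp: g1c mK)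
    { fix b assume b: "b \<in> carrier A"
      show "h (a \<oplus>\<^sub>A b) = h a \<oplus> h b"
        unfolding h_def using a b f by (intro B.finsum_add_eqI) (simp_all add: g1c mK m_add g1_add B.l_distr) }
    fix d assume d: "d \<in> carrier k"
    show "h (d \<odot>\<^sub>A a) = d \<odot> h a"
      unfolding h_def using a d f by (subst B.finsum_smult_ldistr)
        (auto simp: g1c mK m_smult g1_smult B.smult_assoc_l intro!: B.finsum_cong')
  qed
  have "h (a \<otimes>\<^sub>A b) = rh a \<otimes> h b \<oplus> h a \<otimes> rh b \<oplus> ga a b" if ab: "a \<in> carrier A" "b \<in> carrier A" for a b
  proof -
    have kb: "kp (rh b) l j \<in> carrier k" if "l < n" "j < n" for l j using iokp(2)[OF ab(2) that] .
    \<comment> \<open>Up to scalars \<open>m j b\<close> has the single coordinate \<open>b\<close>,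
      at the position \<open>j\<close>, and \<open>ga a\<close> vanishes on scalars by
      normalisation.\<close>
    have c_m: "c a (m j b) = ga a b \<otimes> e j" if j: "j < n" for j
    proof -
      have z: "ga a \<zero>\<^sub>A = \<zero>" using gaio(2)[of "\<zero>\<^sub>k" a] ab by (simp add: io_def)
      have gam: "ga a (x \<ominus>\<^sub>A y) = ga a x \<ominus> ga a y" if "x \<in> carrier A" "y \<in> carrier A" for x y
        using lmod_hom_minus[of "ga a" k, OF _ A.abelian_group_axioms B.abelian_group_axioms that] ab
        by (simp add: lmod_hom_def gac gar gasr Pi_iff)
      have "c a (m j b) = (\<Oplus>t<n. if t = j then ga a b \<otimes> e j else \<zero>)"
        unfolding c_def using ab j e
        by (intro B.finsum_cong') (auto simp: m_def gam iokp gaio z gac B0)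
      thus ?thesis using j ab e by (simp add: B.finsum_delta gac)
    qed
    have gm: "g1 (m j (a \<otimes>\<^sub>A b)) = rh a \<otimes> g1 (m j b) \<oplus> (\<Oplus>l<n. kp (rh b) l j \<odot> g1 (m l a)) \<oplus> ga a b \<otimes> e j" if j: "j < n" for j
    proof -
      let ?y = "\<lambda>l. io (kp (rh b) l j) \<odot>\<^sub>?F m l a"
      have yK: "?y l \<in> ?K" if "l < n" for l using that j ab by (intro K_smult mK iokp)
      have s: "g1 (\<Oplus>\<^sub>?F l<n. ?y l) = (\<Oplus>l<n. g1 (?y l))" "(\<Oplus>\<^sub>?F l<n. ?y l) \<in> ?K"
        using g1_sum[of "{..<n}" ?y] yK by auto
      have "(\<Oplus>l<n. g1 (?y l)) = (\<Oplus>l<n. kp (rh b) l j \<odot> g1 (m l a))"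
        using kb j ab by (intro B.finsum_cong') (auto simp: g1_smult mK g1c)
      hence "g1 (m j (a \<otimes>\<^sub>A b)) = rh a \<otimes> g1 (m j b) \<oplus> ga a b \<otimes> e j \<oplus> (\<Oplus>l<n. kp (rh b) l j \<odot> g1 (m l a))"
        using j ab s by (simp add: m_mult g1_add K_smult mK g1_act c_m)
      moreover have "(\<Oplus>l<n. kp (rh b) l j \<odot> g1 (m l a)) \<in> carrier B"
        using kb j ab by (intro B.finsum_closed) (auto simp: g1c mK)
      ultimately show ?thesis using j ab e by (simp add: rhs g1c mK gac B.a_ac)
    qed
    let ?t1 = "\<lambda>j. rh a \<otimes> (g1 (m j b) \<otimes> f j)"
    let ?t2 = "\<lambda>j. \<Oplus>l<n. kp (rh b) l j \<odot> (g1 (m l a) \<otimes> f j)"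
    let ?t3 = "\<lambda>j. ga a b \<otimes> (e j \<otimes> f j)"
    have tc: "?t1 j \<in> carrier B" "?t2 j \<in> carrier B" "?t3 j \<in> carrier B" if "j \<in> {..<n}" for j
      using that ab e f kb by (auto simp: rhs g1c mK gac intro!: B.finsum_closed)
    have "g1 (m j (a \<otimes>\<^sub>A b)) \<otimes> f j = ?t1 j \<oplus> ?t2 j \<oplus> ?t3 j" if j: "j \<in> {..<n}" for j
    proof -
      have "(\<Oplus>l<n. kp (rh b) l j \<odot> g1 (m l a)) \<otimes> f j = ?t2 j"
        using j kb ab f by (subst B.finsum_ldistr) (auto simp: g1c mK B.smult_assoc_l intro!: B.finsum_cong')
      moreover have "(\<Oplus>l<n. kp (rh b) l j \<odot> g1 (m l a)) \<in> carrier B"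
        using kb j ab by (intro B.finsum_closed) (auto simp: g1c mK)
      ultimately show ?thesis using j ab e f by (simp add: gm rhs g1c mK gac B.l_distr B.m_assoc)
    qed
    hence "h (a \<otimes>\<^sub>A b) = (\<Oplus>j<n. ?t1 j \<oplus> ?t2 j) \<oplus> (\<Oplus>j<n. ?t3 j)"
      unfolding h_def using tc by (intro B.finsum_add_eqI) simp_all
    also have "(\<Oplus>j<n. ?t1 j \<oplus> ?t2 j) = (\<Oplus>j<n. ?t1 j) \<oplus> (\<Oplus>j<n. ?t2 j)"
      using tc by (intro B.finsum_addf) auto
    also have "(\<Oplus>j<n. ?t1 j) = rh a \<otimes> h b"
      unfolding h_def using ab f by (intro B.finsum_rdistr[symmetric]) (auto simp: rhs g1c mK)
    \<comment> \<open>Exchanging the sums turns the matrix entries of \<open>rh b\<close> into right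
      multiplication by \<open>rh b\<close>, by \<open>fx\<close>.\<close>
    also have "(\<Oplus>j<n. ?t2 j) = (\<Oplus>l<n. \<Oplus>j<n. kp (rh b) l j \<odot> (g1 (m l a) \<otimes> f j))"
      using ab f kb by (intro B.finsum_swap) (auto simp: g1c mK)
    also have "\<dots> = (\<Oplus>l<n. (g1 (m l a) \<otimes> f l) \<otimes> rh b)"
    proof (rule B.finsum_cong')
      fix l assume l: "l \<in> {..<n}"
      have "g1 (m l a) \<otimes> (f l \<otimes> rh b) = (\<Oplus>j<n. kp (rh b) l j \<odot> (g1 (m l a) \<otimes> f j))"
        using l ab f kb by (simp add: fx rhs) (subst B.finsum_rdistr; auto simp: g1c mK B.smult_assoc_r intro!: B.finsum_cong')
      thus "(\<Oplus>j<n. kp (rh b) l j \<odot> (g1 (m l a) \<otimes> f j)) = (g1 (m l a) \<otimes> f l) \<otimes> rh b"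
        using l ab f by (simp add: g1c mK rhs B.m_assoc)
    qed (use ab f in \<open>auto simp: g1c mK rhs\<close>)
    also have "\<dots> = h a \<otimes> rh b"
      unfolding h_def using ab f by (intro B.finsum_ldistr[symmetric]) (auto simp: rhs g1c mK)
    also have "(\<Oplus>j<n. ?t3 j) = ga a b"
      using ab e f ef by (subst B.finsum_rdistr[symmetric]) (auto simp: gac)
    finally show ?thesis .
  qed
  thus ?thesis using h by blast
qed

subsection \<open>Matrix bimodules over the coordinate ring\<close>

text \<open>M_n(M) for an R-module \<open>M\<close>. Such a module has no scalar multiplication by
  \<open>k\<close> of its own, so \<open>k\<close> acts through
  \<open>c \<odot>\<^sub>R \<one>\<^sub>R\<close>.\<close>

definition mat_module :: "('k, 'r, 'd) module_scheme \<Rightarrow> ('r, 'm, 'e) module_scheme \<Rightarrow> nat \<Rightarrow> ('k, nat \<times> nat \<Rightarrow> 'm) module"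
  where "mat_module R M n = \<lparr>carrier = {..<n} \<times> {..<n} \<rightarrow>\<^sub>E carrier M, monoid.mult = undefined, one = undefined,
     zero = \<lambda>_\<in>{..<n} \<times> {..<n}. \<zero>\<^sub>M, add = \<lambda>Y Z. \<lambda>p\<in>{..<n} \<times> {..<n}. Y p \<oplus>\<^sub>M Z p,
     smult = \<lambda>c Z. \<lambda>p\<in>{..<n} \<times> {..<n}. (c \<odot>\<^sub>R \<one>\<^sub>R) \<odot>\<^sub>M Z p\<rparr>"

lemma mat_module_simps:
  "Z \<in> carrier (mat_module R M n) \<longleftrightarrow> (\<forall>i<n. \<forall>j<n. Z (i, j) \<in> carrier M) \<and> Z \<in> extensional ({..<n} \<times> {..<n})"
  "\<lbrakk>i < n; j < n\<rbrakk> \<Longrightarrow> \<zero>\<^bsub>mat_module R M n\<^esub> (i, j) = \<zero>\<^sub>M"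
  "\<lbrakk>i < n; j < n\<rbrakk> \<Longrightarrow> (Y \<oplus>\<^bsub>mat_module R M n\<^esub> Z) (i, j) = Y (i, j) \<oplus>\<^sub>M Z (i, j)"
  "\<lbrakk>i < n; j < n\<rbrakk> \<Longrightarrow> (c \<odot>\<^bsub>mat_module R M n\<^esub> Z) (i, j) = (c \<odot>\<^sub>R \<one>\<^sub>R) \<odot>\<^sub>M Z (i, j)"
  "\<zero>\<^bsub>mat_module R M n\<^esub> \<in> extensional ({..<n} \<times> {..<n})"
  "Y \<oplus>\<^bsub>mat_module R M n\<^esub> Z \<in> extensional ({..<n} \<times> {..<n})"
  "c \<odot>\<^bsub>mat_module R M n\<^esub> Z \<in> extensional ({..<n} \<times> {..<n})"
  by (auto simp: mat_module_def PiE_iff)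

lemma mat_eqI:
  assumes "Y \<in> extensional ({..<n :: nat} \<times> {..<n})" "Z \<in> extensional ({..<n} \<times> {..<n})"
    "\<And>i j. i < n \<Longrightarrow> j < n \<Longrightarrow> Y (i, j) = Z (i, j)"
  shows "Y = Z"
  using assms by (intro gmat_eqI[of _ "{..<n}"]) auto

context module
begin

lemma finsum_smult_left:
  assumes "finite I" "\<And>i. i \<in> I \<Longrightarrow> a i \<in> carrier R" "x \<in> carrier M"
  shows "(\<Oplus>i\<in>I. a i) \<odot>\<^sub>M x = (\<Oplus>\<^sub>M i\<in>I. a i \<odot>\<^sub>M x)"
  using assms by (induction I rule: finite_induct) (simp_all add: smult_l_distr Pi_iff)

lemma finsum_smult_assoc:
  assumes "finite I" "finite J" "\<And>l. l \<in> I \<Longrightarrow> a l \<in> carrier R" "\<And>l m. l \<in> I \<Longrightarrow> m \<in> J \<Longrightarrow> b l m \<in> carrier R"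
    "\<And>m. m \<in> J \<Longrightarrow> x m \<in> carrier M"
  shows "(\<Oplus>\<^sub>M m\<in>J. (\<Oplus>l\<in>I. a l \<otimes> b l m) \<odot>\<^sub>M x m) = (\<Oplus>\<^sub>M l\<in>I. a l \<odot>\<^sub>M (\<Oplus>\<^sub>M m\<in>J. b l m \<odot>\<^sub>M x m))"
proof -
  have "(\<Oplus>l\<in>I. a l \<otimes> b l m) \<odot>\<^sub>M x m = (\<Oplus>\<^sub>M l\<in>I. a l \<odot>\<^sub>M (b l m \<odot>\<^sub>M x m))" if "m \<in> J" for m
    using assms that by (subst finsum_smult_left) (auto simp: smult_assoc1 intro!: M.finsum_cong')
  hence "(\<Oplus>\<^sub>M m\<in>J. (\<Oplus>l\<in>I. a l \<otimes> b l m) \<odot>\<^sub>M x m) = (\<Oplus>\<^sub>M m\<in>J. \<Oplus>\<^sub>M l\<in>I. a l \<odot>\<^sub>M (b l m \<odot>\<^sub>M x m))"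
    using assms by (intro M.finsum_cong') (auto intro!: M.finsum_closed)
  also have "\<dots> = (\<Oplus>\<^sub>M l\<in>I. \<Oplus>\<^sub>M m\<in>J. a l \<odot>\<^sub>M (b l m \<odot>\<^sub>M x m))"
    using assms by (intro M.finsum_swap) auto
  also have "\<dots> = (\<Oplus>\<^sub>M l\<in>I. a l \<odot>\<^sub>M (\<Oplus>\<^sub>M m\<in>J. b l m \<odot>\<^sub>M x m))"
    using assms by (intro M.finsum_cong') (auto simp: finsum_smult_ldistr Pi_iff intro!: M.finsum_closed)
  finally show ?thesis .
qed

end

text \<open>\<open>R\<close> and the representation \<open>y\<close> stay fixed while the
  coefficients \<open>M\<close> of the bimodule M_n(M) vary: they will be \<open>R\<close> itself,
  the residue field at a closed point, and the ideal of a square-zero extension.\<close>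

locale rep_module = A: assoc_algebra k A + R: algebra k R + M: module R M
  for k :: "'k ring" and A :: "('k, 'a) module" and R :: "('k, 'r) module" and M :: "('r, 'm) module" (structure) +
  fixes n :: nat and y :: "'a \<Rightarrow> nat \<times> nat \<Rightarrow> 'r"
  assumes field_k: "field k" and y: "y \<in> alg_hom k A (mat_algebra R n)"
begin

abbreviation N where "N \<equiv> mat_module R M n"
abbreviation pure where "pure \<equiv> tensor_pure k A (opposite_algebra A)"

lemmas N_simps = mat_module_simps[where R = R and M = M and n = n]

lemma y_simps:
  "\<lbrakk>a \<in> carrier A; i < n; j < n\<rbrakk> \<Longrightarrow> y a (i, j) \<in> carrier R"
  "\<lbrakk>a \<in> carrier A; b \<in> carrier A; i < n; j < n\<rbrakk> \<Longrightarrow> y (a \<oplus>\<^sub>A b) (i, j) = y a (i, j) \<oplus>\<^sub>R y b (i, j)"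
  "\<lbrakk>c \<in> carrier k; a \<in> carrier A; i < n; j < n\<rbrakk> \<Longrightarrow> y (c \<odot>\<^sub>A a) (i, j) = c \<odot>\<^sub>R y a (i, j)"
  "\<lbrakk>a \<in> carrier A; b \<in> carrier A; i < n; j < n\<rbrakk> \<Longrightarrow> y (a \<otimes>\<^sub>A b) (i, j) = (\<Oplus>\<^sub>R l<n. y a (i, l) \<otimes>\<^sub>R y b (l, j))"
  "\<lbrakk>i < n; j < n\<rbrakk> \<Longrightarrow> y \<one>\<^sub>A (i, j) = (if i = j then \<one>\<^sub>R else \<zero>\<^sub>R)"
  using y unfolding mat_algebra_eq_gmat by (auto simp: alg_hom_def ring_hom_def gmat_simps Pi_iff)

definition la :: "'a \<Rightarrow> (nat \<times> nat \<Rightarrow> 'm) \<Rightarrow> nat \<times> nat \<Rightarrow> 'm" where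
  "la a Z = (\<lambda>(i, l)\<in>{..<n} \<times> {..<n}. \<Oplus>j<n. y a (i, j) \<odot> Z (j, l))"

text \<open>The matrix product Z y(b), with the scalars written on the left because \<open>M\<close>
  is a left module; as \<open>R\<close> is commutative, this is a right action.\<close>

definition ra :: "'a \<Rightarrow> (nat \<times> nat \<Rightarrow> 'm) \<Rightarrow> nat \<times> nat \<Rightarrow> 'm" where
  "ra b Z = (\<lambda>(i, l)\<in>{..<n} \<times> {..<n}. \<Oplus>m<n. y b (m, l) \<odot> Z (i, m))"

lemma lra:
  "\<lbrakk>i < n; l < n\<rbrakk> \<Longrightarrow> la a Z (i, l) = (\<Oplus>j<n. y a (i, j) \<odot> Z (j, l))"
  "\<lbrakk>i < n; l < n\<rbrakk> \<Longrightarrow> ra b Z (i, l) = (\<Oplus>m<n. y b (m, l) \<odot> Z (i, m))"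
  "la a Z \<in> extensional ({..<n} \<times> {..<n})" "ra b Z \<in> extensional ({..<n} \<times> {..<n})"
  by (simp_all add: la_def ra_def)

lemma smult_one_c: "c \<in> carrier k \<Longrightarrow> x \<in> carrier R \<Longrightarrow> c \<odot>\<^sub>R x = (c \<odot>\<^sub>R \<one>\<^sub>R) \<otimes>\<^sub>R x"
  by (simp add: R.smult_assoc2)

lemma module_N: "module k N"
proof (rule moduleI[OF A.R.cring_axioms])
  show "abelian_group N"
  proof (rule abelian_groupI)
    fix Z assume Z: "Z \<in> carrier N"
    show "\<exists>Y\<in>carrier N. Y \<oplus>\<^sub>N Z = \<zero>\<^sub>N"
      using Z by (intro bexI[of _ "\<lambda>p\<in>{..<n} \<times> {..<n}. \<ominus> Z p"] mat_eqI[of _ n]) (auto simp: N_simps M.M.l_neg)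
  qed (auto simp: N_simps M.M.a_ac intro!: mat_eqI[of _ n])
qed (auto simp: N_simps R.smult_l_distr M.smult_l_distr M.smult_r_distr R.smult_assoc1 M.smult_assoc1[symmetric] R.smult_assoc2
   intro!: mat_eqI[of _ n])

sublocale NM: module k N by (rule module_N)

lemma mv_smult:
  assumes "c \<in> carrier R" "\<And>j. j < n \<Longrightarrow> a j \<in> carrier R" "\<And>j. j < n \<Longrightarrow> x j \<in> carrier M"
  shows "(\<Oplus>j<n. a j \<odot> (c \<odot> x j)) = c \<odot> (\<Oplus>j<n. a j \<odot> x j)"
    "(\<Oplus>j<n. (c \<otimes>\<^sub>R a j) \<odot> x j) = c \<odot> (\<Oplus>j<n. a j \<odot> x j)"
  using assms by (subst M.finsum_smult_ldistr;
    auto simp: M.smult_assoc1[symmetric] R.m_comm intro!: M.M.finsum_cong')+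

lemma delta_smult:
  assumes "i < n" "\<And>j. j < n \<Longrightarrow> x j \<in> carrier M"
  shows "(\<Oplus>j<n. (if i = j then \<one>\<^sub>R else \<zero>\<^sub>R) \<odot> x j) = x i"
    "(\<Oplus>j<n. (if j = i then \<one>\<^sub>R else \<zero>\<^sub>R) \<odot> x j) = x i"
proof -
  have "(\<Oplus>j<n. (if i = j then \<one>\<^sub>R else \<zero>\<^sub>R) \<odot> x j) = (\<Oplus>j<n. if j = i then x i else \<zero>)"
    using assms by (intro M.M.finsum_cong') auto
  thus 1: "(\<Oplus>j<n. (if i = j then \<one>\<^sub>R else \<zero>\<^sub>R) \<odot> x j) = x i" using assms by (simp add: M.M.finsum_delta)
  show "(\<Oplus>j<n. (if j = i then \<one>\<^sub>R else \<zero>\<^sub>R) \<odot> x j) = x i"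
    using 1 by (simp only: eq_commute[of _ i])
qed

lemma lra_closed: "a \<in> carrier A \<Longrightarrow> Z \<in> carrier N \<Longrightarrow> la a Z \<in> carrier N" "a \<in> carrier A \<Longrightarrow> Z \<in> carrier N \<Longrightarrow> ra a Z \<in> carrier N"
  by (auto simp: N_simps lra y_simps intro!: M.M.finsum_closed)

lemma env_bimodule: "env_bimodule k A (enveloping_algebra k A) pure N la ra"
proof (intro env_bimodule.intro env_bimodule_axioms.intro module_N bilinear_lifts_enveloping_algebra
    enveloping_enveloping_algebra field_k A.assoc_algebra_axioms)
  fix a assume a: "a \<in> carrier A"
  show "la a \<in> lmod_hom k N N" "ra a \<in> lmod_hom k N N"
    by (rule lmod_homI; (use a in \<open>simp only: lra_closed\<close>)?;
      (rule mat_eqI[of _ n], simp_all only: N_simps(2-) lra)?;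
      (rule M.M.finsum_add_eqI | subst mv_smult(1)[symmetric] | simp only: lra);
      use a in \<open>auto simp: N_simps lra y_simps M.smult_r_distr intro!: M.M.finsum_cong'\<close>)+
next
  fix a b Z assume ab: "a \<in> carrier A" "b \<in> carrier A" and Z: "Z \<in> carrier N"
  have Zc: "Z (i, j) \<in> carrier M" if "i < n" "j < n" for i j using Z that by (simp add: N_simps)
  show "la (a \<oplus>\<^sub>A b) Z = la a Z \<oplus>\<^sub>N la b Z" "ra (a \<oplus>\<^sub>A b) Z = ra a Z \<oplus>\<^sub>N ra b Z"
    by (rule mat_eqI[of _ n]; use ab Zc in \<open>auto simp: N_simps(2-) lra y_simps M.smult_l_distr intro!: M.M.finsum_add_eqI\<close>)+
  show "la (a \<otimes>\<^sub>A b) Z = la a (la b Z)"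
  proof (rule mat_eqI[of _ n])
    fix i l assume il: "i < n" "l < n"
    have "la (a \<otimes>\<^sub>A b) Z (i, l) = (\<Oplus>j<n. (\<Oplus>\<^sub>R t<n. y a (i, t) \<otimes>\<^sub>R y b (t, j)) \<odot> Z (j, l))"
      using ab il Zc by (auto simp: lra y_simps intro!: M.M.finsum_cong' R.finsum_closed)
    also have "\<dots> = (\<Oplus>t<n. y a (i, t) \<odot> (\<Oplus>j<n. y b (t, j) \<odot> Z (j, l)))"
      using ab il Zc by (intro M.finsum_smult_assoc) (auto simp: y_simps)
    also have "\<dots> = la a (la b Z) (i, l)"
      using ab il Zc by (auto simp: lra y_simps intro!: M.M.finsum_cong' M.M.finsum_closed)
    finally show "la (a \<otimes>\<^sub>A b) Z (i, l) = la a (la b Z) (i, l)" .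
  qed (simp_all add: lra)
  show "ra (a \<otimes>\<^sub>A b) Z = ra b (ra a Z)"
  proof (rule mat_eqI[of _ n])
    fix i l assume il: "i < n" "l < n"
    have "ra (a \<otimes>\<^sub>A b) Z (i, l) = (\<Oplus>m<n. (\<Oplus>\<^sub>R t<n. y b (t, l) \<otimes>\<^sub>R y a (m, t)) \<odot> Z (i, m))"
      using ab il Zc by (auto simp: lra y_simps R.m_comm intro!: M.M.finsum_cong' R.finsum_closed arg_cong2[of _ _ _ _ "(\<odot>)"] R.finsum_cong')
    also have "\<dots> = (\<Oplus>t<n. y b (t, l) \<odot> (\<Oplus>m<n. y a (m, t) \<odot> Z (i, m)))"
      using ab il Zc by (intro M.finsum_smult_assoc) (auto simp: y_simps)
    also have "\<dots> = ra b (ra a Z) (i, l)"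
      using ab il Zc by (auto simp: lra y_simps intro!: M.M.finsum_cong' M.M.finsum_closed)
    finally show "ra (a \<otimes>\<^sub>A b) Z (i, l) = ra b (ra a Z) (i, l)" .
  qed (simp_all add: lra)
  show "la a (ra b Z) = ra b (la a Z)"
  proof (rule mat_eqI[of _ n])
    fix i l assume il: "i < n" "l < n"
    have "la a (ra b Z) (i, l) = (\<Oplus>j<n. y a (i, j) \<odot> (\<Oplus>m<n. y b (m, l) \<odot> Z (j, m)))"
      using ab il Zc by (auto simp: lra y_simps intro!: M.M.finsum_cong' M.M.finsum_closed)
    also have "\<dots> = (\<Oplus>j<n. \<Oplus>m<n. y b (m, l) \<odot> (y a (i, j) \<odot> Z (j, m)))"
      using ab il Zc by (intro M.M.finsum_cong')
        (auto simp: y_simps M.finsum_smult_ldistr Pi_iff M.smult_assoc1[symmetric] R.m_comm intro!: M.M.finsum_cong' M.M.finsum_closed)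
    also have "\<dots> = (\<Oplus>m<n. \<Oplus>j<n. y b (m, l) \<odot> (y a (i, j) \<odot> Z (j, m)))"
      using ab il Zc by (intro M.M.finsum_swap) (auto simp: y_simps)
    also have "\<dots> = (\<Oplus>m<n. y b (m, l) \<odot> (\<Oplus>j<n. y a (i, j) \<odot> Z (j, m)))"
      using ab il Zc by (intro M.M.finsum_cong')
        (auto simp: y_simps M.finsum_smult_ldistr Pi_iff intro!: M.M.finsum_closed)
    also have "\<dots> = ra b (la a Z) (i, l)"
      using ab il Zc by (auto simp: lra y_simps intro!: M.M.finsum_cong' M.M.finsum_closed)
    finally show "la a (ra b Z) (i, l) = ra b (la a Z) (i, l)" .
  qed (simp_all add: lra)
next
  fix c a Z assume c: "c \<in> carrier k" and a: "a \<in> carrier A" and Z: "Z \<in> carrier N"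
  have Zc: "Z (i, j) \<in> carrier M" if "i < n" "j < n" for i j using Z that by (simp add: N_simps)
  have yc: "y (c \<odot>\<^sub>A a) (i, j) = (c \<odot>\<^sub>R \<one>\<^sub>R) \<otimes>\<^sub>R y a (i, j)" if "i < n" "j < n" for i j
    using that c a by (simp add: y_simps smult_one_c[symmetric])
  show "la (c \<odot>\<^sub>A a) Z = c \<odot>\<^sub>N la a Z" "ra (c \<odot>\<^sub>A a) Z = c \<odot>\<^sub>N ra a Z"
    by (rule mat_eqI[of _ n]; (simp only: N_simps(2-) lra)?; (subst mv_smult(2)[symmetric])?;
       use c a Zc in \<open>auto simp: y_simps(1) yc intro!: M.M.finsum_cong'\<close>)+
next
  fix Z assume Z: "Z \<in> carrier N"
  show "la \<one>\<^sub>A Z = Z" "ra \<one>\<^sub>A Z = Z"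
  proof -
    have Zc: "Z (i, j) \<in> carrier M" if "i < n" "j < n" for i j using Z that by (simp add: N_simps)
    have "la \<one>\<^sub>A Z (i, l) = Z (i, l)" "ra \<one>\<^sub>A Z (i, l) = Z (i, l)" if il: "i < n" "l < n" for i l
    proof -
      have "la \<one>\<^sub>A Z (i, l) = (\<Oplus>j<n. (if i = j then \<one>\<^sub>R else \<zero>\<^sub>R) \<odot> Z (j, l))"
        "ra \<one>\<^sub>A Z (i, l) = (\<Oplus>m<n. (if m = l then \<one>\<^sub>R else \<zero>\<^sub>R) \<odot> Z (i, m))"
        using il Zc by (auto simp: lra y_simps(5) intro!: M.M.finsum_cong')
      thus "la \<one>\<^sub>A Z (i, l) = Z (i, l)" "ra \<one>\<^sub>A Z (i, l) = Z (i, l)"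
        using il Zc delta_smult(1)[of i "\<lambda>j. Z (j, l)"] delta_smult(2)[of l "\<lambda>m. Z (i, m)"] by simp_all
    qed
    thus "la \<one>\<^sub>A Z = Z" "ra \<one>\<^sub>A Z = Z" using Z by (auto simp: N_simps lra intro!: mat_eqI[of _ n])
  qed
qed

sublocale env: env_bimodule k A "enveloping_algebra k A" pure N la ra by (rule env_bimodule)

end

lemma (in abelian_group) finsum_Times:
  assumes "finite I" "finite J" "\<And>i j. i \<in> I \<Longrightarrow> j \<in> J \<Longrightarrow> h (i, j) \<in> carrier G"
  shows "(\<Oplus>u\<in>I \<times> J. h u) = (\<Oplus>i\<in>I. \<Oplus>j\<in>J. h (i, j))"
  using assms(1,3)
proof (induction I rule: finite_induct)
  case (insert i I)
  have un: "insert i I \<times> J = Pair i ` J \<union> I \<times> J" by auto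
  have "(\<Oplus>u\<in>insert i I \<times> J. h u) = (\<Oplus>u\<in>Pair i ` J. h u) \<oplus> (\<Oplus>u\<in>I \<times> J. h u)"
    unfolding un using insert assms(2) by (intro finsum_Un_disjoint) auto
  also have "(\<Oplus>u\<in>Pair i ` J. h u) = (\<Oplus>j\<in>J. h (i, j))"
    using insert by (intro finsum_reindex) (auto simp: inj_on_def)
  also have "(\<Oplus>u\<in>I \<times> J. h u) = (\<Oplus>i\<in>I. \<Oplus>j\<in>J. h (i, j))" using insert by simp
  finally show ?case using insert by (simp add: Pi_iff)
qed simp

text \<open>Pure tensors span \<open>E\<close>, and on them \<open>act\<close> is composed of the
  two given actions.\<close>

lemma act_hom_commute:
  assumes N: "env_bimodule k A E pure N la ra" and N': "env_bimodule k A E pure N' la' ra'"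
    and ph: "ph \<in> lmod_hom k N N'"
    and la: "\<And>a x. a \<in> carrier A \<Longrightarrow> x \<in> carrier N \<Longrightarrow> ph (la a x) = la' a (ph x)"
    and ra: "\<And>a x. a \<in> carrier A \<Longrightarrow> x \<in> carrier N \<Longrightarrow> ph (ra a x) = ra' a (ph x)"
    and e: "e \<in> carrier E" and x: "x \<in> carrier N"
  shows "ph (env_bimodule.act k A E pure N la ra e x) = env_bimodule.act k A E pure N' la' ra' e (ph x)"
proof -
  interpret N: env_bimodule k A E pure N la ra by fact
  interpret N': env_bimodule k A E pure N' la' ra' by fact
  have phx: "ph x \<in> carrier N'" using lmod_homD(1)[OF ph x] .
  show ?thesis
    using e
  proof (induction rule: N.env_induct)
    case zero
    show ?case using lmod_hom_zero[OF ph N.N.M.abelian_group_axioms N'.N.M.abelian_group_axioms]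
      by (simp add: N.act_zero N'.act_zero x phx)
  next
    case (pure a b)
    thus ?case by (simp add: N.act_pure N'.act_pure x phx la ra N.raD)
  next
    case (add e e')
    thus ?case by (simp add: N.actD N'.actD x phx lmod_homD[OF ph])
  qed
qed

section \<open>The complex as a pair of matrices over the coordinate ring\<close>

context rep_module
begin

interpretation self: rep_module k A R "self_algebra R" n y
proof -
  have "module R (self_algebra R)" using algebra_self_algebra[OF R.is_cring] by (simp add: algebra_def)
  thus "rep_module k A R (self_algebra R) n y"
    by (intro rep_module.intro rep_module_axioms.intro A.assoc_algebra_axioms R.algebra_axioms field_k y)
qed

abbreviation E where "E \<equiv> enveloping_algebra k A"

definition unit_mat :: "nat \<times> nat \<Rightarrow> nat \<times> nat \<Rightarrow> 'r" where
  "unit_mat u = (\<lambda>v\<in>{..<n} \<times> {..<n}. if v = u then \<one>\<^sub>R else \<zero>\<^sub>R)"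

text \<open>The matrix by which \<open>e\<close> acts on M_n(R). It does not involve
  \<open>M\<close>, but by \<open>act_entry\<close> it also describes the action on M_n(M); this is
  what makes the complex one and the same for all coefficients.\<close>

definition coef :: "('a \<times> 'a \<Rightarrow> 'k) set \<Rightarrow> nat \<times> nat \<Rightarrow> nat \<times> nat \<Rightarrow> 'r" where
  "coef e u v = self.env.act e (unit_mat v) u"

lemma unit_mat_closed: "unit_mat u \<in> carrier self.N"
  by (auto simp: self.N_simps unit_mat_def)

lemma coef_closed: "e \<in> carrier E \<Longrightarrow> u \<in> {..<n} \<times> {..<n} \<Longrightarrow> coef e u v \<in> carrier R"
  using self.env.act_hom_r[THEN lmod_homD(1), OF _ unit_mat_closed, of e v]
  by (auto simp: coef_def self.N_simps)

lemma finsum_entry: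
  assumes "finite S" "\<And>t. t \<in> S \<Longrightarrow> Z t \<in> carrier N" "u \<in> {..<n} \<times> {..<n}"
  shows "(\<Oplus>\<^sub>N t\<in>S. Z t) u = (\<Oplus>t\<in>S. Z t u)"
  using assms by (induction S rule: finite_induct) (auto simp: N_simps(2-) Pi_iff mat_module_simps(1))

lemma act_entry:
  assumes e: "e \<in> carrier E" and Z: "Z \<in> carrier N" and u: "u \<in> {..<n} \<times> {..<n}"
  shows "env.act e Z u = (\<Oplus>v\<in>{..<n} \<times> {..<n}. coef e u v \<odot> Z v)"
proof -
  \<comment> \<open>Multiplying a matrix over \<open>R\<close> by an element \<open>z\<close> of
    \<open>M\<close> is a bimodule map from M_n(R) to M_n(M). Every \<open>Z\<close> is a sum of
    images of unit matrices under such maps, so the action on M_n(M) is determined by that on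
    M_n(R).\<close>
  define Tt where "Tt z W = (\<lambda>v\<in>{..<n} \<times> {..<n}. W v \<odot> z)" for z and W :: "nat \<times> nat \<Rightarrow> 'r"
  have Tts: "Tt z W (i, j) = W (i, j) \<odot> z" if "i < n" "j < n" for z W i j using that by (simp add: Tt_def)
  have Tte: "Tt z W \<in> extensional ({..<n} \<times> {..<n})" for z W by (simp add: Tt_def)
  have Ttc: "Tt z W \<in> carrier N" if "z \<in> carrier M" "W \<in> carrier self.N" for z W
    using that by (simp add: N_simps self.N_simps Tts Tte)
  have Wc: "W (i, j) \<in> carrier R" if "W \<in> carrier self.N" "i < n" "j < n" for W i j using that by (simp add: self.N_simps)
  have Tth: "Tt z \<in> lmod_hom k self.N N" if z: "z \<in> carrier M" for z
  proof (rule lmod_homI)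
    fix W assume W: "W \<in> carrier self.N"
    show "Tt z W \<in> carrier N" by (rule Ttc[OF z W])
    { fix W' assume W': "W' \<in> carrier self.N"
      show "Tt z (W \<oplus>\<^sub>self.N W') = Tt z W \<oplus>\<^sub>N Tt z W'"
        using z Wc[OF W] Wc[OF W'] by (intro mat_eqI[of _ n]) (simp_all add: Tts Tte N_simps(2-) self.N_simps(2-) M.smult_l_distr) }
    fix c assume c: "c \<in> carrier k"
    show "Tt z (c \<odot>\<^sub>self.N W) = c \<odot>\<^sub>N Tt z W"
      using z Wc[OF W] c by (intro mat_eqI[of _ n]) (simp_all add: Tts Tte N_simps(2-) self.N_simps(2-) M.smult_assoc1)
  qed
  have la: "Tt z (self.la a W) = la a (Tt z W)" and ra: "Tt z (self.ra a W) = ra a (Tt z W)"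
    if z: "z \<in> carrier M" and a: "a \<in> carrier A" and W: "W \<in> carrier self.N" for z a W
  proof -
    have "(\<Oplus>\<^sub>R j<n. b j \<otimes>\<^sub>R w j) \<odot> z = (\<Oplus>j<n. b j \<odot> (w j \<odot> z))"
      if "\<And>j. j < n \<Longrightarrow> b j \<in> carrier R" "\<And>j. j < n \<Longrightarrow> w j \<in> carrier R" for b w
      using that z by (subst M.finsum_smult_left) (auto simp: M.smult_assoc1 intro!: M.M.finsum_cong')
    hence "Tt z (self.la a W) (i, j) = la a (Tt z W) (i, j)" "Tt z (self.ra a W) (i, j) = ra a (Tt z W) (i, j)" if "i < n" "j < n" for i j
      using that z a Wc[OF W] by (auto simp: lra self.lra Tts y_simps(1) intro!: M.M.finsum_cong')
    thus "Tt z (self.la a W) = la a (Tt z W)" "Tt z (self.ra a W) = ra a (Tt z W)"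
      by (auto simp: lra Tte intro!: mat_eqI[of _ n])
  qed
  have Zc: "Z v \<in> carrier M" if "v \<in> {..<n} \<times> {..<n}" for v using Z that by (auto simp: N_simps)
  have tc: "Tt (Z v) (unit_mat v) \<in> carrier N" if "v \<in> {..<n} \<times> {..<n}" for v using Ttc[OF Zc[OF that] unit_mat_closed] .
  have fin: "finite ({..<n} \<times> {..<n})" by simp
  have Z_eq: "Z = (\<Oplus>\<^sub>N v\<in>{..<n} \<times> {..<n}. Tt (Z v) (unit_mat v))"
  proof (rule mat_eqI[of _ n])
    show "Z \<in> extensional ({..<n} \<times> {..<n})" using Z by (simp add: N_simps)
    have "(\<Oplus>\<^sub>N v\<in>{..<n} \<times> {..<n}. Tt (Z v) (unit_mat v)) \<in> carrier N" using tc by (intro NM.M.finsum_closed) auto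
    thus "(\<Oplus>\<^sub>N v\<in>{..<n} \<times> {..<n}. Tt (Z v) (unit_mat v)) \<in> extensional ({..<n} \<times> {..<n})" by (simp add: N_simps)
    fix i j assume ij: "i < n" "j < n"
    hence ijS: "(i, j) \<in> {..<n} \<times> {..<n}" by simp
    have "(\<Oplus>\<^sub>N v\<in>{..<n} \<times> {..<n}. Tt (Z v) (unit_mat v)) (i, j) = (\<Oplus>v\<in>{..<n} \<times> {..<n}. Tt (Z v) (unit_mat v) (i, j))"
      by (rule finsum_entry[OF fin tc ijS])
    also have "\<dots> = (\<Oplus>v\<in>{..<n} \<times> {..<n}. if v = (i, j) then Z (i, j) else \<zero>)"
      using ij Zc by (intro M.M.finsum_cong') (auto simp: Tts unit_mat_def)
    also have "\<dots> = Z (i, j)" by (rule M.M.finsum_delta[OF fin ijS Zc[OF ijS]])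
    finally show "Z (i, j) = (\<Oplus>\<^sub>N v\<in>{..<n} \<times> {..<n}. Tt (Z v) (unit_mat v)) (i, j)" ..
  qed
  have act: "env.act e (Tt (Z v) (unit_mat v)) = Tt (Z v) (self.env.act e (unit_mat v))" if "v \<in> {..<n} \<times> {..<n}" for v
    by (rule act_hom_commute[OF self.env_bimodule env_bimodule Tth[OF Zc[OF that]] la[OF Zc[OF that]] ra[OF Zc[OF that]] e unit_mat_closed, symmetric])
  have "env.act e Z = (\<Oplus>\<^sub>N v\<in>{..<n} \<times> {..<n}. env.act e (Tt (Z v) (unit_mat v)))"
    by (subst Z_eq) (rule env.act_finsum[OF e tc])
  also have "\<dots> = (\<Oplus>\<^sub>N v\<in>{..<n} \<times> {..<n}. Tt (Z v) (self.env.act e (unit_mat v)))"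
    using Ttc[OF Zc lmod_homD(1)[OF self.env.act_hom_r[OF e] unit_mat_closed]]
    by (intro NM.M.finsum_cong') (simp_all only: act Pi_iff, blast)
  finally have "env.act e Z u = (\<Oplus>\<^sub>N v\<in>{..<n} \<times> {..<n}. Tt (Z v) (self.env.act e (unit_mat v))) u" by simp
  also have "\<dots> = (\<Oplus>v\<in>{..<n} \<times> {..<n}. Tt (Z v) (self.env.act e (unit_mat v)) u)"
    using Ttc[OF Zc lmod_homD(1)[OF self.env.act_hom_r[OF e] unit_mat_closed]] by (intro finsum_entry[OF fin _ u]) blast
  also have "\<dots> = (\<Oplus>v\<in>{..<n} \<times> {..<n}. coef e u v \<odot> Z v)"
    using u by (simp add: Tt_def coef_def cong: restrict_cong)
  finally show ?thesis .
qed

lemma act_sum_entry: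
  fixes q :: nat
  assumes e: "\<And>l. l < q \<Longrightarrow> e l \<in> carrier E" and Z: "\<And>l. l < q \<Longrightarrow> Z l \<in> carrier N" and u: "u \<in> {..<n} \<times> {..<n}"
  shows "(\<Oplus>\<^sub>N l<q. env.act (e l) (Z l)) u =
    (\<Oplus>w\<in>{..<q} \<times> ({..<n} \<times> {..<n}). coef (e (fst w)) u (snd w) \<odot> Z (fst w) (snd w))"
proof -
  have Zc: "Z l v \<in> carrier M" if "l < q" "v \<in> {..<n} \<times> {..<n}" for l v using Z[OF that(1)] that(2) by (auto simp: N_simps)
  have "(\<Oplus>\<^sub>N l<q. env.act (e l) (Z l)) u = (\<Oplus>l<q. env.act (e l) (Z l) u)"
    using e Z lmod_homD(1)[OF env.act_hom_r] by (intro finsum_entry u) auto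
  also have "\<dots> = (\<Oplus>l<q. \<Oplus>v\<in>{..<n} \<times> {..<n}. coef (e l) u v \<odot> Z l v)"
    using e Z Zc coef_closed[OF _ u] by (intro M.M.finsum_cong') (auto simp: act_entry[OF _ _ u] intro!: M.M.finsum_closed)
  also have "\<dots> = (\<Oplus>w\<in>{..<q} \<times> ({..<n} \<times> {..<n}). coef (e (fst w)) u (snd w) \<odot> Z (fst w) (snd w))"
    using e Zc coef_closed[OF _ u] by (subst M.M.finsum_Times) auto
  finally show ?thesis .
qed

end

lemma (in rep_module) rep_module_self: "rep_module k A R (self_algebra R) n y"
proof -
  have "module R (self_algebra R)" using algebra_self_algebra[OF R.is_cring] by (simp add: algebra_def)
  thus "rep_module k A R (self_algebra R) n y"
    by (intro rep_module.intro rep_module_axioms.intro A.assoc_algebra_axioms R.algebra_axioms field_k y)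
qed

locale rep_problem = rep_module k A R M n y + env_resolution k A "enveloping_algebra k A" "tensor_pure k A (opposite_algebra A)" p q r s f g
  for k :: "'k ring" and A :: "('k, 'a) module" and R :: "('k, 'r) module" and M :: "('r, 'm) module" (structure) and n y p q r s f g
begin

sublocale env_problem k A "enveloping_algebra k A" pure N la ra p q r s f g
  by (intro env_problem.intro env_bimodule env_resolution_axioms)

abbreviation P_ind where "P_ind \<equiv> {..<p} \<times> ({..<n} \<times> {..<n})"
abbreviation Q_ind where "Q_ind \<equiv> {..<q} \<times> ({..<n} \<times> {..<n})"
abbreviation S_ind where "S_ind \<equiv> {..<r} \<times> ({..<n} \<times> {..<n})"

text \<open>\<open>D1\<close> and \<open>D2\<close> are the matrices of N^p \<rightarrow> N^q
  \<rightarrow> N^r; an index combines the number of a component with the position of an entry in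
  it.\<close>

definition D1 :: "nat \<times> nat \<times> nat \<Rightarrow> nat \<times> nat \<times> nat \<Rightarrow> 'r" where
  "D1 v w = coef (f (fst v) (fst w)) (snd v) (snd w)"

definition D2 :: "nat \<times> nat \<times> nat \<Rightarrow> nat \<times> nat \<times> nat \<Rightarrow> 'r" where
  "D2 v w = coef (g (fst v) (fst w)) (snd v) (snd w)"

lemma D_closed: "v \<in> Q_ind \<Longrightarrow> w \<in> P_ind \<Longrightarrow> D1 v w \<in> carrier R" "v \<in> S_ind \<Longrightarrow> w \<in> Q_ind \<Longrightarrow> D2 v w \<in> carrier R"
  unfolding D1_def D2_def by (rule coef_closed; auto intro: f_closed g_closed)+

text \<open>Reindexing by triples turns exactness for the matrix bimodule into a statement about
  matrices over \<open>R\<close> with unknowns in \<open>M\<close>, the form to which a change of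
  coefficients applies.\<close>

lemma exact_at_N_iff:
  "exact_at_N \<longleftrightarrow> (\<forall>Y. (\<forall>v\<in>Q_ind. Y v \<in> carrier M) \<longrightarrow> (\<forall>w\<in>S_ind. (\<Oplus>v\<in>Q_ind. D2 w v \<odot> Y v) = \<zero>) \<longrightarrow>
    (\<exists>Z. (\<forall>w\<in>P_ind. Z w \<in> carrier M) \<and> (\<forall>v\<in>Q_ind. Y v = (\<Oplus>w\<in>P_ind. D1 v w \<odot> Z w))))"
proof -
  let ?n = "{..<n} \<times> {..<n}"
  define mk :: "(nat \<times> nat \<times> nat \<Rightarrow> 'm) \<Rightarrow> nat \<Rightarrow> nat \<times> nat \<Rightarrow> 'm" where "mk Y l = (\<lambda>u\<in>?n. Y (l, u))" for Y l
  have mkc: "mk Y l \<in> carrier N" if "\<And>u. u \<in> ?n \<Longrightarrow> Y (l, u) \<in> carrier M" for Y l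
    using that by (auto simp: N_simps mk_def)
  have sum1: "(\<Oplus>\<^sub>N i<p. env.act (f l i) (Z i)) u = (\<Oplus>w\<in>P_ind. D1 (l, u) w \<odot> Z (fst w) (snd w))"
    if "l < q" "\<And>i. i < p \<Longrightarrow> Z i \<in> carrier N" "u \<in> ?n" for l Z u
    unfolding D1_def fst_conv snd_conv by (rule act_sum_entry[OF f_closed[OF that(1)] that(2,3)])
  have sum2: "(\<Oplus>\<^sub>N l<q. env.act (g m l) (Y l)) u = (\<Oplus>w\<in>Q_ind. D2 (m, u) w \<odot> Y (fst w) (snd w))"
    if "m < r" "\<And>l. l < q \<Longrightarrow> Y l \<in> carrier N" "u \<in> ?n" for m Y u
    unfolding D2_def fst_conv snd_conv by (rule act_sum_entry[OF g_closed[OF that(1)] that(2,3)])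
  have sc: "(\<Oplus>\<^sub>N i<b. env.act (e i) (Z i)) \<in> carrier N"
    if "\<And>i. i < b \<Longrightarrow> e i \<in> carrier E" "\<And>i. i < b \<Longrightarrow> Z i \<in> carrier N" for b e and Z :: "nat \<Rightarrow> _"
    using that lmod_homD(1)[OF env.act_hom_r] by (intro NM.M.finsum_closed) auto
  have N_eq: "Y = Z" if "Y \<in> carrier N" "Z \<in> carrier N" "\<And>u. u \<in> ?n \<Longrightarrow> Y u = Z u" for Y Z
    using that by (intro mat_eqI[of _ n]) (auto simp: N_simps)
  have val: "Y u \<in> carrier M" if "Y \<in> carrier N" "u \<in> ?n" for Y u using that by (auto simp: N_simps)
  show ?thesis
  proof (intro iffI allI impI)
    fix Y assume ex: "exact_at_N" and Y: "\<forall>v\<in>Q_ind. Y v \<in> carrier M"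
      and D2Y: "\<forall>w\<in>S_ind. (\<Oplus>v\<in>Q_ind. D2 w v \<odot> Y v) = \<zero>"
    have Yc: "mk Y l \<in> carrier N" if "l < q" for l using Y that by (intro mkc) auto
    have "(\<Oplus>\<^sub>N l<q. env.act (g m l) (mk Y l)) = \<zero>\<^sub>N" if m: "m < r" for m
    proof (rule N_eq)
      show "(\<Oplus>\<^sub>N l<q. env.act (g m l) (mk Y l)) \<in> carrier N" by (rule sc[OF g_closed[OF m] Yc])
      fix u assume u: "u \<in> ?n"
      have "(\<Oplus>\<^sub>N l<q. env.act (g m l) (mk Y l)) u = (\<Oplus>w\<in>Q_ind. D2 (m, u) w \<odot> mk Y (fst w) (snd w))"
        by (rule sum2[OF m Yc u])
      also have "\<dots> = (\<Oplus>w\<in>Q_ind. D2 (m, u) w \<odot> Y w)"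
        using Y D_closed(2)[of "(m, u)"] m u by (intro M.M.finsum_cong') (auto simp: mk_def)
      also have "\<dots> = \<zero>" using D2Y m u by auto
      finally show "(\<Oplus>\<^sub>N l<q. env.act (g m l) (mk Y l)) u = \<zero>\<^sub>N u" using u by (auto simp: N_simps(2))
    qed simp
    hence "\<exists>Z. (\<forall>i<p. Z i \<in> carrier N) \<and> (\<forall>l<q. mk Y l = (\<Oplus>\<^sub>N i<p. env.act (f l i) (Z i)))"
      using ex Yc unfolding exact_at_N_def by simp
    then obtain Z where Z: "\<forall>i<p. Z i \<in> carrier N" "\<forall>l<q. mk Y l = (\<Oplus>\<^sub>N i<p. env.act (f l i) (Z i))" by (elim exE conjE)
    have "Y v = (\<Oplus>w\<in>P_ind. D1 v w \<odot> Z (fst w) (snd w))" if v: "v \<in> Q_ind" for v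
    proof -
      have "Y v = mk Y (fst v) (snd v)" using v by (auto simp: mk_def)
      also have "\<dots> = (\<Oplus>\<^sub>N i<p. env.act (f (fst v) i) (Z i)) (snd v)" using v Z(2) by auto
      also have "\<dots> = (\<Oplus>w\<in>P_ind. D1 (fst v, snd v) w \<odot> Z (fst w) (snd w))" using v Z(1) by (intro sum1) auto
      finally show ?thesis by simp
    qed
    moreover have "\<forall>w\<in>P_ind. Z (fst w) (snd w) \<in> carrier M" using Z(1) val by auto
    ultimately show "\<exists>Z. (\<forall>w\<in>P_ind. Z w \<in> carrier M) \<and> (\<forall>v\<in>Q_ind. Y v = (\<Oplus>w\<in>P_ind. D1 v w \<odot> Z w))"
      by (intro exI[of _ "\<lambda>w. Z (fst w) (snd w)"]) simp
  next
    assume ex: "\<forall>Y. (\<forall>v\<in>Q_ind. Y v \<in> carrier M) \<longrightarrow> (\<forall>w\<in>S_ind. (\<Oplus>v\<in>Q_ind. D2 w v \<odot> Y v) = \<zero>) \<longrightarrow>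
      (\<exists>Z. (\<forall>w\<in>P_ind. Z w \<in> carrier M) \<and> (\<forall>v\<in>Q_ind. Y v = (\<Oplus>w\<in>P_ind. D1 v w \<odot> Z w)))"
    have "\<exists>Z. (\<forall>i<p. Z i \<in> carrier N) \<and> (\<forall>l<q. Y l = (\<Oplus>\<^sub>N i<p. env.act (f l i) (Z i)))"
      if Y: "\<forall>l<q. Y l \<in> carrier N" and gY: "\<forall>m<r. (\<Oplus>\<^sub>N l<q. env.act (g m l) (Y l)) = \<zero>\<^sub>N" for Y
    proof -
      let ?Y = "\<lambda>w. Y (fst w) (snd w)"
      have "\<forall>v\<in>Q_ind. ?Y v \<in> carrier M" using Y val by auto
      moreover have "(\<Oplus>v\<in>Q_ind. D2 w v \<odot> ?Y v) = \<zero>" if w: "w \<in> S_ind" for w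
      proof -
        have "(\<Oplus>v\<in>Q_ind. D2 (fst w, snd w) v \<odot> ?Y v) = (\<Oplus>\<^sub>N l<q. env.act (g (fst w) l) (Y l)) (snd w)"
          using w Y by (intro sum2[symmetric]) auto
        also have "\<dots> = \<zero>" using gY w by (auto simp: N_simps(2))
        finally show ?thesis by simp
      qed
      ultimately have "\<exists>Z. (\<forall>w\<in>P_ind. Z w \<in> carrier M) \<and> (\<forall>v\<in>Q_ind. ?Y v = (\<Oplus>w\<in>P_ind. D1 v w \<odot> Z w))"
        using spec[OF ex, of ?Y] by simp
      then obtain Z where Z: "\<forall>w\<in>P_ind. Z w \<in> carrier M" "\<forall>v\<in>Q_ind. ?Y v = (\<Oplus>w\<in>P_ind. D1 v w \<odot> Z w)" by (elim exE conjE)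
      have Zc: "mk Z i \<in> carrier N" if "i < p" for i using Z(1) that by (intro mkc) auto
      have "Y l = (\<Oplus>\<^sub>N i<p. env.act (f l i) (mk Z i))" if l: "l < q" for l
      proof (rule N_eq)
        show "Y l \<in> carrier N" using Y l by simp
        show "(\<Oplus>\<^sub>N i<p. env.act (f l i) (mk Z i)) \<in> carrier N" by (rule sc[OF f_closed[OF l] Zc])
        fix u assume u: "u \<in> ?n"
        have "Y l u = (\<Oplus>w\<in>P_ind. D1 (l, u) w \<odot> Z w)" using bspec[OF Z(2), of "(l, u)"] l u by auto
        also have "\<dots> = (\<Oplus>w\<in>P_ind. D1 (l, u) w \<odot> mk Z (fst w) (snd w))"
          using Z(1) D_closed(1)[of "(l, u)"] l u by (intro M.M.finsum_cong') (auto simp: mk_def)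
        also have "\<dots> = (\<Oplus>\<^sub>N i<p. env.act (f l i) (mk Z i)) u" by (rule sum1[OF l Zc u, symmetric])
        finally show "Y l u = (\<Oplus>\<^sub>N i<p. env.act (f l i) (mk Z i)) u" .
      qed
      thus ?thesis using Zc by (intro exI[of _ "mk Z"]) simp
    qed
    thus "exact_at_N" unfolding exact_at_N_def by simp
  qed
qed

text \<open>Applied to \<open>Y\<close> with D2 Y = 0, the homotopy identity reads Y = D1 (U Y); as
  an identity over \<open>R\<close> it acts on every module.\<close>

lemma exact_at_N_if_homotopy:
  assumes U: "\<And>w v. w \<in> P_ind \<Longrightarrow> v \<in> Q_ind \<Longrightarrow> U w v \<in> carrier R"
    and V: "\<And>v w. v \<in> Q_ind \<Longrightarrow> w \<in> S_ind \<Longrightarrow> V v w \<in> carrier R"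
    and UV: "\<And>v v'. v \<in> Q_ind \<Longrightarrow> v' \<in> Q_ind \<Longrightarrow> (mprod R P_ind D1 U v v') \<oplus>\<^sub>R
      (mprod R S_ind V D2 v v') = (if v = v' then \<one>\<^sub>R else \<zero>\<^sub>R)"
  shows "exact_at_N"
  unfolding exact_at_N_iff
proof (intro allI impI)
  fix Y assume Y: "\<forall>v\<in>Q_ind. Y v \<in> carrier M" and D2Y: "\<forall>w\<in>S_ind. (\<Oplus>v\<in>Q_ind. D2 w v \<odot> Y v) = \<zero>"
  define Z where "Z w = (\<Oplus>v\<in>Q_ind. U w v \<odot> Y v)" for w
  have fin: "finite P_ind" "finite Q_ind" "finite S_ind" by simp_all
  have Zc: "Z w \<in> carrier M" if "w \<in> P_ind" for w unfolding Z_def using U[OF that] Y by (intro M.M.finsum_closed) auto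
  have "Y v = (\<Oplus>w\<in>P_ind. D1 v w \<odot> Z w)" if v: "v \<in> Q_ind" for v
  proof -
    have 1: "(\<Oplus>v'\<in>Q_ind. (mprod R P_ind D1 U v v') \<odot> Y v') = (\<Oplus>w\<in>P_ind. D1 v w \<odot> Z w)"
      unfolding Z_def using D_closed(1)[OF v] U Y fin by (intro M.finsum_smult_assoc) blast+
    have "(\<Oplus>v'\<in>Q_ind. (mprod R S_ind V D2 v v') \<odot> Y v') = (\<Oplus>w\<in>S_ind. V v w \<odot> (\<Oplus>v'\<in>Q_ind. D2 w v' \<odot> Y v'))"
      using D_closed(2) V[OF v] Y fin by (intro M.finsum_smult_assoc) blast+
    also have "\<dots> = \<zero>"
    proof (rule M.M.add.finprod_one_eqI)
      fix w assume w: "w \<in> S_ind"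
      show "V v w \<odot> (\<Oplus>v'\<in>Q_ind. D2 w v' \<odot> Y v') = \<zero>"
        unfolding bspec[OF D2Y w] by (rule M.smult_r_null[OF V[OF v w]])
    qed
    finally have 2: "(\<Oplus>v'\<in>Q_ind. (mprod R S_ind V D2 v v') \<odot> Y v') = \<zero>" .
    have c1: "(mprod R P_ind D1 U v v') \<in> carrier R" if "v' \<in> Q_ind" for v'
      by (intro R.finsum_closed Pi_I R.m_closed D_closed(1)[OF v] U[OF _ that])
    have c2: "(mprod R S_ind V D2 v v') \<in> carrier R" if "v' \<in> Q_ind" for v'
      by (intro R.finsum_closed Pi_I R.m_closed D_closed(2)[OF _ that] V[OF v])
    have "Y v = (\<Oplus>v'\<in>Q_ind. if v' = v then Y v else \<zero>)" using v Y by (intro M.M.finsum_delta[symmetric]) auto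
    also have "\<dots> = (\<Oplus>v'\<in>Q_ind. (mprod R P_ind D1 U v v') \<odot> Y v') \<oplus>
        (\<Oplus>v'\<in>Q_ind. (mprod R S_ind V D2 v v') \<odot> Y v')"
    proof (rule M.M.finsum_add_eqI)
      fix v' assume v': "v' \<in> Q_ind"
      hence Yv: "Y v' \<in> carrier M" using Y by blast
      show "(mprod R P_ind D1 U v v') \<odot> Y v' \<in> carrier M" by (rule M.smult_closed[OF c1[OF v'] Yv])
      show "(mprod R S_ind V D2 v v') \<odot> Y v' \<in> carrier M" by (rule M.smult_closed[OF c2[OF v'] Yv])
      show "(if v' = v then Y v else \<zero>) = (mprod R P_ind D1 U v v') \<odot> Y v' \<oplus>
          (mprod R S_ind V D2 v v') \<odot> Y v'"
        unfolding M.smult_l_distr[OF c1[OF v'] c2[OF v'] Yv, symmetric] UV[OF v v'] using Yv by auto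
    qed
    finally show ?thesis unfolding 1 2 using Zc D_closed(1)[OF v] by (simp add: M.M.finsum_closed Pi_iff)
  qed
  thus "\<exists>Z. (\<forall>w\<in>P_ind. Z w \<in> carrier M) \<and> (\<forall>v\<in>Q_ind. Y v = (\<Oplus>w\<in>P_ind. D1 v w \<odot> Z w))"
    using Zc by blast
qed

text \<open>The rows of \<open>g\<close> are relations between the rows of \<open>f\<close>. Applied
  to the unit matrices of M_n(R), these relations are the entries of the product of the two
  matrices.\<close>

lemma D2_D1:
  assumes v: "v \<in> S_ind" and w: "w \<in> P_ind"
  shows "(mprod R Q_ind D2 D1 v w) = \<zero>\<^sub>R"
proof -
  interpret self: rep_module k A R "self_algebra R" n y by (rule rep_module_self)
  let ?W = "unit_mat (snd w)"
  have W: "?W \<in> carrier self.N" by (rule unit_mat_closed)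
  have vw: "fst v < r" "snd v \<in> {..<n} \<times> {..<n}" "fst w < p" using v w by auto
  have fW: "self.env.act (f l (fst w)) ?W \<in> carrier self.N" if "l < q" for l
    using lmod_homD(1)[OF self.env.act_hom_r[OF f_closed[OF that vw(3)]] W] .
  have "(\<Oplus>\<^sub>self.N l<q. self.env.act (g (fst v) l) (self.env.act (f l (fst w)) ?W)) =
    (\<Oplus>\<^sub>self.N l<q. self.env.act (g (fst v) l \<otimes>\<^sub>E f l (fst w)) ?W)"
    using vw W fW by (intro self.NM.M.finsum_cong')
      (auto simp: self.env.act_mult g_closed f_closed intro!: lmod_homD(1)[OF self.env.act_hom_r])
  also have "\<dots> = self.env.act (\<Oplus>\<^sub>E l<q. g (fst v) l \<otimes>\<^sub>E f l (fst w)) ?W"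
    using vw W by (intro self.env.finsum_act[symmetric]) (auto simp: g_closed f_closed)
  also have "\<dots> = \<zero>\<^sub>self.N" using vw W by (simp add: g_rel self.env.act_zero)
  finally have "(\<Oplus>\<^sub>self.N l<q. self.env.act (g (fst v) l) (self.env.act (f l (fst w)) ?W)) (snd v) = \<zero>\<^sub>R"
    using vw by (auto simp: self.N_simps(2))
  thus ?thesis using self.act_sum_entry[of q "g (fst v)" "\<lambda>l. self.env.act (f l (fst w)) ?W" "snd v", OF g_closed[OF vw(1)] fW vw(2)]
    by (simp add: D1_def D2_def coef_def)
qed

end

section \<open>Ideals as modules over the coordinate ring\<close>

definition ideal_module :: "('c, 'd) ring_scheme \<Rightarrow> ('r \<Rightarrow> 'c) \<Rightarrow> 'c set \<Rightarrow> ('r, 'c) module"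
  where "ideal_module C cx I = \<lparr>carrier = I, monoid.mult = undefined, one = undefined, zero = \<zero>\<^sub>C,
    add = (\<oplus>\<^sub>C), smult = \<lambda>r z. cx r \<otimes>\<^sub>C z\<rparr>"

lemma ideal_module_simps [simp]:
  "carrier (ideal_module C cx I) = I" "\<zero>\<^bsub>ideal_module C cx I\<^esub> = \<zero>\<^sub>C"
  "x \<oplus>\<^bsub>ideal_module C cx I\<^esub> y = x \<oplus>\<^sub>C y" "r \<odot>\<^bsub>ideal_module C cx I\<^esub> z = cx r \<otimes>\<^sub>C z"
  by (simp_all add: ideal_module_def)

lemma finsum_ideal_module:
  assumes "ideal I C" "module R (ideal_module C cx I)" "\<And>t. t \<in> S \<Longrightarrow> z t \<in> I"
  shows "(\<Oplus>\<^bsub>ideal_module C cx I\<^esub>t\<in>S. z t) = (\<Oplus>\<^sub>C t\<in>S. z t)"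
proof -
  interpret I: ideal I C by fact
  interpret M: module R "ideal_module C cx I" by fact
  show ?thesis using assms(3) I.a_subset
    by (induction S rule: infinite_finite_induct) (auto simp: M.M.finsum_insert I.finsum_insert Pi_iff subset_iff)
qed

text \<open>Additivity and multiplicativity of \<open>cx\<close> are required only after
  multiplication by elements of \<open>I\<close>. This admits a linear lift of a homomorphism to
  C/I: its failure to be multiplicative lies in \<open>I\<close> and dies on \<open>I\<close> when
  I^2 = 0.\<close>

lemma module_ideal_module:
  assumes R: "cring R" and C: "cring C" and I: "ideal I C"
    and cx: "\<And>r. r \<in> carrier R \<Longrightarrow> cx r \<in> carrier C"
    and add: "\<And>r s z. r \<in> carrier R \<Longrightarrow> s \<in> carrier R \<Longrightarrow> z \<in> I \<Longrightarrow> cx (r \<oplus>\<^sub>R s) \<otimes>\<^sub>C z = (cx r \<oplus>\<^sub>C cx s) \<otimes>\<^sub>C z"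
    and mult: "\<And>r s z. r \<in> carrier R \<Longrightarrow> s \<in> carrier R \<Longrightarrow> z \<in> I \<Longrightarrow> cx (r \<otimes>\<^sub>R s) \<otimes>\<^sub>C z = (cx r \<otimes>\<^sub>C cx s) \<otimes>\<^sub>C z"
    and one: "cx \<one>\<^sub>R = \<one>\<^sub>C"
  shows "module R (ideal_module C cx I)"
proof -
  interpret C: cring C by fact
  interpret I: ideal I C by fact
  have Ic: "z \<in> carrier C" if "z \<in> I" for z using that I.a_subset by auto
  have "abelian_group (ideal_module C cx I)"
  proof (rule abelian_groupI)
    fix z assume "z \<in> carrier (ideal_module C cx I)"
    thus "\<exists>w\<in>carrier (ideal_module C cx I). w \<oplus>\<^bsub>ideal_module C cx I\<^esub> z = \<zero>\<^bsub>ideal_module C cx I\<^esub>"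
      by (intro bexI[of _ "\<ominus>\<^sub>C z"]) (simp_all add: C.l_neg Ic)
  qed (simp_all add: Ic C.a_ac I.a_closed)
  thus ?thesis
    by (intro moduleI R) (simp_all add: Ic cx I.I_l_closed add mult one C.l_distr C.r_distr C.m_assoc)
qed

lemma gmat_finsum_entry:
  assumes B: "algebra k B" and Q: "finite Q" and S: "finite S" "\<And>t. t \<in> S \<Longrightarrow> Z t \<in> carrier (gmat B Q)" and u: "i \<in> Q" "j \<in> Q"
  shows "(\<Oplus>\<^bsub>gmat B Q\<^esub>t\<in>S. Z t) (i, j) = (\<Oplus>\<^sub>B t\<in>S. Z t (i, j))"
proof -
  interpret G: assoc_algebra k "gmat B Q" by (rule assoc_algebra_gmat[OF B Q])
  interpret B: algebra k B by fact
  show ?thesis using S u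
    by (induction S rule: finite_induct) (auto simp: gmat_simps Pi_iff)
qed

text \<open>\<open>hereditary_coboundary\<close> with the matrix units of the first column as
  \<open>e\<close>, those of the first row as \<open>f\<close>, and their common one as
  \<open>ec\<close>. Positivity of \<open>n\<close> provides the index 0.\<close>

lemma hereditary_mat_coboundary:
  fixes k :: "'k ring" (structure) and A :: "('k, 'a) module" and n :: nat
  assumes k: "cring k" and A: "assoc_algebra k A" and her: "hereditary A" and n: "n \<ge> 1"
  defines "B \<equiv> gmat (self_algebra k) {..<n}"
  assumes rh: "rh \<in> alg_hom k A B" and ga: "bilinear_on k A B ga"
    and coc: "\<And>a b c. a \<in> carrier A \<Longrightarrow> b \<in> carrier A \<Longrightarrow> c \<in> carrier A \<Longrightarrow>
      rh a \<otimes>\<^sub>B ga b c \<oplus>\<^sub>B ga a (b \<otimes>\<^sub>A c) = ga (a \<otimes>\<^sub>A b) c \<oplus>\<^sub>B ga a b \<otimes>\<^sub>B rh c"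
    and ga1: "\<And>a. a \<in> carrier A \<Longrightarrow> ga \<one>\<^sub>A a = \<zero>\<^sub>B" "\<And>a. a \<in> carrier A \<Longrightarrow> ga a \<one>\<^sub>A = \<zero>\<^sub>B"
  shows "\<exists>h\<in>lmod_hom k A B. \<forall>a\<in>carrier A. \<forall>b\<in>carrier A.
    h (a \<otimes>\<^sub>A b) = rh a \<otimes>\<^sub>B h b \<oplus>\<^sub>B h a \<otimes>\<^sub>B rh b \<oplus>\<^sub>B ga a b"
proof -
  interpret k: cring k by fact
  have ka: "algebra k (self_algebra k)" by (rule algebra_self_algebra[OF k])
  have B: "assoc_algebra k B" unfolding B_def by (rule assoc_algebra_gmat[OF ka]) simp
  interpret B: assoc_algebra k B by fact
  define E where "E u = (\<lambda>v\<in>{..<n} \<times> {..<n}. if v = u then \<one> else \<zero>)" for u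
  note s = gmat_simps[where Q = "{..<n}" and B = "self_algebra k", folded B_def, simplified]
  note ext = gmat_extensional[where Q = "{..<n}" and B = "self_algebra k", folded B_def]
  have Ec: "E u \<in> carrier B" for u by (auto simp: s(1) E_def)
  have Es: "E u (i, j) = (if (i, j) = u then \<one> else \<zero>)" if "i < n" "j < n" for u i j using that by (simp add: E_def)
  have val: "x (i, j) \<in> carrier k" if "x \<in> carrier B" "i < n" "j < n" for x i j using that by (auto simp: s(1))
  have ex: "x \<in> extensional ({..<n} \<times> {..<n})" if "x \<in> carrier B" for x using that by (simp add: s(1))
  have sum: "(\<Oplus>\<^sub>B t<n. Z t) (i, j) = (\<Oplus>t<n. Z t (i, j))"
    if "\<And>t. t < n \<Longrightarrow> Z t \<in> carrier B" "i < n" "j < n" for Z i j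
    using gmat_finsum_entry[OF ka, of "{..<n}" "{..<n}" Z i j] that unfolding B_def by auto
  have delta: "(\<Oplus>t<n. y t) = y j" if "j < n" "y j \<in> carrier k" "\<And>t. t < n \<Longrightarrow> t \<noteq> j \<Longrightarrow> y t = \<zero>" for y j
  proof -
    have "(\<Oplus>t<n. y t) = (\<Oplus>t<n. if t = j then y j else \<zero>)"
      using that by (intro k.finsum_cong') auto
    thus ?thesis using that by (simp add: k.finsum_delta)
  qed
  have xE: "(x \<otimes>\<^sub>B E (t, m)) (i, j) = (if j = m then x (i, t) else \<zero>)"
    if "x \<in> carrier B" "t < n" "m < n" "i < n" "j < n" for x t m i j
  proof -
    have "(x \<otimes>\<^sub>B E (t, m)) (i, j) = (\<Oplus>l<n. x (i, l) \<otimes> E (t, m) (l, j))" using that by (simp add: s)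
    also have "\<dots> = x (i, t) \<otimes> E (t, m) (t, j)" using that val[OF that(1)] by (intro delta) (auto simp: Es)
    finally show ?thesis using that val[OF that(1)] by (simp add: Es)
  qed
  have Ex: "(E (m, t) \<otimes>\<^sub>B x) (i, j) = (if i = m then x (t, j) else \<zero>)"
    if "x \<in> carrier B" "t < n" "m < n" "i < n" "j < n" for x t m i j
  proof -
    have "(E (m, t) \<otimes>\<^sub>B x) (i, j) = (\<Oplus>l<n. E (m, t) (i, l) \<otimes> x (l, j))" using that by (simp add: s)
    also have "\<dots> = E (m, t) (i, t) \<otimes> x (t, j)" using that val[OF that(1)] by (intro delta) (auto simp: Es)
    finally show ?thesis using that val[OF that(1)] by (simp add: Es)
  qed
  have combo: "(\<Oplus>\<^sub>B t<n. c t \<odot>\<^sub>B E (u t)) (i, j) = (\<Oplus>t<n. if (i, j) = u t then c t else \<zero>)"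
    if "\<And>t. t < n \<Longrightarrow> c t \<in> carrier k" "i < n" "j < n" for c u i j
  proof -
    have "(\<Oplus>\<^sub>B t<n. c t \<odot>\<^sub>B E (u t)) (i, j) = (\<Oplus>t<n. (c t \<odot>\<^sub>B E (u t)) (i, j))"
      using that by (intro sum) (simp_all add: Ec)
    also have "\<dots> = (\<Oplus>t<n. if (i, j) = u t then c t else \<zero>)"
      using that by (intro k.finsum_cong') (auto simp: s Es)
    finally show ?thesis .
  qed
  have col: "(\<Oplus>\<^sub>B t<n. c t \<odot>\<^sub>B E (t, m)) (i, j) = (if j = m then c i else \<zero>)"
    if "\<And>t. t < n \<Longrightarrow> c t \<in> carrier k" "i < n" "j < n" for c m i j
  proof -
    have "(\<Oplus>t<n. if (i, j) = (t, m) then c t else \<zero>) = (if (i, j) = (i, m) then c i else \<zero>)"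
      using that by (intro delta) auto
    thus ?thesis using combo[of c i j "\<lambda>t. (t, m)", OF that] by simp
  qed
  have row: "(\<Oplus>\<^sub>B t<n. c t \<odot>\<^sub>B E (m, t)) (i, j) = (if i = m then c j else \<zero>)"
    if "\<And>t. t < n \<Longrightarrow> c t \<in> carrier k" "i < n" "j < n" for c m i j
  proof -
    have "(\<Oplus>t<n. if (i, j) = (m, t) then c t else \<zero>) = (if (i, j) = (m, j) then c j else \<zero>)"
      using that by (intro delta) auto
    thus ?thesis using combo[of c i j "\<lambda>t. (m, t)", OF that] by simp
  qed
  have comboc: "(\<Oplus>\<^sub>B t<n. c t \<odot>\<^sub>B E (u t)) \<in> carrier B" if "\<And>t. t < n \<Longrightarrow> c t \<in> carrier k" for c u
    using that by (intro B.finsum_closed) (auto simp: Ec)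
  have eqI: "x = x'" if "x \<in> carrier B" "x' \<in> carrier B" "\<And>i j. i < n \<Longrightarrow> j < n \<Longrightarrow> x (i, j) = x' (i, j)" for x x'
    using that by (intro mat_eqI[of _ n]) (auto simp: ex)
  have n0: "0 < n" using n by simp
  show ?thesis
  proof (rule hereditary_coboundary[where n = n and e = "\<lambda>j. E (j, 0)" and f = "\<lambda>j. E (0, j)" and ec = "E (0, 0)" and kp = "\<lambda>x l j. x (l, j)",
        OF A her B rh _ _ _ _ _ _ _ _ _ _ _ _ ga coc ga1])
    fix x j assume x: "x \<in> carrier B" and j: "j < n"
    show "x \<otimes>\<^sub>B E (j, 0) = (\<Oplus>\<^sub>B l<n. x (l, j) \<odot>\<^sub>B E (l, 0))"
      using x j n0 by (intro eqI) (simp_all add: Ec xE col val comboc)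
    show "E (0, j) \<otimes>\<^sub>B x = (\<Oplus>\<^sub>B l<n. x (j, l) \<odot>\<^sub>B E (0, l))"
      using x j n0 by (intro eqI) (simp_all add: Ec Ex row val comboc)
  next
    show "(\<Oplus>\<^sub>B j<n. E (j, 0) \<otimes>\<^sub>B E (0, j)) = \<one>\<^sub>B"
    proof (rule eqI)
      fix i j assume ij: "i < n" "j < n"
      have "(\<Oplus>\<^sub>B t<n. E (t, 0) \<otimes>\<^sub>B E (0, t)) (i, j) = (\<Oplus>t<n. (E (t, 0) \<otimes>\<^sub>B E (0, t)) (i, j))"
        using ij by (intro sum) (simp_all add: Ec)
      also have "\<dots> = (E (i, 0) \<otimes>\<^sub>B E (0, i)) (i, j)"
        using ij n0 by (intro delta) (auto simp: Ec xE Es)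
      finally show "(\<Oplus>\<^sub>B t<n. E (t, 0) \<otimes>\<^sub>B E (0, t)) (i, j) = \<one>\<^sub>B (i, j)"
        using ij n0 by (simp add: Ec xE Es s(3))
    qed (auto simp: Ec intro!: B.finsum_closed)
  next
    fix j assume "j < n"
    thus "E (j, 0) \<otimes>\<^sub>B E (0, 0) = E (j, 0)" using n0 by (intro eqI) (simp_all add: Ec xE Es)
  next
    fix z assume z: "z \<in> carrier B" "z \<otimes>\<^sub>B E (0, 0) = z"
    have zz: "z (i, j) = (if j = 0 then z (i, 0) else \<zero>)" if "i < n" "j < n" for i j
      using xE[OF z(1) n0 n0 that] unfolding z(2) .
    have zc: "z (j, 0) \<in> carrier k" if "j < n" for j using val[OF z(1) that n0] .
    have "z = (\<Oplus>\<^sub>B j<n. z (j, 0) \<odot>\<^sub>B E (j, 0))"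
      by (rule eqI[OF z(1) comboc[OF zc]]) (simp_all only: col[OF zc] zz[symmetric])
    thus "\<exists>c. (\<forall>j<n. c j \<in> carrier k) \<and> z = (\<Oplus>\<^sub>B j<n. c j \<odot>\<^sub>B E (j, 0))"
      using z(1) n0 by (intro exI[of _ "\<lambda>j. z (j, 0)"]) (simp add: val)
  qed (simp_all only: Ec s(2,5,6) val)
qed

text \<open>M_n(I) sits inside the ring M_n(B), and the two actions become products with
  \<open>sg a\<close> there. Cocycle computations can then be carried out in this ring, even where
  \<open>sg\<close> is not multiplicative.\<close>

lemma (in rep_module) ideal_module_actions:
  fixes B :: "('k, 'm) module" and x sg
  defines "T \<equiv> gmat B {..<n}"
  assumes M_eq: "M = ideal_module B x I" and B: "algebra k B" and I: "ideal I B"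
    and xsg: "x \<in> carrier R \<rightarrow> carrier B" "\<forall>b\<in>carrier k. x (b \<odot>\<^sub>R \<one>\<^sub>R) = b \<odot>\<^sub>B \<one>\<^sub>B"
      "\<forall>a. \<forall>i<n. \<forall>j<n. sg a (i, j) = x (y a (i, j))"
  shows "Z \<oplus>\<^sub>N W = Z \<oplus>\<^sub>T W" and "\<zero>\<^sub>N = \<zero>\<^sub>T"
    and "c \<in> carrier k \<Longrightarrow> Z \<in> carrier N \<Longrightarrow> c \<odot>\<^sub>N Z = c \<odot>\<^sub>T Z"
    and "a \<in> carrier A \<Longrightarrow> Z \<in> carrier N \<Longrightarrow> la a Z = sg a \<otimes>\<^sub>T Z"
    and "a \<in> carrier A \<Longrightarrow> Z \<in> carrier N \<Longrightarrow> ra a Z = Z \<otimes>\<^sub>T sg a"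
proof -
  interpret Bc: cring B by (rule algebra.M_cring[OF B])
  interpret B: algebra k B by fact
  interpret I: ideal I B by fact
  note gs = gmat_simps[where Q = "{..<n}" and B = B, simplified] gmat_extensional[where Q = "{..<n}" and B = B]
  have x: "x c \<in> carrier B" if "c \<in> carrier R" for c using that xsg(1) by auto
  have sg: "sg a (i, j) = x (y a (i, j))" if "i < n" "j < n" for a i j using that xsg(3) by simp
  note fs = finsum_ideal_module[OF I M.module_axioms[unfolded M_eq], folded M_eq]
  have M_simps: "carrier M = I" "\<zero> = \<zero>\<^sub>B" "z \<oplus> w = z \<oplus>\<^sub>B w" "r \<odot> z = x r \<otimes>\<^sub>B z" for z w r by (simp_all add: M_eq)
  have Zv: "Z (i, j) \<in> I" if "Z \<in> carrier N" "i < n" "j < n" for Z i j using that by (simp add: N_simps M_simps)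
  show "Z \<oplus>\<^sub>N W = Z \<oplus>\<^sub>T W" "\<zero>\<^sub>N = \<zero>\<^sub>T"
    unfolding T_def by (rule mat_eqI[of _ n]; simp add: gs(2-) N_simps(2-) M_simps)+
  show "c \<odot>\<^sub>N Z = c \<odot>\<^sub>T Z" if "c \<in> carrier k" "Z \<in> carrier N"
    unfolding T_def using that I.Icarr[OF Zv[OF that(2)]]
    by (intro mat_eqI[of _ n]) (simp_all add: gs(2-) N_simps(2-) M_simps x xsg(2) B.smult_assoc2)
  assume a: "a \<in> carrier A" and Z: "Z \<in> carrier N"
  have "la a Z (i, l) = (sg a \<otimes>\<^sub>T Z) (i, l)" "ra a Z (i, l) = (Z \<otimes>\<^sub>T sg a) (i, l)" if il: "i < n" "l < n" for i l
  proof -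
    have "la a Z (i, l) = (\<Oplus>\<^sub>B j<n. x (y a (i, j)) \<otimes>\<^sub>B Z (j, l))" "ra a Z (i, l) = (\<Oplus>\<^sub>B j<n. x (y a (j, l)) \<otimes>\<^sub>B Z (i, j))"
      unfolding lra(1,2)[OF il] M_simps using a Zv[OF Z] il by (subst fs; simp add: x y_simps I.I_l_closed)+
    moreover have "(\<Oplus>\<^sub>B j<n. x (y a (i, j)) \<otimes>\<^sub>B Z (j, l)) = (\<Oplus>\<^sub>B j<n. sg a (i, j) \<otimes>\<^sub>B Z (j, l))"
      using a I.Icarr[OF Zv[OF Z]] il by (intro Bc.finsum_cong') (auto simp: sg x y_simps)
    moreover have "(\<Oplus>\<^sub>B j<n. x (y a (j, l)) \<otimes>\<^sub>B Z (i, j)) = (\<Oplus>\<^sub>B j<n. Z (i, j) \<otimes>\<^sub>B sg a (j, l))"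
      using a I.Icarr[OF Zv[OF Z]] il by (intro Bc.finsum_cong') (auto simp: sg x y_simps Bc.m_comm)
    ultimately show "la a Z (i, l) = (sg a \<otimes>\<^sub>T Z) (i, l)" "ra a Z (i, l) = (Z \<otimes>\<^sub>T sg a) (i, l)"
      using il by (simp_all add: gs(2) T_def)
  qed
  thus "la a Z = sg a \<otimes>\<^sub>T Z" "ra a Z = Z \<otimes>\<^sub>T sg a" by (auto simp: lra gs T_def intro!: mat_eqI[of _ n])
qed

context rep_problem
begin

text \<open>The point \<open>x\<close> turns \<open>y\<close> into a representation over
  \<open>k\<close> and makes M_n(k) its bimodule. All cocycles are coboundaries there because
  \<open>A\<close> is hereditary, so \<open>exact_if_coboundary\<close> applies.\<close>

lemma fibre_exact:
  assumes her: "hereditary A" and n: "n \<ge> 1" and x: "x \<in> alg_hom k R (self_algebra k)"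
    and Y: "\<And>v. v \<in> Q_ind \<Longrightarrow> Y v \<in> carrier k"
    and D2Y: "\<And>w. w \<in> S_ind \<Longrightarrow> (\<Oplus>\<^sub>k v\<in>Q_ind. x (D2 w v) \<otimes>\<^sub>k Y v) = \<zero>\<^sub>k"
  shows "\<exists>Z. (\<forall>w\<in>P_ind. Z w \<in> carrier k) \<and> (\<forall>v\<in>Q_ind. Y v = (\<Oplus>\<^sub>k w\<in>P_ind. x (D1 v w) \<otimes>\<^sub>k Z w))"
proof -
  have xs: "x c \<in> carrier k" "x (c \<oplus>\<^sub>R d) = x c \<oplus>\<^sub>k x d" "x (c \<otimes>\<^sub>R d) = x c \<otimes>\<^sub>k x d" "x \<one>\<^sub>R = \<one>\<^sub>k"
    if "c \<in> carrier R" "d \<in> carrier R" for c d using x that by (auto simp: alg_hom_def ring_hom_def)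
  have xsm: "x (b \<odot>\<^sub>R c) = b \<otimes>\<^sub>k x c" if "b \<in> carrier k" "c \<in> carrier R" for b c using x that by (auto simp: alg_hom_def)
  have x1: "x \<one>\<^sub>R = \<one>\<^sub>k" using xs(4) by blast
  have xh: "x \<in> ring_hom R k" using x by (simp add: alg_hom_def ring_hom_def)
  interpret x: ring_hom_cring R k x
    by (intro UnivPoly.ring_hom_cringI R.is_cring A.R.cring_axioms xh)
  let ?k = "self_algebra k"
  \<comment> \<open>The residue field at \<open>x\<close>, obtained as the unit ideal of
    \<open>k\<close> with \<open>R\<close> acting through \<open>x\<close>.\<close>
  let ?M = "ideal_module ?k x (carrier k)"
  have ka: "algebra k ?k" by (rule algebra_self_algebra[OF A.R.cring_axioms])
  have kc: "cring ?k" by (rule algebra.M_cring[OF ka])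
  have kI: "ideal (carrier k) ?k" using ring.oneideal[OF cring.axioms(1)[OF kc]] by simp
  have M: "module R ?M" by (rule module_ideal_module[OF R.is_cring kc kI]) (simp_all add: xs x1)
  interpret F: rep_problem k A R ?M n y p q r s f g
    by (intro rep_problem.intro rep_module.intro rep_module_axioms.intro A.assoc_algebra_axioms R.algebra_axioms M field_k y env_resolution_axioms)
  note fs = finsum_ideal_module[OF kI M]
  let ?B = "gmat (self_algebra k) {..<n}"
  interpret B: assoc_algebra k ?B by (rule assoc_algebra_gmat[OF ka]) simp
  define rh where "rh a = (\<lambda>v\<in>{..<n} \<times> {..<n}. x (y a v))" for a
  have rhs: "rh a (i, j) = x (y a (i, j))" if "i < n" "j < n" for a i j using that by (simp add: rh_def)
  have rhe: "rh a \<in> extensional ({..<n} \<times> {..<n})" for a by (simp add: rh_def)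
  note gs = gmat_simps[where Q = "{..<n}" and B = "self_algebra k", simplified] gmat_extensional[where Q = "{..<n}" and B = "self_algebra k"]
  have rhc: "rh a \<in> carrier ?B" if "a \<in> carrier A" for a using that by (auto simp: gs rhs rhe xs y_simps)
  have rh: "rh \<in> alg_hom k A ?B"
    unfolding alg_hom_def
  proof (intro CollectI conjI ballI ring_hom_memI)
    fix a b assume a: "a \<in> carrier A" and b: "b \<in> carrier A"
    show "rh (a \<oplus>\<^sub>A b) = rh a \<oplus>\<^sub>?B rh b"
      using a b by (intro mat_eqI[of _ n]) (simp_all add: gs(2-) rhs rhe y_simps)
    show "rh (a \<otimes>\<^sub>A b) = rh a \<otimes>\<^sub>?B rh b"
    proof (rule mat_eqI[of _ n])
      fix i j assume ij: "i < n" "j < n"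
      have "rh (a \<otimes>\<^sub>A b) (i, j) = x (\<Oplus>\<^sub>R l<n. y a (i, l) \<otimes>\<^sub>R y b (l, j))" using a b ij by (simp add: rhs y_simps)
      also have "\<dots> = (\<Oplus>\<^sub>k l<n. rh a (i, l) \<otimes>\<^sub>k rh b (l, j))"
        using a b ij by (subst x.hom_finsum) (auto simp: o_def y_simps rhs intro!: A.R.finsum_cong')
      finally show "rh (a \<otimes>\<^sub>A b) (i, j) = (rh a \<otimes>\<^sub>?B rh b) (i, j)" using ij by (simp add: gs(2))
    qed (simp_all add: gs rhe)
  next
    show "rh \<one>\<^sub>A = \<one>\<^sub>?B" by (rule mat_eqI[of _ n]) (simp_all add: gs(2-) rhs rhe y_simps(5) x1)
  next
    fix c a assume c: "c \<in> carrier k" and a: "a \<in> carrier A"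
    show "rh (c \<odot>\<^sub>A a) = c \<odot>\<^sub>?B rh a"
      using a c by (intro mat_eqI[of _ n]) (simp_all add: gs(2-) rhs rhe y_simps xsm)
  qed (rule rhc)
  have Nc: "carrier F.N = carrier ?B" by (auto simp: gs F.N_simps)
  have "x \<in> carrier R \<rightarrow> carrier ?k" "\<forall>b\<in>carrier k. x (b \<odot>\<^sub>R \<one>\<^sub>R) = b \<odot>\<^bsub>?k\<^esub> \<one>\<^bsub>?k\<^esub>"
    "\<forall>a. \<forall>i<n. \<forall>j<n. rh a (i, j) = x (y a (i, j))" by (simp_all add: xs xsm x1 rhs)
  note acts = F.ideal_module_actions[OF refl ka kI this, unfolded Nc]
  have "F.env.coboundary ga" if coc: "F.env.cocycle ga" for ga
  proof -
    have bil: "bilinear_on k A F.N ga" using coc unfolding F.env.cocycle_def by simp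
    have gac: "ga a b \<in> carrier ?B" if "a \<in> carrier A" "b \<in> carrier A" for a b using bil that unfolding bilinear_on_def Nc by simp
    have bil': "bilinear_on k A ?B ga"
      using bil gac unfolding bilinear_on_def Nc acts(1) by (simp add: acts(3))
    have id: "rh a \<otimes>\<^sub>?B ga b c \<oplus>\<^sub>?B ga a (b \<otimes>\<^sub>A c) = ga (a \<otimes>\<^sub>A b) c \<oplus>\<^sub>?B ga a b \<otimes>\<^sub>?B rh c"
      if "a \<in> carrier A" "b \<in> carrier A" "c \<in> carrier A" for a b c
      using coc that gac unfolding F.env.cocycle_def acts(1) by (simp add: acts(4,5))
    have "\<exists>h\<in>lmod_hom k A ?B. \<forall>a\<in>carrier A. \<forall>b\<in>carrier A.
      h (a \<otimes>\<^sub>A b) = rh a \<otimes>\<^sub>?B h b \<oplus>\<^sub>?B h a \<otimes>\<^sub>?B rh b \<oplus>\<^sub>?B ga a b"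
      by (rule hereditary_mat_coboundary[OF A.R.cring_axioms A.assoc_algebra_axioms her n rh bil' id])
        (use coc in \<open>simp_all add: F.env.cocycle_def acts(2)\<close>)
    then obtain h where h: "h \<in> lmod_hom k A ?B" "\<forall>a\<in>carrier A. \<forall>b\<in>carrier A.
      h (a \<otimes>\<^sub>A b) = rh a \<otimes>\<^sub>?B h b \<oplus>\<^sub>?B h a \<otimes>\<^sub>?B rh b \<oplus>\<^sub>?B ga a b" by (elim bexE)
    have "h \<in> lmod_hom k A F.N" using lmod_homD[OF h(1)] by (intro lmod_homI) (simp_all add: Nc acts)
    moreover have "\<forall>a\<in>carrier A. \<forall>b\<in>carrier A. h (a \<otimes>\<^sub>A b) = F.la a (h b) \<oplus>\<^sub>F.N F.ra b (h a) \<oplus>\<^sub>F.N ga a b"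
      using h(2) lmod_homD(1)[OF h(1)] by (simp add: acts)
    ultimately show ?thesis unfolding F.env.coboundary_def by blast
  qed
  moreover have "bilinear_lifts k A E pure E"
    by (rule bilinear_lifts_enveloping_algebra[OF field_k A.assoc_algebra_axioms env.E.module_axioms])
  ultimately have "F.exact_at_N" by (intro F.exact_if_coboundary)
  hence ex: "(\<forall>v\<in>Q_ind. Y v \<in> carrier ?M) \<longrightarrow> (\<forall>w\<in>S_ind. (\<Oplus>\<^sub>?M v\<in>Q_ind. D2 w v \<odot>\<^sub>?M Y v) = \<zero>\<^sub>?M) \<longrightarrow>
    (\<exists>Z. (\<forall>w\<in>P_ind. Z w \<in> carrier ?M) \<and> (\<forall>v\<in>Q_ind. Y v = (\<Oplus>\<^sub>?M w\<in>P_ind. D1 v w \<odot>\<^sub>?M Z w)))"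
    unfolding F.exact_at_N_iff by (rule spec)
  have "\<forall>v\<in>Q_ind. Y v \<in> carrier ?M" using Y by simp
  note ex = mp[OF ex this]
  have yc: "D2 w v \<odot>\<^sub>?M Y v \<in> carrier k" if "w \<in> S_ind" "v \<in> Q_ind" for v w
    using Y[OF that(2)] D_closed(2)[OF that] by (simp add: xs)
  have "(\<Oplus>\<^sub>?M v\<in>Q_ind. D2 w v \<odot>\<^sub>?M Y v) = \<zero>\<^sub>?M" if w: "w \<in> S_ind" for w
    by (subst fs[OF yc[OF w]]) (use D2Y[OF w] in simp_all)
  with ex obtain Z where Z: "\<forall>w\<in>P_ind. Z w \<in> carrier ?M" "\<forall>v\<in>Q_ind. Y v = (\<Oplus>\<^sub>?M w\<in>P_ind. D1 v w \<odot>\<^sub>?M Z w)"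
    by (elim impE exE conjE) blast
  have zc: "D1 v w \<odot>\<^sub>?M Z w \<in> carrier k" if "v \<in> Q_ind" "w \<in> P_ind" for v w
    using bspec[OF Z(1) that(2)] D_closed(1)[OF that] by (simp add: xs)
  have "(\<Oplus>\<^sub>?M w\<in>P_ind. D1 v w \<odot>\<^sub>?M Z w) = (\<Oplus>\<^sub>k w\<in>P_ind. x (D1 v w) \<otimes>\<^sub>k Z w)" if v: "v \<in> Q_ind" for v
    by (subst fs[OF zc[OF v]]) simp_all
  thus ?thesis using Z by (intro exI[of _ Z]) simp
qed

text \<open>Exactness at all closed points yields a homotopy over \<open>R\<close>, and the homotopy
  yields exactness for the given coefficient module, which is arbitrary.\<close>

lemma exact_at_N_if_hereditary:
  assumes k: "algebraically_closed k" and fg: "finitely_generated_algebra k R" and her: "hereditary A" and n: "n \<ge> 1"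
  shows "exact_at_N"
proof -
  have "\<exists>U V. (\<forall>w\<in>P_ind. \<forall>v\<in>Q_ind. U w v \<in> carrier R) \<and> (\<forall>v\<in>Q_ind. \<forall>w\<in>S_ind. V v w \<in> carrier R) \<and>
    (\<forall>v\<in>Q_ind. \<forall>v'\<in>Q_ind. (mprod R P_ind D1 U v v') \<oplus>\<^sub>R (mprod R S_ind V D2 v v') = (if v = v' then \<one>\<^sub>R else \<zero>\<^sub>R))"
    by (rule homotopy_exists[OF k R.algebra_axioms fg]) (simp, simp, simp, (rule D_closed D2_D1 fibre_exact[OF her n]; assumption?)+)
  then obtain U V where "\<forall>w\<in>P_ind. \<forall>v\<in>Q_ind. U w v \<in> carrier R" "\<forall>v\<in>Q_ind. \<forall>w\<in>S_ind. V v w \<in> carrier R"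
    "\<forall>v\<in>Q_ind. \<forall>v'\<in>Q_ind. (mprod R P_ind D1 U v v') \<oplus>\<^sub>R (mprod R S_ind V D2 v v') = (if v = v' then \<one>\<^sub>R else \<zero>\<^sub>R)"
    by (elim exE conjE)
  thus ?thesis by (intro exact_at_N_if_homotopy[of U V]) blast+
qed

end

subsection \<open>Lifting along square-zero extensions\<close>

lemma (in abelian_group) minus_plus_minus:
  assumes "x \<in> carrier G" "y \<in> carrier G" "z \<in> carrier G"
  shows "(x \<ominus> y) \<oplus> (y \<ominus> z) = x \<ominus> z" "(y \<ominus> z) \<oplus> (x \<ominus> y) = x \<ominus> z"
proof -
  show *: "(x \<ominus> y) \<oplus> (y \<ominus> z) = x \<ominus> z" using assms by (simp add: a_minus_def a_assoc r_neg1)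
  show "(y \<ominus> z) \<oplus> (x \<ominus> y) = x \<ominus> z" using assms by (subst a_comm) (simp_all add: *)
qed

lemma (in ideal) a_rcos_eq_iff:
  assumes "x \<in> carrier R" "y \<in> carrier R"
  shows "I +> x = I +> y \<longleftrightarrow> x \<ominus> y \<in> I"
proof
  assume "I +> x = I +> y"
  hence "x \<in> I +> y" using a_rcos_self[OF assms(1)] by simp
  then obtain i where i: "i \<in> I" "x = i \<oplus> y" by (auto simp: a_r_coset_def')
  hence "x \<ominus> y = i" using assms Icarr[OF i(1)] by (simp add: a_minus_def a_assoc r_neg)
  thus "x \<ominus> y \<in> I" using i by simp
next
  assume i: "x \<ominus> y \<in> I"
  have "x = (x \<ominus> y) \<oplus> y" using assms by (simp add: a_minus_def a_assoc l_neg)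
  hence "x \<in> I +> y" using i by (auto simp: a_r_coset_def')
  thus "I +> x = I +> y" using a_repr_independence' assms by auto
qed

lemma (in ideal) finsum_in_ideal: "(\<And>i. i \<in> S \<Longrightarrow> x i \<in> I) \<Longrightarrow> (\<Oplus>i\<in>S. x i) \<in> I"
proof (induction S rule: infinite_finite_induct)
  case (insert i S)
  have "x \<in> S \<rightarrow> carrier R" "x i \<in> carrier R" using insert.prems Icarr by auto
  thus ?case using insert a_closed by simp
qed auto

text \<open>A linear section of B \<rightarrow> B/I gives a linear lift, but it may send the unit to
  1 + nu with nu in \<open>I\<close>. Since nu^2 = 0, multiplication by 1 - nu repairs this without
  leaving the cosets.\<close>

lemma unital_linear_lift_exists:
  fixes k :: "'k ring" and R :: "('k, 'r) module" and B :: "('k, 'b) module" (structure)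
  assumes k: "field k" and R: "algebra k R" and B: "algebra k B" and I: "ideal I B"
    and sq: "\<And>x y. x \<in> I \<Longrightarrow> y \<in> I \<Longrightarrow> x \<otimes> y = \<zero>" and g: "g \<in> alg_hom k R (quot_algebra B I)"
  shows "\<exists>cx. cx \<in> lmod_hom k R B \<and> cx \<one>\<^sub>R = \<one> \<and> (\<forall>r\<in>carrier R. I +> cx r = g r)"
proof -
  interpret R: algebra k R by fact
  interpret B: algebra k B by fact
  interpret I: ideal I B by fact
  let ?Q = "quot_algebra B I"
  note aB = B.is_assoc_algebra
  interpret Q: assoc_algebra k ?Q by (rule assoc_algebra_quot_algebra[OF aB I])
  note proj = quot_algebra_proj[OF aB I]
  have proj_lin: "(\<lambda>x. I +> x) \<in> lmod_hom k B ?Q"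
    using proj by (simp add: lmod_hom_def alg_hom_def ring_hom_def)
  obtain s where s: "s \<in> lmod_hom k ?Q B" "\<forall>w\<in>carrier B. I +> s (I +> w) = I +> w"
    using linear_generalized_inverse[OF k B.module_axioms Q.module_axioms proj_lin] by (elim exE conjE)
  note sD = lmod_homD[OF s(1)]
  have gc: "g r \<in> carrier ?Q" if "r \<in> carrier R" for r using g that by (auto simp: alg_hom_def ring_hom_def)
  have gs: "g (r \<oplus>\<^sub>R t) = g r \<oplus>\<^sub>?Q g t" if "r \<in> carrier R" "t \<in> carrier R" for r t using g that by (auto simp: alg_hom_def ring_hom_def)
  have gsm: "g (c \<odot>\<^sub>R r) = c \<odot>\<^sub>?Q g r" if "r \<in> carrier R" "c \<in> carrier k" for r c using g that by (auto simp: alg_hom_def)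
  have g1: "g \<one>\<^sub>R = I +> \<one>" using g by (simp add: alg_hom_def ring_hom_def quot_algebra_simps[OF aB I])
  have sg: "s (g r) \<in> carrier B" "I +> s (g r) = g r" if "r \<in> carrier R" for r
  proof -
    show "s (g r) \<in> carrier B" using gc[OF that] sD by simp
    from gc[OF that] obtain b where "b \<in> carrier B" "g r = I +> b" unfolding quot_algebra_simps(1)[OF aB I] by (elim imageE)
    thus "I +> s (g r) = g r" using s(2) by simp
  qed
  define nu where "nu = s (g \<one>\<^sub>R) \<ominus> \<one>"
  have nu: "nu \<in> I" unfolding nu_def using sg[of "\<one>\<^sub>R"] g1 by (simp flip: I.a_rcos_eq_iff)
  have nuc: "nu \<in> carrier B" using I.Icarr[OF nu] .
  define cx where "cx r = s (g r) \<otimes> (\<one> \<ominus> nu)" for r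
  have w: "\<one> \<ominus> nu \<in> carrier B" using nuc by simp
  have "cx \<in> lmod_hom k R B"
    using w by (intro lmod_homI) (simp_all add: cx_def gs gsm sD gc B.l_distr B.smult_assoc2)
  moreover have "cx \<one>\<^sub>R = \<one>"
  proof -
    have "s (g \<one>\<^sub>R) = nu \<oplus> \<one>" using sg(1)[of "\<one>\<^sub>R"] by (simp add: nu_def a_minus_def B.a_assoc B.l_neg)
    hence "cx \<one>\<^sub>R = (nu \<oplus> \<one>) \<otimes> (\<one> \<ominus> nu)" by (simp add: cx_def)
    also have "\<dots> = \<one>"
      using nuc sq[OF nu nu] by (simp add: a_minus_def B.l_distr B.r_distr B.r_minus) (simp add: B.a_comm[of _ "\<ominus> nu"] B.r_neg1)
    finally show ?thesis .
  qed
  moreover have "I +> cx r = g r" if r: "r \<in> carrier R" for r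
  proof -
    have "cx r \<ominus> s (g r) = \<ominus> (s (g r) \<otimes> nu)"
      using sg(1)[OF r] nuc by (simp add: cx_def a_minus_def B.r_distr B.r_minus B.a_ac B.r_neg1 B.r_neg2)
    hence "cx r \<ominus> s (g r) \<in> I" using I.I_l_closed[OF nu sg(1)[OF r]] by simp
    thus ?thesis using sg[OF r] w by (simp add: cx_def flip: I.a_rcos_eq_iff)
  qed
  ultimately show ?thesis by blast
qed

context rep_problem
begin

text \<open>The entries of the representation are lifted linearly, giving \<open>sg\<close>. Its
  failure to be multiplicative is a cocycle with values in M_n(I), and a cochain \<open>h\<close>
  bounding it makes sg + h a homomorphism, since products of values of \<open>h\<close>
  vanish.\<close>

lemma square_zero_lift_exists:
  fixes B :: "('k, 'b) module"
  assumes k: "algebraically_closed k" and fg: "finitely_generated_algebra k R" and her: "hereditary A" and n: "n \<ge> 1"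
    and B: "algebra k B" and I: "ideal I B" and sq: "\<And>x y. x \<in> I \<Longrightarrow> y \<in> I \<Longrightarrow> x \<otimes>\<^sub>B y = \<zero>\<^sub>B"
    and h0: "h0 \<in> alg_hom k R (quot_algebra B I)"
  shows "\<exists>ta\<in>alg_hom k A (mat_algebra B n). \<forall>a\<in>carrier A. \<forall>i<n. \<forall>j<n. I +>\<^sub>B ta a (i, j) = h0 (y a (i, j))"
proof -
  interpret Bc: cring B by (rule algebra.M_cring[OF B])
  interpret B: algebra k B by fact
  interpret I: ideal I B by fact
  note aB = B.is_assoc_algebra
  obtain cx where cx: "cx \<in> lmod_hom k R B" and cx1: "cx \<one>\<^sub>R = \<one>\<^sub>B" and cxh: "\<forall>r\<in>carrier R. I +>\<^sub>B cx r = h0 r"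
  proof -
    have "\<exists>cx. cx \<in> lmod_hom k R B \<and> cx \<one>\<^sub>R = \<one>\<^sub>B \<and> (\<forall>r\<in>carrier R. I +>\<^sub>B cx r = h0 r)"
      by (rule unital_linear_lift_exists[OF field_k R.algebra_axioms B I sq h0])
    thus thesis using that by (elim exE conjE)
  qed
  note cxD = lmod_homD[OF cx]
  have h0m: "h0 (c \<otimes>\<^sub>R d) = h0 c \<otimes>\<^bsub>quot_algebra B I\<^esub> h0 d" if "c \<in> carrier R" "d \<in> carrier R" for c d
    using h0 that by (auto simp: alg_hom_def ring_hom_def)
  have cx_mult: "cx c \<otimes>\<^sub>B cx d \<ominus>\<^sub>B cx (c \<otimes>\<^sub>R d) \<in> I" if "c \<in> carrier R" "d \<in> carrier R" for c d
  proof -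
    have "I +>\<^sub>B cx c \<otimes>\<^sub>B cx d = I +>\<^sub>B cx (c \<otimes>\<^sub>R d)"
      using that cxh by (simp add: h0m cxD flip: quot_algebra_simps(5)[OF aB I])
    thus ?thesis using that by (subst (asm) I.a_rcos_eq_iff) (simp_all add: cxD)
  qed
  \<comment> \<open>\<open>cx\<close> is only linear, but by \<open>cx_mult\<close> its error on
    products lies in \<open>I\<close> and is killed by \<open>I\<close>. So \<open>I\<close> is an
    R-module through \<open>cx\<close>.\<close>
  let ?M = "ideal_module B cx I"
  have Ic: "z \<in> carrier B" if "z \<in> I" for z using I.Icarr[OF that] .
  have M: "module R ?M"
  proof (rule module_ideal_module[OF R.is_cring Bc.cring_axioms I])
    fix c d z assume cd: "c \<in> carrier R" "d \<in> carrier R" and z: "z \<in> I"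
    have "(cx c \<otimes>\<^sub>B cx d \<ominus>\<^sub>B cx (c \<otimes>\<^sub>R d)) \<otimes>\<^sub>B z = \<zero>\<^sub>B" by (rule sq[OF cx_mult[OF cd] z])
    hence "cx c \<otimes>\<^sub>B cx d \<otimes>\<^sub>B z \<ominus>\<^sub>B cx (c \<otimes>\<^sub>R d) \<otimes>\<^sub>B z = \<zero>\<^sub>B"
      using cd Ic[OF z] by (simp add: cxD a_minus_def Bc.l_distr Bc.l_minus)
    thus "cx (c \<otimes>\<^sub>R d) \<otimes>\<^sub>B z = (cx c \<otimes>\<^sub>B cx d) \<otimes>\<^sub>B z"
      using cd Ic[OF z] by (simp add: cxD Bc.minus_eq_zero_iff)
  qed (simp_all add: cxD cx1)
  interpret F: rep_problem k A R ?M n y p q r s f g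
    by (intro rep_problem.intro rep_module.intro rep_module_axioms.intro A.assoc_algebra_axioms R.algebra_axioms M field_k y env_resolution_axioms)
  note fs = finsum_ideal_module[OF I M]
  let ?B = "gmat B {..<n}"
  interpret G: assoc_algebra k ?B by (rule assoc_algebra_gmat[OF B]) simp
  note gs = gmat_simps[where Q = "{..<n}" and B = B, simplified] gmat_extensional[where Q = "{..<n}" and B = B]
  define sg where "sg a = (\<lambda>v\<in>{..<n} \<times> {..<n}. cx (y a v))" for a
  have sgs: "sg a (i, j) = cx (y a (i, j))" if "i < n" "j < n" for a i j using that by (simp add: sg_def)
  have sge: "sg a \<in> extensional ({..<n} \<times> {..<n})" for a by (simp add: sg_def)
  have sgc: "sg a \<in> carrier ?B" if "a \<in> carrier A" for a using that by (auto simp: gs sgs sge cxD y_simps)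
  have sg_add: "sg (a \<oplus>\<^sub>A b) = sg a \<oplus>\<^sub>?B sg b" if "a \<in> carrier A" "b \<in> carrier A" for a b
    using that by (intro mat_eqI[of _ n]) (simp_all add: gs(2-) sgs sge y_simps cxD)
  have sg_smult: "sg (c \<odot>\<^sub>A a) = c \<odot>\<^sub>?B sg a" if "a \<in> carrier A" "c \<in> carrier k" for a c
    using that by (intro mat_eqI[of _ n]) (simp_all add: gs(2-) sgs sge y_simps cxD)
  have cx0: "cx \<zero>\<^sub>R = \<zero>\<^sub>B" by (rule lmod_hom_zero[OF cx R.M.abelian_group_axioms Bc.abelian_group_axioms])
  have sg_one: "sg \<one>\<^sub>A = \<one>\<^sub>?B" by (rule mat_eqI[of _ n]) (simp_all add: gs(2-) sgs sge y_simps(5) cx1 cx0)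
  note sg = sgc sg_add sg_smult sg_one
  have Nc: "Z \<in> carrier F.N \<longleftrightarrow> (\<forall>i<n. \<forall>j<n. Z (i, j) \<in> I) \<and> Z \<in> extensional ({..<n} \<times> {..<n})" for Z by (simp add: F.N_simps)
  have NB: "Z \<in> carrier ?B" if "Z \<in> carrier F.N" for Z using that Ic by (auto simp: gs Nc)
  have "cx \<in> carrier R \<rightarrow> carrier B" "\<forall>b\<in>carrier k. cx (b \<odot>\<^sub>R \<one>\<^sub>R) = b \<odot>\<^sub>B \<one>\<^sub>B"
    "\<forall>a. \<forall>i<n. \<forall>j<n. sg a (i, j) = cx (y a (i, j))" by (simp_all add: cxD cx1 sgs)
  note acts = F.ideal_module_actions[OF refl B I this]
  note Na = acts(1) and Nz = acts(2) and Ns = acts(3) and la = acts(4) and ra = acts(5)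
  define ga where "ga a b = sg a \<otimes>\<^sub>?B sg b \<ominus>\<^sub>?B sg (a \<otimes>\<^sub>A b)" for a b
  have gaB: "ga a b \<in> carrier ?B" if "a \<in> carrier A" "b \<in> carrier A" for a b using that by (simp add: ga_def sgc)
  have gaN: "ga a b \<in> carrier F.N" if ab: "a \<in> carrier A" "b \<in> carrier A" for a b
  proof -
    have "ga a b (i, l) \<in> I" if il: "i < n" "l < n" for i l
    proof -
      have yR: "y a (i, j) \<in> carrier R" "y b (j, l) \<in> carrier R" if "j < n" for j using that ab il by (simp_all add: y_simps)
      have e: "(Z \<ominus>\<^sub>?B W) (i, l) = Z (i, l) \<ominus>\<^sub>B W (i, l)" if "Z \<in> carrier ?B" "W \<in> carrier ?B" for Z W
      proof -
        have "Z (i, l) = ((Z \<ominus>\<^sub>?B W) \<oplus>\<^sub>?B W) (i, l)" using that by (simp add: a_minus_def G.a_assoc G.l_neg)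
        also have "\<dots> = (Z \<ominus>\<^sub>?B W) (i, l) \<oplus>\<^sub>B W (i, l)" using il by (simp add: gs)
        finally have "Z (i, l) = (Z \<ominus>\<^sub>?B W) (i, l) \<oplus>\<^sub>B W (i, l)" .
        moreover have "(Z \<ominus>\<^sub>?B W) (i, l) \<in> carrier B" "W (i, l) \<in> carrier B"
          using G.minus_closed[OF that] that(2) il by (auto simp: gs(1))
        ultimately show ?thesis by (simp add: a_minus_def Bc.a_assoc Bc.r_neg)
      qed
      have "sg (a \<otimes>\<^sub>A b) (i, l) = cx (\<Oplus>\<^sub>R j<n. y a (i, j) \<otimes>\<^sub>R y b (j, l))" using ab il by (simp add: sgs y_simps)
      also have "\<dots> = (\<Oplus>\<^sub>B j<n. cx (y a (i, j) \<otimes>\<^sub>R y b (j, l)))"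
        using yR by (intro lmod_hom_finsum[OF cx R.M.abelian_group_axioms Bc.abelian_group_axioms]) auto
      finally have t: "sg (a \<otimes>\<^sub>A b) (i, l) = (\<Oplus>\<^sub>B j<n. cx (y a (i, j) \<otimes>\<^sub>R y b (j, l)))" .
      have "(sg a \<otimes>\<^sub>?B sg b) (i, l) = (\<Oplus>\<^sub>B j<n. cx (y a (i, j)) \<otimes>\<^sub>B cx (y b (j, l)))"
        using il yR by (auto simp: gs(2) sgs cxD intro!: Bc.finsum_cong')
      hence "ga a b (i, l) = (\<Oplus>\<^sub>B j<n. cx (y a (i, j)) \<otimes>\<^sub>B cx (y b (j, l)) \<ominus>\<^sub>B cx (y a (i, j) \<otimes>\<^sub>R y b (j, l)))"
        using ab yR by (subst Bc.finsum_minus) (simp_all add: ga_def e sgc t cxD)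
      thus ?thesis using I.finsum_in_ideal[of "{..<n}" "\<lambda>j. cx (y a (i, j)) \<otimes>\<^sub>B cx (y b (j, l)) \<ominus>\<^sub>B cx (y a (i, j) \<otimes>\<^sub>R y b (j, l))"] cx_mult yR by simp
    qed
    thus ?thesis using gaB[OF ab] by (simp add: Nc gs(1))
  qed
  have ga_add: "ga (a \<oplus>\<^sub>A a') b = ga a b \<oplus>\<^sub>F.N ga a' b" "ga b (a \<oplus>\<^sub>A a') = ga b a \<oplus>\<^sub>F.N ga b a'"
    if "a \<in> carrier A" "a' \<in> carrier A" "b \<in> carrier A" for a a' b
    unfolding Na using that
    by (simp_all add: ga_def sg A.l_distr A.r_distr G.l_distr G.r_distr a_minus_def G.minus_add G.a_ac)
  \<comment> \<open>Associativity in M_n(B): both sides are sg(a) sg(b) sg(c) - sg(abc).\<close>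
  have ga_cocycle: "F.la a (ga b c) \<oplus>\<^sub>F.N ga a (b \<otimes>\<^sub>A c) = ga (a \<otimes>\<^sub>A b) c \<oplus>\<^sub>F.N F.ra c (ga a b)"
    if ab: "a \<in> carrier A" "b \<in> carrier A" and c: "c \<in> carrier A" for a b c
  proof -
      note cl = sgc[OF ab(1)] sgc[OF ab(2)] sgc[OF c] sgc[OF A.m_closed[OF ab]] sgc[OF A.m_closed[OF ab(2) c]]
        sgc[OF A.m_closed[OF ab(1) A.m_closed[OF ab(2) c]]]
      have "sg a \<otimes>\<^sub>?B ga b c \<oplus>\<^sub>?B ga a (b \<otimes>\<^sub>A c) =
        (sg a \<otimes>\<^sub>?B sg b \<otimes>\<^sub>?B sg c \<ominus>\<^sub>?B sg a \<otimes>\<^sub>?B sg (b \<otimes>\<^sub>A c)) \<oplus>\<^sub>?B (sg a \<otimes>\<^sub>?B sg (b \<otimes>\<^sub>A c) \<ominus>\<^sub>?B sg (a \<otimes>\<^sub>A (b \<otimes>\<^sub>A c)))"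
        using cl by (simp add: ga_def a_minus_def G.r_distr G.r_minus G.m_assoc)
      also have "\<dots> = sg a \<otimes>\<^sub>?B sg b \<otimes>\<^sub>?B sg c \<ominus>\<^sub>?B sg (a \<otimes>\<^sub>A (b \<otimes>\<^sub>A c))" using cl by (intro G.minus_plus_minus) simp_all
      also have "\<dots> = (sg (a \<otimes>\<^sub>A b) \<otimes>\<^sub>?B sg c \<ominus>\<^sub>?B sg (a \<otimes>\<^sub>A (b \<otimes>\<^sub>A c))) \<oplus>\<^sub>?B
          (sg a \<otimes>\<^sub>?B sg b \<otimes>\<^sub>?B sg c \<ominus>\<^sub>?B sg (a \<otimes>\<^sub>A b) \<otimes>\<^sub>?B sg c)" using cl by (intro G.minus_plus_minus(2)[symmetric]) simp_all
      also have "\<dots> = ga (a \<otimes>\<^sub>A b) c \<oplus>\<^sub>?B ga a b \<otimes>\<^sub>?B sg c"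
        using cl ab c by (simp add: ga_def a_minus_def G.l_distr G.l_minus A.m_assoc)
      finally show ?thesis using ab c by (simp add: Na la ra gaN)
  qed
  have ga_one: "ga \<one>\<^sub>A a = \<zero>\<^sub>F.N" "ga a \<one>\<^sub>A = \<zero>\<^sub>F.N" if "a \<in> carrier A" for a
    unfolding Nz using that by (simp_all add: ga_def sg G.minus_eq_zero_iff)
  have ga_smult: "ga (c \<odot>\<^sub>A a) b = c \<odot>\<^sub>F.N ga a b" "ga a (c \<odot>\<^sub>A b) = c \<odot>\<^sub>F.N ga a b"
      if c: "c \<in> carrier k" and ab: "a \<in> carrier A" "b \<in> carrier A" for a b c
    unfolding Ns[OF c gaN[OF ab]] using ab c
    by (simp_all add: ga_def sg A.smult_assoc_l A.smult_assoc_r G.smult_assoc_l G.smult_assoc_r a_minus_def G.smult_r_distr G.smult_r_minus)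
  have "F.env.cocycle ga"
    unfolding F.env.cocycle_def bilinear_on_def
    by (intro conjI ballI gaN ga_add ga_smult ga_cocycle ga_one)
  hence "F.env.coboundary ga" by (rule F.coboundary_if_exact[OF F.exact_at_N_if_hereditary[OF k fg her n]])
  then obtain h where h: "h \<in> lmod_hom k A F.N" and hm: "\<forall>a\<in>carrier A. \<forall>b\<in>carrier A.
      h (a \<otimes>\<^sub>A b) = F.la a (h b) \<oplus>\<^sub>F.N F.ra b (h a) \<oplus>\<^sub>F.N ga a b"
    unfolding F.env.coboundary_def by (elim exE conjE)
  note hD = lmod_homD[OF h]
  have hB: "h a \<in> carrier ?B" if "a \<in> carrier A" for a using NB[OF hD(1)[OF that]] .
  have hmult: "h (a \<otimes>\<^sub>A b) = sg a \<otimes>\<^sub>?B h b \<oplus>\<^sub>?B h a \<otimes>\<^sub>?B sg b \<oplus>\<^sub>?B ga a b" if "a \<in> carrier A" "b \<in> carrier A" for a b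
    using hm that hD(1) by (simp add: Na la ra)
  \<comment> \<open>The entries are sums of products of two elements of \<open>I\<close>.\<close>
  have hh: "h a \<otimes>\<^sub>?B h b = \<zero>\<^sub>?B" if ab: "a \<in> carrier A" "b \<in> carrier A" for a b
  proof (rule mat_eqI[of _ n])
    fix i l assume il: "i < n" "l < n"
    have "(\<Oplus>\<^sub>B j<n. h a (i, j) \<otimes>\<^sub>B h b (j, l)) = \<zero>\<^sub>B"
      using il hD(1)[OF ab(1)] hD(1)[OF ab(2)] by (intro Bc.add.finprod_one_eqI sq) (auto simp: Nc)
    thus "(h a \<otimes>\<^sub>?B h b) (i, l) = \<zero>\<^sub>?B (i, l)" using il by (simp add: gs)
  qed (simp_all add: gs)
  define ta where "ta a = sg a \<oplus>\<^sub>?B h a" for a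
  have tac: "ta a \<in> carrier ?B" if "a \<in> carrier A" for a using that by (simp add: ta_def sgc hB)
  have "ta \<in> alg_hom k A ?B"
    unfolding alg_hom_def
  proof (intro CollectI conjI ballI ring_hom_memI)
    fix a b assume ab: "a \<in> carrier A" "b \<in> carrier A"
    show "ta (a \<oplus>\<^sub>A b) = ta a \<oplus>\<^sub>?B ta b" using ab by (simp add: ta_def sg hD hB Na G.a_ac)
    have st: "t \<oplus>\<^sub>?B (u \<oplus>\<^sub>?B v \<oplus>\<^sub>?B (w \<ominus>\<^sub>?B t)) = w \<oplus>\<^sub>?B u \<oplus>\<^sub>?B v"
      if "t \<in> carrier ?B" "u \<in> carrier ?B" "v \<in> carrier ?B" "w \<in> carrier ?B" for t u v w
    proof -
      have "t \<oplus>\<^sub>?B (u \<oplus>\<^sub>?B v \<oplus>\<^sub>?B (w \<ominus>\<^sub>?B t)) = (u \<oplus>\<^sub>?B v) \<oplus>\<^sub>?B ((w \<ominus>\<^sub>?B t) \<oplus>\<^sub>?B t)"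
        using that by (simp add: G.a_ac)
      also have "(w \<ominus>\<^sub>?B t) \<oplus>\<^sub>?B t = w" using that by (simp add: a_minus_def G.a_assoc G.l_neg)
      finally show ?thesis using that by (simp add: G.a_ac)
    qed
    have "ta (a \<otimes>\<^sub>A b) = sg a \<otimes>\<^sub>?B sg b \<oplus>\<^sub>?B sg a \<otimes>\<^sub>?B h b \<oplus>\<^sub>?B h a \<otimes>\<^sub>?B sg b"
      unfolding ta_def hmult[OF ab] ga_def using ab by (intro st) (simp_all add: sgc hB)
    also have "\<dots> = ta a \<otimes>\<^sub>?B ta b"
      using ab by (simp add: ta_def sgc hB G.l_distr G.r_distr hh G.a_ac)
    finally show "ta (a \<otimes>\<^sub>A b) = ta a \<otimes>\<^sub>?B ta b" .
  next
    \<comment> \<open>At the pair of units, where \<open>ga\<close> vanishes, the equation for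
      \<open>h\<close> reads h(1) = h(1) + h(1); hence sg + h is still unital.\<close>
    have "h \<one>\<^sub>A = h \<one>\<^sub>A \<oplus>\<^sub>?B h \<one>\<^sub>A"
      using hmult[of "\<one>\<^sub>A" "\<one>\<^sub>A"] by (simp add: sg_one hB ga_def G.minus_eq_zero_iff[THEN iffD2])
    hence "h \<one>\<^sub>A = \<zero>\<^sub>?B" using hB[OF A.one_closed] by simp
    thus "ta \<one>\<^sub>A = \<one>\<^sub>?B" by (simp add: ta_def sg_one)
  next
    fix c a assume "c \<in> carrier k" "a \<in> carrier A"
    thus "ta (c \<odot>\<^sub>A a) = c \<odot>\<^sub>?B ta a" by (simp add: ta_def sg hD hB Ns G.smult_r_distr)
  qed (rule tac)
  moreover have "I +>\<^sub>B ta a (i, j) = h0 (y a (i, j))" if a: "a \<in> carrier A" and ij: "i < n" "j < n" for a i j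
  proof -
    have c: "cx (y a (i, j)) \<in> carrier B" "h a (i, j) \<in> I" using a ij hD(1)[OF a] by (simp_all add: cxD y_simps Nc)
    have "ta a (i, j) = cx (y a (i, j)) \<oplus>\<^sub>B h a (i, j)" using ij by (simp add: ta_def gs sgs)
    moreover have "cx (y a (i, j)) \<oplus>\<^sub>B h a (i, j) \<ominus>\<^sub>B cx (y a (i, j)) = h a (i, j)"
      using c Ic[OF c(2)] by (simp add: a_minus_def Bc.a_ac Bc.r_neg1 Bc.r_neg2 Bc.r_neg)
    ultimately have "I +>\<^sub>B ta a (i, j) = I +>\<^sub>B cx (y a (i, j))" using c Ic[OF c(2)] by (subst I.a_rcos_eq_iff) simp_all
    thus ?thesis using cxh a ij by (simp add: y_simps)
  qed
  ultimately show ?thesis unfolding mat_algebra_eq_gmat by blast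
qed

end

theorem theorem6p0p1:
  fixes k :: "'k ring" and A :: "('k, 'a) module" and n :: nat
  assumes "algebraically_closed k"
    and "assoc_algebra k A"
    and "finitely_generated_algebra k A"
    and "coherent_algebra k A"
    and "hereditary A"
    and "n \<ge> 1"
  shows "smooth_affine_scheme TYPE('b) k (rep_coord_ring k A n)"
proof -
  interpret k: algebraically_closed k by fact
  define R where "R = rep_coord_ring k A n"
  define y where "y = generic_rep k A n"
  note rep = rep_coord_ring_represents[OF k.cring_axioms assms(2), where n = n, folded R_def y_def]
  have R: "algebra k R" and y: "y \<in> alg_hom k A (mat_algebra R n)" by (rule rep(1), rule rep(2))
  interpret R: algebra k R by fact
  have fg: "finitely_generated_algebra k R"
    unfolding R_def by (rule finitely_generated_rep_coord_ring[OF k.cring_axioms assms(2,3)])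
  have fp: "finitely_presented_algebra k R" by (rule finitely_presented_algebraI[OF k.field_axioms R fg])
  obtain p q r s f g where res: "env_resolution k A (enveloping_algebra k A) (tensor_pure k A (opposite_algebra A)) p q r s f g"
    using env_resolution_exists[OF k.field_axioms assms(2-4)] by (elim exE)
  \<comment> \<open>Entering the locale takes some coefficient module; the ideal of the extension,
    on which the argument rests, is supplied inside \<open>square_zero_lift_exists\<close>.\<close>
  have "module R (self_algebra R)" using algebra_self_algebra[OF R.is_cring] by (simp add: algebra_def)
  then interpret rep_problem k A R "self_algebra R" n y p q r s f g
    by (intro rep_problem.intro rep_module.intro rep_module_axioms.intro assms(2) R k.field_axioms y res)
  have "\<exists>ph\<in>alg_hom k R B. \<forall>x\<in>carrier R. I +>\<^sub>B ph x = h x"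
    if B: "algebra k B" and I: "ideal I B" and sq: "\<forall>x\<in>I. \<forall>y\<in>I. x \<otimes>\<^sub>B y = \<zero>\<^sub>B" and h: "h \<in> alg_hom k R (quot_algebra B I)"
    for B :: "('k, 'b) module" and I h
  proof -
    interpret B: algebra k B by fact
    note aB = B.is_assoc_algebra
    \<comment> \<open>Lifting a homomorphism out of \<open>R\<close> means lifting the corresponding
      representation of \<open>A\<close> from B/I to B.\<close>
    have "\<exists>ta\<in>alg_hom k A (mat_algebra B n). \<forall>a\<in>carrier A. \<forall>i<n. \<forall>j<n. I +>\<^sub>B ta a (i, j) = h (y a (i, j))"
      by (rule square_zero_lift_exists[OF assms(1) fg assms(5,6) B I _ h]) (use sq in blast)
    then obtain ta where ta: "ta \<in> alg_hom k A (mat_algebra B n)"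
      "\<forall>a\<in>carrier A. \<forall>i<n. \<forall>j<n. I +>\<^sub>B ta a (i, j) = h (y a (i, j))" by (elim bexE)
    obtain ph where ph: "ph \<in> alg_hom k R B" "\<forall>a\<in>carrier A. mat_map n ph (y a) = ta a"
      using rep(3)[OF B ta(1)] by (elim bexE)
    have ent: "ph (y a (i, j)) = ta a (i, j)" if "a \<in> carrier A" "i < n" "j < n" for a i j
      using fun_cong[OF bspec[OF ph(2) that(1)], of "(i, j)"] that by (simp add: mat_map_def)
    \<comment> \<open>Both homomorphisms to B/I have the same values on the generic matrices, so the
      uniqueness part of the universal property identifies them.\<close>
    have "\<forall>x\<in>carrier R. I +>\<^sub>B ph x = h x"
    proof (rule rep(4)[OF algebra_quot_algebra[OF B I] alg_hom_comp[OF ph(1) quot_algebra_proj[OF aB I]] h], intro ballI)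
      fix a assume "a \<in> carrier A"
      thus "mat_map n (\<lambda>x. I +>\<^sub>B ph x) (y a) = mat_map n h (y a)"
        using ta(2) by (auto simp: mat_map_def ent intro!: restrict_ext)
    qed
    thus ?thesis using ph(1) by blast
  qed
  hence "formally_smooth TYPE('b) k R" unfolding formally_smooth_def by blast
  thus ?thesis using R fp by (simp add: smooth_affine_scheme_def R_def)
qed

end
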